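(* Let $W\subset\mathbb{C}$ be a domain such that the (unweighted) Bergman space $L^2_H(W)$ is not $\{0\}$. Let $\mu$ be a holomorphic function on a neighborhood of $\overline{W}$ with no zeros on $\overline{W}$, and put $\rho(z)=|\mu(z)|^2$. Let $K_{W,\rho}$ be the weighted Bergman kernel of $W$ with weight $\rho$, and let $G_{W,\rho}$ be the Green's function on $W$ of the operator $P_\rho=\frac{\partial}{\partial\overline{z}}\frac{1}{\rho(z)}\frac{\partial}{\partial z}$. Then for all $z,w\in W$ with $z\neq w$, $$K_{W,\rho}(z,w)=-\frac{2}{\pi\,\rho(z)\rho(w)}\,\frac{\partial^2}{\partial z\,\partial\overline{w}}G_{W,\rho}(z,w).$$
   Context: No regularity of $\partial W$ is assumed. $L^2_H(W)$ is the space of holomorphic functions on $W$ that are square integrable with respect to Lebesgue measure $dV$. For a weight $\rho>0$, $L^2_H(W,\rho)$ is the space of holomorphic $f$ on $W$ with $\|f\|_\rho^2=\int_W|f|^2\rho\,dV<\infty$. Weighted Bergman kernel: for $t\in W$ let $\phi_\rho(\cdot,t)$ be the unique element of minimal norm $\|\cdot\|_\rho$ in $\{f\in L^2_H(W,\rho): f(t)=1\}$, and set $K_{W,\rho}(z,t)=\phi_\rho(z,t)/\|\phi_\rho(\cdot,t)\|_\rho^2$. Equivalently, $K_{W,\rho}$ is the reproducing kernel of $L^2_H(W,\rho)$: $K_{W,\rho}(\cdot,t)\in L^2_H(W,\rho)$ and $f(t)=\int_W f(z)\overline{K_{W,\rho}(z,t)}\rho(z)\,dV(z)$ for all $f\in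 L^2_H(W,\rho)$ (so $K_{W,\rho}(\cdot,t)=0$ if every $f\in L^2_H(W,\rho)$ vanishes at $t$). Green's function of $P_\rho$: for a bounded domain $D$ whose boundary consists of finitely many disjoint Jordan curves, with $\rho$ positive and continuously differentiable near $\overline{D}$, $G_{D,\rho}(\cdot,w)$ (for $w\in D$) is the function, continuous on $\overline{D}\setminus\{w\}$ and zero on $\partial D$, which satisfies $\frac{\partial}{\partial\overline{z}}\left(\frac{1}{\rho(z)}\frac{\partial}{\partial z}G_{D,\rho}(z,w)\right)=-\frac{\pi}{2}\delta_w$ in the sense of distributions on $D$. With this normalization, for $\rho\equiv1$ it is the usual Green's function $G_D(z,w)=h_D(z,w)-\ln|z-w|$, with $h_D$ harmonic in $z$. For a general domain $W$, $G_{W,\rho}(z,w)=\lim_{j\to\infty}G_{W_j,\rho}(z,w)$, locally uniformly on $\{(z,w)\in W\times W: z\ne w\}$, for any exhaustion $W=\bigcup_j W_j$, $W_1\Subset W_2\Subset\cdots$, by bounded domains each bounded by finitely many disjoint Jordan curves, the limit being independent of the exhaustion. *)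

theory Defs
  imports "HOL-Complex_Analysis.Complex_Analysis"
begin

subsection \<open>Weighted Bergman space and kernel\<close>

text \<open>
  Elements are total functions, so only their restrictions to \<open>W\<close> are meaningful.
\<close>

definition bergman_space :: "complex set \<Rightarrow> (complex \<Rightarrow> real) \<Rightarrow> (complex \<Rightarrow> complex) set" where
  "bergman_space W \<rho> =
     {f. f holomorphic_on W \<and> set_integrable lborel W (\<lambda>z. (cmod (f z))\<^sup>2 * \<rho> z)}"

definition bergman_norm :: "complex set \<Rightarrow> (complex \<Rightarrow> real) \<Rightarrow> (complex \<Rightarrow> complex) \<Rightarrow> real" where
  "bergman_norm W \<rho> f = sqrt (LINT z:W|lborel. (cmod (f z))\<^sup>2 * \<rho> z)"

definition bergman_minimizer ::
    "complex set \<Rightarrow> (complex \<Rightarrow> real) \<Rightarrow> complex \<Rightarrow> (complex \<Rightarrow> complex) \<Rightarrow> bool" where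
  "bergman_minimizer W \<rho> t \<phi> \<longleftrightarrow>
     \<phi> \<in> bergman_space W \<rho> \<and> \<phi> t = 1 \<and>
     (\<forall>f \<in> bergman_space W \<rho>. f t = 1 \<longrightarrow> bergman_norm W \<rho> \<phi> \<le> bergman_norm W \<rho> f)"

text \<open>
  The minimizer is unique on \<open>W\<close>, so \<open>SOME\<close> makes no choice at points \<open>z \<in> W\<close>.  The
  kernel is \<open>0\<close> when every function in the space vanishes at \<open>t\<close>, that is, when
  none takes the value \<open>1\<close> there.
\<close>

definition bergman_kernel ::
    "complex set \<Rightarrow> (complex \<Rightarrow> real) \<Rightarrow> complex \<Rightarrow> complex \<Rightarrow> complex" where
  "bergman_kernel W \<rho> z t =
     (if \<exists>f \<in> bergman_space W \<rho>. f t = 1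
      then let \<phi> = (SOME \<phi>. bergman_minimizer W \<rho> t \<phi>)
           in \<phi> z / complex_of_real ((bergman_norm W \<rho> \<phi>)\<^sup>2)
      else 0)"


subsection \<open>Wirtinger derivatives\<close>

definition wirt :: "(complex \<Rightarrow> complex) \<Rightarrow> complex \<Rightarrow> complex" where
  "wirt f z = (frechet_derivative f (at z) 1 - \<i> * frechet_derivative f (at z) \<i>) / 2"

definition wirt_bar :: "(complex \<Rightarrow> complex) \<Rightarrow> complex \<Rightarrow> complex" where
  "wirt_bar f z = (frechet_derivative f (at z) 1 + \<i> * frechet_derivative f (at z) \<i>) / 2"


subsection \<open>Test functions\<close>

primrec C_diff :: "nat \<Rightarrow> (complex \<Rightarrow> complex) \<Rightarrow> bool" where
  "C_diff 0 f \<longleftrightarrow> continuous_on UNIV f"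
| "C_diff (Suc k) f \<longleftrightarrow>
     f differentiable_on UNIV \<and> (\<forall>v. C_diff k (\<lambda>z. frechet_derivative f (at z) v))"

definition test_function :: "complex set \<Rightarrow> (complex \<Rightarrow> complex) \<Rightarrow> bool" where
  "test_function D \<phi> \<longleftrightarrow>
     (\<forall>k. C_diff k \<phi>) \<and> compact (closure {z. \<phi> z \<noteq> 0}) \<and> closure {z. \<phi> z \<noteq> 0} \<subseteq> D"


subsection \<open>The Green's function\<close>

definition jordan_domain :: "complex set \<Rightarrow> bool" where
  "jordan_domain D \<longleftrightarrow>
     open D \<and> connected D \<and> D \<noteq> {} \<and> bounded D \<and>
     (\<exists>\<Gamma>. finite \<Gamma> \<and>
        (\<forall>\<gamma>\<in>\<Gamma>. simple_path \<gamma> \<and> pathfinish \<gamma> = pathstart \<gamma>) \<and>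
        pairwise (\<lambda>\<gamma> \<gamma>'. disjnt (path_image \<gamma>) (path_image \<gamma>')) \<Gamma> \<and>
        frontier D = (\<Union>\<gamma>\<in>\<Gamma>. path_image \<gamma>))"

text \<open>
  \<open>G z w\<close> is complex-valued; \<open>w\<close> is the pole.  The last conjunct is the
  equation
  \<open>\<partial>/\<partial>z\<^sup>- ((1/\<rho>) \<partial>/\<partial>z G(\<cdot>, w)) = - (\<pi>/2) \<delta>\<^sub>w\<close>
  (\<open>z\<^sup>-\<close> is the conjugate variable) as distributions on \<open>D\<close>, where \<open>G(\<cdot>, w)\<close> acts as a
  locally integrable function: both derivatives, and the factor \<open>1/\<rho>\<close>, are moved to the test
  function, and the two sign changes cancel.
\<close>

definition green_function_on_jordan_domain ::
    "complex set \<Rightarrow> (complex \<Rightarrow> real) \<Rightarrow> (complex \<Rightarrow> complex \<Rightarrow> complex) \<Rightarrow> bool" where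
  "green_function_on_jordan_domain D \<rho> G \<longleftrightarrow>
     (\<forall>w\<in>D.
        continuous_on (closure D - {w}) (\<lambda>z. G z w) \<and>
        (\<forall>z\<in>frontier D. G z w = 0) \<and>
        (\<forall>S. compact S \<and> S \<subseteq> D \<longrightarrow> set_integrable lborel S (\<lambda>z. G z w)) \<and>
        (\<forall>\<phi>. test_function D \<phi> \<longrightarrow>
           (LINT z:D|lborel. G z w * wirt (\<lambda>\<zeta>. wirt_bar \<phi> \<zeta> / complex_of_real (\<rho> \<zeta>)) z)
             = - (complex_of_real pi / 2) * \<phi> w))"

text \<open>Since the members are bounded, their closures are compact.\<close>

definition jordan_exhaustion :: "complex set \<Rightarrow> (nat \<Rightarrow> complex set) \<Rightarrow> bool" where
  "jordan_exhaustion W E \<longleftrightarrow>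
     (\<forall>j. jordan_domain (E j)) \<and> (\<forall>j. closure (E j) \<subseteq> E (Suc j)) \<and> W = (\<Union>j. E j)"

definition locally_uniform_limit ::
    "'a::metric_space set \<Rightarrow> (nat \<Rightarrow> 'a \<Rightarrow> 'b::metric_space) \<Rightarrow> ('a \<Rightarrow> 'b) \<Rightarrow> bool" where
  "locally_uniform_limit S f l \<longleftrightarrow>
     (\<forall>p\<in>S. \<exists>\<epsilon>>0. uniform_limit (ball p \<epsilon> \<inter> S) f l sequentially)"

text \<open>
  The Green's function of \<open>W\<close> as the limit along an exhaustion.  The limit does not depend on
  the exhaustion, and so being the limit along some exhaustion already determines \<open>G\<close> off the
  diagonal; no values are prescribed on the diagonal or outside \<open>W \<times> W\<close>.
\<close>

definition green_function ::
    "complex set \<Rightarrow> (complex \<Rightarrow> real) \<Rightarrow> (complex \<Rightarrow> complex \<Rightarrow> complex) \<Rightarrow> bool" where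
  "green_function W \<rho> G \<longleftrightarrow>
     (\<exists>E g. jordan_exhaustion W E \<and>
        (\<forall>j. green_function_on_jordan_domain (E j) \<rho> (g j)) \<and>
        locally_uniform_limit {(z, w). z \<in> W \<and> w \<in> W \<and> z \<noteq> w}
          (\<lambda>j (z, w). g j z w) (\<lambda>(z, w). G z w))"

end

(* The weight enters only through the factorisation rho = mu * cnj mu: since mu is holomorphic, it
   commutes with d/dz-bar and cnj mu commutes with d/dz, so the Green's function of the weighted
   operator on a relatively compact Jordan domain is cnj (mu z) * mu w times the ordinary one (by
   Weyl's lemma its regular part h is harmonic and solves a Dirichlet problem with data ln |z - w|).

   For the ordinary Green's function, H = dh/dw-bar solves the Dirichlet problem with data
   - 1 / (2 cnj (z - w)), so q = H + 1 / (2 cnj (z - w)) vanishes on the boundary.  Integrating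
   d/dz (cnj f * q), with q truncated at small values so that no boundary regularity is needed, picks
   up the residue at w and shows that - (2/pi) dH/dz reproduces L^2 holomorphic functions.  The
   Dirichlet energy of q, obtained from the same truncation, puts that function in L^2.

   Along the exhaustion the kernels converge locally uniformly, Fatou's lemma and the
   Cauchy--Schwarz inequality pass to the limit, and the extremal characterisation of the Bergman
   kernel identifies the limit. *)
theory Submission
  imports Defs "HOL-Real_Asymp.Real_Asymp"
begin

section \<open>Wirtinger calculus\<close>

text \<open>At the frontier nothing is known beyond continuity and vanishing, so every integration
  by parts is made against a function of compact support. The truncation \<open>shrink\<close>
  supplies that support, but its slope tends to 1 only off the zero set of the truncated function;
  this is why the gradient has to vanish almost everywhere on the zero set.

  Solutions of the Dirichlet problem come from the given Green's functions alone: those with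
  logarithmic data are read off from them, those with differentiated data are uniform limits of
  difference quotients in the pole, by the maximum principle.

  The constant: d/dz of 1/cnj(z - w) is pi times the point mass at w and q carries half of this
  pole, so pairing with dH/dz gives -pi/2, which -2/pi normalises.

  The exhaustion says nothing on the diagonal, where G has no prescribed values; convergence at z =
  w is obtained from a circle around w. For the norm and for point evaluation only inequalities
  reach the limit, not the reproducing identity; equality returns through the uniqueness of the
  minimiser.\<close>

definition has_wirt :: "(complex \<Rightarrow> complex) \<Rightarrow> complex \<Rightarrow> complex \<Rightarrow> complex \<Rightarrow> bool" where
  "has_wirt f a b z \<longleftrightarrow> (f has_derivative (\<lambda>v. a * v + b * cnj v)) (at z)"

lemma has_wirt_unique:
  assumes "has_wirt f a b z" shows "wirt f z = a" "wirt_bar f z = b"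
proof -
  have "frechet_derivative f (at z) = (\<lambda>v. a * v + b * cnj v)"
    using assms unfolding has_wirt_def by (metis frechet_derivative_at)
  then show "wirt f z = a" "wirt_bar f z = b"
    unfolding wirt_def wirt_bar_def by (simp_all add: algebra_simps)
qed

lemma linear_wirt_form:
  fixes D :: "complex \<Rightarrow> complex"
  assumes "linear D"
  shows "D v = (D 1 - \<i> * D \<i>) / 2 * v + (D 1 + \<i> * D \<i>) / 2 * cnj v"
proof -
  have v: "v = Re v *\<^sub>R 1 + Im v *\<^sub>R \<i>"
    by (simp add: complex_eq_iff)
  have "D v = Re v *\<^sub>R D 1 + Im v *\<^sub>R D \<i>"
    by (subst v) (simp only: linear_add[OF assms] linear_scale[OF assms])
  also have "\<dots> = (D 1 - \<i> * D \<i>) / 2 * v + (D 1 + \<i> * D \<i>) / 2 * cnj v"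
    by (simp add: complex_eq_iff) (simp add: field_simps)
  finally show ?thesis .
qed

lemma has_wirt_differentiable:
  assumes "f differentiable (at z)"
  shows "has_wirt f (wirt f z) (wirt_bar f z) z"
proof -
  let ?D = "frechet_derivative f (at z)"
  have d: "(f has_derivative ?D) (at z)"
    using assms frechet_derivative_works by blast
  have "?D = (\<lambda>v. wirt f z * v + wirt_bar f z * cnj v)"
    unfolding wirt_def wirt_bar_def
    using linear_wirt_form[OF has_derivative_linear[OF d]] by blast
  then show ?thesis using d unfolding has_wirt_def by metis
qed

lemma has_wirt_imp_differentiable: "has_wirt f a b z \<Longrightarrow> f differentiable (at z)"
  unfolding has_wirt_def differentiable_def by blast

lemma has_wirt_cong: "has_wirt f a b z \<Longrightarrow> a = a' \<Longrightarrow> b = b' \<Longrightarrow> has_wirt f a' b' z"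
  by simp

lemma has_wirt_transform:
  assumes "has_wirt f a b z" "open S" "z \<in> S" "\<And>x. x \<in> S \<Longrightarrow> f x = g x"
  shows "has_wirt g a b z"
  using assms has_derivative_transform_within_open unfolding has_wirt_def by blast

lemma has_wirt_const: "has_wirt (\<lambda>z. c) 0 0 z"
  unfolding has_wirt_def by simp

lemma has_wirt_field_derivative: "(f has_field_derivative a) (at z) \<Longrightarrow> has_wirt f a 0 z"
  unfolding has_wirt_def has_field_derivative_def by simp

lemma has_wirt_holomorphic:
  "f holomorphic_on S \<Longrightarrow> open S \<Longrightarrow> z \<in> S \<Longrightarrow> has_wirt f (deriv f z) 0 z"
  by (intro has_wirt_field_derivative) (rule holomorphic_derivI)

lemma has_wirt_add:
  "has_wirt f a b z \<Longrightarrow> has_wirt g a' b' z \<Longrightarrow> has_wirt (\<lambda>z. f z + g z) (a + a') (b + b') z"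
  unfolding has_wirt_def
  by (drule (1) has_derivative_add) (simp add: algebra_simps)

lemma has_wirt_diff:
  "has_wirt f a b z \<Longrightarrow> has_wirt g a' b' z \<Longrightarrow> has_wirt (\<lambda>z. f z - g z) (a - a') (b - b') z"
  unfolding has_wirt_def
  by (drule (1) has_derivative_diff) (simp add: algebra_simps)

lemma has_wirt_mult:
  "has_wirt f a b z \<Longrightarrow> has_wirt g a' b' z \<Longrightarrow>
   has_wirt (\<lambda>z. f z * g z) (a * g z + f z * a') (b * g z + f z * b') z"
  unfolding has_wirt_def
  by (drule (1) has_derivative_mult) (simp add: algebra_simps)

lemma has_wirt_cnj:
  "has_wirt f a b z \<Longrightarrow> has_wirt (\<lambda>z. cnj (f z)) (cnj b) (cnj a) z"
  unfolding has_wirt_def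
  by (drule has_derivative_cnj) (simp add: algebra_simps)

lemma has_wirt_cmult: "has_wirt f a b z \<Longrightarrow> has_wirt (\<lambda>z. c * f z) (c * a) (c * b) z"
  using has_wirt_mult[OF has_wirt_const] by simp

lemma has_wirt_Re:
  assumes "has_wirt f a b z"
  shows "has_wirt (\<lambda>z. of_real (Re (f z))) ((a + cnj b) / 2) (cnj ((a + cnj b) / 2)) z"
proof -
  have "(\<lambda>z. of_real (Re (f z))) = (\<lambda>z. (1/2) * (f z + cnj (f z)))"
    by (auto simp: complex_eq_iff)
  then show ?thesis
    using has_wirt_cmult[OF has_wirt_add[OF assms has_wirt_cnj[OF assms]], of "1/2"]
    by (simp add: add.commute)
qed

text \<open>The imaginary part of the inner function is constantly 0, so its differential is
  real-valued and the chain rule for the real function \<open>\<theta>\<close> applies; both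
  Wirtinger coefficients are scaled by the same factor.\<close>

lemma has_wirt_chain_real:
  assumes "has_wirt (\<lambda>z. of_real (u z)) a b z" "(\<theta> has_real_derivative \<theta>') (at (u z))"
  shows "has_wirt (\<lambda>z. of_real (\<theta> (u z))) (of_real \<theta>' * a) (of_real \<theta>' * b) z"
proof -
  let ?h = "\<lambda>v. a * v + b * cnj v"
  have d: "((\<lambda>z. complex_of_real (u z)) has_derivative ?h) (at z)"
    using assms(1) unfolding has_wirt_def .
  have du: "(u has_derivative (\<lambda>v. Re (?h v))) (at z)"
    using has_derivative_Re[OF d] by simp
  have im: "((\<lambda>z. 0::real) has_derivative (\<lambda>v. Im (?h v))) (at z)"
    using has_derivative_Im[OF d] by simp
  have "(\<lambda>v. Im (?h v)) = (\<lambda>v. 0)"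
    using has_derivative_unique[OF im has_derivative_const] by simp
  then have *: "?h v = of_real (Re (?h v))" for v
    by (metis (no_types, lifting) complex_is_Real_iff of_real_Re)
  have "((\<lambda>z. \<theta> (u z)) has_derivative (\<lambda>v. \<theta>' * Re (?h v))) (at z)"
    using has_derivative_compose[OF du assms(2)[unfolded has_field_derivative_def]] by simp
  then have "((\<lambda>z. complex_of_real (\<theta> (u z))) has_derivative (\<lambda>v. of_real (\<theta>' * Re (?h v)))) (at z)"
    by (rule has_derivative_of_real)
  moreover have "(\<lambda>v. complex_of_real (\<theta>' * Re (?h v))) = (\<lambda>v. of_real \<theta>' * ?h v)"
    unfolding of_real_mult by (subst *[symmetric]) (rule refl)
  ultimately show ?thesis unfolding has_wirt_def by (simp add: algebra_simps)
qed

lemma has_wirt_field_derivative_iff: "has_wirt f a 0 z \<longleftrightarrow> (f has_field_derivative a) (at z)"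
  unfolding has_wirt_def has_field_derivative_def by simp

lemma has_wirt_ident: "has_wirt (\<lambda>z. z) 1 0 z"
  by (rule has_wirt_field_derivative) simp

lemma has_wirt_cmod_sq: "has_wirt (\<lambda>z. of_real ((cmod (z - w))\<^sup>2)) (cnj (z - w)) (z - w) z"
proof -
  have "has_wirt (\<lambda>z. (z - w) * cnj (z - w)) (cnj (z - w)) (z - w) z"
    by (rule has_wirt_cong[OF has_wirt_mult[OF has_wirt_diff[OF has_wirt_ident has_wirt_const]
            has_wirt_cnj[OF has_wirt_diff[OF has_wirt_ident has_wirt_const]]]]) auto
  then show ?thesis by (simp add: complex_norm_square del: of_real_power)
qed


section \<open>Harmonic functions\<close>

text \<open>Encodes the Laplace equation by first derivatives only: \<open>wirt f\<close> is
  holomorphic and \<open>wirt_bar f\<close> antiholomorphic. Locally such an \<open>f\<close> is a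
  holomorphic function plus the conjugate of another, see
  \<open>harmonic_on_local_rep\<close>.\<close>

definition harmonic_on :: "(complex \<Rightarrow> complex) \<Rightarrow> complex set \<Rightarrow> bool" (infixl "harmonic'_on" 50) where
  "f harmonic_on S \<longleftrightarrow> (\<forall>z\<in>S. f differentiable (at z)) \<and> wirt f holomorphic_on S \<and>
     (\<lambda>z. cnj (wirt_bar f z)) holomorphic_on S"

lemma harmonic_on_subset: "f harmonic_on S \<Longrightarrow> T \<subseteq> S \<Longrightarrow> f harmonic_on T"
  unfolding harmonic_on_def using holomorphic_on_subset by blast

lemma harmonic_on_has_wirt:
  "f harmonic_on S \<Longrightarrow> z \<in> S \<Longrightarrow> has_wirt f (wirt f z) (wirt_bar f z) z"
  unfolding harmonic_on_def by (intro has_wirt_differentiable) blast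

lemma harmonic_on_continuous: "f harmonic_on S \<Longrightarrow> continuous_on S f"
  unfolding harmonic_on_def
  by (intro continuous_at_imp_continuous_on) (auto intro: differentiable_imp_continuous_within)

lemma harmonic_onI:
  assumes "\<And>z. z \<in> S \<Longrightarrow> has_wirt f (a z) (b z) z"
    and "a holomorphic_on S" and "(\<lambda>z. cnj (b z)) holomorphic_on S"
  shows "f harmonic_on S"
proof -
  have "wirt f z = a z" "wirt_bar f z = b z" if "z \<in> S" for z
    using has_wirt_unique[OF assms(1)[OF that]] by auto
  then show ?thesis
    unfolding harmonic_on_def
    using assms(2,3) has_wirt_imp_differentiable[OF assms(1)]
    by (auto cong: holomorphic_cong)
qed

lemma harmonic_on_transform:
  assumes "f harmonic_on S" "open S" "\<And>z. z \<in> S \<Longrightarrow> f z = g z"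
  shows "g harmonic_on S"
proof (rule harmonic_onI[of S g "wirt f" "wirt_bar f"])
  show "has_wirt g (wirt f z) (wirt_bar f z) z" if "z \<in> S" for z
    using has_wirt_transform[OF harmonic_on_has_wirt[OF assms(1) that] assms(2) that assms(3)] .
qed (use assms(1) in \<open>auto simp: harmonic_on_def\<close>)

lemma harmonic_on_open_cover:
  assumes "\<And>z. z \<in> S \<Longrightarrow> \<exists>T. open T \<and> z \<in> T \<and> f harmonic_on T"
  shows "f harmonic_on S"
proof -
  have "wirt f field_differentiable (at z)" "(\<lambda>z. cnj (wirt_bar f z)) field_differentiable (at z)"
     "f differentiable (at z)"
    if "z \<in> S" for z
    using assms[OF that] unfolding harmonic_on_def
    by (auto simp: holomorphic_on_imp_differentiable_at)
  then show ?thesis unfolding harmonic_on_def holomorphic_on_def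
    using field_differentiable_at_within by blast
qed

lemma harmonic_on_cnj:
  assumes "f harmonic_on S" shows "(\<lambda>z. cnj (f z)) harmonic_on S"
proof (rule harmonic_onI)
  show "has_wirt (\<lambda>z. cnj (f z)) (cnj (wirt_bar f z)) (cnj (wirt f z)) z" if "z \<in> S" for z
    by (rule has_wirt_cnj[OF harmonic_on_has_wirt[OF assms that]])
qed (use assms in \<open>auto simp: harmonic_on_def\<close>)

lemma harmonic_on_add:
  assumes "f harmonic_on S" "g harmonic_on S" shows "(\<lambda>z. f z + g z) harmonic_on S"
proof (rule harmonic_onI)
  show "has_wirt (\<lambda>z. f z + g z) (wirt f z + wirt g z) (wirt_bar f z + wirt_bar g z) z" if "z \<in> S" for z
    by (intro has_wirt_add harmonic_on_has_wirt[OF _ that] assms)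
qed (use assms in \<open>auto simp: harmonic_on_def intro!: holomorphic_intros\<close>)

lemma harmonic_on_cmult:
  assumes "f harmonic_on S" shows "(\<lambda>z. c * f z) harmonic_on S"
proof (rule harmonic_onI)
  show "has_wirt (\<lambda>z. c * f z) (c * wirt f z) (c * wirt_bar f z) z" if "z \<in> S" for z
    by (intro has_wirt_cmult harmonic_on_has_wirt[OF _ that] assms)
qed (use assms in \<open>auto simp: harmonic_on_def intro!: holomorphic_intros\<close>)

lemma harmonic_on_diff:
  assumes "f harmonic_on S" "g harmonic_on S" shows "(\<lambda>z. f z - g z) harmonic_on S"
  using harmonic_on_add[OF assms(1) harmonic_on_cmult[OF assms(2), of "-1"]] by simp

text \<open>Subtracting primitives of the two Wirtinger derivatives on the disc leaves a function
  with zero differential, a constant, which is absorbed into \<open>K\<close>.\<close>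

lemma harmonic_on_local_rep:
  assumes "f harmonic_on ball a r"
  obtains K L where "K holomorphic_on ball a r" "L holomorphic_on ball a r"
    "\<And>z. z \<in> ball a r \<Longrightarrow> f z = K z + cnj (L z)"
    "\<And>z. z \<in> ball a r \<Longrightarrow> (K has_field_derivative wirt f z) (at z)"
    "\<And>z. z \<in> ball a r \<Longrightarrow> (L has_field_derivative cnj (wirt_bar f z)) (at z)"
proof (cases "r > 0")
  case False
  then have "z \<notin> ball a r" for z by (metis mem_ball not_le zero_le_dist order.strict_trans1)
  then show ?thesis by (intro that[of "\<lambda>_. 0" "\<lambda>_. 0"]) (auto simp del: mem_ball)
next
  case True
  have h: "wirt f holomorphic_on ball a r" "(\<lambda>z. cnj (wirt_bar f z)) holomorphic_on ball a r"
    using assms unfolding harmonic_on_def by auto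
  obtain K0 where "\<And>z. z \<in> ball a r \<Longrightarrow> (K0 has_field_derivative wirt f z) (at z within ball a r)"
    using holomorphic_convex_primitive'[OF convex_ball open_ball h(1)] by blast
  then have K0: "\<And>z. z \<in> ball a r \<Longrightarrow> (K0 has_field_derivative wirt f z) (at z)"
    by (simp add: at_within_open[OF _ open_ball])
  obtain L where "\<And>z. z \<in> ball a r \<Longrightarrow> (L has_field_derivative cnj (wirt_bar f z)) (at z within ball a r)"
    using holomorphic_convex_primitive'[OF convex_ball open_ball h(2)] by blast
  then have L: "\<And>z. z \<in> ball a r \<Longrightarrow> (L has_field_derivative cnj (wirt_bar f z)) (at z)"
    by (simp add: at_within_open[OF _ open_ball])
  define E where "E z = f z - K0 z - cnj (L z)" for z
  have "has_wirt E 0 0 z" if "z \<in> ball a r" for z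
    unfolding E_def
    by (rule has_wirt_cong[OF has_wirt_diff[OF has_wirt_diff[OF harmonic_on_has_wirt[OF assms that]
          has_wirt_field_derivative[OF K0[OF that]]]
          has_wirt_cnj[OF has_wirt_field_derivative[OF L[OF that]]]]]) auto
  then have "(E has_derivative (\<lambda>h. 0)) (at z within ball a r)" if "z \<in> ball a r" for z
    unfolding has_wirt_def using that by (auto intro: has_derivative_at_withinI)
  then obtain c where c: "\<And>z. z \<in> ball a r \<Longrightarrow> E z = c"
    using has_derivative_zero_constant[OF convex_ball, of a r E] by blast
  show ?thesis
  proof (rule that[of "\<lambda>z. K0 z + c" L])
    show "((\<lambda>z. K0 z + c) has_field_derivative wirt f z) (at z)" if "z \<in> ball a r" for z
      using K0[OF that] by (auto intro!: derivative_eq_intros)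
    then show "(\<lambda>z. K0 z + c) holomorphic_on ball a r"
      using holomorphic_on_open by blast
    show "L holomorphic_on ball a r" using L holomorphic_on_open by blast
    show "f z = K0 z + c + cnj (L z)" if "z \<in> ball a r" for z
      using c[OF that] by (simp add: E_def algebra_simps)
  qed (use L in auto)
qed

text \<open>\<open>L\<close> and its conjugate have the same real part, so \<open>K + L\<close> is
  holomorphic with the real part of \<open>f\<close>. This opens theorems on holomorphic functions
  to harmonic ones.\<close>

lemma harmonic_on_Re_local:
  assumes "f harmonic_on ball a r"
  obtains F where "F holomorphic_on ball a r" "\<And>z. z \<in> ball a r \<Longrightarrow> Re (F z) = Re (f z)"
    "\<And>z. z \<in> ball a r \<Longrightarrow> (F has_field_derivative (wirt f z + cnj (wirt_bar f z))) (at z)"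
proof -
  obtain K L where KL: "K holomorphic_on ball a r" "L holomorphic_on ball a r"
    "\<And>z. z \<in> ball a r \<Longrightarrow> f z = K z + cnj (L z)"
    "\<And>z. z \<in> ball a r \<Longrightarrow> (K has_field_derivative wirt f z) (at z)"
    "\<And>z. z \<in> ball a r \<Longrightarrow> (L has_field_derivative cnj (wirt_bar f z)) (at z)"
    using harmonic_on_local_rep[OF assms] by blast
  show ?thesis
    by (rule that[of "\<lambda>z. K z + L z"])
       (use KL in \<open>auto intro!: holomorphic_intros derivative_eq_intros\<close>)
qed

section \<open>Gradient estimates for harmonic functions\<close>

lemma holomorphic_Re_bound_deriv:
  assumes hol: "f holomorphic_on ball a r" and r: "0 < r"
    and M: "\<And>z. z \<in> ball a r \<Longrightarrow> \<bar>Re (f z)\<bar> \<le> M"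
  shows "cmod (deriv f a) \<le> 4 * M / r"
proof -
  \<comment> \<open>A Borel--Caratheodory estimate through the Schwarz lemma. The increment
    \<open>F\<close> lies in the half plane Re < 2A, and 4A is the mirror image of 0 in its boundary
    line, so \<open>F / (4A - F)\<close> maps into the unit disc and fixes 0. A > M yields the
    strict inequality that the Schwarz lemma asks for; A is sent to M at the end.\<close>
  have "cmod (deriv f a) \<le> 4 * A / r" if A: "A > M" for A
  proof -
    have M0: "0 \<le> M" using M[of a] r by force
    define F where "F z = f (a + of_real r * z) - f a" for z :: complex
    have ain: "a + of_real r * z \<in> ball a r" if "z \<in> ball 0 1" for z :: complex
      using that r by (simp add: dist_norm norm_mult)
    have dF: "(F has_field_derivative deriv f (a + of_real r * z) * of_real r) (at z)" if "z \<in> ball 0 1" for z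
    proof -
      have "((\<lambda>z. a + of_real r * z) has_field_derivative of_real r) (at z)"
        by (auto intro!: derivative_eq_intros)
      from DERIV_chain2[OF holomorphic_derivI[OF hol open_ball ain[OF that]] this]
      show ?thesis unfolding F_def by (auto intro!: derivative_eq_intros)
    qed
    then have holF: "F holomorphic_on ball 0 1" using holomorphic_on_open by blast
    have ReF: "Re (F z) < 2 * A" if "z \<in> ball 0 1" for z
    proof -
      have "Re (F z) \<le> 2 * M" unfolding F_def
        using M[OF ain[OF that]] M[of a] r by auto
      then show ?thesis using A by simp
    qed
    define g where "g z = F z / (4 * A - F z)" for z
    have nz: "4 * A - F z \<noteq> 0" if "z \<in> ball 0 1" for z
    proof
      assume "4 * A - F z = 0"
      then have "Re (4 * A - F z) = 0" by simp
      then have "Re (F z) = 4 * A" by simp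
      then show False using ReF[OF that] A M0 by simp
    qed
    have holg: "g holomorphic_on ball 0 1"
      unfolding g_def by (intro holomorphic_intros holF) (use nz in auto)
    have lt: "cmod (g z) < 1" if "cmod z < 1" for z
    proof -
      have z: "z \<in> ball 0 1" using that by simp
      have "(cmod (F z))\<^sup>2 < (cmod (4 * A - F z))\<^sup>2"
      proof -
        have "0 < A * (2 * A - Re (F z))" using ReF[OF z] A M0 by simp
        then show ?thesis unfolding cmod_power2 by (simp add: power2_eq_square algebra_simps)
      qed
      then have "cmod (F z) < cmod (4 * A - F z)" by (simp add: power_less_imp_less_base)
      then show ?thesis unfolding g_def using nz[OF z] by (simp add: norm_divide)
    qed
    have F0: "F 0 = 0" by (simp add: F_def)
    have "cmod (deriv g 0) \<le> 1"
      using Schwarz_Lemma(2)[OF holg _ lt, of 0] F0 by (simp add: g_def[abs_def])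
    moreover have "deriv g 0 = deriv f a * r / (4 * A)"
    proof -
      have "(g has_field_derivative deriv f a * r / (4 * A)) (at 0)"
        unfolding g_def
        using F0 A M0 by (auto intro!: derivative_eq_intros dF simp: power2_eq_square field_simps)
      then show ?thesis by (rule DERIV_imp_deriv)
    qed
    ultimately show ?thesis using A M0 r by (simp add: norm_mult norm_divide field_simps)
  qed
  then have "\<forall>A>M. cmod (deriv f a) * r / 4 \<le> A" using r by (simp add: field_simps)
  then have "cmod (deriv f a) * r / 4 \<le> M" by (meson dense_ge)
  then show ?thesis using r by (simp add: field_simps)
qed

text \<open>Let p be \<open>wirt f a\<close> and q the conjugate of \<open>wirt_bar f a\<close>.
  Then p + q is the derivative of a holomorphic function with real part Re f, and i(p - q) that of
  one with real part Re(i f). Both obey \<open>holomorphic_Re_bound_deriv\<close>, and p and q are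
  half the sum and half the difference.\<close>

lemma harmonic_gradient_bound:
  assumes har: "f harmonic_on ball a r" and r: "0 < r"
    and M: "\<And>z. z \<in> ball a r \<Longrightarrow> cmod (f z) \<le> M"
  shows "cmod (wirt f a) \<le> 4 * M / r" "cmod (wirt_bar f a) \<le> 4 * M / r"
proof -
  let ?p = "wirt f a" and ?q = "cnj (wirt_bar f a)"
  have 1: "cmod (?p + ?q) \<le> 4 * M / r"
  proof -
    obtain F where F: "F holomorphic_on ball a r" "\<And>z. z \<in> ball a r \<Longrightarrow> Re (F z) = Re (f z)"
      "\<And>z. z \<in> ball a r \<Longrightarrow> (F has_field_derivative (wirt f z + cnj (wirt_bar f z))) (at z)"
      using harmonic_on_Re_local[OF har] by blast
    have "cmod (deriv F a) \<le> 4 * M / r"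
      using F(2) M by (intro holomorphic_Re_bound_deriv[OF F(1) r]) (metis abs_Re_le_cmod order_trans)
    then show ?thesis using DERIV_imp_deriv[OF F(3)[of a]] r by simp
  qed
  have 2: "cmod (?p - ?q) \<le> 4 * M / r"
  proof -
    have har': "(\<lambda>z. \<i> * f z) harmonic_on ball a r" by (rule harmonic_on_cmult[OF har])
    obtain F where F: "F holomorphic_on ball a r" "\<And>z. z \<in> ball a r \<Longrightarrow> Re (F z) = Re (\<i> * f z)"
      "\<And>z. z \<in> ball a r \<Longrightarrow> (F has_field_derivative (wirt (\<lambda>z. \<i> * f z) z + cnj (wirt_bar (\<lambda>z. \<i> * f z) z))) (at z)"
      using harmonic_on_Re_local[OF har'] by blast
    have "cmod (deriv F a) \<le> 4 * M / r"
    proof (intro holomorphic_Re_bound_deriv[OF F(1) r])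
      show "\<bar>Re (F z)\<bar> \<le> M" if "z \<in> ball a r" for z
        using F(2)[OF that] M[OF that] abs_Re_le_cmod[of "\<i> * f z"] by (simp add: norm_mult)
    qed
    moreover have "deriv F a = \<i> * (?p - ?q)"
    proof -
      have "has_wirt (\<lambda>z. \<i> * f z) (\<i> * wirt f a) (\<i> * wirt_bar f a) a"
        by (intro has_wirt_cmult harmonic_on_has_wirt[OF har]) (use r in simp)
      from has_wirt_unique[OF this] show ?thesis
        using DERIV_imp_deriv[OF F(3)[of a]] r by (simp add: algebra_simps)
    qed
    ultimately show ?thesis by (simp add: norm_mult)
  qed
  have "cmod (2 * ?p) \<le> 8 * M / r"
    using norm_triangle_mono[OF 1 2] by (simp add: algebra_simps)
  then show "cmod ?p \<le> 4 * M / r" by (simp add: norm_mult)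
  have "cmod (2 * ?q) \<le> 8 * M / r"
    using norm_triangle_ineq4[of "?p + ?q" "?p - ?q"] 1 2 by simp
  then show "cmod (wirt_bar f a) \<le> 4 * M / r" by (simp add: norm_mult)
qed

section \<open>The maximum principle\<close>

lemma harmonic_Re_local_max:
  assumes har: "f harmonic_on ball a r" and r: "0 < r"
    and le: "\<And>z. z \<in> ball a r \<Longrightarrow> Re (f z) \<le> Re (f a)" and z: "z \<in> ball a r"
  shows "Re (f z) = Re (f a)"
proof -
  obtain F where F: "F holomorphic_on ball a r" "\<And>z. z \<in> ball a r \<Longrightarrow> Re (F z) = Re (f z)"
      "\<And>z. z \<in> ball a r \<Longrightarrow> (F has_field_derivative (wirt f z + cnj (wirt_bar f z))) (at z)"
    using harmonic_on_Re_local[OF har] by blast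
  \<comment> \<open>The modulus of \<open>exp (F z)\<close> is \<open>exp (Re (f z))\<close>, so a
    maximum of the real part is a maximum of a modulus.\<close>
  have "(\<lambda>z. exp (F z)) constant_on ball a r"
  proof (rule maximum_modulus_principle[of _ "ball a r" "ball a r" a])
    show "cmod (exp (F z)) \<le> cmod (exp (F a))" if "z \<in> ball a r" for z
      using F(2) le that r by simp
  qed (use F r in \<open>auto intro!: holomorphic_intros\<close>)
  then have "exp (F z) = exp (F a)" using z r unfolding constant_on_def by fastforce
  then have "exp (Re (F z)) = exp (Re (F a))" by (metis norm_exp_eq_Re)
  then show ?thesis using F(2) z r by simp
qed

text \<open>If the bound failed, the points of \<open>closure D\<close> where the real part is
  largest would form a nonempty compact set inside \<open>D\<close>, open by
  \<open>harmonic_Re_local_max\<close>; the plane has no such set.\<close>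

lemma harmonic_Re_max_principle:
  assumes D: "open D" "bounded D" and cont: "continuous_on (closure D) f"
    and har: "f harmonic_on D" and le: "\<And>z. z \<in> frontier D \<Longrightarrow> Re (f z) \<le> M"
    and z: "z \<in> closure D"
  shows "Re (f z) \<le> M"
proof (rule ccontr)
  assume neg: "\<not> Re (f z) \<le> M"
  have comp: "compact (closure D)" using D by (simp add: compact_closure)
  have contR: "continuous_on (closure D) (\<lambda>z. Re (f z))" by (intro continuous_intros cont)
  have "closure D \<noteq> {}" using z by auto
  then obtain m where m: "m \<in> closure D" "\<And>y. y \<in> closure D \<Longrightarrow> Re (f y) \<le> Re (f m)"
    using continuous_attains_sup[OF comp _ contR] by auto
  define S where "S = {y \<in> closure D. Re (f y) = Re (f m)}"
  have "compact S"
  proof -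
    have "closed S" unfolding S_def
      using continuous_closed_preimage_constant[OF contR] by (simp add: closed_closure)
    then show ?thesis
      using D(2) S_def by (simp add: compact_eq_bounded_closed bounded_subset[OF bounded_closure[OF D(2)]])
  qed
  moreover have "S \<subseteq> D"
  proof
    fix y assume y: "y \<in> S"
    then have "Re (f y) > M" using neg m(2)[OF z] by (simp add: S_def)
    then have "y \<notin> frontier D" using le by force
    then show "y \<in> D" using y D(1) by (simp add: S_def frontier_def interior_open)
  qed
  moreover have "open S"
    unfolding open_contains_ball
  proof
    fix y assume y: "y \<in> S"
    then obtain e where e: "e > 0" "ball y e \<subseteq> D"
      using \<open>S \<subseteq> D\<close> D(1) open_contains_ball by blast
    have "Re (f x) = Re (f y)" if "x \<in> ball y e" for x
    proof (rule harmonic_Re_local_max[OF harmonic_on_subset[OF har e(2)] e(1) _ that])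
      show "Re (f z) \<le> Re (f y)" if "z \<in> ball y e" for z
      proof -
        have "z \<in> closure D" using that e(2) closure_subset by blast
        from m(2)[OF this] show ?thesis using y by (simp add: S_def)
      qed
    qed
    moreover have "ball y e \<subseteq> closure D" using e(2) closure_subset[of D] by blast
    ultimately have "ball y e \<subseteq> S" using y unfolding S_def by auto
    then show "\<exists>e>0. ball y e \<subseteq> S" using e(1) by blast
  qed
  ultimately have "S = {}" using compact_open by blast
  then show False using m(1) by (auto simp: S_def)
qed

lemma harmonic_max_principle:
  assumes D: "open D" "bounded D" and cont: "continuous_on (closure D) f"
    and har: "f harmonic_on D" and le: "\<And>z. z \<in> frontier D \<Longrightarrow> cmod (f z) \<le> M"
    and z: "z \<in> closure D"
  shows "cmod (f z) \<le> M"
proof -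
  \<comment> \<open>The phase turns \<open>f z\<close> into its modulus, so the bound for real parts
    applies; for \<open>f z = 0\<close> the phase is 0 as well.\<close>
  define c where "c = cnj (sgn (f z))"
  have c: "cmod c \<le> 1" by (simp add: c_def norm_sgn)
  have "Re (c * f z) \<le> M"
  proof (rule harmonic_Re_max_principle[OF D, of "\<lambda>z. c * f z"])
    show "Re (c * f y) \<le> M" if "y \<in> frontier D" for y
    proof -
      have "Re (c * f y) \<le> cmod (c * f y)" by (rule complex_Re_le_cmod)
      also have "\<dots> \<le> 1 * cmod (f y)" unfolding norm_mult by (rule mult_right_mono[OF c]) simp
      finally show ?thesis using le[OF that] by simp
    qed
  qed (use cont har z in \<open>auto intro!: continuous_intros harmonic_on_cmult\<close>)
  moreover have "c * f z = cmod (f z)"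
    by (simp add: c_def sgn_eq complex_norm_square[symmetric] power2_eq_square mult.commute[of "cnj _"])
  ultimately show ?thesis by simp
qed

section \<open>Uniform limits of harmonic functions\<close>

lemma has_derivative_sequence_limit:
  fixes f :: "nat \<Rightarrow> complex \<Rightarrow> complex"
  assumes "convex S" "open S"
    and "\<And>n x. x \<in> S \<Longrightarrow> has_wirt (f n) (a n x) (b n x) x"
    and "uniform_limit S a A sequentially" "uniform_limit S b B sequentially"
    and lim: "\<And>x. x \<in> S \<Longrightarrow> (\<lambda>n. f n x) \<longlonglongrightarrow> g x" and x: "x \<in> S"
  shows "has_wirt g (A x) (B x) x"
proof -
  have "\<exists>G. \<forall>x\<in>S. (\<lambda>n. f n x) \<longlonglongrightarrow> G x \<and> (G has_derivative (\<lambda>v. A x * v + B x * cnj v)) (at x within S)"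
  proof (rule has_derivative_sequence[OF assms(1)])
    show "(f n has_derivative (\<lambda>v. a n x * v + b n x * cnj v)) (at x within S)" if "x \<in> S" for n x
      using assms(3)[OF that] unfolding has_wirt_def by (rule has_derivative_at_withinI)
    show "\<forall>\<^sub>F n in sequentially. \<forall>x\<in>S. \<forall>h. norm (a n x * h + b n x * cnj h - (A x * h + B x * cnj h)) \<le> e * norm h"
      if "e > 0" for e
    proof -
      have "\<forall>\<^sub>F n in sequentially. \<forall>x\<in>S. dist (a n x) (A x) < e / 2"
        using assms(4) that by (intro uniform_limitD) auto
      moreover have "\<forall>\<^sub>F n in sequentially. \<forall>x\<in>S. dist (b n x) (B x) < e / 2"
        using assms(5) that by (intro uniform_limitD) auto
      ultimately show ?thesis
      proof eventually_elim
        case (elim n)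
        show ?case
        proof (intro ballI allI)
          fix x h assume xS: "x \<in> S"
          have "norm (a n x * h + b n x * cnj h - (A x * h + B x * cnj h)) =
                norm ((a n x - A x) * h + (b n x - B x) * cnj h)" by (simp add: algebra_simps)
          also have "\<dots> \<le> norm (a n x - A x) * norm h + norm (b n x - B x) * norm h"
            using norm_triangle_ineq[of "(a n x - A x) * h" "(b n x - B x) * cnj h"]
            by (simp add: norm_mult)
          also have "\<dots> \<le> e / 2 * norm h + e / 2 * norm h"
            using elim xS by (intro add_mono mult_right_mono) (auto simp: dist_norm intro: less_imp_le)
          finally show "norm (a n x * h + b n x * cnj h - (A x * h + B x * cnj h)) \<le> e * norm h" by simp
        qed
      qed
    qed
    show "x \<in> S" "(\<lambda>n. f n x) \<longlonglongrightarrow> g x" using x lim by auto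
  qed
  then obtain G where G: "\<And>y. y \<in> S \<Longrightarrow> (\<lambda>n. f n y) \<longlonglongrightarrow> G y"
    "\<And>y. y \<in> S \<Longrightarrow> (G has_derivative (\<lambda>v. A y * v + B y * cnj v)) (at y within S)" by blast
  have "has_wirt G (A x) (B x) x"
    using G(2)[OF x] at_within_open[OF x assms(2)] unfolding has_wirt_def by simp
  then show ?thesis
    by (rule has_wirt_transform[OF _ assms(2) x]) (metis G(1) lim LIMSEQ_unique)
qed

lemma harmonic_gradient_diff:
  assumes "f harmonic_on ball a r" "g harmonic_on ball a r" "0 < r"
    and "\<And>z. z \<in> ball a r \<Longrightarrow> cmod (f z - g z) \<le> M"
  shows "cmod (wirt f a - wirt g a) \<le> 4 * M / r" "cmod (wirt_bar f a - wirt_bar g a) \<le> 4 * M / r"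
proof -
  have a: "a \<in> ball a r" using assms(3) by simp
  have "has_wirt (\<lambda>z. f z - g z) (wirt f a - wirt g a) (wirt_bar f a - wirt_bar g a) a"
    by (intro has_wirt_diff harmonic_on_has_wirt[OF _ a] assms)
  note w = has_wirt_unique[OF this]
  show "cmod (wirt f a - wirt g a) \<le> 4 * M / r" "cmod (wirt_bar f a - wirt_bar g a) \<le> 4 * M / r"
    using harmonic_gradient_bound[OF harmonic_on_diff[OF assms(1,2)] assms(3,4)] w by auto
qed

lemma uniform_limit_shift:
  assumes "uniform_limit S f g sequentially" shows "uniform_limit S (\<lambda>n. f (n + N)) g sequentially"
  using filterlim_compose[OF assms filterlim_add_const_nat_at_top] .

text \<open>The gradient estimate on discs of radius r/2 about the points of the half disc turns a
  uniformly Cauchy sequence of functions into uniformly Cauchy sequences of Wirtinger derivatives;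
  hence the loss of radius.\<close>

lemma harmonic_uniform_limit_aux:
  assumes har: "\<And>n. u n harmonic_on ball a r" and r: "0 < r"
    and ul: "uniform_limit (ball a r) u g sequentially"
  shows "g harmonic_on ball a (r/2)"
    and "uniform_limit (ball a (r/2)) (\<lambda>n. wirt (u n)) (wirt g) sequentially"
    and "uniform_limit (ball a (r/2)) (\<lambda>n. wirt_bar (u n)) (wirt_bar g) sequentially"
proof -
  let ?B = "ball a (r/2)"
  have sub: "ball x (r/2) \<subseteq> ball a r" if "x \<in> ?B" for x
  proof
    fix y assume "y \<in> ball x (r/2)"
    then show "y \<in> ball a r" using that dist_triangle[of a y x] by (simp add: dist_commute)
  qed
  have cau: "\<exists>N. \<forall>x\<in>?B. \<forall>m\<ge>N. \<forall>n\<ge>N. cmod (wirt (u m) x - wirt (u n) x) < e \<and>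
       cmod (wirt_bar (u m) x - wirt_bar (u n) x) < e"
    if e: "e > 0" for e
  proof -
    \<comment> \<open>Two functions within \<open>e'\<close> of the limit differ by at most 2e', so
      the gradient estimate on radius r/2 gives 4 * 2e' / (r/2) = e/2.\<close>
    define e' where "e' = e * r / 32"
    have e': "e' > 0" using e r by (simp add: e'_def)
    obtain N where N: "\<And>n z. n \<ge> N \<Longrightarrow> z \<in> ball a r \<Longrightarrow> dist (u n z) (g z) < e'"
      using uniform_limitD[OF ul e'] unfolding eventually_sequentially by blast
    have "cmod (wirt (u m) x - wirt (u n) x) < e \<and> cmod (wirt_bar (u m) x - wirt_bar (u n) x) < e"
      if mn: "m \<ge> N" "n \<ge> N" and x: "x \<in> ?B" for m n x
    proof -
      have b: "cmod (u m z - u n z) \<le> 2 * e'" if "z \<in> ball x (r/2)" for z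
      proof -
        have "z \<in> ball a r" using sub[OF x] that by blast
        then show ?thesis
          using N[OF mn(1)] N[OF mn(2)] dist_triangle2[of "u m z" "u n z" "g z"]
          by (smt (verit) dist_norm)
      qed
      have "4 * (2 * e') / (r/2) < e" using r e by (simp add: e'_def field_simps)
      then show ?thesis
        using harmonic_gradient_diff[OF harmonic_on_subset[OF har sub[OF x], of m]
          harmonic_on_subset[OF har sub[OF x], of n] _ b] r by (smt (verit) half_gt_zero)
    qed
    then show ?thesis by blast
  qed
  have "uniformly_convergent_on ?B (\<lambda>n. wirt (u n))" "uniformly_convergent_on ?B (\<lambda>n. wirt_bar (u n))"
    using cau by (intro Cauchy_uniformly_convergent; unfold uniformly_Cauchy_on_def dist_norm; meson)+
  then obtain A B where AB: "uniform_limit ?B (\<lambda>n. wirt (u n)) A sequentially"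
     "uniform_limit ?B (\<lambda>n. wirt_bar (u n)) B sequentially"
    unfolding uniformly_convergent_on_def by blast
  have subB: "?B \<subseteq> ball a r" using r by auto
  have hw: "has_wirt g (A x) (B x) x" if "x \<in> ?B" for x
  proof (rule has_derivative_sequence_limit[OF convex_ball open_ball _ AB _ that])
    show "has_wirt (u n) (wirt (u n) x) (wirt_bar (u n) x) x" if "x \<in> ?B" for n x
      using harmonic_on_has_wirt[OF har] that subB by blast
    show "(\<lambda>n. u n x) \<longlonglongrightarrow> g x" if "x \<in> ?B" for x
      using tendsto_uniform_limitI[OF ul] that subB by blast
  qed
  have AB': "wirt g x = A x" "wirt_bar g x = B x" if "x \<in> ?B" for x
    using has_wirt_unique[OF hw[OF that]] by auto
  have hol: "F holomorphic_on ?B" if ulF: "uniform_limit ?B f F sequentially" and "\<And>n. f n holomorphic_on ?B" for f F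
  proof (rule holomorphic_uniform_sequence[OF open_ball that(2)])
    fix x assume "x \<in> ?B"
    then obtain d where "d > 0" "cball x d \<subseteq> ?B" using open_contains_cball open_ball by blast
    then show "\<exists>d>0. cball x d \<subseteq> ?B \<and> uniform_limit (cball x d) f F sequentially"
      using uniform_limit_on_subset[OF ulF] by blast
  qed
  have h: "wirt (u n) holomorphic_on ?B" "(\<lambda>z. cnj (wirt_bar (u n) z)) holomorphic_on ?B" for n
    using har[of n] harmonic_on_subset[OF har subB] unfolding harmonic_on_def by blast+
  have ulB': "uniform_limit ?B (\<lambda>n z. cnj (wirt_bar (u n) z)) (\<lambda>z. cnj (B z)) sequentially"
    using AB(2) unfolding uniform_limit_iff dist_norm by (simp flip: complex_cnj_diff)
  show "g harmonic_on ?B"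
    by (rule harmonic_onI[OF hw hol[OF AB(1) h(1)] hol[OF ulB' h(2)]])
  show "uniform_limit ?B (\<lambda>n. wirt (u n)) (wirt g) sequentially"
       "uniform_limit ?B (\<lambda>n. wirt_bar (u n)) (wirt_bar g) sequentially"
    using uniform_limit_cong'[of ?B "\<lambda>n. wirt (u n)" "\<lambda>n. wirt (u n)" A "wirt g"]
      uniform_limit_cong'[of ?B "\<lambda>n. wirt_bar (u n)" "\<lambda>n. wirt_bar (u n)" B "wirt_bar g"] AB AB' by metis+
qed

text \<open>Applying the previous lemma around each point removes the loss of radius: harmonicity is
  local, and for the derivatives only pointwise convergence is claimed.\<close>

lemma harmonic_uniform_limit:
  assumes har: "\<forall>\<^sub>F n in sequentially. u n harmonic_on ball a r" and r: "0 < r"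
    and ul: "uniform_limit (ball a r) u g sequentially"
  shows "g harmonic_on ball a r"
    and "\<And>x. x \<in> ball a r \<Longrightarrow> (\<lambda>n. wirt (u n) x) \<longlonglongrightarrow> wirt g x"
    and "\<And>x. x \<in> ball a r \<Longrightarrow> (\<lambda>n. wirt_bar (u n) x) \<longlonglongrightarrow> wirt_bar g x"
proof -
  obtain N where N: "\<And>n. n \<ge> N \<Longrightarrow> u n harmonic_on ball a r"
    using har unfolding eventually_sequentially by blast
  define v where "v n = u (n + N)" for n
  have harv: "v n harmonic_on ball a r" for n unfolding v_def by (rule N) simp
  have ulv: "uniform_limit (ball a r) v g sequentially"
    unfolding v_def by (rule uniform_limit_shift[OF ul])
  have loc: "\<exists>s>0. g harmonic_on ball x s \<and> (\<lambda>n. wirt (u n) x) \<longlonglongrightarrow> wirt g x \<and>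
      (\<lambda>n. wirt_bar (u n) x) \<longlonglongrightarrow> wirt_bar g x" if "x \<in> ball a r" for x
  proof -
    obtain s where s: "s > 0" "ball x s \<subseteq> ball a r"
      using \<open>x \<in> ball a r\<close> open_contains_ball open_ball by blast
    note aux = harmonic_uniform_limit_aux[OF harmonic_on_subset[OF harv s(2)] s(1)
        uniform_limit_on_subset[OF ulv s(2)]]
    have x: "x \<in> ball x (s/2)" using s by simp
    have "(\<lambda>n. wirt (u (n + N)) x) \<longlonglongrightarrow> wirt g x" "(\<lambda>n. wirt_bar (u (n + N)) x) \<longlonglongrightarrow> wirt_bar g x"
      using tendsto_uniform_limitI[OF aux(2) x] tendsto_uniform_limitI[OF aux(3) x] by (simp_all add: v_def)
    then have "(\<lambda>n. wirt (u n) x) \<longlonglongrightarrow> wirt g x" "(\<lambda>n. wirt_bar (u n) x) \<longlonglongrightarrow> wirt_bar g x"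
      using LIMSEQ_offset[of "\<lambda>n. wirt (u n) x" N] LIMSEQ_offset[of "\<lambda>n. wirt_bar (u n) x" N] by auto
    then show ?thesis using aux(1) s(1) by (intro exI[of _ "s/2"]) auto
  qed
  show "g harmonic_on ball a r"
    by (rule harmonic_on_open_cover) (metis loc open_ball centre_in_ball)
  show "\<And>x. x \<in> ball a r \<Longrightarrow> (\<lambda>n. wirt (u n) x) \<longlonglongrightarrow> wirt g x"
    "\<And>x. x \<in> ball a r \<Longrightarrow> (\<lambda>n. wirt_bar (u n) x) \<longlonglongrightarrow> wirt_bar g x" using loc by blast+
qed


section \<open>Integration of Wirtinger derivatives\<close>

text \<open>The bounds \<open>c n\<close> may vary with n as long as they converge, which is what an
  exhaustion delivers; integrability of the limit is part of the conclusion.\<close>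

lemma Fatou_integrable:
  fixes f :: "nat \<Rightarrow> 'a \<Rightarrow> real"
  assumes int: "\<And>n. integrable M (f n)" and pos: "\<And>n x. 0 \<le> f n x"
    and lim: "AE x in M. (\<lambda>n. f n x) \<longlonglongrightarrow> g x" and meas: "g \<in> borel_measurable M"
    and g0: "\<And>x. 0 \<le> g x"
    and le: "\<And>n. integral\<^sup>L M (f n) \<le> c n" and c: "c \<longlonglongrightarrow> C"
  shows "integrable M g" "integral\<^sup>L M g \<le> C"
proof -
  have "(\<integral>\<^sup>+x. ennreal (g x) \<partial>M) = (\<integral>\<^sup>+x. liminf (\<lambda>n. ennreal (f n x)) \<partial>M)"
    using lim by (intro nn_integral_cong_AE) (auto elim!: eventually_mono intro!: lim_imp_Liminf[symmetric] tendsto_ennrealI)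
  also have "\<dots> \<le> liminf (\<lambda>n. \<integral>\<^sup>+x. ennreal (f n x) \<partial>M)"
    using int by (intro nn_integral_liminf) auto
  also have "\<dots> \<le> liminf (\<lambda>n. ennreal (c n))"
    using int pos le by (intro Liminf_mono always_eventually allI)
       (auto simp: nn_integral_eq_integral intro!: ennreal_leI)
  also have "\<dots> = ennreal C" using c by (intro lim_imp_Liminf tendsto_ennrealI) auto
  finally have *: "(\<integral>\<^sup>+x. ennreal (g x) \<partial>M) \<le> ennreal C" .
  have C: "0 \<le> C"
  proof (rule LIMSEQ_le_const[OF c])
    show "\<exists>N. \<forall>n\<ge>N. 0 \<le> c n" using le pos Bochner_Integration.integral_nonneg by (metis order_trans)
  qed
  show int: "integrable M g"
    using * g0 meas by (intro integrableI_bounded) (auto intro: le_less_trans)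
  show "integral\<^sup>L M g \<le> C"
    using * nn_integral_eq_integral[OF int] g0 C by (simp add: Bochner_Integration.integral_nonneg)
qed

section \<open>Integrals of derivatives of Lipschitz functions with bounded support\<close>

lemma lborel_integral_translate:
  fixes f :: "complex \<Rightarrow> complex"
  shows "(LINT z|lborel. f (v + z)) = (LINT z|lborel. f z)"
    and "integrable lborel f \<Longrightarrow> integrable lborel (\<lambda>z. f (v + z))"
proof -
  show "(LINT z|lborel. f (v + z)) = (LINT z|lborel. f z)"
  proof (cases "integrable lborel f")
    case True
    then have m: "f \<in> borel_measurable borel" by auto
    have "(LINT z|lborel. f z) = (LINT z|distr lborel borel ((+) v). f z)"
      by (simp add: lborel_distr_plus)
    also have "\<dots> = (LINT z|lborel. f (v + z))" using m by (subst integral_distr) auto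
    finally show ?thesis by simp
  next
    \<comment> \<open>Both integrals are 0 by convention once the translate is known not to be
      integrable either.\<close>
    case False
    have "\<not> integrable lborel (\<lambda>z. f (v + z))"
    proof
      assume i: "integrable lborel (\<lambda>z. f (v + z))"
      have "integrable (distr lborel borel ((+) (- v))) (\<lambda>z. f (v + z))"
        using i by (simp add: lborel_distr_plus)
      then have "integrable lborel (\<lambda>z. f (v + (- v + z)))"
        by (subst (asm) integrable_distr_eq) (use i in \<open>auto dest: borel_measurable_integrable\<close>)
      then show False using False by simp
    qed
    then show ?thesis using False by (simp add: not_integrable_integral_eq)
  qed
  show "integrable lborel (\<lambda>z. f (v + z))" if i: "integrable lborel f"
  proof -
    have "integrable (distr lborel borel ((+) v)) f" using i by (simp add: lborel_distr_plus)
    then show ?thesis using i by (subst (asm) integrable_distr_eq) auto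
  qed
qed

lemma integral_directional_derivative:
  fixes F :: "complex \<Rightarrow> complex"
  assumes lip: "\<And>x y. cmod (F x - F y) \<le> L * cmod (x - y)"
    and supp: "\<And>z. cmod z > R \<Longrightarrow> F z = 0"
    and der: "AE z in lborel. has_wirt F (A z) (B z) z"
    and meas: "A \<in> borel_measurable borel" "B \<in> borel_measurable borel"
  shows "integrable lborel (\<lambda>z. A z * v + B z * cnj v)"
    and "(LINT z|lborel. A z * v + B z * cnj v) = 0"
proof -
  define h where "h n = inverse (real (Suc n))" for n
  have h: "h n > 0" "h n \<le> 1" "h \<longlonglongrightarrow> 0" for n
    unfolding h_def using LIMSEQ_inverse_real_of_nat by (simp_all add: inverse_le_1_iff)
  have "cmod (F x - F y) \<le> \<bar>L\<bar> * cmod (x - y)" for x y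
    using lip[of x y] mult_right_mono[OF abs_ge_self norm_ge_zero, of L "x - y"] by linarith
  then have "\<bar>L\<bar>-lipschitz_on UNIV F" by (intro lipschitz_onI) (auto simp: dist_norm)
  then have "continuous_on UNIV F" by (rule lipschitz_on_continuous_on)
  then have mF: "F \<in> borel_measurable borel" by (rule borel_measurable_continuous_onI)
  define q where "q n z = (F (of_real (h n) * v + z) - F z) / of_real (h n)" for n z
  have intF: "integrable lborel F"
  proof -
    have "compact (cball 0 R :: complex set)" by simp
    moreover have "F = (\<lambda>z. indicator (cball 0 R) z *\<^sub>R F z)"
      using supp by (auto simp: indicator_def fun_eq_iff not_le)
    moreover have "continuous_on (cball 0 R) F" using \<open>continuous_on UNIV F\<close> continuous_on_subset by blast
    ultimately show ?thesis
      using borel_integrable_compact[of "cball 0 R" F] by metis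
  qed
  have int_q: "(LINT z|lborel. q n z) = 0" for n
    unfolding q_def using intF lborel_integral_translate(1)[of F "of_real (h n) * v"]
      lborel_integral_translate(2)[of F "of_real (h n) * v"] by simp
  \<comment> \<open>The steps \<open>h n\<close> are at most 1, so every difference quotient
    vanishes beyond radius R + |v|.\<close>
  define w where "w z = indicator (cball 0 (R + cmod v)) z * (\<bar>L\<bar> * cmod v)" for z :: complex
  have w: "integrable lborel w" unfolding w_def
    using borel_integrable_compact[of "cball 0 (R + cmod v) :: complex set" "\<lambda>_. \<bar>L\<bar> * cmod v"] by simp
  have bound: "cmod (q n z) \<le> w z" for n z
  proof (cases "cmod z > R + cmod v")
    case True
    have "cmod z \<le> cmod (of_real (h n) * v + z) + cmod (of_real (h n) * v)"
      by (metis add_diff_cancel_left' norm_triangle_sub norm_minus_commute add.commute)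
    moreover have "cmod (of_real (h n) * v) \<le> cmod v"
      using h(1)[of n] h(2)[of n] by (simp add: norm_mult mult_left_le_one_le)
    ultimately have "cmod (of_real (h n) * v + z) > R" using True by linarith
    moreover have "cmod z > R" using True norm_ge_zero[of v] by linarith
    ultimately show ?thesis using supp by (simp add: q_def w_def)
  next
    case False
    have "cmod (F (of_real (h n) * v + z) - F z) \<le> L * cmod (of_real (h n) * v)"
      using lip[of "of_real (h n) * v + z" z] by simp
    also have "\<dots> \<le> \<bar>L\<bar> * (h n * cmod v)" using h(1)[of n] h(2)[of n] by (simp add: norm_mult mult_right_mono)
    finally have "cmod (q n z) \<le> \<bar>L\<bar> * cmod v"
      using h(1)[of n] h(2)[of n] by (simp add: q_def norm_divide field_simps)
    then show ?thesis using False by (simp add: w_def)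
  qed
  have lim: "AE z in lborel. (\<lambda>n. q n z) \<longlonglongrightarrow> A z * v + B z * cnj v"
    using der
  proof eventually_elim
    case (elim z)
    let ?c = "A z * v + B z * cnj v"
    have 1: "((\<lambda>t. z + t *\<^sub>R v) has_derivative (\<lambda>t. t *\<^sub>R v)) (at 0)"
      by (auto intro!: derivative_eq_intros)
    have 2: "(F has_derivative (\<lambda>y. A z * y + B z * cnj y)) (at (z + 0 *\<^sub>R v))"
      using elim unfolding has_wirt_def by simp
    have "((\<lambda>t. F (z + t *\<^sub>R v)) has_derivative (\<lambda>t. A z * (t *\<^sub>R v) + B z * cnj (t *\<^sub>R v))) (at 0)"
      by (rule has_derivative_compose[OF 1 2])
    then have "((\<lambda>t. cmod (F (z + t *\<^sub>R v) - F z - (A z * (t *\<^sub>R v) + B z * cnj (t *\<^sub>R v))) / \<bar>t\<bar>) \<longlongrightarrow> 0) (at 0)"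
      unfolding has_derivative_at by simp
    moreover have "filterlim h (at 0) sequentially"
      using h by (intro filterlim_atI) (auto simp: less_imp_neq[OF h(1), symmetric])
    ultimately have "(\<lambda>n. cmod (F (z + h n *\<^sub>R v) - F z - (A z * (h n *\<^sub>R v) + B z * cnj (h n *\<^sub>R v))) / \<bar>h n\<bar>) \<longlonglongrightarrow> 0"
      by (rule filterlim_compose)
    moreover have "cmod (F (z + h n *\<^sub>R v) - F z - (A z * (h n *\<^sub>R v) + B z * cnj (h n *\<^sub>R v))) / \<bar>h n\<bar> = cmod (q n z - ?c)" for n
    proof -
      have "q n z - ?c = (F (z + h n *\<^sub>R v) - F z - (A z * (h n *\<^sub>R v) + B z * cnj (h n *\<^sub>R v))) / of_real (h n)"
        using h(1)[of n] by (simp add: q_def scaleR_conv_of_real add.commute field_simps)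
      then show ?thesis by (simp add: norm_divide)
    qed
    ultimately have "(\<lambda>n. cmod (q n z - ?c)) \<longlonglongrightarrow> 0" by simp
    then show ?case by (rule LIM_zero_cancel[OF tendsto_norm_zero_cancel])
  qed
  have mq: "q n \<in> borel_measurable lborel" for n
    unfolding q_def using mF by measurable
  have mAB: "(\<lambda>z. A z * v + B z * cnj v) \<in> borel_measurable lborel" using meas by measurable
  show "integrable lborel (\<lambda>z. A z * v + B z * cnj v)"
    by (rule integrable_dominated_convergence[OF mAB mq w lim]) (simp add: bound)
  have "(\<lambda>n. LINT z|lborel. q n z) \<longlonglongrightarrow> (LINT z|lborel. A z * v + B z * cnj v)"
    by (rule integral_dominated_convergence[OF mAB mq w lim]) (simp add: bound)
  then show "(LINT z|lborel. A z * v + B z * cnj v) = 0"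
    by (simp add: int_q LIMSEQ_const_iff)
qed

text \<open>The directions 1 and i give the integrals of \<open>A + B\<close> and of i(A -
  B).\<close>

lemma integral_wirt_zero:
  fixes F :: "complex \<Rightarrow> complex"
  assumes lip: "\<And>x y. cmod (F x - F y) \<le> L * cmod (x - y)"
    and supp: "\<And>z. cmod z > R \<Longrightarrow> F z = 0"
    and der: "AE z in lborel. has_wirt F (A z) (B z) z"
    and meas: "A \<in> borel_measurable borel" "B \<in> borel_measurable borel"
  shows "integrable lborel A" "integrable lborel B"
    and "(LINT z|lborel. A z) = 0" "(LINT z|lborel. B z) = 0"
proof -
  have D: "integrable lborel (\<lambda>z. A z * v + B z * cnj v)" "(LINT z|lborel. A z * v + B z * cnj v) = 0" for v
    using integral_directional_derivative[OF lip supp der meas] by blast+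
  have 1: "integrable lborel (\<lambda>z. A z + B z)" "(LINT z|lborel. A z + B z) = 0"
    using D[of 1] by auto
  have 2: "integrable lborel (\<lambda>z. A z - B z)" "(LINT z|lborel. A z - B z) = 0"
  proof -
    have "(\<lambda>z. A z - B z) = (\<lambda>z. - \<i> * (A z * \<i> + B z * cnj \<i>))" by (auto simp: algebra_simps)
    moreover have "integrable lborel (\<lambda>z. - \<i> * (A z * \<i> + B z * cnj \<i>))"
      by (intro integrable_mult_right D(1))
    moreover have "(LINT z|lborel. - \<i> * (A z * \<i> + B z * cnj \<i>)) = 0"
      by (subst integral_mult_right_zero) (simp only: D(2) mult_zero_right)
    ultimately show "integrable lborel (\<lambda>z. A z - B z)" "(LINT z|lborel. A z - B z) = 0" by auto
  qed
  have A: "A = (\<lambda>z. (1/2) * ((A z + B z) + (A z - B z)))" by auto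
  have B: "B = (\<lambda>z. (1/2) * ((A z + B z) - (A z - B z)))" by auto
  show iA: "integrable lborel A" by (subst A) (intro integrable_mult_right Bochner_Integration.integrable_add 1 2)
  show iB: "integrable lborel B" by (subst B) (intro integrable_mult_right Bochner_Integration.integrable_diff 1 2)
  have "integral\<^sup>L lborel A + integral\<^sup>L lborel B = 0" "integral\<^sup>L lborel A - integral\<^sup>L lborel B = 0"
    using 1 2 iA iB by auto
  then show "(LINT z|lborel. A z) = 0" "(LINT z|lborel. B z) = 0" by auto
qed

section \<open>Compactly supported C^1 functions and integration by parts on open sets\<close>

definition C1_compact :: "(complex \<Rightarrow> complex) \<Rightarrow> (complex \<Rightarrow> complex) \<Rightarrow> (complex \<Rightarrow> complex) \<Rightarrow> bool" where
  "C1_compact F A B \<longleftrightarrow> (\<forall>z. has_wirt F (A z) (B z) z) \<and> continuous_on UNIV A \<and> continuous_on UNIV B \<and>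
     (\<exists>R. \<forall>z. cmod z > R \<longrightarrow> F z = 0)"

lemma has_wirt_zero_on_open:
  assumes "has_wirt F a b z" "open S" "z \<in> S" "\<And>x. x \<in> S \<Longrightarrow> F x = 0"
  shows "a = 0" "b = 0"
proof -
  have "has_wirt (\<lambda>_. 0) a b z" by (rule has_wirt_transform[OF assms])
  then show "a = 0" "b = 0"
    using has_wirt_unique[OF has_wirt_const, of 0 z] has_wirt_unique[of "\<lambda>_. 0" a b z] by auto
qed

lemma continuous_compact_support_integrable:
  fixes f :: "complex \<Rightarrow> 'a::euclidean_space"
  assumes "continuous_on UNIV f" "\<And>z. cmod z > R \<Longrightarrow> f z = 0"
  shows "integrable lborel f" "\<exists>M. \<forall>z. norm (f z) \<le> M"
proof -
  have c: "continuous_on (cball 0 R) f" using assms(1) continuous_on_subset by blast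
  have e: "f = (\<lambda>z. indicator (cball 0 R) z *\<^sub>R f z)"
    using assms(2) by (auto simp: indicator_def fun_eq_iff not_le)
  show "integrable lborel f"
    using borel_integrable_compact[OF compact_cball c] e by metis
  have "bounded (f ` cball 0 R)"
    using compact_continuous_image[OF c compact_cball] compact_imp_bounded by blast
  then obtain M where M: "\<And>z. z \<in> cball 0 R \<Longrightarrow> norm (f z) \<le> M" unfolding bounded_iff by blast
  have "norm (f z) \<le> max M 0" for z
    using M[of z] assms(2)[of z] by (cases "cmod z > R") (auto simp: not_less)
  then show "\<exists>M. \<forall>z. norm (f z) \<le> M" by blast
qed

lemma C1_compactD:
  assumes "C1_compact F A B"
  obtains R where "\<And>z. cmod z > R \<Longrightarrow> F z = 0" "\<And>z. cmod z > R \<Longrightarrow> A z = 0" "\<And>z. cmod z > R \<Longrightarrow> B z = 0"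
proof -
  obtain R where R: "\<And>z. cmod z > R \<Longrightarrow> F z = 0" and w: "\<And>z. has_wirt F (A z) (B z) z"
    using assms unfolding C1_compact_def by blast
  have o: "open {z::complex. cmod z > R}" by (intro open_Collect_less continuous_intros)
  have "A z = 0" "B z = 0" if "cmod z > R" for z
    using has_wirt_zero_on_open[OF w o, of z] R that by auto
  then show ?thesis using that[of R] R by blast
qed

lemma C1_compact_continuous:
  assumes "C1_compact F A B" shows "continuous_on UNIV F" "continuous_on UNIV A" "continuous_on UNIV B"
proof -
  have "F differentiable (at z)" for z
    using assms has_wirt_imp_differentiable unfolding C1_compact_def by blast
  then show "continuous_on UNIV F"
    by (intro continuous_at_imp_continuous_on ballI differentiable_imp_continuous_within) 
qed (use assms in \<open>auto simp: C1_compact_def\<close>)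

lemma C1_compact_bounded:
  assumes "C1_compact F A B"
  obtains M where "\<And>z. cmod (F z) \<le> M" "\<And>z. cmod (A z) \<le> M" "\<And>z. cmod (B z) \<le> M"
proof -
  obtain R where R: "\<And>z. cmod z > R \<Longrightarrow> F z = 0" "\<And>z. cmod z > R \<Longrightarrow> A z = 0" "\<And>z. cmod z > R \<Longrightarrow> B z = 0"
    by (rule C1_compactD[OF assms]) blast
  obtain M1 where "\<And>z. cmod (F z) \<le> M1"
    using continuous_compact_support_integrable(2)[OF C1_compact_continuous(1)[OF assms] R(1)] by blast
  moreover obtain M2 where "\<And>z. cmod (A z) \<le> M2"
    using continuous_compact_support_integrable(2)[OF C1_compact_continuous(2)[OF assms] R(2)] by blast
  moreover obtain M3 where "\<And>z. cmod (B z) \<le> M3"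
    using continuous_compact_support_integrable(2)[OF C1_compact_continuous(3)[OF assms] R(3)] by blast
  ultimately show ?thesis using that[of "max M1 (max M2 M3)"] by (simp add: le_max_iff_disj)
qed

lemma C1_compact_lipschitz:
  assumes "C1_compact F A B"
  obtains L where "0 \<le> L" "\<And>x y. cmod (F x - F y) \<le> L * cmod (x - y)"
proof -
  obtain M where M: "\<And>z. cmod (F z) \<le> M" "\<And>z. cmod (A z) \<le> M" "\<And>z. cmod (B z) \<le> M"
    by (rule C1_compact_bounded[OF assms]) blast
  have M0: "0 \<le> M" using M(1)[of 0] norm_ge_zero order_trans by blast
  have "cmod (F x - F y) \<le> (2 * M) * cmod (x - y)" for x y
  proof (rule differentiable_bound[OF convex_UNIV])
    show "(F has_derivative (\<lambda>v. A z * v + B z * cnj v)) (at z within UNIV)" for z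
      using assms unfolding C1_compact_def has_wirt_def by auto
    show "onorm (\<lambda>v. A z * v + B z * cnj v) \<le> 2 * M" for z
    proof (rule onorm_le)
      fix v
      have "cmod (A z * v + B z * cnj v) \<le> cmod (A z) * cmod v + cmod (B z) * cmod v"
        by (metis complex_mod_cnj norm_mult norm_triangle_ineq)
      also have "\<dots> \<le> M * cmod v + M * cmod v" by (intro add_mono mult_right_mono M) auto
      finally show "cmod (A z * v + B z * cnj v) \<le> 2 * M * cmod v" by simp
    qed
  qed auto
  then show ?thesis using that[of "2 * M"] M0 by auto
qed

lemma C1_compact_integral:
  assumes "C1_compact F A B"
  shows "integrable lborel F" "integrable lborel A" "integrable lborel B"
    "(LINT z|lborel. A z) = 0" "(LINT z|lborel. B z) = 0"
proof -
  obtain R where R: "\<And>z. cmod z > R \<Longrightarrow> F z = 0" "\<And>z. cmod z > R \<Longrightarrow> A z = 0" "\<And>z. cmod z > R \<Longrightarrow> B z = 0"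
    by (rule C1_compactD[OF assms]) blast
  obtain L where L: "0 \<le> L" "\<And>x y. cmod (F x - F y) \<le> L * cmod (x - y)"
    by (rule C1_compact_lipschitz[OF assms]) blast
  show "integrable lborel F" 
    by (rule continuous_compact_support_integrable(1)[OF C1_compact_continuous(1)[OF assms] R(1)])
  have w: "AE z in lborel. has_wirt F (A z) (B z) z" using assms by (simp add: C1_compact_def)
  have m: "A \<in> borel_measurable borel" "B \<in> borel_measurable borel"
    using C1_compact_continuous[OF assms] borel_measurable_continuous_onI by blast+
  show "integrable lborel A" "integrable lborel B" "(LINT z|lborel. A z) = 0" "(LINT z|lborel. B z) = 0"
    using integral_wirt_zero[OF L(2) R(1) w m] by auto
qed

lemma C1_compact_mult:
  assumes "C1_compact F A B" "\<And>z. has_wirt f (a z) (b z) z" "continuous_on UNIV a" "continuous_on UNIV b"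
  shows "C1_compact (\<lambda>z. F z * f z) (\<lambda>z. A z * f z + F z * a z) (\<lambda>z. B z * f z + F z * b z)"
proof -
  have "continuous_on UNIV f"
    using assms(2) has_wirt_imp_differentiable
    by (intro continuous_at_imp_continuous_on ballI differentiable_imp_continuous_within) blast
  then show ?thesis
    using assms C1_compact_continuous[OF assms(1)] unfolding C1_compact_def
    by (auto intro!: has_wirt_mult continuous_intros)
qed

lemma C1_compact_cnj: "C1_compact F A B \<Longrightarrow> C1_compact (\<lambda>z. cnj (F z)) (\<lambda>z. cnj (B z)) (\<lambda>z. cnj (A z))"
  unfolding C1_compact_def by (auto intro!: has_wirt_cnj continuous_intros)

definition extend0 :: "complex set \<Rightarrow> (complex \<Rightarrow> complex) \<Rightarrow> complex \<Rightarrow> complex" where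
  "extend0 S F z = (if z \<in> S then F z else 0)"

text \<open>On the open set \<open>S - K\<close> the function vanishes, hence so do its derivatives,
  and extension by 0 is C^1 across the frontier of \<open>S\<close>, however irregular that frontier
  is.\<close>

lemma C1_compact_extend0:
  assumes S: "open S" and K: "compact K" "K \<subseteq> S"
    and w: "\<And>z. z \<in> S \<Longrightarrow> has_wirt F (A z) (B z) z"
    and c: "continuous_on S A" "continuous_on S B"
    and zero: "\<And>z. z \<in> S - K \<Longrightarrow> F z = 0"
  shows "C1_compact (extend0 S F) (extend0 S A) (extend0 S B)"
proof -
  have oK: "open (- K)" using K by (simp add: compact_imp_closed open_Compl)
  have oSK: "open (S - K)" using S K by (simp add: compact_imp_closed open_Diff)
  have zAB: "A z = 0" "B z = 0" if "z \<in> S - K" for z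
    using has_wirt_zero_on_open[OF w oSK that] zero that by auto
  have un: "UNIV = S \<union> - K" using K by auto
  have e0: "extend0 S F z = 0" "extend0 S A z = 0" "extend0 S B z = 0" if "z \<in> - K" for z
    using that zero zAB by (auto simp: extend0_def)
  have "has_wirt (extend0 S F) (extend0 S A z) (extend0 S B z) z" for z
  proof (cases "z \<in> S")
    case True
    show ?thesis
      by (rule has_wirt_transform[OF _ S True, of F])
         (use w[OF True] True in \<open>auto simp: extend0_def\<close>)
  next
    case False
    then have z: "z \<in> - K" using K by auto
    show ?thesis
      by (rule has_wirt_transform[OF _ oK z, of "\<lambda>_. 0"]) (use e0 z has_wirt_const in auto)
  qed
  moreover have "continuous_on UNIV (extend0 S G)"
    if "continuous_on S G" "\<And>z. z \<in> - K \<Longrightarrow> extend0 S G z = 0" for G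
  proof -
    have "continuous_on S (extend0 S G)" using that(1) by (simp add: extend0_def cong: continuous_on_cong)
    moreover have "continuous_on (- K) (extend0 S G)" using that(2)
      by (intro continuous_on_eq[OF continuous_on_const[of _ 0]]) simp
    ultimately show ?thesis using continuous_on_open_Un[OF S oK] un by metis
  qed
  moreover obtain R where "\<And>z. z \<in> K \<Longrightarrow> cmod z \<le> R"
    using compact_imp_bounded[OF K(1)] unfolding bounded_iff by blast
  then have "\<forall>z. cmod z > R \<longrightarrow> extend0 S F z = 0" using e0(1) by fastforce
  ultimately show ?thesis unfolding C1_compact_def using c e0 by blast
qed

lemma set_lint_extend0: "(LINT z:S|M. F z) = (LINT z|M. extend0 S F z)"
  unfolding set_lebesgue_integral_def extend0_def by (rule Bochner_Integration.integral_cong) auto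

lemma set_integrable_extend0: "set_integrable M S F \<longleftrightarrow> integrable M (extend0 S F)"
  unfolding set_integrable_def extend0_def by (rule Bochner_Integration.integrable_cong) auto

text \<open>A divergence theorem on an open set; there is no boundary term because \<open>F\<close>
  vanishes off a compact subset.\<close>

lemma integral_wirt_open_zero:
  assumes "open S" "compact K" "K \<subseteq> S"
    and "\<And>z. z \<in> S \<Longrightarrow> has_wirt F (A z) (B z) z"
    and "continuous_on S A" "continuous_on S B"
    and "\<And>z. z \<in> S - K \<Longrightarrow> F z = 0"
  shows "set_integrable lborel S A" "set_integrable lborel S B"
    "(LINT z:S|lborel. A z) = 0" "(LINT z:S|lborel. B z) = 0"
  using C1_compact_integral[OF C1_compact_extend0[OF assms]]
  by (auto simp: set_lint_extend0 set_integrable_extend0)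


subsection \<open>Cutoff functions\<close>

definition ramp_sq :: "real \<Rightarrow> real" where "ramp_sq x = (max x 0)\<^sup>2"

lemma ramp_sq_deriv: "(ramp_sq has_real_derivative 2 * max x 0) (at x)"
proof (cases x "0::real" rule: linorder_cases)
  case less
  have "((\<lambda>x::real. 0) has_real_derivative 0) (at x)" by simp
  then have "(ramp_sq has_real_derivative 0) (at x)"
    by (rule has_field_derivative_transform_within_open[where S = "{..<0}"])
       (use less in \<open>simp_all add: ramp_sq_def\<close>)
  then show ?thesis using less by simp
next
  case greater
  have "((\<lambda>x::real. x\<^sup>2) has_real_derivative 2 * x) (at x)" by (auto intro!: derivative_eq_intros)
  then have "(ramp_sq has_real_derivative 2 * x) (at x)"
    by (rule has_field_derivative_transform_within_open[where S = "{0<..}"])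
       (use greater in \<open>simp_all add: ramp_sq_def\<close>)
  then show ?thesis using greater by simp
next
  case equal
  have "((\<lambda>h::real. (ramp_sq (0 + h) - ramp_sq 0) / h) \<longlongrightarrow> 0) (at 0)"
  proof (rule Lim_null_comparison)
    show "\<forall>\<^sub>F h in at 0. norm ((ramp_sq (0 + h) - ramp_sq 0) / h) \<le> \<bar>h\<bar>"
      by (auto simp: ramp_sq_def power2_eq_square max_def abs_mult intro!: always_eventually)
    show "((\<lambda>h::real. \<bar>h\<bar>) \<longlongrightarrow> 0) (at 0)" by (auto intro!: tendsto_eq_intros)
  qed
  then show ?thesis using equal by (simp add: DERIV_def)
qed

text \<open>With s = 2 - 2|z - w|^2 / r^2, the inner \<open>ramp_sq\<close> is at least 1 when |z -
  w|^2 <= r^2 / 2, where the outer one vanishes, and it is 0 when |z - w| >= r. Squares of positive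
  parts keep everything C^1, which is enough for a single integration by parts; smooth test
  functions come from \<open>bump\<close>.\<close>

definition cutoff :: "complex \<Rightarrow> real \<Rightarrow> complex \<Rightarrow> real" where
  "cutoff w r z = 1 - ramp_sq (1 - ramp_sq (2 - 2 * (cmod (z - w))\<^sup>2 / r\<^sup>2))"

lemma cutoff_range: "0 \<le> cutoff w r z" "cutoff w r z \<le> 1"
proof -
  have "0 \<le> ramp_sq t" for t by (simp add: ramp_sq_def)
  moreover have "ramp_sq (1 - t) \<le> 1" if "t \<ge> 0" for t
    using that by (auto simp: ramp_sq_def max_def intro!: power_le_one)
  ultimately show "0 \<le> cutoff w r z" "cutoff w r z \<le> 1" unfolding cutoff_def by (auto simp: field_simps)
qed

lemma cutoff_eq_1:
  assumes "r > 0" "(cmod (z - w))\<^sup>2 \<le> r\<^sup>2 / 2" shows "cutoff w r z = 1"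
proof -
  have "2 - 2 * (cmod (z - w))\<^sup>2 / r\<^sup>2 \<ge> 1" using assms by (simp add: field_simps)
  then have "ramp_sq (2 - 2 * (cmod (z - w))\<^sup>2 / r\<^sup>2) \<ge> 1" by (simp add: ramp_sq_def one_le_power)
  then show ?thesis by (simp add: cutoff_def ramp_sq_def)
qed

lemma cutoff_eq_1':
  assumes "r > 0" "cmod (z - w) \<le> r / 2" shows "cutoff w r z = 1"
proof (rule cutoff_eq_1[OF assms(1)])
  have "(cmod (z - w))\<^sup>2 \<le> (r / 2)\<^sup>2" using assms by (intro power_mono) auto
  also have "\<dots> \<le> r\<^sup>2 / 2" by (simp add: power_divide)
  finally show "(cmod (z - w))\<^sup>2 \<le> r\<^sup>2 / 2" .
qed

lemma cutoff_eq_0: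
  assumes "r > 0" "cmod (z - w) \<ge> r" shows "cutoff w r z = 0"
proof -
  have "(cmod (z - w))\<^sup>2 \<ge> r\<^sup>2" using assms by (intro power_mono) auto
  then have "2 - 2 * (cmod (z - w))\<^sup>2 / r\<^sup>2 \<le> 0" using assms(1) by (simp add: field_simps)
  then show ?thesis by (simp add: cutoff_def ramp_sq_def)
qed

lemma cutoff_C1_compact:
  assumes "r > 0"
  obtains A B where "C1_compact (\<lambda>z. of_real (cutoff w r z)) A B"
proof -
  define \<theta> where "\<theta> t = 1 - ramp_sq (1 - ramp_sq (2 - 2 * t / r\<^sup>2))" for t
  define \<theta>' where "\<theta>' t = (2 * max (1 - ramp_sq (2 - 2 * t / r\<^sup>2)) 0) * (2 * max (2 - 2 * t / r\<^sup>2) 0 * (- 2 / r\<^sup>2))" for t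
  have d: "(\<theta> has_real_derivative \<theta>' t) (at t)" for t
  proof -
    have 1: "((\<lambda>t. 2 - 2 * t / r\<^sup>2) has_real_derivative - 2 / r\<^sup>2) (at t)"
    proof -
      show ?thesis using DERIV_diff[OF DERIV_const DERIV_cmult_Id, of 2 "2 / r\<^sup>2" t UNIV] by simp
    qed
    have 2: "((\<lambda>t. 1 - ramp_sq (2 - 2 * t / r\<^sup>2)) has_real_derivative - (2 * max (2 - 2 * t / r\<^sup>2) 0 * (- 2 / r\<^sup>2))) (at t)"
      using DERIV_diff[OF DERIV_const DERIV_chain2[OF ramp_sq_deriv 1], of 1] by simp
    show ?thesis
      unfolding \<theta>_def \<theta>'_def using DERIV_diff[OF DERIV_const DERIV_chain2[OF ramp_sq_deriv 2], of 1] by simp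
  qed
  have c': "continuous_on UNIV \<theta>'"
    unfolding \<theta>'_def ramp_sq_def by (intro continuous_intros) (use assms in auto)
  have w: "has_wirt (\<lambda>z. of_real (cutoff w r z)) (of_real (\<theta>' ((cmod (z - w))\<^sup>2)) * cnj (z - w))
      (of_real (\<theta>' ((cmod (z - w))\<^sup>2)) * (z - w)) z" for z
    using has_wirt_chain_real[OF has_wirt_cmod_sq d] by (simp add: cutoff_def \<theta>_def)
  have "C1_compact (\<lambda>z. of_real (cutoff w r z)) (\<lambda>z. of_real (\<theta>' ((cmod (z - w))\<^sup>2)) * cnj (z - w))
      (\<lambda>z. of_real (\<theta>' ((cmod (z - w))\<^sup>2)) * (z - w))"
    unfolding C1_compact_def
  proof (intro conjI allI w)
    show "continuous_on UNIV (\<lambda>z. complex_of_real (\<theta>' ((cmod (z - w))\<^sup>2)) * cnj (z - w))"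
      by (intro continuous_intros continuous_on_compose2[OF c']) auto
    show "continuous_on UNIV (\<lambda>z. complex_of_real (\<theta>' ((cmod (z - w))\<^sup>2)) * (z - w))"
      by (intro continuous_intros continuous_on_compose2[OF c']) auto
    have "cutoff w r z = 0" if "cmod z > r + cmod w" for z
    proof (rule cutoff_eq_0[OF assms])
      show "r \<le> cmod (z - w)" using that norm_triangle_ineq2[of z w] by linarith
    qed
    then show "\<exists>R. \<forall>z. R < cmod z \<longrightarrow> complex_of_real (cutoff w r z) = 0"
      by (intro exI[of _ "r + cmod w"]) auto
  qed
  then show ?thesis using that by blast
qed


subsection \<open>The Cauchy--Pompeiu formula\<close>

lemma max_cmod_lipschitz:
  assumes "\<delta> > 0"
  shows "\<bar>max (cmod x) \<delta> - max (cmod y) \<delta>\<bar> \<le> cmod (x - y)"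
    and "\<bar>1 / max (cmod x) \<delta> - 1 / max (cmod y) \<delta>\<bar> \<le> 1 / (max (cmod y) \<delta> * \<delta>) * cmod (x - y)"
proof -
  show 1: "\<bar>max (cmod x) \<delta> - max (cmod y) \<delta>\<bar> \<le> cmod (x - y)"
    using norm_triangle_ineq3[of x y] by linarith
  define a b where "a = max (cmod x) \<delta>" and "b = max (cmod y) \<delta>"
  have p: "a > 0" "b > 0" "a \<ge> \<delta>" using assms by (simp_all add: a_def b_def)
  have "1 / a - 1 / b = (b - a) / (a * b)" using p by (simp add: field_simps)
  then have "\<bar>1 / a - 1 / b\<bar> = \<bar>a - b\<bar> / (a * b)" using p by (simp add: abs_minus_commute)
  also have "\<dots> \<le> cmod (x - y) / (\<delta> * b)"
    using 1 p assms by (intro frac_le mult_right_mono) (simp_all add: a_def[symmetric] b_def[symmetric])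
  finally have "\<bar>1 / a - 1 / b\<bar> \<le> 1 / (b * \<delta>) * cmod (x - y)" by (simp add: mult.commute)
  then show "\<bar>1 / max (cmod x) \<delta> - 1 / max (cmod y) \<delta>\<bar> \<le> 1 / (max (cmod y) \<delta> * \<delta>) * cmod (x - y)"
    by (simp only: a_def b_def)
qed

lemma of_real_cmod_power2: "(complex_of_real (cmod z))\<^sup>2 = z * cnj z"
  by (metis complex_norm_square of_real_power)

text \<open>The \<open>z\<close>-derivative of \<open>trunc_unit \<delta>\<close> dominates \<open>1 / (2 |z|)\<close> off the disc of radius \<open>\<delta>\<close>, which yields
  the local integrability of \<open>1 / |z|\<close> without polar coordinates.\<close>

definition trunc_unit :: "real \<Rightarrow> complex \<Rightarrow> complex" where
  "trunc_unit \<delta> z = z / of_real (max (cmod z) \<delta>)"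

text \<open>A Lipschitz truncation of \<open>1 / cnj z\<close>: its \<open>z\<close>-derivative is the normalised indicator
  \<open>1 / \<delta>\<^sup>2\<close> of the disc of radius \<open>\<delta>\<close>, so the constant in Cauchy--Pompeiu is the area of the unit disc.\<close>

definition trunc_inv :: "real \<Rightarrow> complex \<Rightarrow> complex" where
  "trunc_inv \<delta> z = z / of_real ((max (cmod z) \<delta>)\<^sup>2)"

lemma trunc_unit_bounds:
  assumes d: "\<delta> > 0"
  shows "cmod (trunc_unit \<delta> z) \<le> 1" "cmod (trunc_unit \<delta> x - trunc_unit \<delta> y) \<le> 2 / \<delta> * cmod (x - y)"
proof -
  show "cmod (trunc_unit \<delta> z) \<le> 1"
    using d by (simp add: trunc_unit_def norm_divide)
  define a b where "a = max (cmod x) \<delta>" and "b = max (cmod y) \<delta>"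
  have p: "a > 0" "b > 0" "a \<ge> \<delta>" "cmod y \<le> b" using d by (simp_all add: a_def b_def)
  have L: "\<bar>1 / a - 1 / b\<bar> \<le> 1 / (b * \<delta>) * cmod (x - y)"
    using max_cmod_lipschitz(2)[OF d] by (simp only: a_def b_def)
  have "trunc_unit \<delta> x - trunc_unit \<delta> y = (x - y) / of_real a + y * of_real (1 / a - 1 / b)"
    using p by (simp add: trunc_unit_def a_def[symmetric] b_def[symmetric] field_simps)
  then have "cmod (trunc_unit \<delta> x - trunc_unit \<delta> y) \<le> cmod ((x - y) / of_real a) + cmod (y * of_real (1 / a - 1 / b))"
    by (simp only: norm_triangle_ineq)
  also have "\<dots> = cmod (x - y) / a + cmod y * \<bar>1 / a - 1 / b\<bar>"
    using p by (simp add: norm_divide norm_mult del: of_real_diff of_real_divide)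
  also have "\<dots> \<le> cmod (x - y) / \<delta> + cmod y * (1 / (b * \<delta>) * cmod (x - y))"
    using p d by (intro add_mono divide_left_mono mult_left_mono L) simp_all
  also have "cmod y * (1 / (b * \<delta>) * cmod (x - y)) = (cmod y / b) * (cmod (x - y) / \<delta>)" by simp
  also have "\<dots> \<le> 1 * (cmod (x - y) / \<delta>)" using p d by (intro mult_right_mono) simp_all
  finally show "cmod (trunc_unit \<delta> x - trunc_unit \<delta> y) \<le> 2 / \<delta> * cmod (x - y)" by simp
qed

lemma trunc_inv_bounds:
  assumes d: "\<delta> > 0"
  shows "cmod (trunc_inv \<delta> z) \<le> 1 / \<delta>" "cmod (trunc_inv \<delta> x - trunc_inv \<delta> y) \<le> 3 / \<delta>\<^sup>2 * cmod (x - y)"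
proof -
  define m where "m z = max (cmod z) \<delta>" for z
  have p: "m z > 0" "m z \<ge> \<delta>" for z using d by (simp_all add: m_def less_max_iff_disj)
  have i: "1 / m z \<le> 1 / \<delta>" "\<bar>1 / m z\<bar> \<le> 1 / \<delta>" for z
    using p[of z] d by (simp_all add: frac_le abs_of_pos)
  have L: "\<bar>1 / m x - 1 / m y\<bar> \<le> 1 / (m y * \<delta>) * cmod (x - y)"
    using max_cmod_lipschitz(2)[OF d] by (simp only: m_def)
  have eq: "trunc_inv \<delta> z = trunc_unit \<delta> z * of_real (1 / m z)" for z
    by (simp add: trunc_inv_def trunc_unit_def power2_eq_square m_def)
  show "cmod (trunc_inv \<delta> z) \<le> 1 / \<delta>"
  proof -
    have "cmod (trunc_inv \<delta> z) = cmod (trunc_unit \<delta> z) * \<bar>1 / m z\<bar>"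
      unfolding eq norm_mult norm_of_real ..
    also have "\<dots> \<le> 1 * (1 / \<delta>)" using i d by (intro mult_mono trunc_unit_bounds(1)) simp_all
    finally show ?thesis by simp
  qed
  have "trunc_inv \<delta> x - trunc_inv \<delta> y = (trunc_unit \<delta> x - trunc_unit \<delta> y) * of_real (1 / m x) +
      trunc_unit \<delta> y * of_real (1 / m x - 1 / m y)"
    by (simp add: eq algebra_simps diff_divide_distrib)
  then have "cmod (trunc_inv \<delta> x - trunc_inv \<delta> y) \<le> cmod (trunc_unit \<delta> x - trunc_unit \<delta> y) * \<bar>1 / m x\<bar> +
      cmod (trunc_unit \<delta> y) * \<bar>1 / m x - 1 / m y\<bar>"
    by (metis norm_mult norm_of_real norm_triangle_ineq)
  also have "\<dots> \<le> (2 / \<delta> * cmod (x - y)) * (1 / \<delta>) + 1 * (1 / (m y * \<delta>) * cmod (x - y))"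
    using d by (intro add_mono mult_mono trunc_unit_bounds L i) simp_all
  also have "\<dots> \<le> (2 / \<delta> * cmod (x - y)) * (1 / \<delta>) + 1 * (1 / (\<delta> * \<delta>) * cmod (x - y))"
    using p[of y] d by (intro add_left_mono mult_left_mono mult_right_mono divide_left_mono) simp_all
  also have "\<dots> = 3 / \<delta>\<^sup>2 * cmod (x - y)" using d by (simp add: power2_eq_square field_simps)
  finally show "cmod (trunc_inv \<delta> x - trunc_inv \<delta> y) \<le> 3 / \<delta>\<^sup>2 * cmod (x - y)" .
qed

lemma open_cmod_less: "open {z::complex. cmod z < \<delta>}" "open {z::complex. \<delta> < cmod z}"
  by (intro open_Collect_less continuous_intros)+

lemma trunc_inv_has_wirt:
  assumes d: "\<delta> > 0" and z: "cmod z \<noteq> \<delta>"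
  shows "has_wirt (trunc_inv \<delta>) (if cmod z < \<delta> then of_real (1 / \<delta>\<^sup>2) else 0)
     (if cmod z < \<delta> then 0 else - 1 / (cnj z)\<^sup>2) z"
proof (cases "cmod z < \<delta>")
  case True
  have "has_wirt (\<lambda>z. of_real (1 / \<delta>\<^sup>2) * z) (of_real (1 / \<delta>\<^sup>2)) 0 z"
    using has_wirt_cmult[OF has_wirt_ident, of "of_real (1 / \<delta>\<^sup>2)" z] by simp
  then have "has_wirt (trunc_inv \<delta>) (of_real (1 / \<delta>\<^sup>2)) 0 z"
    by (rule has_wirt_transform[OF _ open_cmod_less(1)[of \<delta>]]) (use True in \<open>auto simp: trunc_inv_def max_def\<close>)
  then show ?thesis using True by simp
next
  case False
  then have zd: "\<delta> < cmod z" using z by simp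
  then have z0: "z \<noteq> 0" using d by auto
  have "((\<lambda>z. 1 / z) has_field_derivative (- 1 / z\<^sup>2)) (at z)"
    using z0 by (auto intro!: derivative_eq_intros simp: power2_eq_square)
  from has_wirt_cnj[OF has_wirt_field_derivative[OF this]]
  have "has_wirt (\<lambda>z. cnj (1 / z)) 0 (- 1 / (cnj z)\<^sup>2) z" by simp
  then have "has_wirt (trunc_inv \<delta>) 0 (- 1 / (cnj z)\<^sup>2) z"
  proof (rule has_wirt_transform[OF _ open_cmod_less(2)[of \<delta>]])
    fix x assume "x \<in> {z. \<delta> < cmod z}"
    then have "x \<noteq> 0" "max (cmod x) \<delta> = cmod x" using d by auto
    then show "cnj (1 / x) = trunc_inv \<delta> x"
      by (simp add: trunc_inv_def of_real_cmod_power2 divide_simps)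
  qed (use zd in auto)
  then show ?thesis using False by simp
qed

lemma trunc_unit_has_wirt:
  assumes d: "\<delta> > 0" and z: "cmod z \<noteq> \<delta>"
  shows "has_wirt (trunc_unit \<delta>) (if cmod z < \<delta> then of_real (1 / \<delta>) else of_real (1 / (2 * cmod z)))
     (if cmod z < \<delta> then 0 else - (z\<^sup>2) / of_real (2 * cmod z ^ 3)) z"
proof (cases "cmod z < \<delta>")
  case True
  have "has_wirt (\<lambda>z. of_real (1 / \<delta>) * z) (of_real (1 / \<delta>)) 0 z"
    using has_wirt_cmult[OF has_wirt_ident, of "of_real (1 / \<delta>)" z] by simp
  then have "has_wirt (trunc_unit \<delta>) (of_real (1 / \<delta>)) 0 z"
    by (rule has_wirt_transform[OF _ open_cmod_less(1)[of \<delta>]]) (use True in \<open>auto simp: trunc_unit_def max_def\<close>)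
  then show ?thesis using True by simp
next
  case False
  then have zd: "\<delta> < cmod z" using z by simp
  then have z0: "z \<noteq> 0" using d by auto
  have sq: "has_wirt (\<lambda>z. of_real ((cmod z)\<^sup>2)) (cnj z) z z" using has_wirt_cmod_sq[of 0 z] by simp
  have "((\<lambda>t. 1 / sqrt t) has_real_derivative (- 1 / (2 * cmod z ^ 3))) (at ((cmod z)\<^sup>2))"
    using z0 by (auto intro!: derivative_eq_intros simp: power2_eq_square power3_eq_cube field_simps)
  from has_wirt_mult[OF has_wirt_ident has_wirt_chain_real[OF sq this]]
  have 1: "has_wirt (\<lambda>z. z * of_real (1 / sqrt ((cmod z)\<^sup>2))) (1 * of_real (1 / sqrt ((cmod z)\<^sup>2)) +
       z * (of_real (- 1 / (2 * cmod z ^ 3)) * cnj z)) (0 * of_real (1 / sqrt ((cmod z)\<^sup>2)) +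
       z * (of_real (- 1 / (2 * cmod z ^ 3)) * z)) z" .
  have 2: "1 * complex_of_real (1 / sqrt ((cmod z)\<^sup>2)) + z * (of_real (- 1 / (2 * cmod z ^ 3)) * cnj z) = of_real (1 / (2 * cmod z))"
  proof -
    have "z * (of_real (- 1 / (2 * cmod z ^ 3)) * cnj z) = of_real (- 1 / (2 * cmod z ^ 3)) * of_real ((cmod z)\<^sup>2)"
      by (simp add: of_real_cmod_power2 algebra_simps)
    also have "\<dots> = of_real (- 1 / (2 * cmod z))" using z0 by (simp add: power2_eq_square power3_eq_cube)
    finally show ?thesis using z0 by (simp add: field_simps)
  qed
  have 3: "0 * of_real (1 / sqrt ((cmod z)\<^sup>2)) + z * (of_real (- 1 / (2 * cmod z ^ 3)) * z) = - (z\<^sup>2) / of_real (2 * cmod z ^ 3)"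
    by (simp add: power2_eq_square)
  have "has_wirt (trunc_unit \<delta>) (of_real (1 / (2 * cmod z))) (- (z\<^sup>2) / of_real (2 * cmod z ^ 3)) z"
    by (rule has_wirt_transform[OF has_wirt_cong[OF 1 2 3] open_cmod_less(2)[of \<delta>]])
       (use zd in \<open>simp_all add: trunc_unit_def divide_inverse\<close>)
  then show ?thesis using False by simp
qed

section \<open>Local integrability of 1/|z - w|\<close>

lemma AE_cmod_neq: "\<delta> > 0 \<Longrightarrow> AE z in lborel. cmod (z - w) \<noteq> \<delta>"
proof -
  have "sphere w \<delta> \<in> null_sets lborel"
    using negligible_sphere[of w \<delta>] by (simp add: negligible_iff_null_sets null_sets_completion_iff)
  then have "AE z in lborel. z \<notin> sphere w \<delta>" by (rule AE_not_in)
  then show ?thesis by (rule eventually_mono) (simp add: dist_norm norm_minus_commute)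
qed

lemma has_wirt_shift: "has_wirt f a b (z - w) \<Longrightarrow> has_wirt (\<lambda>z. f (z - w)) a b z"
proof -
  assume "has_wirt f a b (z - w)"
  then have "(f has_derivative (\<lambda>v. a * v + b * cnj v)) (at (z - w))" unfolding has_wirt_def .
  moreover have "((\<lambda>z. z - w) has_derivative (\<lambda>v. v)) (at z)" by (auto intro!: derivative_eq_intros)
  ultimately show ?thesis unfolding has_wirt_def by (rule has_derivative_compose[rotated])
qed

lemma lipschitz_mult_bound:
  fixes f g :: "complex \<Rightarrow> complex"
  assumes "\<And>z. cmod (f z) \<le> M" "\<And>z. cmod (g z) \<le> N"
    and "\<And>x y. cmod (f x - f y) \<le> K * cmod (x - y)" "\<And>x y. cmod (g x - g y) \<le> L * cmod (x - y)"
  shows "cmod (f x * g x - f y * g y) \<le> (K * N + M * L) * cmod (x - y)"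
proof -
  have "f x * g x - f y * g y = (f x - f y) * g x + f y * (g x - g y)" by (simp add: algebra_simps)
  then have "cmod (f x * g x - f y * g y) \<le> cmod (f x - f y) * cmod (g x) + cmod (f y) * cmod (g x - g y)"
    by (metis norm_mult norm_triangle_ineq)
  also have "\<dots> \<le> (K * cmod (x - y)) * N + M * (L * cmod (x - y))"
  proof (intro add_mono mult_mono assms)
    show "0 \<le> K * cmod (x - y)" using assms(3)[of x y] norm_ge_zero order_trans by blast
    show "0 \<le> M" using assms(1)[of x] norm_ge_zero order_trans by blast
  qed auto
  finally show ?thesis by (simp add: algebra_simps)
qed

lemma borel_measurable_cnj [measurable]: "cnj \<in> borel_measurable borel"
  by (intro borel_measurable_continuous_onI continuous_intros)

lemma borel_measurable_trunc [measurable]: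
  "trunc_unit \<delta> \<in> borel_measurable borel" "trunc_inv \<delta> \<in> borel_measurable borel"
  unfolding trunc_unit_def trunc_inv_def by measurable

text \<open>The z-derivative of \<open>\<psi>\<close> times a translated
  \<open>trunc_unit \<delta>\<close> has integral 0. Since \<open>trunc_unit\<close> is bounded by
  1, the part that contains its derivative is bounded by the integral of |A|, uniformly in
  \<open>\<delta>\<close> and \<open>w\<close>.\<close>

lemma trunc_unit_integral_bound:
  assumes C1: "C1_compact (\<lambda>z. of_real (\<psi> z)) A B" and p: "\<And>z. 0 \<le> \<psi> z" and d: "\<delta> > 0"
  shows "(LINT z|lborel. \<psi> z / (2 * max (cmod (z - w)) \<delta>)) \<le> (LINT z|lborel. cmod (A z))"
    and "integrable lborel (\<lambda>z. \<psi> z / (2 * max (cmod (z - w)) \<delta>))"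
proof -
  obtain R where R: "\<And>z. cmod z > R \<Longrightarrow> complex_of_real (\<psi> z) = 0" "\<And>z. cmod z > R \<Longrightarrow> A z = 0" "\<And>z. cmod z > R \<Longrightarrow> B z = 0"
    by (rule C1_compactD[OF C1]) blast
  obtain M where M: "\<And>z. cmod (complex_of_real (\<psi> z)) \<le> M" "\<And>z. cmod (A z) \<le> M" "\<And>z. cmod (B z) \<le> M"
    by (rule C1_compact_bounded[OF C1]) blast
  obtain L where L: "0 \<le> L" "\<And>x y. cmod (complex_of_real (\<psi> x) - complex_of_real (\<psi> y)) \<le> L * cmod (x - y)"
    by (rule C1_compact_lipschitz[OF C1]) blast
  note cont = C1_compact_continuous[OF C1]
  have contp: "continuous_on UNIV \<psi>" using continuous_on_Re[OF cont(1)] by simp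
  have [measurable]: "A \<in> borel_measurable borel" "B \<in> borel_measurable borel" "\<psi> \<in> borel_measurable borel"
    using cont contp borel_measurable_continuous_onI by blast+
  define T where "T z = trunc_unit \<delta> (z - w)" for z
  define Ta where "Ta z = (if cmod (z - w) < \<delta> then 1 / \<delta> else 1 / (2 * cmod (z - w)))" for z
  define Tb where "Tb z = (if cmod (z - w) < \<delta> then 0 else - ((z - w)\<^sup>2) / complex_of_real (2 * cmod (z - w) ^ 3))" for z
  have Tm [measurable]: "T \<in> borel_measurable borel" "Ta \<in> borel_measurable borel" "Tb \<in> borel_measurable borel"
    unfolding T_def Ta_def Tb_def by measurable
  have T1: "cmod (T z) \<le> 1" for z unfolding T_def by (rule trunc_unit_bounds(1)[OF d])
  have T2: "cmod (T x - T y) \<le> 2 / \<delta> * cmod (x - y)" for x y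
    unfolding T_def using trunc_unit_bounds(2)[OF d, of "x - w" "y - w"] by simp
  have w: "AE z in lborel. has_wirt (\<lambda>z. of_real (\<psi> z) * T z) (A z * T z + of_real (\<psi> z) * of_real (Ta z)) (B z * T z + of_real (\<psi> z) * Tb z) z"
    using AE_cmod_neq[OF d, of w]
  proof eventually_elim
    case (elim z)
    have "has_wirt T (of_real (Ta z)) (Tb z) z"
      using has_wirt_shift[OF trunc_unit_has_wirt[OF d elim]]
      by (simp add: T_def[abs_def] Ta_def Tb_def if_distrib[of of_real])
    then show ?case using C1 by (intro has_wirt_mult) (auto simp: C1_compact_def)
  qed
  have supp: "of_real (\<psi> z) * T z = 0" if "cmod z > R" for z using R(1)[OF that] by simp
  have lip: "cmod (of_real (\<psi> x) * T x - of_real (\<psi> y) * T y) \<le> (L * 1 + M * (2 / \<delta>)) * cmod (x - y)" for x y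
    by (rule lipschitz_mult_bound[OF M(1) T1 L(2) T2])
  have m: "(\<lambda>z. A z * T z + of_real (\<psi> z) * of_real (Ta z)) \<in> borel_measurable borel"
       "(\<lambda>z. B z * T z + of_real (\<psi> z) * Tb z) \<in> borel_measurable borel" by measurable
  have z: "(LINT z|lborel. A z * T z + of_real (\<psi> z) * of_real (Ta z)) = 0"
    by (rule integral_wirt_zero(3)[OF lip supp w m])
  have i: "integrable lborel (\<lambda>z. A z * T z + of_real (\<psi> z) * of_real (Ta z))"
    by (rule integral_wirt_zero(1)[OF lip supp w m])
  have iA: "integrable lborel (\<lambda>z. A z * T z)"
    by (rule Bochner_Integration.integrable_bound[OF C1_compact_integral(2)[OF C1]])
       (use T1 in \<open>auto simp: norm_mult mult_left_le\<close>)
  have iT: "integrable lborel (\<lambda>z. complex_of_real (\<psi> z * Ta z))"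
    using Bochner_Integration.integrable_diff[OF i iA] by simp
  have eq: "(LINT z|lborel. complex_of_real (\<psi> z * Ta z)) = - (LINT z|lborel. A z * T z)"
    using z Bochner_Integration.integral_add[OF iA iT] by (simp add: eq_neg_iff_add_eq_0 add.commute)
  have iTr: "integrable lborel (\<lambda>z. \<psi> z * Ta z)" using iT by (simp only: complex_of_real_integrable_eq)
  show int: "integrable lborel (\<lambda>z. \<psi> z / (2 * max (cmod (z - w)) \<delta>))"
  proof (rule continuous_compact_support_integrable(1))
    show "continuous_on UNIV (\<lambda>z. \<psi> z / (2 * max (cmod (z - w)) \<delta>))"
      by (intro continuous_intros contp) (use d in \<open>auto simp: max_def\<close>)
    show "\<psi> z / (2 * max (cmod (z - w)) \<delta>) = 0" if "cmod z > R" for z using R(1)[OF that] by simp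
  qed
  have "(LINT z|lborel. \<psi> z / (2 * max (cmod (z - w)) \<delta>)) \<le> (LINT z|lborel. \<psi> z * Ta z)"
  proof (rule integral_mono[OF int iTr])
    fix z
    have "1 / (2 * max (cmod (z - w)) \<delta>) \<le> Ta z"
      using d by (auto simp: Ta_def max_def field_simps)
    then show "\<psi> z / (2 * max (cmod (z - w)) \<delta>) \<le> \<psi> z * Ta z"
      using mult_left_mono[OF _ p[of z]] by fastforce
  qed
  also have "\<dots> = Re (LINT z|lborel. complex_of_real (\<psi> z * Ta z))" by (simp only: integral_complex_of_real Re_complex_of_real)
  also have "\<dots> \<le> cmod (LINT z|lborel. A z * T z)" unfolding eq using complex_Re_le_cmod[of "- (LINT z|lborel. A z * T z)"] by simp
  also have "\<dots> \<le> (LINT z|lborel. cmod (A z * T z))" by (rule integral_norm_bound)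
  also have "\<dots> \<le> (LINT z|lborel. cmod (A z))"
    using T1 by (intro integral_mono integrable_norm iA C1_compact_integral(2)[OF C1])
      (auto simp: norm_mult mult_left_le)
  finally show "(LINT z|lborel. \<psi> z / (2 * max (cmod (z - w)) \<delta>)) \<le> (LINT z|lborel. cmod (A z))" .
qed

text \<open>The bound of \<open>trunc_unit_integral_bound\<close> does not depend on the truncation
  radius, so Fatou's lemma lets that radius tend to 0.\<close>

lemma integrable_cutoff_div_cmod:
  assumes r: "r > 0"
  shows "integrable lborel (\<lambda>z. cutoff a r z / cmod (z - w))"
proof -
  obtain A B where AB: "C1_compact (\<lambda>z. of_real (cutoff a r z)) A B" using cutoff_C1_compact[OF r] by blast
  have [measurable]: "cutoff a r \<in> borel_measurable borel"
    unfolding cutoff_def[abs_def] ramp_sq_def by measurable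
  let ?d = "\<lambda>n. inverse (real (Suc n))"
  have "integrable lborel (\<lambda>z. cutoff a r z / (2 * cmod (z - w)))"
  proof (rule Fatou_integrable(1)[where f = "\<lambda>n z. cutoff a r z / (2 * max (cmod (z - w)) (?d n))"])
    show "AE z in lborel. (\<lambda>n. cutoff a r z / (2 * max (cmod (z - w)) (?d n))) \<longlonglongrightarrow> cutoff a r z / (2 * cmod (z - w))"
      using AE_lborel_singleton[of w]
    proof eventually_elim
      case (elim z)
      have "(\<lambda>n. max (cmod (z - w)) (?d n)) \<longlonglongrightarrow> max (cmod (z - w)) 0"
        by (intro tendsto_max tendsto_const LIMSEQ_inverse_real_of_nat)
      then show ?case using elim by (auto intro!: tendsto_intros simp: max_absorb1)
    qed
    show "\<And>n. (LINT z|lborel. cutoff a r z / (2 * max (cmod (z - w)) (?d n))) \<le> (LINT z|lborel. cmod (A z))"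
         "\<And>n. integrable lborel (\<lambda>z. cutoff a r z / (2 * max (cmod (z - w)) (?d n)))"
      using trunc_unit_integral_bound[OF AB cutoff_range(1), of "?d _" w] by auto
  qed (auto simp: cutoff_range max_def intro!: divide_nonneg_nonneg)
  from integrable_mult_right[OF this, of 2] show ?thesis by simp
qed

lemma bounded_support_cutoff:
  assumes "\<And>z. cmod z > R \<Longrightarrow> f z = (0::complex)" "\<And>z. cmod (f z) \<le> M"
  shows "\<exists>r>0. \<forall>z. cmod (f z) \<le> M * cutoff w r z"
proof -
  \<comment> \<open>Twice a radius of a disc about \<open>w\<close> holding the support, because
    \<open>cutoff_eq_1'\<close> gives the value 1 up to distance r/2; the summand 1 makes
    \<open>r\<close> positive.\<close>
  define r where "r = 2 * (\<bar>R\<bar> + cmod w + 1)"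
  have r: "r > 0" using norm_ge_zero[of w] by (simp add: r_def add_nonneg_pos)
  have "cmod (f z) \<le> M * cutoff w r z" for z
  proof (cases "cmod z > R")
    case True
    have "0 \<le> M" using assms(2)[of z] norm_ge_zero order_trans by blast
    then show ?thesis using assms(1)[OF True] cutoff_range(1) by simp
  next
    case False
    have "cmod (z - w) \<le> r / 2" using False norm_triangle_ineq4[of z w] by (simp add: r_def)
    then show ?thesis using cutoff_eq_1'[OF r] assms(2) by simp
  qed
  then show ?thesis using r by blast
qed

lemma integrable_div_cmod:
  fixes f :: "complex \<Rightarrow> complex"
  assumes "\<And>z. cmod z > R \<Longrightarrow> f z = 0" "\<And>z. cmod (f z) \<le> M" "f \<in> borel_measurable borel"
  shows "integrable lborel (\<lambda>z. cmod (f z) / cmod (z - w))"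
proof -
  obtain r where r: "r > 0" "\<And>z. cmod (f z) \<le> M * cutoff w r z"
    using bounded_support_cutoff[where f = f and w = w, OF assms(1,2)] by blast
  note [measurable] = assms(3)
  show ?thesis
  proof (rule Bochner_Integration.integrable_bound[OF integrable_mult_right[OF integrable_cutoff_div_cmod[OF r(1), of w w], of M]])
    show "AE z in lborel. norm (cmod (f z) / cmod (z - w)) \<le> norm (M * (cutoff w r z / cmod (z - w)))"
    proof (intro AE_I2)
      fix z
      have "cmod (f z) / cmod (z - w) \<le> M * cutoff w r z / cmod (z - w)"
        by (intro divide_right_mono r(2)) simp
      also have "\<dots> \<le> \<bar>M * cutoff w r z / cmod (z - w)\<bar>" by (rule abs_ge_self)
      finally show "norm (cmod (f z) / cmod (z - w)) \<le> norm (M * (cutoff w r z / cmod (z - w)))" by simp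
    qed
  qed measurable
qed

section \<open>The point mass in the derivative of the Cauchy kernel\<close>

lemma measure_ball_complex: "r \<ge> 0 \<Longrightarrow> measure lborel (ball (w::complex) r) = pi * r\<^sup>2"
  using content_ball[of r w] by (simp add: unit_ball_vol_2)

text \<open>The indicator is divided by the squared radius and not by the area, whence the factor
  pi; the error is at most the Lipschitz constant times the radius times pi.\<close>

lemma average_tendsto:
  assumes L: "\<And>x y. cmod (\<phi> x - \<phi> y) \<le> L * cmod (x - y)"
    and d: "\<And>n. \<delta> n > 0" "\<delta> \<longlonglongrightarrow> 0"
    and c: "continuous_on UNIV \<phi>"
  shows "(\<lambda>n. LINT z|lborel. \<phi> z * of_real (indicator (ball w (\<delta> n)) z / (\<delta> n)\<^sup>2)) \<longlonglongrightarrow> of_real pi * \<phi> w"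
proof -
  have L0: "0 \<le> L" using order_trans[OF norm_ge_zero L[of 0 1]] by simp
  have [measurable]: "\<phi> \<in> borel_measurable borel" using c borel_measurable_continuous_onI by blast
  have fin: "integrable lborel (indicat_real (ball w r))" for r
    by (rule integrable_real_indicator) (use emeasure_bounded_finite[OF bounded_ball] in auto)
  have ind: "(LINT z|lborel. indicat_real (ball w r) z) = pi * r\<^sup>2" if "r > 0" for r
    using measure_ball_complex[of r w] that by simp
  have "cmod ((LINT z|lborel. \<phi> z * of_real (indicator (ball w (\<delta> n)) z / (\<delta> n)\<^sup>2)) - of_real pi * \<phi> w) \<le> L * \<delta> n * pi" for n
  proof -
    let ?I = "\<lambda>z. indicat_real (ball w (\<delta> n)) z / (\<delta> n)\<^sup>2"
    have iI: "integrable lborel ?I" using fin by simp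
    have II: "(LINT z|lborel. ?I z) = pi" using ind[OF d(1)[of n]] d(1)[of n] by simp
    have iJ: "integrable lborel (\<lambda>z. complex_of_real (?I z))" using iI by (rule integrable_of_real)
    have b: "cmod ((\<phi> z - \<phi> w) * of_real (?I z)) \<le> (L * \<delta> n) * ?I z" for z
    proof (cases "z \<in> ball w (\<delta> n)")
      case True
      have "cmod (\<phi> z - \<phi> w) \<le> L * \<delta> n"
        using L[of z w] True L0 by (smt (verit) dist_norm mem_ball mult_left_mono norm_minus_commute)
      moreover have "cmod (complex_of_real (?I z)) = ?I z" by (subst norm_of_real) simp
      ultimately show ?thesis unfolding norm_mult by (intro mult_mono) (use L0 d(1)[of n] in auto)
    qed auto
    have iD: "integrable lborel (\<lambda>z. (\<phi> z - \<phi> w) * complex_of_real (?I z))"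
    proof (rule Bochner_Integration.integrable_bound[OF integrable_mult_right[OF iI, of "L * \<delta> n"]])
      have [measurable]: "ball w (\<delta> n) \<in> sets borel" by simp
      show "(\<lambda>z. (\<phi> z - \<phi> w) * complex_of_real (?I z)) \<in> borel_measurable lborel" by measurable
      show "AE z in lborel. norm ((\<phi> z - \<phi> w) * complex_of_real (?I z)) \<le> norm (L * \<delta> n * ?I z)"
        by (intro AE_I2 order_trans[OF b]) (simp only: real_norm_def abs_ge_self)
    qed
    have iE: "integrable lborel (\<lambda>z. \<phi> w * complex_of_real (?I z))" by (rule integrable_mult_right[OF iJ])
    have "(LINT z|lborel. \<phi> z * of_real (?I z)) = (LINT z|lborel. (\<phi> z - \<phi> w) * of_real (?I z) + \<phi> w * of_real (?I z))"
      by (rule Bochner_Integration.integral_cong) (auto simp: algebra_simps diff_divide_distrib)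
    also have "\<dots> = (LINT z|lborel. (\<phi> z - \<phi> w) * of_real (?I z)) + (LINT z|lborel. \<phi> w * of_real (?I z))"
      by (rule Bochner_Integration.integral_add[OF iD iE])
    also have "(LINT z|lborel. \<phi> w * complex_of_real (?I z)) = \<phi> w * of_real pi"
      using II by (simp only: integral_mult_right_zero integral_complex_of_real)
    finally have "(LINT z|lborel. \<phi> z * of_real (?I z)) - of_real pi * \<phi> w = (LINT z|lborel. (\<phi> z - \<phi> w) * of_real (?I z))"
      by (simp add: mult.commute)
    then have "cmod ((LINT z|lborel. \<phi> z * of_real (?I z)) - of_real pi * \<phi> w) \<le> (LINT z|lborel. cmod ((\<phi> z - \<phi> w) * of_real (?I z)))"
      by (simp only: integral_norm_bound)
    also have "\<dots> \<le> (LINT z|lborel. (L * \<delta> n) * ?I z)"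
      by (rule integral_mono[OF integrable_norm[OF iD] integrable_mult_right[OF iI] b])
    also have "\<dots> = L * \<delta> n * pi" using II by (simp only: integral_mult_right_zero)
    finally show ?thesis .
  qed
  note bound = this
  have lim0: "(\<lambda>n. L * \<delta> n * pi) \<longlonglongrightarrow> 0" using tendsto_mult[OF tendsto_mult[OF tendsto_const d(2)] tendsto_const, of L pi] by simp
  have "(\<lambda>n. (LINT z|lborel. \<phi> z * of_real (indicator (ball w (\<delta> n)) z / (\<delta> n)\<^sup>2)) - of_real pi * \<phi> w) \<longlonglongrightarrow> 0"
    by (rule Lim_null_comparison[OF always_eventually[OF allI[OF bound]] lim0])
  then show ?thesis by (rule LIM_zero_cancel)
qed

text \<open>\<open>integral_wirt_zero\<close> for \<open>\<phi>\<close> times a translated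
  \<open>trunc_inv\<close> yields two integrals that cancel. As the truncation radius tends to 0,
  one tends to the Cauchy integral, dominated by |A| / |z - w|, and the other to pi times
  \<open>\<phi> w\<close> by \<open>average_tendsto\<close>.\<close>

theorem Cauchy_Pompeiu_cnj:
  assumes C1: "C1_compact \<phi> A B"
  shows "(LINT z|lborel. A z / cnj (z - w)) = - of_real pi * \<phi> w"
    and "integrable lborel (\<lambda>z. A z / cnj (z - w))"
proof -
  obtain R where R: "\<And>z. cmod z > R \<Longrightarrow> \<phi> z = 0" "\<And>z. cmod z > R \<Longrightarrow> A z = 0" "\<And>z. cmod z > R \<Longrightarrow> B z = 0"
    by (rule C1_compactD[OF C1]) blast
  obtain M where M: "\<And>z. cmod (\<phi> z) \<le> M" "\<And>z. cmod (A z) \<le> M" "\<And>z. cmod (B z) \<le> M"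
    by (rule C1_compact_bounded[OF C1]) blast
  obtain L where L: "0 \<le> L" "\<And>x y. cmod (\<phi> x - \<phi> y) \<le> L * cmod (x - y)"
    by (rule C1_compact_lipschitz[OF C1]) blast
  note cont = C1_compact_continuous[OF C1]
  have [measurable]: "A \<in> borel_measurable borel" "B \<in> borel_measurable borel" "\<phi> \<in> borel_measurable borel"
    using cont borel_measurable_continuous_onI by blast+
  define d where "d n = inverse (real (Suc n))" for n
  have d: "d n > 0" "d \<longlonglongrightarrow> 0" for n unfolding d_def using LIMSEQ_inverse_real_of_nat by auto
  define T where "T n z = trunc_inv (d n) (z - w)" for n z
  define Ta where "Ta n z = indicator (ball w (d n)) z / (d n)\<^sup>2" for n z
  define Tb where "Tb n z = (if cmod (z - w) < d n then 0 else - 1 / (cnj (z - w))\<^sup>2)" for n z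
  have [measurable]: "ball w (d n) \<in> sets borel" for n by simp
  have Tm [measurable]: "T n \<in> borel_measurable borel" "Ta n \<in> borel_measurable borel" "Tb n \<in> borel_measurable borel" for n
    unfolding T_def Ta_def Tb_def by measurable
  have T1: "cmod (T n z) \<le> 1 / d n" for n z unfolding T_def by (rule trunc_inv_bounds(1)[OF d(1)])
  have T2: "cmod (T n x - T n y) \<le> 3 / (d n)\<^sup>2 * cmod (x - y)" for n x y
    unfolding T_def using trunc_inv_bounds(2)[OF d(1), of n "x - w" "y - w"] by simp
  have T3: "cmod (T n z) \<le> 1 / cmod (z - w)" for n z
  proof (cases "z = w")
    case False
    then have c: "cmod (z - w) > 0" by simp
    have "cmod (T n z) = cmod (z - w) / (max (cmod (z - w)) (d n))\<^sup>2"
      by (simp add: T_def trunc_inv_def norm_divide norm_power)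
    also have "\<dots> \<le> cmod (z - w) / (cmod (z - w))\<^sup>2"
    proof -
      have "0 < max (cmod (z - w)) (d n)" using c by (simp add: less_max_iff_disj)
      then show ?thesis
        using c by (intro divide_left_mono power_mono mult_pos_pos zero_less_power) simp_all
    qed
    finally show ?thesis using c by (simp add: power2_eq_square)
  qed (simp add: T_def trunc_inv_def)
  have wi: "AE z in lborel. has_wirt (\<lambda>z. \<phi> z * T n z) (A z * T n z + \<phi> z * of_real (Ta n z)) (B z * T n z + \<phi> z * Tb n z) z" for n
    using AE_cmod_neq[OF d(1)[of n], of w]
  proof eventually_elim
    case (elim z)
    have "has_wirt (T n) (of_real (Ta n z)) (Tb n z) z"
      using has_wirt_shift[OF trunc_inv_has_wirt[OF d(1) elim]]
      by (simp add: T_def[abs_def] Ta_def Tb_def indicator_def dist_norm norm_minus_commute split: if_splits)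
    then show ?case using C1 by (intro has_wirt_mult) (auto simp: C1_compact_def)
  qed
  have supp: "\<phi> z * T n z = 0" if "cmod z > R" for z n using R(1)[OF that] by simp
  have lip: "cmod (\<phi> x * T n x - \<phi> y * T n y) \<le> (L * (1 / d n) + M * (3 / (d n)\<^sup>2)) * cmod (x - y)" for n x y
    by (rule lipschitz_mult_bound[OF M(1) T1 L(2) T2])
  have m: "(\<lambda>z. A z * T n z + \<phi> z * of_real (Ta n z)) \<in> borel_measurable borel"
       "(\<lambda>z. B z * T n z + \<phi> z * Tb n z) \<in> borel_measurable borel" for n by measurable
  have z: "(LINT z|lborel. A z * T n z + \<phi> z * of_real (Ta n z)) = 0" for n
    by (rule integral_wirt_zero(3)[OF lip supp wi m])
  have i: "integrable lborel (\<lambda>z. A z * T n z + \<phi> z * of_real (Ta n z))" for n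
    by (rule integral_wirt_zero(1)[OF lip supp wi m])
  have dom: "integrable lborel (\<lambda>z. cmod (A z) / cmod (z - w))"
    by (rule integrable_div_cmod[OF R(2) M(2)]) auto
  have le: "cmod (A z * T n z) \<le> cmod (A z) / cmod (z - w)" for n z
    using mult_left_mono[OF T3[of n z] norm_ge_zero[of "A z"]] by (simp add: norm_mult)
  have lim: "AE z in lborel. (\<lambda>n. A z * T n z) \<longlonglongrightarrow> A z / cnj (z - w)"
    using AE_lborel_singleton[of w]
  proof eventually_elim
    case (elim z)
    have "(\<lambda>n. max (cmod (z - w)) (d n)) \<longlonglongrightarrow> max (cmod (z - w)) 0"
      by (intro tendsto_max tendsto_const d)
    then have "(\<lambda>n. max (cmod (z - w)) (d n)) \<longlonglongrightarrow> cmod (z - w)" by (simp add: max_absorb1)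
    then have "(\<lambda>n. A z * T n z) \<longlonglongrightarrow> A z * ((z - w) / of_real ((cmod (z - w))\<^sup>2))"
      unfolding T_def trunc_inv_def using elim
      by (intro tendsto_mult tendsto_divide tendsto_of_real tendsto_power tendsto_const) auto
    also have "A z * ((z - w) / of_real ((cmod (z - w))\<^sup>2)) = A z / cnj (z - w)"
      using elim by (simp add: of_real_cmod_power2)
    finally show ?case .
  qed
  show "integrable lborel (\<lambda>z. A z / cnj (z - w))"
    by (rule integrable_dominated_convergence[OF _ _ dom lim]) (use le in auto)
  have l1: "(\<lambda>n. LINT z|lborel. A z * T n z) \<longlonglongrightarrow> (LINT z|lborel. A z / cnj (z - w))"
    by (rule integral_dominated_convergence[OF _ _ dom lim]) (use le in auto)
  have iA: "integrable lborel (\<lambda>z. A z * T n z)" for n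
    by (rule Bochner_Integration.integrable_bound[OF dom]) (use le in auto)
  have iT: "integrable lborel (\<lambda>z. \<phi> z * of_real (Ta n z))" for n
    using Bochner_Integration.integrable_diff[OF i[of n] iA[of n]] by simp
  have eq: "(LINT z|lborel. A z * T n z) = - (LINT z|lborel. \<phi> z * of_real (Ta n z))" for n
    using z[of n] Bochner_Integration.integral_add[OF iA[of n] iT[of n]] by (simp add: eq_neg_iff_add_eq_0)
  have "(\<lambda>n. LINT z|lborel. \<phi> z * of_real (Ta n z)) \<longlonglongrightarrow> of_real pi * \<phi> w"
    unfolding Ta_def by (rule average_tendsto[OF L(2) d cont(1)])
  from tendsto_minus[OF this] have "(\<lambda>n. LINT z|lborel. A z * T n z) \<longlonglongrightarrow> - (of_real pi * \<phi> w)"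
    unfolding eq .
  from LIMSEQ_unique[OF l1 this] show "(LINT z|lborel. A z / cnj (z - w)) = - of_real pi * \<phi> w" by simp
qed

corollary Cauchy_Pompeiu:
  assumes "C1_compact \<phi> A B"
  shows "(LINT z|lborel. B z / (z - w)) = - of_real pi * \<phi> w"
    and "integrable lborel (\<lambda>z. B z / (z - w))"
proof -
  note P = Cauchy_Pompeiu_cnj[OF C1_compact_cnj[OF assms], of w]
  have e: "B z / (z - w) = cnj (cnj (B z) / cnj (z - w))" for z by simp
  show "integrable lborel (\<lambda>z. B z / (z - w))"
    unfolding e by (simp only: integrable_cnj P)
  have "(LINT z|lborel. B z / (z - w)) = cnj (LINT z|lborel. cnj (B z) / cnj (z - w))"
    unfolding e by (simp only: Bochner_Integration.integral_cnj)
  then show "(LINT z|lborel. B z / (z - w)) = - of_real pi * \<phi> w" using P(1) by simp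
qed

section \<open>The logarithm as a fundamental solution\<close>

lemma abs_ln_le:
  fixes x d :: real
  assumes "x > 0" "0 \<le> d" "d \<le> 1"
  shows "\<bar>ln (x\<^sup>2 + d\<^sup>2) / 2\<bar> \<le> 1 / x + (x\<^sup>2 + 1)" "\<bar>ln x\<bar> \<le> 1 / x + (x\<^sup>2 + 1)"
proof -
  have l: "- ln x \<le> 1 / x" using ln_le_minus_one[of "1 / x"] assms by (simp add: ln_div)
  have 1: "ln x \<le> ln (x\<^sup>2 + d\<^sup>2) / 2"
  proof -
    have "0 < x\<^sup>2" "x\<^sup>2 \<le> x\<^sup>2 + d\<^sup>2" using assms by simp_all
    then have "ln (x\<^sup>2) \<le> ln (x\<^sup>2 + d\<^sup>2)" by (intro ln_mono) linarith+
    then show ?thesis using assms by (simp add: ln_realpow)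
  qed
  have "ln (x\<^sup>2 + d\<^sup>2) \<le> x\<^sup>2 + d\<^sup>2"
    using ln_le_minus_one[of "x\<^sup>2 + d\<^sup>2"] assms by (simp add: add_pos_nonneg)
  moreover have "d\<^sup>2 \<le> 1" using assms by (simp add: power_le_one)
  ultimately have 2: "ln (x\<^sup>2 + d\<^sup>2) / 2 \<le> x\<^sup>2 + 1" using zero_le_power2[of x] by linarith
  have "1 / x > 0" "x\<^sup>2 + 1 > 0" using assms by (simp_all add: add_nonneg_pos)
  then show "\<bar>ln (x\<^sup>2 + d\<^sup>2) / 2\<bar> \<le> 1 / x + (x\<^sup>2 + 1)" "\<bar>ln x\<bar> \<le> 1 / x + (x\<^sup>2 + 1)"
    using l 1 2 by linarith+
qed

text \<open>For the smooth regularisation ln(|z - w|^2 + d^2) / 2, one integration by parts moves a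
  z-derivative from \<open>P\<close> to the logarithm and leaves \<open>B\<close>. The
  differentiated logarithm tends to 1/(2(z - w)), so Cauchy--Pompeiu with a factor 1/2 gives pi/2.
  The bounds of \<open>abs_ln_le\<close> are uniform in d <= 1 and justify the limit.\<close>

theorem log_fundamental_solution:
  assumes C1: "C1_compact \<phi> A B" and C2: "C1_compact B P Q"
  shows "(LINT z|lborel. of_real (ln (cmod (z - w))) * P z) = of_real (pi / 2) * \<phi> w"
    and "integrable lborel (\<lambda>z. of_real (ln (cmod (z - w))) * P z)"
proof -
  obtain R where R: "\<And>z. cmod z > R \<Longrightarrow> B z = 0" "\<And>z. cmod z > R \<Longrightarrow> P z = 0" "\<And>z. cmod z > R \<Longrightarrow> Q z = 0"
    by (rule C1_compactD[OF C2]) blast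
  obtain M where M: "\<And>z. cmod (B z) \<le> M" "\<And>z. cmod (P z) \<le> M" "\<And>z. cmod (Q z) \<le> M"
    by (rule C1_compact_bounded[OF C2]) blast
  note cont = C1_compact_continuous[OF C2]
  have [measurable]: "B \<in> borel_measurable borel" "P \<in> borel_measurable borel"
    using cont borel_measurable_continuous_onI by blast+
  define d where "d n = inverse (real (Suc n))" for n
  have d: "d n > 0" "d n \<le> 1" for n unfolding d_def by (simp_all add: inverse_le_1_iff)
  have d0: "d \<longlonglongrightarrow> 0" unfolding d_def using LIMSEQ_inverse_real_of_nat by auto
  define E where "E n z = (cmod (z - w))\<^sup>2 + (d n)\<^sup>2" for n z
  have E: "E n z > 0" for n z using d(1)[of n] by (simp add: E_def add_nonneg_pos)
  define l where "l n z = ln (E n z) / 2" for n z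
  have wl: "has_wirt (\<lambda>z. of_real (l n z)) (of_real (1 / (2 * E n z)) * cnj (z - w)) (of_real (1 / (2 * E n z)) * (z - w)) z" for n z
  proof -
    have "((\<lambda>t. ln (t + (d n)\<^sup>2)) has_real_derivative 1 / E n z) (at ((cmod (z - w))\<^sup>2))"
      using E[of n z] by (auto intro!: derivative_eq_intros simp: E_def)
    from DERIV_cdivide[OF this, of 2]
    have "((\<lambda>t. ln (t + (d n)\<^sup>2) / 2) has_real_derivative (1 / (2 * E n z))) (at ((cmod (z - w))\<^sup>2))"
      by (simp add: mult.commute)
    from has_wirt_chain_real[OF has_wirt_cmod_sq this] show ?thesis by (simp add: l_def E_def)
  qed
  have cE: "continuous_on UNIV (E n)" for n unfolding E_def by (intro continuous_intros)
  have E0: "2 * E n z \<noteq> 0" for n z using E[of n z] by simp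
  have C: "C1_compact (\<lambda>z. B z * of_real (l n z)) (\<lambda>z. P z * of_real (l n z) + B z * (of_real (1 / (2 * E n z)) * cnj (z - w)))
     (\<lambda>z. Q z * of_real (l n z) + B z * (of_real (1 / (2 * E n z)) * (z - w)))" for n
    by (rule C1_compact_mult[OF C2 wl]; intro continuous_intros cE ballI E0 continuous_on_of_real)
  let ?S = "\<lambda>n z. B z * (of_real (1 / (2 * E n z)) * cnj (z - w))"
  have cl: "continuous_on UNIV (l n)" for n unfolding l_def using E
    by (intro continuous_intros cE) (auto simp: less_imp_neq[symmetric])
  have i1: "integrable lborel (\<lambda>z. P z * of_real (l n z))" for n
    by (rule continuous_compact_support_integrable(1)[where R = R])
       (use R in \<open>auto intro!: continuous_intros cl cont\<close>)
  have i2: "integrable lborel (?S n)" for n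
    using Bochner_Integration.integrable_diff[OF C1_compact_integral(2)[OF C[of n]] i1[of n]] by simp
  have eq: "(LINT z|lborel. P z * of_real (l n z)) = - (LINT z|lborel. ?S n z)" for n
    using C1_compact_integral(4)[OF C[of n]] Bochner_Integration.integral_add[OF i1[of n] i2[of n]]
    by (simp add: eq_neg_iff_add_eq_0)
  have domB: "integrable lborel (\<lambda>z. cmod (B z) / cmod (z - w))"
    by (rule integrable_div_cmod[OF R(1) M(1)]) auto
  have domP: "integrable lborel (\<lambda>z. cmod (P z) / cmod (z - w) + cmod (P z) * ((cmod (z - w))\<^sup>2 + 1))"
  proof (rule Bochner_Integration.integrable_add)
    show "integrable lborel (\<lambda>z. cmod (P z) / cmod (z - w))"
      by (rule integrable_div_cmod[OF R(2) M(2)]) auto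
    show "integrable lborel (\<lambda>z. cmod (P z) * ((cmod (z - w))\<^sup>2 + 1))"
      by (rule continuous_compact_support_integrable(1)[where R = R])
         (use R in \<open>auto intro!: continuous_intros cont\<close>)
  qed
  have limE: "(\<lambda>n. E n z) \<longlonglongrightarrow> (cmod (z - w))\<^sup>2" for z
    unfolding E_def using tendsto_add[OF tendsto_const tendsto_power[OF d0, of 2]] by fastforce
  have limS: "AE z in lborel. (\<lambda>n. ?S n z) \<longlonglongrightarrow> (1/2) * (B z / (z - w))"
    using AE_lborel_singleton[of w]
  proof eventually_elim
    case (elim z)
    have "(\<lambda>n. ?S n z) \<longlonglongrightarrow> B z * (of_real (1 / (2 * (cmod (z - w))\<^sup>2)) * cnj (z - w))"
      using elim by (intro tendsto_intros limE) auto
    also have "B z * (of_real (1 / (2 * (cmod (z - w))\<^sup>2)) * cnj (z - w)) = (1/2) * (B z / (z - w))"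
      using elim by (simp add: of_real_cmod_power2)
    finally show ?case .
  qed
  have leS: "cmod (?S n z) \<le> cmod (B z) / cmod (z - w)" for n z
  proof (cases "z = w")
    case False
    have "cmod (z - w) * cmod (z - w) \<le> 2 * E n z"
      using zero_le_power2[of "cmod (z - w)"] zero_le_power2[of "d n"] by (simp add: E_def power2_eq_square)
    then have "cmod (z - w) / (2 * E n z) \<le> 1 / cmod (z - w)"
      using False E[of n z] by (simp add: field_simps)
    then have "cmod (of_real (1 / (2 * E n z)) * cnj (z - w)) \<le> 1 / cmod (z - w)"
      using E[of n z] by (simp add: norm_mult norm_divide del: complex_cnj_diff)
    from mult_left_mono[OF this norm_ge_zero[of "B z"]] show ?thesis by (simp add: norm_mult norm_divide)
  qed simp
  have "(\<lambda>n. LINT z|lborel. ?S n z) \<longlonglongrightarrow> (LINT z|lborel. (1/2) * (B z / (z - w)))"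
    by (rule integral_dominated_convergence[OF _ _ domB limS]) (use leS i2 in \<open>auto dest: borel_measurable_integrable\<close>)
  also have "(LINT z|lborel. (1/2) * (B z / (z - w))) = (1/2) * (- of_real pi * \<phi> w)"
    by (simp only: integral_mult_right_zero Cauchy_Pompeiu(1)[OF C1])
  finally have L1: "(\<lambda>n. LINT z|lborel. P z * of_real (l n z)) \<longlonglongrightarrow> - ((1/2) * (- of_real pi * \<phi> w))"
    unfolding eq by (rule tendsto_minus)
  have limP: "AE z in lborel. (\<lambda>n. P z * of_real (l n z)) \<longlonglongrightarrow> of_real (ln (cmod (z - w))) * P z"
    using AE_lborel_singleton[of w]
  proof eventually_elim
    case (elim z)
    have "(\<lambda>n. P z * of_real (l n z)) \<longlonglongrightarrow> P z * of_real (ln ((cmod (z - w))\<^sup>2) / 2)"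
      unfolding l_def using elim by (intro tendsto_intros limE) auto
    then show ?case using elim by (simp add: ln_realpow mult.commute)
  qed
  have leP: "AE z in lborel. cmod (P z * of_real (l n z)) \<le> cmod (P z) / cmod (z - w) + cmod (P z) * ((cmod (z - w))\<^sup>2 + 1)" for n
    using AE_lborel_singleton[of w]
  proof eventually_elim
    case (elim z)
    have "\<bar>l n z\<bar> \<le> 1 / cmod (z - w) + ((cmod (z - w))\<^sup>2 + 1)"
      unfolding l_def E_def using elim d[of n] by (intro abs_ln_le(1)) auto
    from mult_left_mono[OF this norm_ge_zero[of "P z"]]
    show ?case by (simp add: norm_mult algebra_simps)
  qed
  have mm: "(\<lambda>z. of_real (ln (cmod (z - w))) * P z) \<in> borel_measurable lborel" by measurable
  show "integrable lborel (\<lambda>z. of_real (ln (cmod (z - w))) * P z)"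
    by (rule integrable_dominated_convergence[OF mm _ domP limP leP]) (use i1 in \<open>auto dest: borel_measurable_integrable\<close>)
  have "(\<lambda>n. LINT z|lborel. P z * of_real (l n z)) \<longlonglongrightarrow> (LINT z|lborel. of_real (ln (cmod (z - w))) * P z)"
    by (rule integral_dominated_convergence[OF mm _ domP limP leP]) (use i1 in \<open>auto dest: borel_measurable_integrable\<close>)
  from LIMSEQ_unique[OF this L1]
  show "(LINT z|lborel. of_real (ln (cmod (z - w))) * P z) = of_real (pi / 2) * \<phi> w" by simp
qed

section \<open>Test functions\<close>

lemma C_diff_continuous: "C_diff k f \<Longrightarrow> continuous_on UNIV f"
  by (cases k) (auto simp: differentiable_imp_continuous_on)

lemma C_diff_SucD: "C_diff (Suc k) f \<Longrightarrow> C_diff k f"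
proof (induction k arbitrary: f)
  case 0
  then show ?case by (simp add: differentiable_imp_continuous_on)
next
  case (Suc k)
  then show ?case unfolding C_diff.simps(2)[of "Suc k"] C_diff.simps(2)[of k] by blast
qed

lemma C_diff_SucI:
  assumes "\<And>z. (f has_derivative D z) (at z)" "\<And>v. C_diff k (\<lambda>z. D z v)"
  shows "C_diff (Suc k) f"
proof -
  have "frechet_derivative f (at z) = D z" for z
    using assms(1) frechet_derivative_at by metis
  then show ?thesis using assms
    unfolding C_diff.simps differentiable_on_def differentiable_def by auto
qed

lemma C_diff_SucE:
  assumes "C_diff (Suc k) f"
  obtains D where "\<And>z. (f has_derivative D z) (at z)" "\<And>v. C_diff k (\<lambda>z. D z v)"
  using assms frechet_derivative_works unfolding C_diff.simps differentiable_on_def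
  by (metis UNIV_I)

lemma C_diff_const: "C_diff k (\<lambda>z. c)"
proof (induction k arbitrary: c)
  case (Suc k)
  show ?case by (rule C_diff_SucI[of _ "\<lambda>z v. 0"]) (auto intro: Suc)
qed auto

lemma C_diff_add: "C_diff k f \<Longrightarrow> C_diff k g \<Longrightarrow> C_diff k (\<lambda>z. f z + g z)"
proof (induction k arbitrary: f g)
  case (Suc k)
  obtain D where D: "\<And>z. (f has_derivative D z) (at z)" "\<And>v. C_diff k (\<lambda>z. D z v)"
    by (rule C_diff_SucE[OF Suc.prems(1)]) blast
  obtain E where E: "\<And>z. (g has_derivative E z) (at z)" "\<And>v. C_diff k (\<lambda>z. E z v)"
    by (rule C_diff_SucE[OF Suc.prems(2)]) blast
  show ?case
    by (rule C_diff_SucI[of _ "\<lambda>z v. D z v + E z v"]) (auto intro!: derivative_intros D E Suc.IH)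
qed (auto intro: continuous_intros)

lemma C_diff_mult: "C_diff k f \<Longrightarrow> C_diff k g \<Longrightarrow> C_diff k (\<lambda>z. f z * g z)"
proof (induction k arbitrary: f g)
  case (Suc k)
  obtain D where D: "\<And>z. (f has_derivative D z) (at z)" "\<And>v. C_diff k (\<lambda>z. D z v)"
    by (rule C_diff_SucE[OF Suc.prems(1)]) blast
  obtain E where E: "\<And>z. (g has_derivative E z) (at z)" "\<And>v. C_diff k (\<lambda>z. E z v)"
    by (rule C_diff_SucE[OF Suc.prems(2)]) blast
  show ?case
  proof (rule C_diff_SucI[of _ "\<lambda>z v. f z * E z v + D z v * g z"])
    show "((\<lambda>z. f z * g z) has_derivative (\<lambda>v. f z * E z v + D z v * g z)) (at z)" for z
      by (rule has_derivative_mult[OF D(1) E(1)])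
    show "C_diff k (\<lambda>z. f z * E z v + D z v * g z)" for v
      by (intro C_diff_add Suc.IH D(2) E(2) C_diff_SucD[OF Suc.prems(1)] C_diff_SucD[OF Suc.prems(2)])
  qed
qed (auto intro: continuous_intros)

lemma C_diff_linear:
  assumes "bounded_linear f" shows "C_diff k f"
proof (cases k)
  case 0
  then show ?thesis using assms by (simp add: linear_continuous_on)
next
  case (Suc n)
  have "C_diff (Suc n) f"
    by (rule C_diff_SucI[of _ "\<lambda>z. f"]) (auto intro: bounded_linear_imp_has_derivative assms C_diff_const)
  then show ?thesis using Suc by simp
qed

lemma C_diff_wirt:
  assumes "\<forall>k. C_diff k f"
  shows "C_diff k (wirt f)" "C_diff k (wirt_bar f)"
proof -
  have D: "C_diff k (\<lambda>z. frechet_derivative f (at z) v)" for v using assms[rule_format, of "Suc k"] by simp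
  have "wirt f = (\<lambda>z. (1/2) * (frechet_derivative f (at z) 1 + (- \<i>) * frechet_derivative f (at z) \<i>))"
    by (auto simp: wirt_def)
  moreover have "C_diff k \<dots>" by (intro C_diff_mult C_diff_add C_diff_const D)
  ultimately show "C_diff k (wirt f)" by simp
  have "wirt_bar f = (\<lambda>z. (1/2) * (frechet_derivative f (at z) 1 + \<i> * frechet_derivative f (at z) \<i>))"
    by (auto simp: wirt_bar_def)
  moreover have "C_diff k \<dots>" by (intro C_diff_mult C_diff_add C_diff_const D)
  ultimately show "C_diff k (wirt_bar f)" by simp
qed

lemma C_diff_has_wirt:
  assumes "\<forall>k. C_diff k f"
  shows "has_wirt f (wirt f z) (wirt_bar f z) z"
proof (rule has_wirt_differentiable)
  show "f differentiable at z" using assms[rule_format, of "Suc 0"] by (simp add: differentiable_on_def)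
qed


subsection \<open>Smooth bump functions\<close>

text \<open>Polynomials in 1/x times exp(-1/x), extended by 0, form a class closed under
  differentiation: in t = 1/x, d/dx is -t^2 d/dt, which replaces p by t^2 (p - p').\<close>

definition exp_family :: "real poly \<Rightarrow> real \<Rightarrow> real" where
  "exp_family p x = (if x > 0 then poly p (1 / x) * exp (- 1 / x) else 0)"

lemma poly_exp_tendsto: "((\<lambda>x::real. poly p (1 / x) * exp (- 1 / x)) \<longlongrightarrow> 0) (at_right 0)"
proof (induction p)
  case 0
  then show ?case by simp
next
  case (pCons a p)
  have pw: "((\<lambda>x::real. (1 / x) ^ n * exp (- 1 / x)) \<longlongrightarrow> 0) (at_right 0)" for n
    by real_asymp
  have "poly q (1/x) = (\<Sum>i\<le>degree q. coeff q i * (1/x) ^ i)" for q :: "real poly" and x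
    by (rule poly_altdef)
  then have eq: "(\<lambda>x::real. poly (pCons a p) (1 / x) * exp (- 1 / x)) =
     (\<lambda>x. \<Sum>i\<le>degree (pCons a p). coeff (pCons a p) i * ((1 / x) ^ i * exp (- 1 / x)))"
    by (simp add: sum_distrib_right mult.assoc)
  have "((\<lambda>x. \<Sum>i\<le>degree (pCons a p). coeff (pCons a p) i * ((1 / x) ^ i * exp (- 1 / x))) \<longlongrightarrow> (\<Sum>i\<le>degree (pCons a p). coeff (pCons a p) i * 0)) (at_right 0)"
    by (intro tendsto_sum tendsto_mult tendsto_const pw)
  then show ?case unfolding eq by simp
qed

lemma exp_family_deriv:
  "(exp_family p has_real_derivative exp_family ([:0, 0, 1:] * (p - pderiv p)) x) (at x)"
proof (cases x "0::real" rule: linorder_cases)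
  case less
  have "((\<lambda>x::real. 0) has_real_derivative 0) (at x)" by simp
  then have "(exp_family p has_real_derivative 0) (at x)"
    by (rule has_field_derivative_transform_within_open[where S = "{..<0}"])
       (use less in \<open>simp_all add: exp_family_def\<close>)
  then show ?thesis using less by (simp add: exp_family_def)
next
  case greater
  have i: "((\<lambda>x. 1 / x) has_real_derivative - (1 / x\<^sup>2)) (at x)"
    using greater by (auto intro!: derivative_eq_intros simp: power2_eq_square)
  have i': "((\<lambda>x. - 1 / x) has_real_derivative 1 / x\<^sup>2) (at x)"
    using DERIV_minus[OF i] by simp
  have "((\<lambda>x. poly p (1 / x) * exp (- 1 / x)) has_real_derivative
      poly (pderiv p) (1 / x) * - (1 / x\<^sup>2) * exp (- 1 / x) + exp (- 1 / x) * (1 / x\<^sup>2) * poly p (1 / x)) (at x)"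
    by (rule DERIV_mult[OF DERIV_chain2[OF poly_DERIV i] DERIV_chain2[OF DERIV_exp i']])
  also have "poly (pderiv p) (1 / x) * - (1 / x\<^sup>2) * exp (- 1 / x) + exp (- 1 / x) * (1 / x\<^sup>2) * poly p (1 / x)
     = exp_family ([:0, 0, 1:] * (p - pderiv p)) x"
    using greater by (simp add: exp_family_def power2_eq_square algebra_simps diff_divide_distrib)
  finally show ?thesis
    by (rule has_field_derivative_transform_within_open[where S = "{0<..}"])
       (use greater in \<open>simp_all add: exp_family_def\<close>)
next
  case equal
  have "((\<lambda>h. exp_family p h / h) \<longlongrightarrow> 0) (at_right 0)"
  \<comment> \<open>Division by h multiplies the polynomial by its variable 1/h, hence
    \<open>[:0, 1:] * p\<close>.\<close>
  proof (rule Lim_transform_eventually[OF poly_exp_tendsto[of "[:0, 1:] * p"]])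
    have "\<forall>\<^sub>F h::real in at_right 0. 0 < h" by (rule eventually_at_right_less)
    then show "\<forall>\<^sub>F h in at_right 0. poly ([:0, 1:] * p) (1 / h) * exp (- 1 / h) = exp_family p h / h"
      by eventually_elim (simp add: exp_family_def)
  qed
  moreover have "((\<lambda>h. exp_family p h / h) \<longlongrightarrow> 0) (at_left 0)"
  proof (rule Lim_transform_eventually[OF tendsto_const])
    have "\<forall>\<^sub>F h::real in at_left 0. h < 0" by (simp add: eventually_at_left_field) (metis less_numeral_extra(1) neg_less_0_iff_less)
    then show "\<forall>\<^sub>F h in at_left 0. 0 = exp_family p h / h"
      by eventually_elim (simp add: exp_family_def)
  qed
  ultimately have "((\<lambda>h. exp_family p h / h) \<longlongrightarrow> 0) (at 0)"
    by (simp add: filterlim_split_at)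
  then show ?thesis using equal by (simp add: DERIV_def exp_family_def)
qed

text \<open>Induction on k with \<open>p\<close> arbitrary, since differentiation only changes the
  polynomial and brings out a derivative of \<open>s\<close>.\<close>

lemma C_diff_exp_family:
  assumes s: "\<And>k. C_diff k (\<lambda>z. of_real (s z))"
  shows "C_diff k (\<lambda>z. of_real (exp_family p (s z)))"
proof (induction k arbitrary: p)
  case 0
  have "continuous_on UNIV (exp_family p)"
    using exp_family_deriv by (intro continuous_at_imp_continuous_on ballI DERIV_isCont) blast
  moreover have "continuous_on UNIV s" using continuous_on_Re[OF C_diff_continuous[OF s[of 0]]] by simp
  ultimately show ?case by (auto intro!: continuous_intros continuous_on_compose2[of UNIV "exp_family p"])
next
  case (Suc k)
  obtain D where D: "\<And>z. ((\<lambda>z. complex_of_real (s z)) has_derivative D z) (at z)" "\<And>v. C_diff k (\<lambda>z. D z v)"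
    by (rule C_diff_SucE[OF s[of "Suc k"]]) blast
  have Dw: "has_wirt (\<lambda>z. of_real (s z)) (wirt (\<lambda>z. of_real (s z)) z) (wirt_bar (\<lambda>z. of_real (s z)) z) z" for z
    by (rule C_diff_has_wirt) (use s in blast)
  have D': "D z = (\<lambda>v. wirt (\<lambda>z. of_real (s z)) z * v + wirt_bar (\<lambda>z. of_real (s z)) z * cnj v)" for z
    using has_derivative_unique[OF D(1) Dw[unfolded has_wirt_def]] .
  let ?p = "[:0, 0, 1:] * (p - pderiv p)"
  show ?case
  proof (rule C_diff_SucI[of _ "\<lambda>z v. of_real (exp_family ?p (s z)) * D z v"])
    fix z
    have "((\<lambda>z. complex_of_real (exp_family p (s z))) has_derivative (\<lambda>v. of_real (exp_family ?p (s z)) * wirt (\<lambda>z. of_real (s z)) z * v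
       + of_real (exp_family ?p (s z)) * wirt_bar (\<lambda>z. of_real (s z)) z * cnj v)) (at z)"
      using has_wirt_chain_real[OF Dw exp_family_deriv] unfolding has_wirt_def .
    then show "((\<lambda>z. complex_of_real (exp_family p (s z))) has_derivative (\<lambda>v. of_real (exp_family ?p (s z)) * D z v)) (at z)"
      unfolding D' by (simp only: ring_distribs mult.assoc)
    show "C_diff k (\<lambda>z. complex_of_real (exp_family ?p (s z)) * D z v)" for v
      by (intro C_diff_mult Suc.IH D)
  qed
qed

text \<open>The first index counts derivatives of the profile \<open>exp (- 1 / x)\<close>.\<close>

definition bump :: "nat \<Rightarrow> real \<Rightarrow> complex \<Rightarrow> complex \<Rightarrow> real" where
  "bump n r a z = exp_family (((\<lambda>p. [:0, 0, 1:] * (p - pderiv p)) ^^ n) 1) (r\<^sup>2 - (cmod (z - a))\<^sup>2)"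

lemma bump_sym: "bump n r a z = bump n r z a"
  by (simp add: bump_def norm_minus_commute)

lemma C_diff_radius_sq: "C_diff k (\<lambda>z. of_real (r\<^sup>2 - (cmod (z - a))\<^sup>2))"
proof -
  have "(\<lambda>z. complex_of_real (r\<^sup>2 - (cmod (z - a))\<^sup>2)) = (\<lambda>z. of_real (r\<^sup>2) + (- 1) * ((z + - a) * (cnj z + - cnj a)))"
    by (auto simp: of_real_cmod_power2)
  moreover have "C_diff k \<dots>"
    by (intro C_diff_add C_diff_mult C_diff_const C_diff_linear[OF bounded_linear_ident] C_diff_linear[OF bounded_linear_cnj])
  ultimately show ?thesis by simp
qed

lemma C_diff_bump: "C_diff k (\<lambda>z. of_real (bump n r a z))"
  unfolding bump_def by (intro C_diff_exp_family C_diff_radius_sq)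

lemma bump_has_wirt:
  "has_wirt (\<lambda>z. of_real (bump n r a z)) (- of_real (bump (Suc n) r a z) * cnj (z - a))
     (- of_real (bump (Suc n) r a z) * (z - a)) z"
proof -
  have s: "has_wirt (\<lambda>z. of_real (r\<^sup>2 - (cmod (z - a))\<^sup>2)) (- cnj (z - a)) (- (z - a)) z"
    using has_wirt_diff[OF has_wirt_const has_wirt_cmod_sq, of "of_real (r\<^sup>2)" a z] by simp
  define P where "P = ((\<lambda>p. [:0, 0, 1:] * (p - pderiv p)) ^^ n) (1 :: real poly)"
  have b: "bump n r a = (\<lambda>z. exp_family P (r\<^sup>2 - (cmod (z - a))\<^sup>2))"
    "bump (Suc n) r a z = exp_family ([:0, 0, 1:] * (P - pderiv P)) (r\<^sup>2 - (cmod (z - a))\<^sup>2)"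
    by (simp_all only: bump_def[abs_def] P_def funpow.simps o_apply)
  show ?thesis unfolding b
    by (rule has_wirt_cong[OF has_wirt_chain_real[OF s exp_family_deriv]]) (simp_all add: right_diff_distrib)
qed

lemma bump_eq_0:
  assumes "cmod (z - a) \<ge> r" "r > 0" shows "bump n r a z = 0"
proof -
  have "r\<^sup>2 \<le> (cmod (z - a))\<^sup>2" using assms by (intro power_mono) auto
  then show ?thesis by (simp add: bump_def exp_family_def)
qed

lemma bump_pos: assumes "cmod (z - a) < r" shows "bump 0 r a z > 0"
proof -
  have "(cmod (z - a))\<^sup>2 < r\<^sup>2" using assms by (intro power_strict_mono) auto
  then show ?thesis by (simp add: bump_def exp_family_def)
qed

lemma bump_nonneg: "bump 0 r a z \<ge> 0"
  by (simp add: bump_def exp_family_def)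

section \<open>Test functions from bumps and from holomorphic multiples\<close>

lemma closure_support_subset:
  fixes f :: "complex \<Rightarrow> complex"
  assumes "\<And>z. z \<notin> K \<Longrightarrow> f z = (0::complex)" "compact K" "K \<subseteq> D"
  shows "compact (closure {z. f z \<noteq> 0})" "closure {z. f z \<noteq> 0} \<subseteq> D"
proof -
  have "{z. f z \<noteq> 0} \<subseteq> K" using assms(1) by blast
  then have c: "closure {z. f z \<noteq> 0} \<subseteq> K" using compact_imp_closed[OF assms(2)] by (rule closure_minimal)
  then show "closure {z. f z \<noteq> 0} \<subseteq> D" using assms(3) by blast
  show "compact (closure {z. f z \<noteq> 0})"
    using c assms(2) by (meson bounded_subset closed_closure compact_eq_bounded_closed)
qed

lemma test_functionI:
  fixes f :: "complex \<Rightarrow> complex"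
  assumes "\<And>k. C_diff k f" "\<And>z. z \<notin> K \<Longrightarrow> f z = (0::complex)" "compact K" "K \<subseteq> D"
  shows "test_function D f"
  unfolding test_function_def using assms closure_support_subset[of K f D] by blast

lemma test_function_bump:
  assumes "r > 0" "cball a r \<subseteq> D"
  shows "test_function D (\<lambda>z. of_real (bump 0 r a z))"
  by (rule test_functionI[OF C_diff_bump _ _ assms(2)])
     (use bump_eq_0 assms(1) in \<open>auto simp: dist_norm norm_minus_commute\<close>)

text \<open>Off \<open>D\<close> the values of \<open>m\<close> are arbitrary, but the product is 0
  there. The derivative consists of two products of the same shape, one of them with
  \<open>deriv m\<close>, so the induction varies \<open>m\<close> and \<open>f\<close> together.
  The purpose is that \<open>\<mu>\<close> times a test function is a test function.\<close>

lemma C_diff_holomorphic_mult: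
  assumes D: "open D" and K: "compact K" "K \<subseteq> D"
  shows "m holomorphic_on D \<Longrightarrow> (\<And>k. C_diff k f) \<Longrightarrow> (\<And>z. z \<notin> K \<Longrightarrow> f z = 0) \<Longrightarrow> C_diff k (\<lambda>z. m z * f z)"
proof (induction k arbitrary: m f)
  case 0
  have o: "open (- K)" using K by (simp add: compact_imp_closed open_Compl)
  have "continuous_on D (\<lambda>z. m z * f z)"
    using 0 by (intro continuous_intros holomorphic_on_imp_continuous_on continuous_on_subset[OF C_diff_continuous[of 0 f]]) auto
  moreover have "continuous_on (- K) (\<lambda>z. m z * f z)"
    using 0(3) by (intro continuous_on_eq[OF continuous_on_const[of _ 0]]) simp
  moreover have "UNIV = D \<union> - K" using K by auto
  ultimately show ?case using continuous_on_open_Un[OF D o] by (metis C_diff.simps(1))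
next
  case (Suc k)
  have o: "open (- K)" using K by (simp add: compact_imp_closed open_Compl)
  define E where "E = (\<lambda>z. frechet_derivative f (at z))"
  have fd: "(f has_derivative E z) (at z)" for z
    using Suc.prems(2)[of "Suc 0"] unfolding E_def by (simp add: differentiable_on_def frechet_derivative_works)
  have Ck: "C_diff j (\<lambda>z. E z v)" for j v using Suc.prems(2)[of "Suc j"] unfolding E_def by simp
  have E0: "E z v = 0" if "z \<notin> K" for z v
  proof -
    have "((\<lambda>_. 0) has_derivative E z) (at z)"
      by (rule has_derivative_transform_within_open[OF fd o]) (use that Suc.prems(3) in auto)
    then show ?thesis using has_derivative_unique[OF _ has_derivative_const] by metis
  qed
  show ?case
  proof (rule C_diff_SucI[of _ "\<lambda>z v. m z * E z v + v * (deriv m z * f z)"])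
    fix z
    show "((\<lambda>z. m z * f z) has_derivative (\<lambda>v. m z * E z v + v * (deriv m z * f z))) (at z)"
    proof (cases "z \<in> D")
      case True
      have "(m has_derivative (\<lambda>v. deriv m z * v)) (at z)"
        using holomorphic_derivI[OF Suc.prems(1) D True] unfolding has_field_derivative_def by simp
      from has_derivative_mult[OF this fd] show ?thesis by (simp add: mult.commute mult.left_commute)
    next
      case False
      then have z: "z \<notin> K" using K by auto
      have "((\<lambda>z. m z * f z) has_derivative (\<lambda>v. 0)) (at z)"
        by (rule has_derivative_transform_within_open[OF has_derivative_const o]) (use z Suc.prems(3) in auto)
      then show ?thesis using E0[OF z] Suc.prems(3)[OF z] by simp
    qed
    show "C_diff k (\<lambda>z. m z * E z v + v * (deriv m z * f z))" for v
      by (intro C_diff_add C_diff_mult[OF C_diff_const] Suc.IH holomorphic_deriv D Suc.prems Ck E0)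
  qed
qed

section \<open>Weyl's lemma\<close>

text \<open>The remainder of first order divided by |h| tends to 0 pointwise and is bounded by 4C,
  so dominated convergence against \<open>U\<close> applies along every sequence tending to
  0.\<close>

lemma has_wirt_integral:
  fixes \<Phi> \<Phi>1 \<Phi>2 :: "complex \<Rightarrow> complex \<Rightarrow> complex"
  assumes U: "integrable lborel U"
    and w: "\<And>\<zeta> a. has_wirt (\<lambda>a. \<Phi> \<zeta> a) (\<Phi>1 \<zeta> a) (\<Phi>2 \<zeta> a) a"
    and C: "\<And>\<zeta> a. cmod (\<Phi> \<zeta> a) \<le> C" "\<And>\<zeta> a. cmod (\<Phi>1 \<zeta> a) \<le> C" "\<And>\<zeta> a. cmod (\<Phi>2 \<zeta> a) \<le> C"
    and m: "\<And>a. (\<lambda>\<zeta>. \<Phi> \<zeta> a) \<in> borel_measurable borel" "\<And>a. (\<lambda>\<zeta>. \<Phi>1 \<zeta> a) \<in> borel_measurable borel"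
      "\<And>a. (\<lambda>\<zeta>. \<Phi>2 \<zeta> a) \<in> borel_measurable borel"
  shows "has_wirt (\<lambda>a. LINT \<zeta>|lborel. U \<zeta> * \<Phi> \<zeta> a) (LINT \<zeta>|lborel. U \<zeta> * \<Phi>1 \<zeta> a) (LINT \<zeta>|lborel. U \<zeta> * \<Phi>2 \<zeta> a) a"
proof -
  have C0: "0 \<le> C" using C(1)[of 0 0] norm_ge_zero order_trans by blast
  have mU: "U \<in> borel_measurable lborel" using U by auto
  have int: "integrable lborel (\<lambda>\<zeta>. U \<zeta> * f \<zeta>)"
    if "f \<in> borel_measurable borel" "\<And>\<zeta>. cmod (f \<zeta>) \<le> K" for f K
  proof (rule Bochner_Integration.integrable_bound[OF integrable_mult_right[OF integrable_norm[OF U], of K]])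
    show "(\<lambda>\<zeta>. U \<zeta> * f \<zeta>) \<in> borel_measurable lborel" using mU that(1) by measurable
    show "AE \<zeta> in lborel. norm (U \<zeta> * f \<zeta>) \<le> norm (K * norm (U \<zeta>))"
    proof (rule AE_I2)
      fix \<zeta>
      have "norm (U \<zeta> * f \<zeta>) \<le> K * norm (U \<zeta>)"
        unfolding norm_mult using mult_right_mono[OF that(2) norm_ge_zero] by (simp add: mult.commute)
      also have "\<dots> \<le> norm (K * norm (U \<zeta>))" by (simp only: real_norm_def abs_ge_self)
      finally show "norm (U \<zeta> * f \<zeta>) \<le> norm (K * norm (U \<zeta>))" .
    qed
  qed
  note i = int[OF m(1) C(1)] int[OF m(2) C(2)] int[OF m(3) C(3)]
  have lip: "cmod (\<Phi> \<zeta> x - \<Phi> \<zeta> y) \<le> (2 * C) * cmod (x - y)" for \<zeta> x y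
  proof (rule differentiable_bound[OF convex_UNIV])
    show "((\<lambda>a. \<Phi> \<zeta> a) has_derivative (\<lambda>v. \<Phi>1 \<zeta> z * v + \<Phi>2 \<zeta> z * cnj v)) (at z within UNIV)" for z
      using w unfolding has_wirt_def by auto
    show "onorm (\<lambda>v. \<Phi>1 \<zeta> z * v + \<Phi>2 \<zeta> z * cnj v) \<le> 2 * C" for z
    proof (rule onorm_le)
      fix v
      have "cmod (\<Phi>1 \<zeta> z * v + \<Phi>2 \<zeta> z * cnj v) \<le> cmod (\<Phi>1 \<zeta> z) * cmod v + cmod (\<Phi>2 \<zeta> z) * cmod v"
        by (metis complex_mod_cnj norm_mult norm_triangle_ineq)
      also have "\<dots> \<le> C * cmod v + C * cmod v" by (intro add_mono mult_right_mono C) auto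
      finally show "cmod (\<Phi>1 \<zeta> z * v + \<Phi>2 \<zeta> z * cnj v) \<le> 2 * C * cmod v" by simp
    qed
  qed auto
  define D where "D \<zeta> v = \<Phi>1 \<zeta> a * v + \<Phi>2 \<zeta> a * cnj v" for \<zeta> v
  define F where "F a = (LINT \<zeta>|lborel. U \<zeta> * \<Phi> \<zeta> a)" for a
  define E where "E v = (LINT \<zeta>|lborel. U \<zeta> * \<Phi>1 \<zeta> a) * v + (LINT \<zeta>|lborel. U \<zeta> * \<Phi>2 \<zeta> a) * cnj v" for v
  have Dle: "cmod (D \<zeta> v) \<le> 2 * C * cmod v" for \<zeta> v
  proof -
    have "cmod (D \<zeta> v) \<le> cmod (\<Phi>1 \<zeta> a) * cmod v + cmod (\<Phi>2 \<zeta> a) * cmod v"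
      unfolding D_def by (metis complex_mod_cnj norm_mult norm_triangle_ineq)
    also have "\<dots> \<le> C * cmod v + C * cmod v" by (intro add_mono mult_right_mono C) auto
    finally show ?thesis by simp
  qed
  have diff: "F (a + h) - F a - E h = (LINT \<zeta>|lborel. U \<zeta> * (\<Phi> \<zeta> (a + h) - \<Phi> \<zeta> a - D \<zeta> h))" for h
  proof -
    have "(LINT \<zeta>|lborel. U \<zeta> * (\<Phi> \<zeta> (a + h) - \<Phi> \<zeta> a - D \<zeta> h)) =
       (LINT \<zeta>|lborel. U \<zeta> * \<Phi> \<zeta> (a + h) - U \<zeta> * \<Phi> \<zeta> a - (U \<zeta> * \<Phi>1 \<zeta> a * h + U \<zeta> * \<Phi>2 \<zeta> a * cnj h))"
      by (rule Bochner_Integration.integral_cong) (auto simp: D_def algebra_simps)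
    also have "\<dots> = F (a + h) - F a - E h"
      unfolding F_def E_def using i
      by (subst Bochner_Integration.integral_diff Bochner_Integration.integral_add;
          (intro Bochner_Integration.integrable_diff Bochner_Integration.integrable_add integrable_mult_left i)?)+ simp
    finally show ?thesis by simp
  qed
  have "((\<lambda>h. norm (F (a + h) - F a - E h) / norm h) \<longlongrightarrow> 0) (at 0)"
    unfolding tendsto_at_iff_sequentially comp_def
  proof (intro allI impI)
    fix X :: "nat \<Rightarrow> complex"
    assume X: "\<forall>i. X i \<in> UNIV - {0}" "X \<longlonglongrightarrow> 0"
    let ?R = "\<lambda>n \<zeta>. (\<Phi> \<zeta> (a + X n) - \<Phi> \<zeta> a - D \<zeta> (X n)) / of_real (norm (X n))"
    have X0: "norm (X n) > 0" for n using X(1) by auto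
    have "(\<lambda>n. LINT \<zeta>|lborel. U \<zeta> * ?R n \<zeta>) \<longlonglongrightarrow> (LINT \<zeta>|(lborel :: complex measure). 0)"
    proof (rule integral_dominated_convergence[where w = "\<lambda>\<zeta>. 4 * C * norm (U \<zeta>)"])
      show "integrable lborel (\<lambda>\<zeta>. 4 * C * norm (U \<zeta>))" by (intro integrable_mult_right integrable_norm U)
      show "(\<lambda>\<zeta>. U \<zeta> * ?R n \<zeta>) \<in> borel_measurable lborel" for n
        unfolding D_def using mU m by measurable
      show "AE \<zeta> in lborel. norm (U \<zeta> * ?R n \<zeta>) \<le> 4 * C * norm (U \<zeta>)" for n
      proof (rule AE_I2)
        fix \<zeta>
        have "cmod (\<Phi> \<zeta> (a + X n) - \<Phi> \<zeta> a - D \<zeta> (X n)) \<le> cmod (\<Phi> \<zeta> (a + X n) - \<Phi> \<zeta> a) + cmod (D \<zeta> (X n))"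
          by (rule norm_triangle_ineq4)
        also have "\<dots> \<le> 2 * C * cmod (X n) + 2 * C * cmod (X n)"
          using lip[of \<zeta> "a + X n" a] Dle by (intro add_mono) auto
        finally have "cmod (?R n \<zeta>) \<le> 4 * C" using X0[of n] by (simp add: norm_divide field_simps)
        from mult_left_mono[OF this norm_ge_zero[of "U \<zeta>"]]
        show "norm (U \<zeta> * ?R n \<zeta>) \<le> 4 * C * norm (U \<zeta>)" by (simp add: norm_mult norm_divide mult.commute)
      qed
      show "AE \<zeta> in lborel. (\<lambda>n. U \<zeta> * ?R n \<zeta>) \<longlonglongrightarrow> 0"
      proof (rule AE_I2)
        fix \<zeta>
        have "((\<lambda>h. norm (\<Phi> \<zeta> (a + h) - \<Phi> \<zeta> a - D \<zeta> h) / norm h) \<longlongrightarrow> 0) (at 0)"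
          using w[of \<zeta> a] unfolding has_wirt_def has_derivative_at D_def by simp
        moreover have "filterlim X (at 0) sequentially"
          using X by (intro filterlim_atI) (auto simp: eventually_sequentially)
        ultimately have "(\<lambda>n. norm (\<Phi> \<zeta> (a + X n) - \<Phi> \<zeta> a - D \<zeta> (X n)) / norm (X n)) \<longlonglongrightarrow> 0"
          by (rule filterlim_compose)
        then have "(\<lambda>n. norm (?R n \<zeta>)) \<longlonglongrightarrow> 0" by (simp add: norm_divide)
        then have "(\<lambda>n. ?R n \<zeta>) \<longlonglongrightarrow> 0" by (rule tendsto_norm_zero_cancel)
        from tendsto_mult_left[OF this, of "U \<zeta>"] show "(\<lambda>n. U \<zeta> * ?R n \<zeta>) \<longlonglongrightarrow> 0" by simp
      qed
    qed auto
    then have "(\<lambda>n. norm (LINT \<zeta>|lborel. U \<zeta> * ?R n \<zeta>)) \<longlonglongrightarrow> 0"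
      using tendsto_norm_zero by fastforce
    moreover have "norm (LINT \<zeta>|lborel. U \<zeta> * ?R n \<zeta>) = norm (F (a + X n) - F a - E (X n)) / norm (X n)" for n
    proof -
      have "(LINT \<zeta>|lborel. U \<zeta> * ?R n \<zeta>) = (F (a + X n) - F a - E (X n)) / of_real (norm (X n))"
        unfolding diff by (simp only: times_divide_eq_right integral_divide_zero)
      then show ?thesis by (simp only: norm_divide norm_of_real abs_norm_cancel)
    qed
    ultimately show "(\<lambda>n. norm (F (a + X n) - F a - E (X n)) / norm (X n)) \<longlonglongrightarrow> 0" by simp
  qed
  moreover have "bounded_linear E"
    unfolding E_def by (intro bounded_linear_add bounded_linear_mult_right bounded_linear_compose[OF bounded_linear_mult_right bounded_linear_cnj])
  ultimately have "(F has_derivative E) (at a)" unfolding has_derivative_at by simp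
  then show ?thesis unfolding has_wirt_def E_def[abs_def] F_def[abs_def] .
qed

section \<open>Mollification\<close>

lemma bump_bounded: 
  assumes "r > 0"
  obtains C where "\<And>\<zeta> a. cmod (of_real (bump n r \<zeta> a)) \<le> C" "\<And>\<zeta> a. cmod (of_real (bump n r \<zeta> a) * (a - \<zeta>)) \<le> C"
   "\<And>\<zeta> a. cmod (of_real (bump n r \<zeta> a) * (a - \<zeta>) * (a - \<zeta>)) \<le> C"
proof -
  have c: "continuous_on UNIV (\<lambda>z. complex_of_real (bump n r 0 z))" by (rule C_diff_continuous[OF C_diff_bump])
  have z: "complex_of_real (bump n r 0 z) = 0" if "cmod z > r" for z using bump_eq_0[of r z 0] that assms by simp
  obtain M where M: "\<And>z. cmod (complex_of_real (bump n r 0 z)) \<le> M"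
    using continuous_compact_support_integrable(2)[OF c z] by blast
  have M0: "M \<ge> 0" using M norm_ge_zero order_trans by blast
  have t: "bump n r \<zeta> a = bump n r 0 (a - \<zeta>)" for \<zeta> a by (simp add: bump_def)
  have b: "cmod (of_real (bump n r \<zeta> a) * x) \<le> M * K"
    if "cmod (a - \<zeta>) \<le> r \<Longrightarrow> cmod x \<le> K" "K \<ge> 0" for x \<zeta> a K
  proof (cases "cmod (a - \<zeta>) > r")
    case True
    then have "complex_of_real (bump n r \<zeta> a) = 0" unfolding t[of \<zeta> a] by (rule z)
    then show ?thesis using M0 that(2) by simp
  next
    case False
    then have "cmod x \<le> K" using that(1) by simp
    then show ?thesis unfolding t[of \<zeta> a] norm_mult by (intro mult_mono M M0) auto
  qed
  show ?thesis
  proof (rule that[of "M * max 1 (max r (r * r))"])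
    fix \<zeta> a :: complex
    show "cmod (of_real (bump n r \<zeta> a)) \<le> M * max 1 (max r (r * r))"
      using b[where x = 1 and \<zeta> = \<zeta> and a = a and K = "max 1 (max r (r * r))"] by simp
    show "cmod (of_real (bump n r \<zeta> a) * (a - \<zeta>)) \<le> M * max 1 (max r (r * r))"
      by (rule b) (simp_all add: le_max_iff_disj)
    have "cmod ((a - \<zeta>) * (a - \<zeta>)) \<le> max 1 (max r (r * r))" if "cmod (a - \<zeta>) \<le> r"
      using mult_mono[OF that that] assms by (simp add: norm_mult le_max_iff_disj)
    from b[OF this] show "cmod (of_real (bump n r \<zeta> a) * (a - \<zeta>) * (a - \<zeta>)) \<le> M * max 1 (max r (r * r))"
      by (simp add: mult.assoc)
  qed
qed

lemma borel_measurable_bump [measurable]: "(\<lambda>\<zeta>. bump n r \<zeta> a) \<in> borel_measurable borel" "bump n r a \<in> borel_measurable borel"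
proof -
  have "continuous_on UNIV (\<lambda>z. Re (of_real (bump n r a z)))" for a
    by (intro continuous_on_Re C_diff_continuous[OF C_diff_bump])
  then have "bump n r a \<in> borel_measurable borel" for a by (intro borel_measurable_continuous_onI) simp
  then show "bump n r a \<in> borel_measurable borel" "(\<lambda>\<zeta>. bump n r \<zeta> a) \<in> borel_measurable borel"
    by (auto simp: bump_sym[of n r _ a])
qed

text \<open>The right-hand side is symmetric in \<open>z\<close> and \<open>a\<close>: the mixed
  second derivative of a mollification in its centre equals the test against the mixed derivative in
  the integration variable.\<close>

lemma wirt_laplace_bump:
  "wirt (wirt_bar (\<lambda>z. of_real (bump 0 r a z))) z =
    of_real (bump 2 r a z) * cnj (z - a) * (z - a) - of_real (bump 1 r a z)"
proof -
  have 1: "wirt_bar (\<lambda>z. of_real (bump 0 r a z)) = (\<lambda>z. - of_real (bump 1 r a z) * (z - a))"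
    using has_wirt_unique(2)[OF bump_has_wirt] by force
  have "has_wirt (\<lambda>z. of_real (bump 1 r a z) * (z - a))
     (- of_real (bump 2 r a z) * cnj (z - a) * (z - a) + of_real (bump 1 r a z) * (1 - 0))
     (- of_real (bump 2 r a z) * (z - a) * (z - a) + of_real (bump 1 r a z) * (0 - 0)) z"
    using has_wirt_mult[OF bump_has_wirt[of 1 r a z] has_wirt_diff[OF has_wirt_ident has_wirt_const[of a]]]
    by (simp add: numeral_2_eq_2)
  from has_wirt_unique(1)[OF has_wirt_cmult[OF this, of "-1"]]
  show ?thesis unfolding 1 by simp
qed

definition mollify :: "(complex \<Rightarrow> complex) \<Rightarrow> real \<Rightarrow> complex \<Rightarrow> complex" where
  "mollify U r a = (LINT \<zeta>|lborel. U \<zeta> * of_real (bump 0 r \<zeta> a)) / of_real (LINT z|lborel. bump 0 r 0 z)"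

lemma bump_integral:
  assumes "r > 0"
  shows "integrable lborel (\<lambda>\<zeta>. bump 0 r \<zeta> a)" "(LINT \<zeta>|lborel. bump 0 r \<zeta> a) = (LINT z|lborel. bump 0 r 0 z)"
    "(LINT z|lborel. bump 0 r 0 z) > 0"
proof -
  have c: "continuous_on UNIV (bump 0 r a)" for a
    using continuous_on_Re[OF C_diff_continuous[OF C_diff_bump[of 0 0 r a]]] by simp
  have z: "bump 0 r 0 z = 0" if "cmod z > r" for z using bump_eq_0[of r z 0] that assms by simp
  have i0: "integrable lborel (bump 0 r 0)" by (rule continuous_compact_support_integrable(1)[OF c z])
  have i0': "integrable lborel (\<lambda>z. complex_of_real (bump 0 r 0 z))" using i0 by (simp only: complex_of_real_integrable_eq)
  have t: "bump 0 r \<zeta> a = bump 0 r 0 (- a + \<zeta>)" for \<zeta> by (simp add: bump_def norm_minus_commute)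
  have "integrable lborel (\<lambda>\<zeta>. complex_of_real (bump 0 r \<zeta> a))"
    unfolding t using lborel_integral_translate(2)[OF i0'] .
  then show "integrable lborel (\<lambda>\<zeta>. bump 0 r \<zeta> a)" by (simp only: complex_of_real_integrable_eq)
  have "(LINT \<zeta>|lborel. complex_of_real (bump 0 r \<zeta> a)) = (LINT z|lborel. complex_of_real (bump 0 r 0 z))"
    unfolding t by (rule lborel_integral_translate(1))
  then show "(LINT \<zeta>|lborel. bump 0 r \<zeta> a) = (LINT z|lborel. bump 0 r 0 z)"
    by (simp only: integral_complex_of_real of_real_eq_iff)
  have "(LINT z|lborel. bump 0 r 0 z) \<noteq> 0"
  proof
    assume "(LINT z|lborel. bump 0 r 0 z) = 0"
    then have "AE z in lborel. bump 0 r 0 z = 0"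
      using integral_nonneg_eq_0_iff_AE[OF i0] bump_nonneg by simp
    moreover have "bump 0 r 0 z = 0 \<longleftrightarrow> z \<notin> ball 0 r" for z
      using bump_pos[of z 0 r] bump_eq_0[of r z 0 0] assms by (cases "cmod z < r") auto
    ultimately have "AE z in lborel. z \<notin> ball (0::complex) r" by simp
    then have "ball (0::complex) r \<in> null_sets lborel" by (subst AE_iff_null_sets) auto
    then have "measure lborel (ball (0::complex) r) = 0" by (simp add: null_setsD1 measure_def)
    then show False using measure_ball_complex[of r 0] assms by simp
  qed
  moreover have "(LINT z|lborel. bump 0 r 0 z) \<ge> 0" by (intro Bochner_Integration.integral_nonneg bump_nonneg)
  ultimately show "(LINT z|lborel. bump 0 r 0 z) > 0" by simp
qed

text \<open>The mixed second derivative \<open>Z\<close> in the centre is the weak Laplacian of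
  \<open>U\<close> tested against a bump, which is 0 for centres in \<open>S\<close>. So the z-bar
  coefficient of \<open>L\<close> and the z coefficient of \<open>R\<close> vanish there, and
  \<open>L\<close> is holomorphic, \<open>R\<close> antiholomorphic.\<close>

lemma mollify_harmonic:
  assumes U: "integrable lborel U" and r: "r > 0"
    and weak: "\<And>a. a \<in> S \<Longrightarrow> (LINT \<zeta>|lborel. U \<zeta> * wirt (wirt_bar (\<lambda>z. of_real (bump 0 r a z))) \<zeta>) = 0"
  shows "mollify U r harmonic_on S"
proof -
  obtain C0 where C0: "\<And>\<zeta> a. cmod (of_real (bump 0 r \<zeta> a)) \<le> C0" by (rule bump_bounded[OF r]) blast
  obtain C1 where C1: "\<And>\<zeta> a. cmod (of_real (bump 1 r \<zeta> a)) \<le> C1" "\<And>\<zeta> a. cmod (of_real (bump 1 r \<zeta> a) * (a - \<zeta>)) \<le> C1"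
    by (rule bump_bounded[OF r]) blast
  obtain C2 where C2: "\<And>\<zeta> a. cmod (of_real (bump 2 r \<zeta> a) * (a - \<zeta>) * (a - \<zeta>)) \<le> C2"
    by (rule bump_bounded[OF r]) blast
  let ?C = "max C0 (C1 + C2)"
  have nn: "0 \<le> C1" "0 \<le> C2" using C1(1) C2 norm_ge_zero order_trans by blast+
  have cc: "cmod (x * cnj y) = cmod (x * y)" "cmod (x * cnj y * cnj y) = cmod (x * y * y)" "cmod (x * cnj y * y) = cmod (x * y * y)" for x y
    by (simp_all only: norm_mult complex_mod_cnj)
  have s2: "Suc 1 = 2" by simp
  have w0: "has_wirt (\<lambda>a. of_real (bump 0 r \<zeta> a)) (- (of_real (bump 1 r \<zeta> a) * cnj (a - \<zeta>))) (- (of_real (bump 1 r \<zeta> a) * (a - \<zeta>))) a" for \<zeta> a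
    using bump_has_wirt[of 0 r \<zeta> a] by simp
  have w1: "has_wirt (\<lambda>a. - (of_real (bump 1 r \<zeta> a) * (a - \<zeta>)))
     (of_real (bump 2 r \<zeta> a) * cnj (a - \<zeta>) * (a - \<zeta>) - of_real (bump 1 r \<zeta> a))
     (of_real (bump 2 r \<zeta> a) * (a - \<zeta>) * (a - \<zeta>)) a" for \<zeta> a
    by (rule has_wirt_cong[OF has_wirt_cmult[OF has_wirt_mult[OF bump_has_wirt has_wirt_diff[OF has_wirt_ident has_wirt_const]], of "-1", simplified mult_minus1]])
       (simp_all add: numeral_2_eq_2)
  have w2: "has_wirt (\<lambda>a. - (of_real (bump 1 r \<zeta> a) * cnj (a - \<zeta>)))
     (of_real (bump 2 r \<zeta> a) * cnj (a - \<zeta>) * cnj (a - \<zeta>))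
     (of_real (bump 2 r \<zeta> a) * cnj (a - \<zeta>) * (a - \<zeta>) - of_real (bump 1 r \<zeta> a)) a" for \<zeta> a
    using has_wirt_cnj[OF w1[of \<zeta> a]] by (simp add: mult.commute mult.left_commute)
  have bnd: "cmod (of_real (bump 2 r \<zeta> a) * cnj (a - \<zeta>) * (a - \<zeta>) - of_real (bump 1 r \<zeta> a)) \<le> ?C" for \<zeta> a
  proof -
    have "cmod (of_real (bump 2 r \<zeta> a) * cnj (a - \<zeta>) * (a - \<zeta>) - of_real (bump 1 r \<zeta> a))
        \<le> cmod (of_real (bump 2 r \<zeta> a) * (a - \<zeta>) * (a - \<zeta>)) + cmod (of_real (bump 1 r \<zeta> a))"
      unfolding cc(3)[symmetric] by (rule norm_triangle_ineq4)
    also have "\<dots> \<le> C2 + C1" by (intro add_mono C1 C2)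
    finally show ?thesis by (simp add: le_max_iff_disj)
  qed
  define c where "c = complex_of_real (LINT z|lborel. bump 0 r 0 z)"
  define L where "L a = (LINT \<zeta>|lborel. U \<zeta> * (- (of_real (bump 1 r \<zeta> a) * cnj (a - \<zeta>))))" for a
  define R where "R a = (LINT \<zeta>|lborel. U \<zeta> * (- (of_real (bump 1 r \<zeta> a) * (a - \<zeta>))))" for a
  define Z where "Z a = (LINT \<zeta>|lborel. U \<zeta> * (of_real (bump 2 r \<zeta> a) * cnj (a - \<zeta>) * (a - \<zeta>) - of_real (bump 1 r \<zeta> a)))" for a
  have hF: "has_wirt (\<lambda>a. LINT \<zeta>|lborel. U \<zeta> * of_real (bump 0 r \<zeta> a)) (L a) (R a) a" for a
    unfolding L_def R_def
  proof (rule has_wirt_integral[OF U w0, where C = ?C])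
    show "cmod (of_real (bump 0 r \<zeta> a)) \<le> ?C" for \<zeta> a using C0[of \<zeta> a] by (simp add: le_max_iff_disj)
    show "cmod (- (of_real (bump 1 r \<zeta> a) * cnj (a - \<zeta>))) \<le> ?C" "cmod (- (of_real (bump 1 r \<zeta> a) * (a - \<zeta>))) \<le> ?C" for \<zeta> a
      unfolding norm_minus_cancel cc using C1(2)[of \<zeta> a] nn by linarith+
  qed measurable
  have hR: "has_wirt R (Z a) (LINT \<zeta>|lborel. U \<zeta> * (of_real (bump 2 r \<zeta> a) * (a - \<zeta>) * (a - \<zeta>))) a" for a
    unfolding R_def Z_def
  proof (rule has_wirt_integral[OF U w1 _ bnd])
    show "cmod (- (of_real (bump 1 r \<zeta> a) * (a - \<zeta>))) \<le> ?C" for \<zeta> a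
      unfolding norm_minus_cancel cc using C1(2)[of \<zeta> a] nn by linarith
    show "cmod (of_real (bump 2 r \<zeta> a) * (a - \<zeta>) * (a - \<zeta>)) \<le> ?C" for \<zeta> a
      using C2[of \<zeta> a] nn by linarith
  qed measurable
  have hL: "has_wirt L (LINT \<zeta>|lborel. U \<zeta> * (of_real (bump 2 r \<zeta> a) * cnj (a - \<zeta>) * cnj (a - \<zeta>))) (Z a) a" for a
    unfolding L_def Z_def
  proof (rule has_wirt_integral[OF U w2 _ _ bnd])
    show "cmod (- (of_real (bump 1 r \<zeta> a) * cnj (a - \<zeta>))) \<le> ?C" for \<zeta> a
      unfolding norm_minus_cancel cc using C1(2)[of \<zeta> a] nn by linarith
    show "cmod (of_real (bump 2 r \<zeta> a) * cnj (a - \<zeta>) * cnj (a - \<zeta>)) \<le> ?C" for \<zeta> a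
      unfolding cc using C2[of \<zeta> a] nn by linarith
  qed measurable
  have Z0: "Z a = 0" if "a \<in> S" for a
  proof -
    have "Z a = (LINT \<zeta>|lborel. U \<zeta> * wirt (wirt_bar (\<lambda>z. of_real (bump 0 r a z))) \<zeta>)"
      unfolding Z_def wirt_laplace_bump
      by (rule Bochner_Integration.integral_cong) (auto simp: bump_sym[of _ r _ a] algebra_simps)
    then show ?thesis using weak[OF that] by simp
  qed
  show ?thesis
  proof (rule harmonic_onI[of S _ "\<lambda>a. (1 / c) * L a" "\<lambda>a. (1 / c) * R a"])
    show "has_wirt (mollify U r) (1 / c * L a) (1 / c * R a) a" for a
      using has_wirt_cmult[OF hF, of "1 / c" a] by (simp add: mollify_def[abs_def] c_def)
    have "(L has_field_derivative (LINT \<zeta>|lborel. U \<zeta> * (of_real (bump 2 r \<zeta> a) * cnj (a - \<zeta>) * cnj (a - \<zeta>)))) (at a)" if "a \<in> S" for a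
      using hL[of a] Z0[OF that] by (simp only: has_wirt_field_derivative_iff)
    then have "L holomorphic_on S"
      unfolding holomorphic_on_def field_differentiable_def using has_field_derivative_at_within by blast
    then show "(\<lambda>a. 1 / c * L a) holomorphic_on S" by (intro holomorphic_intros)
    have "((\<lambda>a. cnj (R a)) has_field_derivative cnj (LINT \<zeta>|lborel. U \<zeta> * (of_real (bump 2 r \<zeta> a) * (a - \<zeta>) * (a - \<zeta>)))) (at a)" if "a \<in> S" for a
      using has_wirt_cnj[OF hR[of a]] Z0[OF that] by (simp only: has_wirt_field_derivative_iff complex_cnj_zero)
    then have "(\<lambda>a. cnj (R a)) holomorphic_on S"
      unfolding holomorphic_on_def field_differentiable_def using has_field_derivative_at_within by blast
    then show "(\<lambda>a. cnj (1 / c * R a)) holomorphic_on S"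
      by (simp only: complex_cnj_mult) (intro holomorphic_intros)
  qed
qed

lemma mollify_approx:
  assumes U: "integrable lborel U" and r: "r > 0"
    and e: "\<And>\<zeta>. cmod (\<zeta> - a) < r \<Longrightarrow> cmod (U \<zeta> - v) \<le> e"
  shows "cmod (mollify U r a - v) \<le> e"
proof -
  define c where "c = (LINT z|lborel. bump 0 r 0 z)"
  have c: "c > 0" unfolding c_def by (rule bump_integral(3)[OF r])
  have ib: "integrable lborel (\<lambda>\<zeta>. bump 0 r \<zeta> a)" "(LINT \<zeta>|lborel. bump 0 r \<zeta> a) = c"
    using bump_integral[OF r] by (auto simp: c_def)
  have ibc: "integrable lborel (\<lambda>\<zeta>. complex_of_real (bump 0 r \<zeta> a))" using ib(1) by (simp only: complex_of_real_integrable_eq)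
  obtain C0 where C0: "\<And>\<zeta> a. cmod (of_real (bump 0 r \<zeta> a)) \<le> C0" by (rule bump_bounded[OF r]) blast
  have [measurable]: "U \<in> borel_measurable lborel" using U by auto
  have iU: "integrable lborel (\<lambda>\<zeta>. U \<zeta> * of_real (bump 0 r \<zeta> a))"
  proof (rule Bochner_Integration.integrable_bound[OF integrable_mult_right[OF integrable_norm[OF U], of C0]])
    show "AE \<zeta> in lborel. norm (U \<zeta> * of_real (bump 0 r \<zeta> a)) \<le> norm (C0 * norm (U \<zeta>))"
    proof (rule AE_I2)
      fix \<zeta>
      have "norm (U \<zeta> * of_real (bump 0 r \<zeta> a)) \<le> norm (U \<zeta>) * C0"
        unfolding norm_mult by (rule mult_left_mono[OF C0]) simp
      then show "norm (U \<zeta> * of_real (bump 0 r \<zeta> a)) \<le> norm (C0 * norm (U \<zeta>))"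
        by (metis abs_ge_self mult.commute order_trans real_norm_def)
    qed
  qed measurable
  have iv: "integrable lborel (\<lambda>\<zeta>. v * of_real (bump 0 r \<zeta> a))" by (rule integrable_mult_right[OF ibc])
  have "(LINT \<zeta>|lborel. (U \<zeta> - v) * of_real (bump 0 r \<zeta> a)) = (LINT \<zeta>|lborel. U \<zeta> * of_real (bump 0 r \<zeta> a)) - v * of_real c"
  proof -
    have "(LINT \<zeta>|lborel. (U \<zeta> - v) * of_real (bump 0 r \<zeta> a)) = (LINT \<zeta>|lborel. U \<zeta> * of_real (bump 0 r \<zeta> a) - v * of_real (bump 0 r \<zeta> a))"
      by (rule Bochner_Integration.integral_cong) (auto simp: algebra_simps)
    also have "\<dots> = (LINT \<zeta>|lborel. U \<zeta> * of_real (bump 0 r \<zeta> a)) - (LINT \<zeta>|lborel. v * of_real (bump 0 r \<zeta> a))"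
      by (rule Bochner_Integration.integral_diff[OF iU iv])
    finally show ?thesis using ib(2) by (simp only: integral_mult_right_zero integral_complex_of_real)
  qed
  moreover have "of_real c * (mollify U r a - v) = (LINT \<zeta>|lborel. U \<zeta> * of_real (bump 0 r \<zeta> a)) - v * of_real c"
    using c by (simp add: mollify_def c_def[symmetric] right_diff_distrib mult.commute)
  ultimately have eq: "of_real c * (mollify U r a - v) = (LINT \<zeta>|lborel. (U \<zeta> - v) * of_real (bump 0 r \<zeta> a))"
    by (simp only:)
  have id: "integrable lborel (\<lambda>\<zeta>. (U \<zeta> - v) * of_real (bump 0 r \<zeta> a))"
    using Bochner_Integration.integrable_diff[OF iU iv] by (simp add: algebra_simps)
  have "cmod (of_real c * (mollify U r a - v)) \<le> (LINT \<zeta>|lborel. cmod ((U \<zeta> - v) * of_real (bump 0 r \<zeta> a)))"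
    unfolding eq by (rule integral_norm_bound)
  also have "\<dots> \<le> (LINT \<zeta>|lborel. e * bump 0 r \<zeta> a)"
  proof (rule integral_mono[OF integrable_norm[OF id] integrable_mult_right[OF ib(1)]])
    fix \<zeta>
    show "cmod ((U \<zeta> - v) * of_real (bump 0 r \<zeta> a)) \<le> e * bump 0 r \<zeta> a"
    proof (cases "cmod (\<zeta> - a) < r")
      case True
      have "cmod (of_real (bump 0 r \<zeta> a)) = bump 0 r \<zeta> a" using bump_nonneg by simp
      then show ?thesis unfolding norm_mult using e[OF True] bump_nonneg[of r \<zeta> a] by (simp add: mult_right_mono)
    next
      case False
      then have "bump 0 r \<zeta> a = 0" using bump_eq_0[of r a \<zeta> 0] r by (simp add: norm_minus_commute)
      then show ?thesis by simp
    qed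
  qed
  also have "\<dots> = e * c" using ib(2) by (simp only: integral_mult_right_zero)
  finally have "c * cmod (mollify U r a - v) \<le> c * e" using c by (simp add: norm_mult mult.commute)
  then show ?thesis using c by simp
qed

text \<open>By the maximum principle a uniformly Cauchy sequence on the circle is uniformly Cauchy
  on the disc. Convergence thus extends over an interior point at which nothing is known.\<close>

lemma harmonic_uniform_limit_from_sphere:
  assumes har: "\<And>n. u n harmonic_on ball a s" and R: "0 < R" "R < s"
    and ul: "uniform_limit (sphere a R) u v sequentially"
  obtains g where "uniform_limit (cball a R) u g sequentially"
proof -
  have "uniformly_Cauchy_on (cball a R) u"
    unfolding uniformly_Cauchy_on_def
  proof (intro allI impI)
    fix e :: real assume e: "e > 0"
    obtain N where N: "\<And>n z. n \<ge> N \<Longrightarrow> z \<in> sphere a R \<Longrightarrow> dist (u n z) (v z) < e / 4"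
      using uniform_limitD[OF ul, of "e / 4"] e unfolding eventually_sequentially by force
    have "dist (u m x) (u n x) < e" if x: "x \<in> cball a R" and mn: "m \<ge> N" "n \<ge> N" for x m n
    proof -
      have sub: "ball a R \<subseteq> ball a s" "cball a R \<subseteq> ball a s" using R by auto
      have "cmod (u m x - u n x) \<le> e / 2"
      proof (rule harmonic_max_principle[of "ball a R" "\<lambda>z. u m z - u n z"])
        show "continuous_on (closure (ball a R)) (\<lambda>z. u m z - u n z)"
          using R sub(2) har by (auto intro!: continuous_intros continuous_on_subset[OF harmonic_on_continuous[OF har]])
        show "(\<lambda>z. u m z - u n z) harmonic_on ball a R"
          by (intro harmonic_on_diff harmonic_on_subset[OF har sub(1)])
        show "x \<in> closure (ball a R)" using x R by simp
        fix z assume "z \<in> frontier (ball a R)"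
        then have z: "z \<in> sphere a R" using R by simp
        show "cmod (u m z - u n z) \<le> e / 2"
          using N[OF mn(1) z] N[OF mn(2) z] dist_triangle2[of "u m z" "u n z" "v z"] by (simp add: dist_norm)
      qed auto
      then show ?thesis using e by (simp add: dist_norm)
    qed
    then show "\<exists>M. \<forall>x\<in>cball a R. \<forall>m\<ge>M. \<forall>n\<ge>M. dist (u m x) (u n x) < e" by blast
  qed
  then show ?thesis using that Cauchy_uniformly_convergent unfolding uniformly_convergent_on_def by blast
qed

lemma uniform_nbhd:
  fixes u :: "complex \<Rightarrow> complex"
  assumes "compact C" "C \<subseteq> V" "open V" "continuous_on V u" "e > 0"
  obtains d where "d > 0" "\<And>a \<zeta>. a \<in> C \<Longrightarrow> cmod (\<zeta> - a) < d \<Longrightarrow> \<zeta> \<in> V \<and> cmod (u \<zeta> - u a) \<le> e"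
proof -
  obtain d0 where d0: "d0 > 0" "\<And>x y. x \<in> C \<Longrightarrow> y \<in> - V \<Longrightarrow> d0 \<le> dist x y"
  proof -
    have "closed (- V)" "C \<inter> - V = {}" using assms(2,3) by (auto simp: closed_Compl)
    from separate_compact_closed[OF assms(1) this] show ?thesis using that by blast
  qed
  \<comment> \<open>A compact neighbourhood of \<open>C\<close> inside \<open>V\<close>: uniform
    continuity is needed for comparison points outside \<open>C\<close>.\<close>
  define K where "K = {x + y | x y. x \<in> C \<and> y \<in> cball 0 (d0/2)}"
  have K: "compact K" unfolding K_def by (rule compact_sums[OF assms(1)]) simp
  have KO: "K \<subseteq> V"
  proof
    fix z assume "z \<in> K"
    then obtain x y where xy: "z = x + y" "x \<in> C" "cmod y \<le> d0/2" unfolding K_def by auto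
    then have "dist x z \<le> d0/2" by (simp add: dist_norm)
    then show "z \<in> V" using d0(1) d0(2)[OF xy(2), of z] by force
  qed
  have "uniformly_continuous_on K u"
    by (rule compact_uniformly_continuous[OF continuous_on_subset[OF assms(4) KO] K])
  then obtain d1 where d1: "d1 > 0" "\<And>x y. x \<in> K \<Longrightarrow> y \<in> K \<Longrightarrow> dist y x < d1 \<Longrightarrow> dist (u y) (u x) < e"
    using assms(5) unfolding uniformly_continuous_on_def by metis
  show ?thesis
  proof (rule that[of "min (d0/2) d1"])
    show "min (d0/2) d1 > 0" using d0 d1 by simp
    fix a \<zeta> assume a: "a \<in> C" and z: "cmod (\<zeta> - a) < min (d0/2) d1"
    have aK: "a \<in> K" unfolding K_def mem_Collect_eq by (rule exI[of _ a], rule exI[of _ 0]) (use a d0(1) in simp)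
    have zK: "\<zeta> \<in> K" unfolding K_def mem_Collect_eq by (rule exI[of _ a], rule exI[of _ "\<zeta> - a"]) (use a z in simp)
    show "\<zeta> \<in> V \<and> cmod (u \<zeta> - u a) \<le> e"
      using zK KO d1(2)[OF aK zK] z by (auto simp: dist_norm)
  qed
qed

text \<open>Mollifications are harmonic and converge to \<open>u\<close> locally uniformly off
  \<open>w\<close>. A circle avoiding \<open>w\<close> carries the convergence to its disc, also
  when the disc is centred at \<open>w\<close>; the limit there is the harmonic extension across
  \<open>w\<close>.\<close>

theorem Weyl_lemma:
  assumes D: "open D" and loc: "\<And>S. compact S \<Longrightarrow> S \<subseteq> D \<Longrightarrow> set_integrable lborel S u"
    and cont: "continuous_on (D - {w}) u"
    and weak: "\<And>\<psi>. test_function D \<psi> \<Longrightarrow> (LINT z:D|lborel. u z * wirt (wirt_bar \<psi>) z) = 0"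
  obtains h where "h harmonic_on D" "\<And>z. z \<in> D \<Longrightarrow> z \<noteq> w \<Longrightarrow> h z = u z"
proof -
  have oDw: "open (D - {w})" using D by (simp add: open_delete)
  have local: "\<exists>g R. R > 0 \<and> ball a R \<subseteq> D \<and> (a \<noteq> w \<longrightarrow> w \<notin> ball a R) \<and> g harmonic_on ball a R \<and>
       (\<forall>z\<in>ball a R. z \<noteq> w \<longrightarrow> g z = u z)" if a: "a \<in> D" for a
  proof -
    obtain t where t: "t > 0" "cball a t \<subseteq> D" using D a open_contains_cball by blast
    \<comment> \<open>Half the distance keeps the disc and its circle away from \<open>w\<close>
      when \<open>a\<close> is another point; in both cases t/2 leaves room for the bumps.\<close>
    define R where "R = (if a = w then t / 2 else min (t/2) (dist a w / 2))"
    have R: "R > 0" "2 * R \<le> t" "w \<notin> sphere a R" "a \<noteq> w \<longrightarrow> w \<notin> ball a R"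
      using t by (auto simp: R_def min_def)
    define U where "U = extend0 (cball a t) u"
    have U: "integrable lborel U" unfolding U_def set_integrable_extend0[symmetric] by (rule loc[OF compact_cball t(2)])
    \<comment> \<open>Bumps of radius at most R/2 with centres in the disc of radius 3R/2 stay
      within radius 2R <= t.\<close>
    define \<delta> where "\<delta> n = R / 2 * inverse (real (Suc n))" for n
    have \<delta>: "\<delta> n > 0" "\<delta> n \<le> R / 2" "\<delta> \<longlonglongrightarrow> 0" for n
      using R(1) tendsto_mult[OF tendsto_const LIMSEQ_inverse_real_of_nat, of "R / 2"]
      by (simp_all add: \<delta>_def[abs_def] inverse_le_1_iff mult_left_le)
    define f where "f n = mollify U (\<delta> n)" for n
    have har: "f n harmonic_on ball a (3 / 2 * R)" for n
      unfolding f_def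
    proof (rule mollify_harmonic[OF U \<delta>(1)])
      fix b assume b: "b \<in> ball a (3 / 2 * R)"
      have sub: "cball b (\<delta> n) \<subseteq> cball a t"
      proof
        fix y assume "y \<in> cball b (\<delta> n)"
        then show "y \<in> cball a t" using b \<delta>(2)[of n] R(2) dist_triangle[of a y b] by simp
      qed
      have zero: "wirt (wirt_bar (\<lambda>z. of_real (bump 0 (\<delta> n) b z))) \<zeta> = 0" if "\<zeta> \<notin> cball a t" for \<zeta>
      proof -
        have "\<zeta> \<notin> cball b (\<delta> n)" using sub that by blast
        then have "cmod (\<zeta> - b) \<ge> \<delta> n" by (simp add: dist_norm norm_minus_commute)
        then show ?thesis unfolding wirt_laplace_bump using bump_eq_0[OF _ \<delta>(1)] by simp
      qed
      have "(LINT \<zeta>|lborel. U \<zeta> * wirt (wirt_bar (\<lambda>z. of_real (bump 0 (\<delta> n) b z))) \<zeta>)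
          = (LINT z:D|lborel. u z * wirt (wirt_bar (\<lambda>z. of_real (bump 0 (\<delta> n) b z))) z)"
        unfolding set_lebesgue_integral_def
        by (rule Bochner_Integration.integral_cong) (use zero t(2) in \<open>auto simp: U_def extend0_def indicator_def\<close>)
      also have "\<dots> = 0"
        by (rule weak[OF test_function_bump[OF \<delta>(1)]]) (use sub t(2) in blast)
      finally show "(LINT \<zeta>|lborel. U \<zeta> * wirt (wirt_bar (\<lambda>z. of_real (bump 0 (\<delta> n) b z))) \<zeta>) = 0" .
    qed
    have unif: "uniform_limit C f u sequentially" if C: "compact C" "C \<subseteq> ball a t - {w}" for C
    proof (rule uniform_limitI)
      fix e :: real assume e: "e > 0"
      have cu: "continuous_on (ball a t - {w}) u"
        by (rule continuous_on_subset[OF cont]) (use t(2) ball_subset_cball in blast)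
      have e2: "e / 2 > 0" using e by simp
      obtain d where d: "d > 0" "\<And>b \<zeta>. b \<in> C \<Longrightarrow> cmod (\<zeta> - b) < d \<Longrightarrow> \<zeta> \<in> ball a t - {w} \<and> cmod (u \<zeta> - u b) \<le> e/2"
        by (rule uniform_nbhd[OF C open_delete[OF open_ball] cu e2]) blast
      have "\<forall>\<^sub>F n in sequentially. \<delta> n < d" using order_tendstoD(2)[OF \<delta>(3) d(1)] .
      then show "\<forall>\<^sub>F n in sequentially. \<forall>x\<in>C. dist (f n x) (u x) < e"
      proof eventually_elim
        case (elim n)
        show ?case
        proof
          fix x assume x: "x \<in> C"
          have "cmod (f n x - u x) \<le> e/2"
            unfolding f_def
          proof (rule mollify_approx[OF U \<delta>(1)])
            fix \<zeta> assume "cmod (\<zeta> - x) < \<delta> n"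
            then have "cmod (\<zeta> - x) < d" using elim by simp
            from d(2)[OF x this] show "cmod (U \<zeta> - u x) \<le> e/2" by (auto simp: U_def extend0_def)
          qed
          then show "dist (f n x) (u x) < e" using e by (simp add: dist_norm)
        qed
      qed
    qed
    have "uniform_limit (sphere a R) f u sequentially"
      by (rule unif) (use R in \<open>auto\<close>)
    then obtain g where g: "uniform_limit (cball a R) f g sequentially"
      by (rule harmonic_uniform_limit_from_sphere[OF har R(1), rotated]) (use R(1) in auto)
    have "uniform_limit (ball a R) f g sequentially" by (rule uniform_limit_on_subset[OF g]) auto
    moreover have "\<forall>\<^sub>F n in sequentially. f n harmonic_on ball a R"
      by (intro always_eventually allI harmonic_on_subset[OF har]) (use R(1) in auto)
    ultimately have "g harmonic_on ball a R" using harmonic_uniform_limit(1) R(1) by blast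
    moreover have "g z = u z" if z: "z \<in> ball a R" "z \<noteq> w" for z
    proof (rule LIMSEQ_unique)
      show "(\<lambda>n. f n z) \<longlonglongrightarrow> g z" using tendsto_uniform_limitI[OF g] z by auto
      have "uniform_limit {z} f u sequentially" by (rule unif) (use z R in auto)
      then show "(\<lambda>n. f n z) \<longlonglongrightarrow> u z" by (rule tendsto_uniform_limitI) simp
    qed
    moreover have "ball a R \<subseteq> D" by (rule order_trans[OF _ t(2)]) (use R(1,2) in auto)
    ultimately show ?thesis using R(1,4) by (intro exI[of _ g] exI[of _ R]) simp
  qed
  show ?thesis
  proof (cases "w \<in> D")
    case True
    obtain g R where g: "R > 0" "ball w R \<subseteq> D" "g harmonic_on ball w R" "\<And>z. z \<in> ball w R \<Longrightarrow> z \<noteq> w \<Longrightarrow> g z = u z"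
      using local[OF True] by blast
    \<comment> \<open>Only the value at \<open>w\<close> is replaced, by that of the harmonic
      extension.\<close>
    define h where "h z = (if z = w then g w else u z)" for z
    have "h harmonic_on D"
    proof (rule harmonic_on_open_cover)
      fix a assume a: "a \<in> D"
      show "\<exists>T. open T \<and> a \<in> T \<and> h harmonic_on T"
      proof (cases "a = w")
        case True
        have "h harmonic_on ball w R"
          by (rule harmonic_on_transform[OF g(3)]) (use g in \<open>auto simp: h_def\<close>)
        then show ?thesis using True g(1) by (intro exI[of _ "ball w R"]) auto
      next
        case False
        obtain g' R' where g': "R' > 0" "w \<notin> ball a R'" "g' harmonic_on ball a R'" "\<And>z. z \<in> ball a R' \<Longrightarrow> z \<noteq> w \<Longrightarrow> g' z = u z"
          using local[OF a] False by blast
        have "h harmonic_on ball a R'"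
          by (rule harmonic_on_transform[OF g'(3)]) (use g'(2,4) in \<open>auto simp: h_def\<close>)
        then show ?thesis using g'(1) by (intro exI[of _ "ball a R'"]) auto
      qed
    qed
    then show ?thesis using that[of h] by (auto simp: h_def)
  next
    case False
    have "u harmonic_on D"
    proof (rule harmonic_on_open_cover)
      fix a assume a: "a \<in> D"
      obtain g' R' where g': "R' > 0" "w \<notin> ball a R'" "g' harmonic_on ball a R'" "\<And>z. z \<in> ball a R' \<Longrightarrow> z \<noteq> w \<Longrightarrow> g' z = u z"
        using local[OF a] False a by blast
      have "u harmonic_on ball a R'"
        by (rule harmonic_on_transform[OF g'(3)]) (use g'(2,4) in auto)
      then show "\<exists>T. open T \<and> a \<in> T \<and> u harmonic_on T" using g'(1) by (intro exI[of _ "ball a R'"]) auto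
    qed
    then show ?thesis using that[of u] by blast
  qed
qed

section \<open>The Dirichlet problem with a parameter\<close>

text \<open>A relation instead of a solution operator, because solvability is established for
  particular data only; \<open>dirichlet_bound\<close> gives uniqueness and continuous
  dependence.\<close>

definition dirichlet :: "complex set \<Rightarrow> (complex \<Rightarrow> complex) \<Rightarrow> (complex \<Rightarrow> complex) \<Rightarrow> bool" where
  "dirichlet D b u \<longleftrightarrow> continuous_on (closure D) u \<and> u harmonic_on D \<and> (\<forall>z\<in>frontier D. u z = b z)"

lemma dirichlet_bound:
  assumes D: "open D" "bounded D" and u: "dirichlet D b u" "dirichlet D c v"
    and le: "\<And>z. z \<in> frontier D \<Longrightarrow> cmod (b z - c z) \<le> M" and z: "z \<in> closure D"
  shows "cmod (u z - v z) \<le> M"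
proof (rule harmonic_max_principle[OF D _ _ _ z, of "\<lambda>z. u z - v z"])
  show "continuous_on (closure D) (\<lambda>z. u z - v z)" using u unfolding dirichlet_def by (intro continuous_intros) auto
  show "(\<lambda>z. u z - v z) harmonic_on D" using u unfolding dirichlet_def by (intro harmonic_on_diff) auto
  show "\<And>z. z \<in> frontier D \<Longrightarrow> cmod (u z - v z) \<le> M" using u le unfolding dirichlet_def by auto
qed

lemma dirichlet_add: "dirichlet D b u \<Longrightarrow> dirichlet D c v \<Longrightarrow> dirichlet D (\<lambda>z. b z + c z) (\<lambda>z. u z + v z)"
  unfolding dirichlet_def by (auto intro!: continuous_intros harmonic_on_add)

lemma dirichlet_cmult: "dirichlet D b u \<Longrightarrow> dirichlet D (\<lambda>z. k * b z) (\<lambda>z. k * u z)"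
  unfolding dirichlet_def by (auto intro!: continuous_intros harmonic_on_cmult)

lemma dirichlet_diff: "dirichlet D b u \<Longrightarrow> dirichlet D c v \<Longrightarrow> dirichlet D (\<lambda>z. b z - c z) (\<lambda>z. u z - v z)"
  unfolding dirichlet_def by (auto intro!: continuous_intros harmonic_on_diff)

text \<open>By the maximum principle, uniform convergence of the data on the frontier makes the
  solutions uniformly Cauchy on \<open>closure D\<close>. Solutions for differentiated data arise in
  this way.\<close>

lemma dirichlet_limit:
  assumes D: "open D" "bounded D" and u: "\<And>n. dirichlet D (b n) (u n)"
    and ul: "uniform_limit (frontier D) b \<beta> sequentially"
  obtains v where "dirichlet D \<beta> v"
proof -
  have "uniformly_Cauchy_on (closure D) u"
    unfolding uniformly_Cauchy_on_def
  proof (intro allI impI)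
    fix e :: real assume e: "e > 0"
    then have e4: "e / 4 > 0" by simp
    obtain N where N: "\<And>n z. n \<ge> N \<Longrightarrow> z \<in> frontier D \<Longrightarrow> dist (b n z) (\<beta> z) < e / 4"
      using uniform_limitD[OF ul e4] unfolding eventually_sequentially by blast
    have "dist (u m x) (u n x) < e" if x: "x \<in> closure D" and mn: "m \<ge> N" "n \<ge> N" for x m n
    proof -
      have "cmod (u m x - u n x) \<le> e / 2"
      proof (rule dirichlet_bound[OF D u u _ x])
        fix z assume z: "z \<in> frontier D"
        show "cmod (b m z - b n z) \<le> e / 2"
          using N[OF mn(1) z] N[OF mn(2) z] dist_triangle2[of "b m z" "b n z" "\<beta> z"] by (simp add: dist_norm)
      qed
      then show ?thesis using e by (simp add: dist_norm)
    qed
    then show "\<exists>M. \<forall>x\<in>closure D. \<forall>m\<ge>M. \<forall>n\<ge>M. dist (u m x) (u n x) < e" by blast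
  qed
  then obtain v where v: "uniform_limit (closure D) u v sequentially"
    using Cauchy_uniformly_convergent unfolding uniformly_convergent_on_def by blast
  have "continuous_on (closure D) v"
    by (rule uniform_limit_theorem[OF _ v]) (use u in \<open>auto simp: dirichlet_def\<close>)
  moreover have "v harmonic_on D"
  proof (rule harmonic_on_open_cover)
    fix a assume "a \<in> D"
    then obtain r where r: "r > 0" "ball a r \<subseteq> D" using D open_contains_ball by blast
    have "v harmonic_on ball a r"
    proof (rule harmonic_uniform_limit(1)[OF _ r(1)])
      show "\<forall>\<^sub>F n in sequentially. u n harmonic_on ball a r"
        using u harmonic_on_subset[OF _ r(2)] unfolding dirichlet_def by (intro always_eventually) blast
      show "uniform_limit (ball a r) u v sequentially"
        by (rule uniform_limit_on_subset[OF v]) (use r(2) closure_subset in blast)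
    qed
    then show "\<exists>T. open T \<and> a \<in> T \<and> v harmonic_on T" using r(1) by (intro exI[of _ "ball a r"]) simp
  qed
  moreover have "v z = \<beta> z" if z: "z \<in> frontier D" for z
  proof (rule LIMSEQ_unique)
    have "z \<in> closure D" using z by (simp add: frontier_def)
    then have "(\<lambda>n. u n z) \<longlonglongrightarrow> v z" by (rule tendsto_uniform_limitI[OF v])
    then show "(\<lambda>n. b n z) \<longlonglongrightarrow> v z" using u z by (simp add: dirichlet_def)
    show "(\<lambda>n. b n z) \<longlonglongrightarrow> \<beta> z" by (rule tendsto_uniform_limitI[OF ul z])
  qed
  ultimately show ?thesis using that[of v] unfolding dirichlet_def by blast
qed

section \<open>Differentiability of Dirichlet solutions in a parameter of the data\<close>

lemma dirichlet_directional:
  assumes D: "open D" "bounded D" and V: "open V" "w \<in> V"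
    and S: "\<And>w. w \<in> V \<Longrightarrow> dirichlet D (b w) (S w)"
    and der: "\<And>e. e > 0 \<Longrightarrow> \<exists>d>0. \<forall>v. cmod v < d \<longrightarrow> (\<forall>z\<in>frontier D.
        cmod (b (w + v) z - b w z - (v * \<alpha> z + cnj v * \<beta> z)) \<le> e * cmod v)"
    and v1: "cmod v = 1"
  obtains X where "dirichlet D (\<lambda>z. v * \<alpha> z + cnj v * \<beta> z) X"
proof -
  obtain r where r: "r > 0" "ball w r \<subseteq> V" using V open_contains_ball by blast
  define t where "t n = r / 2 * inverse (real (Suc n))" for n
  have t: "t n > 0" "t n < r" "t \<longlonglongrightarrow> 0" for n
  proof -
    show "t n > 0" using r(1) by (simp add: t_def)
    have "t n \<le> r / 2 * 1" unfolding t_def by (rule mult_left_mono) (use r(1) in \<open>auto simp: inverse_le_1_iff\<close>)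
    then show "t n < r" using r(1) by simp
    show "t \<longlonglongrightarrow> 0" using tendsto_mult[OF tendsto_const LIMSEQ_inverse_real_of_nat, of "r / 2"] by (simp add: t_def[abs_def])
  qed
  have nt: "cmod (of_real (t n) * v) = t n" for n using t(1)[of n] v1 by (simp add: norm_mult)
  have wV: "w + of_real (t n) * v \<in> V" for n using r(2) nt[of n] t(2)[of n] by (auto simp: dist_norm subset_iff norm_minus_commute)
  have q: "dirichlet D (\<lambda>z. (1 / of_real (t n)) * (b (w + of_real (t n) * v) z - b w z))
     (\<lambda>z. (1 / of_real (t n)) * (S (w + of_real (t n) * v) z - S w z))" for n
    by (intro dirichlet_cmult dirichlet_diff S wV V)
  have "uniform_limit (frontier D) (\<lambda>n z. (1 / of_real (t n)) * (b (w + of_real (t n) * v) z - b w z))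
     (\<lambda>z. v * \<alpha> z + cnj v * \<beta> z) sequentially"
  proof (rule uniform_limitI)
    fix e :: real assume e: "e > 0"
    then have e2: "e / 2 > 0" by simp
    obtain d where d: "d > 0" "\<And>v z. cmod v < d \<Longrightarrow> z \<in> frontier D \<Longrightarrow>
        cmod (b (w + v) z - b w z - (v * \<alpha> z + cnj v * \<beta> z)) \<le> e / 2 * cmod v"
      using der[OF e2] by blast
    have "\<forall>\<^sub>F n in sequentially. t n < d" using order_tendstoD(2)[OF t(3) d(1)] .
    then show "\<forall>\<^sub>F n in sequentially. \<forall>z\<in>frontier D.
       dist ((1 / of_real (t n)) * (b (w + of_real (t n) * v) z - b w z)) (v * \<alpha> z + cnj v * \<beta> z) < e"
    proof eventually_elim
      case (elim n)
      show ?case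
      proof
        fix z assume z: "z \<in> frontier D"
        let ?T = "complex_of_real (t n)"
        have T0: "?T \<noteq> 0" using t(1)[of n] by simp
        have "(1 / ?T) * (b (w + ?T * v) z - b w z) - (v * \<alpha> z + cnj v * \<beta> z)
            = (1 / ?T) * (b (w + ?T * v) z - b w z - (?T * v * \<alpha> z + cnj (?T * v) * \<beta> z))"
          using T0 by (simp add: field_simps)
        also have "cmod \<dots> = (1 / t n) * cmod (b (w + ?T * v) z - b w z - (?T * v * \<alpha> z + cnj (?T * v) * \<beta> z))"
          using t(1)[of n] by (simp only: norm_mult norm_divide norm_of_real norm_one abs_of_pos)
        also have "\<dots> \<le> (1 / t n) * (e / 2 * t n)"
          using d(2)[of "?T * v" z] nt[of n] elim z t(1)[of n] by (intro mult_left_mono) simp_all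
        also have "\<dots> < e" using t(1)[of n] e by simp
        finally show "dist ((1 / ?T) * (b (w + ?T * v) z - b w z)) (v * \<alpha> z + cnj v * \<beta> z) < e"
          by (simp only: dist_norm)
      qed
    qed
  qed
  from dirichlet_limit[OF D q this] show ?thesis using that by blast
qed

text \<open>The maximum principle bounds the remainder of the expansion on \<open>closure D\<close>
  by its values on the frontier, so differentiability of the data, uniform along the frontier,
  passes to the solutions.\<close>

lemma dirichlet_parameter_derivative:
  assumes D: "open D" "bounded D" and V: "open V" "w \<in> V"
    and S: "\<And>w. w \<in> V \<Longrightarrow> dirichlet D (b w) (S w)"
    and der: "\<And>e. e > 0 \<Longrightarrow> \<exists>d>0. \<forall>v. cmod v < d \<longrightarrow> (\<forall>z\<in>frontier D.
        cmod (b (w + v) z - b w z - (v * \<alpha> z + cnj v * \<beta> z)) \<le> e * cmod v)"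
  obtains P Q where "dirichlet D \<alpha> P" "dirichlet D \<beta> Q" "\<And>z. z \<in> closure D \<Longrightarrow> has_wirt (\<lambda>w. S w z) (P z) (Q z) w"
proof -
  obtain X where X: "dirichlet D (\<lambda>z. 1 * \<alpha> z + cnj 1 * \<beta> z) X"
    by (rule dirichlet_directional[OF D V S der, of 1]) auto
  obtain Y where Y: "dirichlet D (\<lambda>z. \<i> * \<alpha> z + cnj \<i> * \<beta> z) Y"
    by (rule dirichlet_directional[OF D V S der, of \<i>]) auto
  \<comment> \<open>The directions 1 and i have the data \<alpha> + \<beta> and i(\<alpha> -
    \<beta>); these combinations isolate \<alpha> and \<beta>.\<close>
  define P where "P z = 1/2 * (X z - \<i> * Y z)" for z
  define Q where "Q z = 1/2 * (X z + \<i> * Y z)" for z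
  have P: "dirichlet D \<alpha> P"
    using dirichlet_cmult[OF dirichlet_diff[OF X dirichlet_cmult[OF Y, of \<i>]], of "1/2"]
    unfolding P_def[abs_def] by (simp add: algebra_simps flip: mult.assoc) 
  have Q: "dirichlet D \<beta> Q"
    using dirichlet_cmult[OF dirichlet_add[OF X dirichlet_cmult[OF Y, of \<i>]], of "1/2"]
    unfolding Q_def[abs_def] by (simp add: algebra_simps flip: mult.assoc)
  have hw: "has_wirt (\<lambda>w. S w z) (P z) (Q z) w" if z: "z \<in> closure D" for z
    unfolding has_wirt_def has_derivative_at_alt
  proof (intro conjI allI impI)
    show "bounded_linear (\<lambda>v. P z * v + Q z * cnj v)"
      by (intro bounded_linear_add bounded_linear_mult_right bounded_linear_compose[OF bounded_linear_mult_right bounded_linear_cnj])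
    fix e :: real assume e: "e > 0"
    obtain d where d: "d > 0" "\<And>v z. cmod v < d \<Longrightarrow> z \<in> frontier D \<Longrightarrow>
        cmod (b (w + v) z - b w z - (v * \<alpha> z + cnj v * \<beta> z)) \<le> e * cmod v"
      using der[OF e] by blast
    obtain r where r: "r > 0" "ball w r \<subseteq> V" using V open_contains_ball by blast
    show "\<exists>d>0. \<forall>y. cmod (y - w) < d \<longrightarrow> cmod (S y z - S w z - (P z * (y - w) + Q z * cnj (y - w))) \<le> e * cmod (y - w)"
    proof (intro exI[of _ "min d r"] conjI allI impI)
      show "0 < min d r" using d r by simp
      fix y assume y: "cmod (y - w) < min d r"
      have yV: "y \<in> V" using r(2) y by (auto simp: dist_norm norm_minus_commute)
      have "cmod ((S y z - S w z) - ((y - w) * P z + cnj (y - w) * Q z)) \<le> e * cmod (y - w)"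
      proof (rule dirichlet_bound[OF D dirichlet_diff[OF S[OF yV] S[OF V(2)]]
            dirichlet_add[OF dirichlet_cmult[OF P, of "y - w"] dirichlet_cmult[OF Q, of "cnj (y - w)"]] _ z])
        fix x assume "x \<in> frontier D"
        then show "cmod (b y x - b w x - ((y - w) * \<alpha> x + cnj (y - w) * \<beta> x)) \<le> e * cmod (y - w)"
          using d(2)[of "y - w" x] y by simp
      qed
      then show "cmod (S y z - S w z - (P z * (y - w) + Q z * cnj (y - w))) \<le> e * cmod (y - w)"
        by (simp only: mult.commute)
    qed
  qed
  show ?thesis by (rule that[OF P Q hw])
qed

section \<open>Dependence of the logarithmic boundary data on the pole\<close>

lemma uniform_derivative_quotient:
  assumes "(f has_field_derivative f') (at 0)" "\<delta> > 0" "e > 0"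
  obtains d where "d > 0" "\<And>v y. cmod v < d \<Longrightarrow> cmod y \<ge> \<delta> \<Longrightarrow> cmod (f (v / y) - f 0 - f' * (v / y)) \<le> e * cmod (v / y)"
proof -
  obtain d0 where d0: "d0 > 0" "\<And>x. cmod (x - 0) < d0 \<Longrightarrow> cmod (f x - f 0 - f' * (x - 0)) \<le> e * cmod (x - 0)"
    using assms(1,3) unfolding has_field_derivative_def has_derivative_at_alt by blast
  show ?thesis
  \<comment> \<open>Since |y| is at least \<open>\<delta>\<close>, the point v / y is within
    \<open>d0\<close> of 0 for all admissible y at once.\<close>
  proof (rule that[of "d0 * \<delta>"])
    show "d0 * \<delta> > 0" using d0 assms by simp
    fix v y assume v: "cmod v < d0 * \<delta>" and y: "\<delta> \<le> cmod (y :: complex)"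
    have "cmod (v / y) < d0"
    proof -
      have "cmod v < d0 * cmod y" using v y d0(1) by (meson less_le_trans mult_left_mono less_imp_le)
      moreover have "0 < cmod y" using y assms(2) by linarith
      ultimately show ?thesis by (simp add: norm_divide pos_divide_less_eq)
    qed
    then show "cmod (f (v / y) - f 0 - f' * (v / y)) \<le> e * cmod (v / y)" using d0(2)[of "v / y"] by simp
  qed
qed

lemma frontier_distance:
  assumes "open D" "w \<in> D"
  obtains \<delta> where "\<delta> > 0" "\<And>z. z \<in> frontier D \<Longrightarrow> cmod (z - w) \<ge> \<delta>"
proof -
  obtain r where r: "r > 0" "ball w r \<subseteq> D" using assms open_contains_ball by blast
  have "cmod (z - w) \<ge> r" if "z \<in> frontier D" for z
  proof -
    have "z \<notin> D" using that assms(1) by (simp add: frontier_def interior_open)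
    then have "z \<notin> ball w r" using r(2) by blast
    then show ?thesis by (simp add: dist_norm norm_minus_commute)
  qed
  then show ?thesis using that r(1) by blast
qed

text \<open>ln |z - w - v| - ln |z - w| is the real part of Ln(1 - v / (z - w)); as \<open>w\<close>
  has positive distance from the frontier, one expansion at 0 serves all z uniformly.\<close>

lemma log_parameter_derivative:
  assumes D: "open D" "w \<in> D" and e: "e > 0"
  shows "\<exists>d>0. \<forall>v. cmod v < d \<longrightarrow> (\<forall>z\<in>frontier D.
        cmod (of_real (ln (cmod (z - (w + v)))) - of_real (ln (cmod (z - w)))
           - (v * (- 1 / (2 * (z - w))) + cnj v * (- 1 / (2 * cnj (z - w))))) \<le> e * cmod v)"
proof -
  obtain \<delta> where \<delta>: "\<delta> > 0" "\<And>z. z \<in> frontier D \<Longrightarrow> cmod (z - w) \<ge> \<delta>"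
    by (rule frontier_distance[OF D]) blast
  have L: "((\<lambda>x. Ln (1 - x)) has_field_derivative -1) (at 0)"
    by (auto intro!: derivative_eq_intros)
  have ed: "e * \<delta> > 0" using e \<delta> by simp
  obtain d where d: "d > 0" "\<And>v y. cmod v < d \<Longrightarrow> cmod y \<ge> \<delta> \<Longrightarrow> cmod (Ln (1 - v / y) - Ln (1 - 0) - -1 * (v / y)) \<le> e * \<delta> * cmod (v / y)"
    by (rule uniform_derivative_quotient[OF L \<delta>(1) ed]) blast
  show ?thesis
  proof (intro exI[of _ "min d \<delta>"] conjI allI impI ballI)
    show "min d \<delta> > 0" using d \<delta> by simp
    fix v z assume v: "cmod v < min d \<delta>" and z: "z \<in> frontier D"
    let ?y = "z - w"
    have y: "cmod ?y \<ge> \<delta>" "?y \<noteq> 0" using \<delta>(2)[OF z] \<delta>(1) by auto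
    have nz: "1 - v / ?y \<noteq> 0"
    proof
      assume "1 - v / ?y = 0"
      then have "v = ?y" using y(2) by (simp add: field_simps)
      then show False using v y(1) by simp
    qed
    have "z - (w + v) = ?y * (1 - v / ?y)" using y(2) by (simp add: field_simps)
    then have "ln (cmod (z - (w + v))) = ln (cmod ?y) + ln (cmod (1 - v / ?y))"
      using y(2) nz by (simp add: norm_mult ln_mult)
    also have "ln (cmod (1 - v / ?y)) = Re (Ln (1 - v / ?y))" using nz by simp
    finally have 1: "of_real (ln (cmod (z - (w + v)))) - of_real (ln (cmod ?y)) = complex_of_real (Re (Ln (1 - v / ?y)))" by simp
    have "v * (- 1 / (2 * ?y)) + cnj v * (- 1 / (2 * cnj ?y)) = - (1/2) * (v / ?y + cnj (v / ?y))"
      by (simp add: divide_simps) (simp add: algebra_simps)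
    also have "\<dots> = - complex_of_real (Re (v / ?y))" by (simp only: complex_add_cnj) simp
    finally have 2: "v * (- 1 / (2 * ?y)) + cnj v * (- 1 / (2 * cnj ?y)) = - complex_of_real (Re (v / ?y))" .
    have "of_real (ln (cmod (z - (w + v)))) - of_real (ln (cmod ?y)) - (v * (- 1 / (2 * ?y)) + cnj v * (- 1 / (2 * cnj ?y)))
        = complex_of_real (Re (Ln (1 - v / ?y) - Ln (1 - 0) - -1 * (v / ?y)))"
      unfolding 1 2 by simp
    also have "cmod \<dots> \<le> cmod (Ln (1 - v / ?y) - Ln (1 - 0) - -1 * (v / ?y))"
      by (simp only: norm_of_real abs_Re_le_cmod)
    also have "\<dots> \<le> e * \<delta> * cmod (v / ?y)" using d(2) v y by simp
    also have "\<dots> = e * cmod v * (\<delta> / cmod ?y)" by (simp add: norm_divide)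
    also have "\<dots> \<le> e * cmod v * 1" using y e \<delta> by (intro mult_left_mono) (simp_all add: divide_le_eq)
    finally show "cmod (of_real (ln (cmod (z - (w + v)))) - of_real (ln (cmod ?y)) - (v * (- 1 / (2 * ?y)) + cnj v * (- 1 / (2 * cnj ?y)))) \<le> e * cmod v"
      by simp
  qed
qed

lemma inverse_parameter_derivative:
  assumes D: "open D" "w \<in> D" and e: "e > 0"
  shows "\<exists>d>0. \<forall>v. cmod v < d \<longrightarrow> (\<forall>z\<in>frontier D.
        cmod (- 1 / (2 * (z - (w + v))) - - 1 / (2 * (z - w)) - v * (- 1 / (2 * (z - w)\<^sup>2))) \<le> e * cmod v)"
proof -
  obtain \<delta> where \<delta>: "\<delta> > 0" "\<And>z. z \<in> frontier D \<Longrightarrow> cmod (z - w) \<ge> \<delta>"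
    by (rule frontier_distance[OF D]) blast
  have L: "((\<lambda>x. 1 / (1 - x)) has_field_derivative 1) (at 0)"
    by (auto intro!: derivative_eq_intros)
  \<comment> \<open>One factor \<open>\<delta>\<close> compensates the 1/|y| in v / y, the other the
    prefactor 1/(2y).\<close>
  have ed: "e * \<delta>\<^sup>2 > 0" using e \<delta> by simp
  obtain d where d: "d > 0" "\<And>v y. cmod v < d \<Longrightarrow> cmod y \<ge> \<delta> \<Longrightarrow> cmod (1 / (1 - v / y) - 1 / (1 - 0) - 1 * (v / y)) \<le> e * \<delta>\<^sup>2 * cmod (v / y)"
    by (rule uniform_derivative_quotient[OF L \<delta>(1) ed]) blast
  show ?thesis
  proof (intro exI[of _ "min d \<delta>"] conjI allI impI ballI)
    show "min d \<delta> > 0" using d \<delta> by simp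
    fix v z assume v: "cmod v < min d \<delta>" and z: "z \<in> frontier D"
    define y where "y = z - w"
    have y: "cmod y \<ge> \<delta>" "y \<noteq> 0" using \<delta>(2)[OF z] \<delta>(1) by (auto simp: y_def)
    have nz: "y - v \<noteq> 0" using v y(1) by auto
    have e1: "1 - v / y = (y - v) / y" using y(2) by (simp add: field_simps)
    have "- 1 / (2 * (y - v)) - - 1 / (2 * y) - v * (- 1 / (2 * y\<^sup>2))
        = - (1 / (2 * y)) * (1 / (1 - v / y) - 1 / (1 - 0) - 1 * (v / y))"
      unfolding e1 using y(2) nz by (simp add: divide_simps power2_eq_square) (simp add: algebra_simps)
    then have "cmod (- 1 / (2 * (y - v)) - - 1 / (2 * y) - v * (- 1 / (2 * y\<^sup>2)))
        = (1 / (2 * cmod y)) * cmod (1 / (1 - v / y) - 1 / (1 - 0) - 1 * (v / y))"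
      by (simp only: norm_mult norm_minus_cancel norm_divide norm_one norm_numeral)
    also have "\<dots> \<le> (1 / (2 * cmod y)) * (e * \<delta>\<^sup>2 * cmod (v / y))"
      using d(2)[of v y] v y by (intro mult_left_mono) simp_all
    also have "\<dots> = e * cmod v * ((\<delta> / cmod y)\<^sup>2 / 2)" using y by (simp add: norm_divide power2_eq_square ac_simps)
    also have "\<dots> \<le> e * cmod v * 1"
    proof (rule mult_left_mono)
      have "(\<delta> / cmod y)\<^sup>2 \<le> 1" by (rule power_le_one) (use y \<delta> in \<open>auto simp: divide_le_eq\<close>)
      then show "(\<delta> / cmod y)\<^sup>2 / 2 \<le> 1" by simp
    qed (use e in simp)
    finally show "cmod (- 1 / (2 * (z - (w + v))) - - 1 / (2 * (z - w)) - v * (- 1 / (2 * (z - w)\<^sup>2))) \<le> e * cmod v"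
      by (simp add: y_def diff_diff_eq)
  qed
qed

text \<open>The data of the two first derivatives are holomorphic and antiholomorphic in
  \<open>w\<close>. Their derivatives of the other type therefore solve the Dirichlet problem with
  zero data and vanish, which is harmonicity in the pole.\<close>

theorem log_potential_parameter:
  assumes D: "open D" "bounded D"
    and h: "\<And>w. w \<in> D \<Longrightarrow> dirichlet D (\<lambda>z. of_real (ln (cmod (z - w)))) (h w)"
  shows "\<And>z. z \<in> closure D \<Longrightarrow> (\<lambda>w. h w z) harmonic_on D"
    and "\<And>w. w \<in> D \<Longrightarrow> dirichlet D (\<lambda>z. - 1 / (2 * cnj (z - w))) (\<lambda>z. wirt_bar (\<lambda>w. h w z) w)"
proof -
  have "\<exists>P Q. dirichlet D (\<lambda>z. - 1 / (2 * (z - w))) P \<and> dirichlet D (\<lambda>z. - 1 / (2 * cnj (z - w))) Q \<and>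
       (\<forall>z\<in>closure D. has_wirt (\<lambda>w. h w z) (P z) (Q z) w)" if w: "w \<in> D" for w
    by (rule dirichlet_parameter_derivative[OF D D(1) w h log_parameter_derivative[OF D(1) w]]) blast+
  then obtain P Q where PQ: "\<And>w. w \<in> D \<Longrightarrow> dirichlet D (\<lambda>z. - 1 / (2 * (z - w))) (P w)"
    "\<And>w. w \<in> D \<Longrightarrow> dirichlet D (\<lambda>z. - 1 / (2 * cnj (z - w))) (Q w)"
    "\<And>w z. w \<in> D \<Longrightarrow> z \<in> closure D \<Longrightarrow> has_wirt (\<lambda>w. h w z) (P w z) (Q w z) w" by metis
  have derP: "\<exists>d>0. \<forall>v. cmod v < d \<longrightarrow> (\<forall>z\<in>frontier D.
        cmod (- 1 / (2 * (z - (w + v))) - - 1 / (2 * (z - w)) - (v * (- 1 / (2 * (z - w)\<^sup>2)) + cnj v * 0)) \<le> e * cmod v)"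
    if "w \<in> D" "e > 0" for w e using inverse_parameter_derivative[OF D(1) that] by simp
  have derQ: "\<exists>d>0. \<forall>v. cmod v < d \<longrightarrow> (\<forall>z\<in>frontier D.
        cmod (- 1 / (2 * cnj (z - (w + v))) - - 1 / (2 * cnj (z - w)) - (v * 0 + cnj v * (- 1 / (2 * (cnj (z - w))\<^sup>2)))) \<le> e * cmod v)"
    if w: "w \<in> D" "e > 0" for w e
  proof -
    have "cmod (- 1 / (2 * cnj (z - (w + v))) - - 1 / (2 * cnj (z - w)) - (v * 0 + cnj v * (- 1 / (2 * (cnj (z - w))\<^sup>2))))
      = cmod (- 1 / (2 * (z - (w + v))) - - 1 / (2 * (z - w)) - v * (- 1 / (2 * (z - w)\<^sup>2)))" for v z
    proof -
      have "- 1 / (2 * cnj (z - (w + v))) - - 1 / (2 * cnj (z - w)) - (v * 0 + cnj v * (- 1 / (2 * (cnj (z - w))\<^sup>2)))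
       = cnj (- 1 / (2 * (z - (w + v))) - - 1 / (2 * (z - w)) - v * (- 1 / (2 * (z - w)\<^sup>2)))" by simp
      then show ?thesis by (simp only: complex_mod_cnj)
    qed
    then show ?thesis using inverse_parameter_derivative[OF D(1) w] by simp
  qed
  have P2: "\<exists>a. has_wirt (\<lambda>w. P w z) a 0 w" if w: "w \<in> D" and z: "z \<in> closure D" for w z
  proof -
    obtain A B where AB: "dirichlet D (\<lambda>z. 0) B" "\<And>z. z \<in> closure D \<Longrightarrow> has_wirt (\<lambda>w. P w z) (A z) (B z) w"
      by (rule dirichlet_parameter_derivative[OF D D(1) w PQ(1) derP[OF w]]) blast+
    have "dirichlet D (\<lambda>z. 0) (\<lambda>z. 0)" using dirichlet_cmult[OF AB(1), of 0] by simp
    then have "cmod (B z - 0) \<le> 0" by (rule dirichlet_bound[OF D AB(1) _ _ z]) simp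
    then show ?thesis using AB(2)[OF z] by auto
  qed
  have Q2: "\<exists>b. has_wirt (\<lambda>w. Q w z) 0 b w" if w: "w \<in> D" and z: "z \<in> closure D" for w z
  proof -
    obtain A B where AB: "dirichlet D (\<lambda>z. 0) A" "\<And>z. z \<in> closure D \<Longrightarrow> has_wirt (\<lambda>w. Q w z) (A z) (B z) w"
      by (rule dirichlet_parameter_derivative[OF D D(1) w PQ(2) derQ[OF w]]) blast+
    have "dirichlet D (\<lambda>z. 0) (\<lambda>z. 0)" using dirichlet_cmult[OF AB(1), of 0] by simp
    then have "cmod (A z - 0) \<le> 0" by (rule dirichlet_bound[OF D AB(1) _ _ z]) simp
    then show ?thesis using AB(2)[OF z] by auto
  qed
  show "(\<lambda>w. h w z) harmonic_on D" if z: "z \<in> closure D" for z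
  proof (rule harmonic_onI[OF PQ(3)[OF _ z]])
    show "(\<lambda>w. P w z) holomorphic_on D"
      unfolding holomorphic_on_def field_differentiable_def
      using P2[OF _ z] has_wirt_field_derivative_iff has_field_derivative_at_within by blast
    have "\<exists>a. has_wirt (\<lambda>w. cnj (Q w z)) a 0 w" if "w \<in> D" for w
      using Q2[OF that z] has_wirt_cnj by (metis complex_cnj_zero)
    then show "(\<lambda>w. cnj (Q w z)) holomorphic_on D"
      unfolding holomorphic_on_def field_differentiable_def
      using has_wirt_field_derivative_iff has_field_derivative_at_within by blast
  qed
  show "dirichlet D (\<lambda>z. - 1 / (2 * cnj (z - w))) (\<lambda>z. wirt_bar (\<lambda>w. h w z) w)" if w: "w \<in> D" for w
  proof -
    have e: "wirt_bar (\<lambda>w. h w z) w = Q w z" if "z \<in> closure D" for z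
      using has_wirt_unique(2)[OF PQ(3)[OF w that]] .
    have "D \<subseteq> closure D" "frontier D \<subseteq> closure D" by (auto simp: closure_subset frontier_def)
    then show ?thesis using PQ(2)[OF w] D(1) unfolding dirichlet_def
      by (auto cong: continuous_on_cong simp: e subset_iff intro: harmonic_on_transform[of "Q w"])
  qed
qed

section \<open>Reduction of the weighted Green's function to the logarithmic potential\<close>

lemma set_integrable_ln_cmod:
  assumes S: "compact S"
  shows "set_integrable lborel S (\<lambda>z. complex_of_real (ln (cmod (z - w))))"
proof -
  have [measurable]: "S \<in> sets borel" using S by (simp add: borel_closed compact_imp_closed)
  obtain R where R: "\<And>z. z \<in> S \<Longrightarrow> cmod z \<le> R" using compact_imp_bounded[OF S] unfolding bounded_iff by blast
  have 1: "integrable lborel (\<lambda>z. cmod (complex_of_real (indicator S z)) / cmod (z - w))"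
  proof (rule integrable_div_cmod)
    show "complex_of_real (indicator S z) = 0" if "cmod z > R" for z using R that by (force simp: indicator_def)
    show "cmod (complex_of_real (indicator S z)) \<le> 1" for z by (simp add: indicator_def)
  qed measurable
  have 2: "integrable lborel (\<lambda>z. indicator S z *\<^sub>R ((cmod (z - w))\<^sup>2 + 1))"
    by (intro borel_integrable_compact[OF S] continuous_intros)
  show ?thesis unfolding set_integrable_def
  proof (rule Bochner_Integration.integrable_bound[OF Bochner_Integration.integrable_add[OF 1 2]])
    show "AE z in lborel. norm (indicat_real S z *\<^sub>R complex_of_real (ln (cmod (z - w))))
       \<le> norm (cmod (complex_of_real (indicator S z)) / cmod (z - w) + indicator S z *\<^sub>R ((cmod (z - w))\<^sup>2 + 1))"
      using AE_lborel_singleton[of w]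
    proof eventually_elim
      case (elim z)
      have "\<bar>ln (cmod (z - w))\<bar> \<le> 1 / cmod (z - w) + ((cmod (z - w))\<^sup>2 + 1)"
        using abs_ln_le(2)[of "cmod (z - w)" 0] elim by simp
      then show ?case by (auto simp: indicator_def)
    qed
  qed measurable
qed

lemma C1_compactI:
  assumes "\<And>k. C_diff k F" "\<And>z. z \<notin> K \<Longrightarrow> F z = 0" "compact K"
  shows "C1_compact F (wirt F) (wirt_bar F)"
proof -
  obtain R where "\<And>z. z \<in> K \<Longrightarrow> cmod z \<le> R" using compact_imp_bounded[OF assms(3)] unfolding bounded_iff by blast
  then have "\<forall>z. cmod z > R \<longrightarrow> F z = 0" using assms(2) by force
  then show ?thesis
    unfolding C1_compact_def using assms(1) C_diff_has_wirt C_diff_continuous[OF C_diff_wirt(1)] C_diff_continuous[OF C_diff_wirt(2)]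
    by blast
qed

lemma test_function_support:
  assumes "test_function D \<psi>"
  obtains K where "compact K" "K \<subseteq> D" "\<And>k. C_diff k \<psi>" "\<And>z. z \<notin> K \<Longrightarrow> \<psi> z = 0"
    "\<And>z. z \<notin> K \<Longrightarrow> wirt_bar \<psi> z = 0" "\<And>z. z \<notin> K \<Longrightarrow> wirt (wirt_bar \<psi>) z = 0"
    "C1_compact \<psi> (wirt \<psi>) (wirt_bar \<psi>)"
    "C1_compact (wirt_bar \<psi>) (wirt (wirt_bar \<psi>)) (wirt_bar (wirt_bar \<psi>))"
proof -
  define K where "K = closure {z. \<psi> z \<noteq> 0}"
  have K: "compact K" "K \<subseteq> D" and C: "\<And>k. C_diff k \<psi>" using assms unfolding test_function_def K_def by auto
  have o: "open (- K)" unfolding K_def by (simp add: open_Compl)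
  have z: "\<psi> z = 0" if "z \<notin> K" for z using that closure_subset[of "{z. \<psi> z \<noteq> 0}"] unfolding K_def by blast
  have zb: "wirt_bar \<psi> z = 0" if "z \<notin> K" for z
    using has_wirt_zero_on_open(2)[OF C_diff_has_wirt o, of \<psi> z] C z that by auto
  have Cb: "C_diff k (wirt_bar \<psi>)" for k by (rule C_diff_wirt) (use C in blast)
  have zbb: "wirt (wirt_bar \<psi>) z = 0" if "z \<notin> K" for z
    using has_wirt_zero_on_open(1)[OF C_diff_has_wirt o, of "wirt_bar \<psi>" z] Cb zb that by auto
  show ?thesis
    by (rule that[OF K C z zb zbb C1_compactI[OF C z K(1)] C1_compactI[OF Cb zb K(1)]])
qed

lemma log_weak_solution:
  assumes w: "w \<in> D" and t: "test_function D \<psi>"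
  shows "(LINT z:D|lborel. of_real (ln (cmod (z - w))) * wirt (wirt_bar \<psi>) z) = of_real (pi / 2) * \<psi> w"
    and "set_integrable lborel D (\<lambda>z. of_real (ln (cmod (z - w))) * wirt (wirt_bar \<psi>) z)"
proof -
  obtain K where K: "compact K" "K \<subseteq> D" "\<And>z. z \<notin> K \<Longrightarrow> wirt (wirt_bar \<psi>) z = 0"
    "C1_compact \<psi> (wirt \<psi>) (wirt_bar \<psi>)"
    "C1_compact (wirt_bar \<psi>) (wirt (wirt_bar \<psi>)) (wirt_bar (wirt_bar \<psi>))"
    by (rule test_function_support[OF t]) blast
  have e: "extend0 D (\<lambda>z. of_real (ln (cmod (z - w))) * wirt (wirt_bar \<psi>) z) = (\<lambda>z. of_real (ln (cmod (z - w))) * wirt (wirt_bar \<psi>) z)"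
    using K(2,3) by (auto simp: extend0_def fun_eq_iff)
  show "(LINT z:D|lborel. of_real (ln (cmod (z - w))) * wirt (wirt_bar \<psi>) z) = of_real (pi / 2) * \<psi> w"
    "set_integrable lborel D (\<lambda>z. of_real (ln (cmod (z - w))) * wirt (wirt_bar \<psi>) z)"
    unfolding set_lint_extend0 set_integrable_extend0 e using log_fundamental_solution[OF K(4,5)] by auto
qed

lemma set_integrable_mult_continuous:
  fixes f g :: "complex \<Rightarrow> complex"
  assumes f: "set_integrable lborel K f" and K: "compact K" and g: "continuous_on K g"
  shows "set_integrable lborel K (\<lambda>z. f z * g z)"
proof -
  have [measurable]: "K \<in> sets borel" using K by (simp add: borel_closed compact_imp_closed)
  have mg [measurable]: "(\<lambda>z. indicator K z *\<^sub>R g z) \<in> borel_measurable borel"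
    by (intro borel_measurable_continuous_on_indicator g) measurable
  have mf [measurable]: "(\<lambda>z. indicator K z *\<^sub>R f z) \<in> borel_measurable lborel"
    using f unfolding set_integrable_def by auto
  obtain M where M: "\<And>z. z \<in> K \<Longrightarrow> cmod (g z) \<le> M"
    using compact_imp_bounded[OF compact_continuous_image[OF g K]] unfolding bounded_iff by blast
  have eq: "indicator K z *\<^sub>R (f z * g z) = (indicator K z *\<^sub>R f z) * (indicator K z *\<^sub>R g z)" for z
    by (simp add: indicator_def)
  show ?thesis unfolding set_integrable_def
  proof (rule Bochner_Integration.integrable_bound[OF integrable_mult_right[OF integrable_norm[OF f[unfolded set_integrable_def]], of M]])
    show "(\<lambda>z. indicat_real K z *\<^sub>R (f z * g z)) \<in> borel_measurable lborel" unfolding eq by measurable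
    show "AE z in lborel. norm (indicat_real K z *\<^sub>R (f z * g z)) \<le> norm (M * norm (indicat_real K z *\<^sub>R f z))"
    proof (rule AE_I2)
      fix z
      show "norm (indicat_real K z *\<^sub>R (f z * g z)) \<le> norm (M * norm (indicat_real K z *\<^sub>R f z))"
      proof (cases "z \<in> K")
        case True
        have "cmod (f z * g z) \<le> M * cmod (f z)"
          using mult_right_mono[OF M[OF True], of "cmod (f z)"] by (simp add: norm_mult mult.commute)
        then show ?thesis using True abs_ge_self[of "M * cmod (f z)"] by simp
      qed simp
    qed
  qed
qed

lemma set_integrable_superset_support:
  fixes K :: "complex set"
  assumes "set_integrable lborel K f" "K \<subseteq> D" "\<And>z. z \<notin> K \<Longrightarrow> f z = (0::complex)"
  shows "set_integrable lborel D f"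
proof -
  have "extend0 K f = extend0 D f" using assms(2,3) by (auto simp: extend0_def fun_eq_iff)
  then show ?thesis using assms(1) by (simp add: set_integrable_extend0)
qed

text \<open>Test the defining equation with \<open>\<phi>\<close> = \<open>\<mu>\<close> times
  \<open>\<psi>\<close>. As \<open>\<mu>\<close> is holomorphic, the z-bar derivative of
  \<open>\<phi>\<close> divided by \<open>\<rho>\<close> is that of \<open>\<psi>\<close> divided by
  \<open>cnj \<mu>\<close>, and d/dz passes through this antiholomorphic factor. So \<open>G\<close>
  divided by \<open>cnj (\<mu> z) * \<mu> w\<close> has the weak Laplacian of -ln |z - w|.\<close>

theorem green_function_decomposition:
  assumes D: "open D" "bounded D" and U: "open U" "closure D \<subseteq> U"
    and \<mu>: "\<mu> holomorphic_on U" "\<And>z. z \<in> closure D \<Longrightarrow> \<mu> z \<noteq> 0"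
    and \<rho>: "\<rho> = (\<lambda>z. (cmod (\<mu> z))\<^sup>2)"
    and G: "green_function_on_jordan_domain D \<rho> G" and w: "w \<in> D"
  obtains h where "dirichlet D (\<lambda>z. of_real (ln (cmod (z - w)))) h"
    "\<And>z. z \<in> D \<Longrightarrow> z \<noteq> w \<Longrightarrow> G z w = cnj (\<mu> z) * \<mu> w * (h z - of_real (ln (cmod (z - w))))"
proof -
  let ?l = "\<lambda>z. complex_of_real (ln (cmod (z - w)))"
  have Dc: "D \<subseteq> closure D" by (rule closure_subset)
  have \<mu>D: "\<mu> holomorphic_on D" using \<mu>(1) U(2) Dc by (meson holomorphic_on_subset order_trans)
  have \<mu>0: "\<mu> z \<noteq> 0" if "z \<in> D" for z using \<mu>(2) Dc that by blast
  have c\<mu>: "continuous_on (closure D) \<mu>"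
    using holomorphic_on_imp_continuous_on[OF \<mu>(1)] U(2) continuous_on_subset by blast
  have Gc: "continuous_on (closure D - {w}) (\<lambda>z. G z w)" and Gz: "\<And>z. z \<in> frontier D \<Longrightarrow> G z w = 0"
    and Gi: "\<And>S. compact S \<Longrightarrow> S \<subseteq> D \<Longrightarrow> set_integrable lborel S (\<lambda>z. G z w)"
    and Gw: "\<And>\<phi>. test_function D \<phi> \<Longrightarrow>
       (LINT z:D|lborel. G z w * wirt (\<lambda>\<zeta>. wirt_bar \<phi> \<zeta> / complex_of_real (\<rho> \<zeta>)) z) = - (complex_of_real pi / 2) * \<phi> w"
    using G w unfolding green_function_on_jordan_domain_def by blast+
  have w0: "\<mu> w \<noteq> 0" using \<mu>0 w by blast
  define g where "g z = G z w * (1 / (cnj (\<mu> z) * \<mu> w))" for z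
  \<comment> \<open>The point mass -pi/2 of \<open>g\<close> and the point mass pi/2 of the
    logarithm cancel.\<close>
  define u where "u z = g z + ?l z" for z
  have cinv: "continuous_on (closure D) (\<lambda>z. 1 / (cnj (\<mu> z) * \<mu> w))"
    by (intro continuous_intros c\<mu>) (use \<mu>(2) w0 in auto)
  have gi: "set_integrable lborel S g" if S: "compact S" "S \<subseteq> D" for S
    unfolding g_def using set_integrable_mult_continuous[OF Gi[OF S] S(1) continuous_on_subset[OF cinv]] S(2) Dc by blast
  have uc: "continuous_on (closure D - {w}) u"
    unfolding u_def g_def
  proof (intro continuous_on_add continuous_on_mult Gc continuous_on_of_real)
    show "continuous_on (closure D - {w}) (\<lambda>z. 1 / (cnj (\<mu> z) * \<mu> w))" by (rule continuous_on_subset[OF cinv]) auto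
    show "continuous_on (closure D - {w}) (\<lambda>x. ln (cmod (x - w)))" by (intro continuous_intros) auto
  qed
  obtain h0 where h0: "h0 harmonic_on D" "\<And>z. z \<in> D \<Longrightarrow> z \<noteq> w \<Longrightarrow> h0 z = u z"
  proof (rule Weyl_lemma[OF D(1), of u w])
    show "set_integrable lborel S u" if S: "compact S" "S \<subseteq> D" for S
      unfolding u_def[abs_def] by (rule set_integral_add(1)[OF gi[OF S] set_integrable_ln_cmod[OF S(1)]])
    show "continuous_on (D - {w}) u" by (rule continuous_on_subset[OF uc]) (use Dc in auto)
    fix \<psi> assume t: "test_function D \<psi>"
    obtain K where K: "compact K" "K \<subseteq> D" "\<And>k. C_diff k \<psi>" "\<And>z. z \<notin> K \<Longrightarrow> \<psi> z = 0"
      "\<And>z. z \<notin> K \<Longrightarrow> wirt (wirt_bar \<psi>) z = 0" "C1_compact \<psi> (wirt \<psi>) (wirt_bar \<psi>)"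
      "C1_compact (wirt_bar \<psi>) (wirt (wirt_bar \<psi>)) (wirt_bar (wirt_bar \<psi>))"
      by (rule test_function_support[OF t]) blast
    define \<phi> where "\<phi> z = \<mu> z * \<psi> z" for z
    have "C_diff k \<phi>" for k unfolding \<phi>_def by (rule C_diff_holomorphic_mult[OF D(1) K(1,2) \<mu>D K(3,4)])
    then have t\<phi>: "test_function D \<phi>" by (rule test_functionI[OF _ _ K(1,2)]) (simp add: \<phi>_def K(4))
    have w\<psi>: "has_wirt \<psi> (wirt \<psi> z) (wirt_bar \<psi> z) z" "has_wirt (wirt_bar \<psi>) (wirt (wirt_bar \<psi>) z) (wirt_bar (wirt_bar \<psi>) z) z" for z
      using K(6,7) unfolding C1_compact_def by auto
    have 1: "wirt_bar \<phi> z / of_real (\<rho> z) = wirt_bar \<psi> z * (1 / cnj (\<mu> z))" if z: "z \<in> D" for z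
    proof -
      have "has_wirt \<phi> (deriv \<mu> z * \<psi> z + \<mu> z * wirt \<psi> z) (0 * \<psi> z + \<mu> z * wirt_bar \<psi> z) z"
        unfolding \<phi>_def by (rule has_wirt_mult[OF has_wirt_holomorphic[OF \<mu>D D(1) z] w\<psi>(1)])
      from has_wirt_unique(2)[OF this] show ?thesis using \<mu>0[OF z] by (simp add: \<rho> of_real_cmod_power2)
    qed
    have 2: "wirt (\<lambda>\<zeta>. wirt_bar \<phi> \<zeta> / of_real (\<rho> \<zeta>)) z = wirt (wirt_bar \<psi>) z * (1 / cnj (\<mu> z))" if z: "z \<in> D" for z
    proof -
      have "(\<lambda>z. 1 / \<mu> z) holomorphic_on D" using \<mu>0 by (intro holomorphic_intros \<mu>D) auto
      from has_wirt_cnj[OF has_wirt_holomorphic[OF this D(1) z]]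
      have "has_wirt (\<lambda>z. 1 / cnj (\<mu> z)) 0 (cnj (deriv (\<lambda>z. 1 / \<mu> z) z)) z" by simp
      from has_wirt_transform[OF has_wirt_mult[OF w\<psi>(2) this] D(1) z 1[symmetric]]
      show ?thesis using has_wirt_unique(1) by fastforce
    qed
    have "(LINT z:D|lborel. G z w * wirt (\<lambda>\<zeta>. wirt_bar \<phi> \<zeta> / of_real (\<rho> \<zeta>)) z)
        = (LINT z:D|lborel. \<mu> w * (g z * wirt (wirt_bar \<psi>) z))"
    proof (rule set_lebesgue_integral_cong)
      show "D \<in> sets lborel" using D(1) by simp
      show "\<forall>z. z \<in> D \<longrightarrow> G z w * wirt (\<lambda>\<zeta>. wirt_bar \<phi> \<zeta> / of_real (\<rho> \<zeta>)) z = \<mu> w * (g z * wirt (wirt_bar \<psi>) z)"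
        using w0 by (auto simp: 2 g_def)
    qed
    also have "\<dots> = \<mu> w * (LINT z:D|lborel. g z * wirt (wirt_bar \<psi>) z)" by simp
    finally have "\<mu> w * (LINT z:D|lborel. g z * wirt (wirt_bar \<psi>) z) = \<mu> w * (- (of_real pi / 2) * \<psi> w)"
      using Gw[OF t\<phi>] unfolding \<phi>_def by (simp only: mult.left_commute[of "\<mu> w"])
    then have i1: "(LINT z:D|lborel. g z * wirt (wirt_bar \<psi>) z) = - (of_real pi / 2) * \<psi> w" using w0 by (simp only: mult_cancel_left simp_thms)
    have "set_integrable lborel K (\<lambda>z. g z * wirt (wirt_bar \<psi>) z)"
      by (rule set_integrable_mult_continuous[OF gi[OF K(1,2)] K(1)])
         (rule continuous_on_subset[OF C1_compact_continuous(2)[OF K(7)]], simp)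
    then have si: "set_integrable lborel D (\<lambda>z. g z * wirt (wirt_bar \<psi>) z)"
      by (rule set_integrable_superset_support[OF _ K(2)]) (simp add: K(5))
    have "(LINT z:D|lborel. u z * wirt (wirt_bar \<psi>) z)
        = (LINT z:D|lborel. g z * wirt (wirt_bar \<psi>) z + ?l z * wirt (wirt_bar \<psi>) z)"
      by (simp add: u_def algebra_simps)
    also have "\<dots> = (LINT z:D|lborel. g z * wirt (wirt_bar \<psi>) z) + (LINT z:D|lborel. ?l z * wirt (wirt_bar \<psi>) z)"
      by (rule set_integral_add(2)[OF si log_weak_solution(2)[OF w t]])
    finally show "(LINT z:D|lborel. u z * wirt (wirt_bar \<psi>) z) = 0"
      unfolding i1 log_weak_solution(1)[OF w t] by simp
  qed blast
  \<comment> \<open>The frontier values are set explicitly, \<open>h0\<close> being controlled on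
    \<open>D\<close> only.\<close>
  define h where "h z = (if z \<in> D then h0 z else ?l z)" for z
  have hu: "h z = u z" if z: "z \<in> closure D - {w}" for z
  proof (cases "z \<in> D")
    case False
    then have "z \<in> frontier D" using z D(1) by (simp add: frontier_def interior_open)
    then show ?thesis using False Gz by (simp add: h_def u_def g_def)
  qed (use z h0(2) in \<open>simp add: h_def\<close>)
  have hh: "h harmonic_on D" by (rule harmonic_on_transform[OF h0(1) D(1)]) (simp add: h_def)
  \<comment> \<open>Two relatively open pieces cover \<open>closure D\<close>: on \<open>D\<close>
    there is harmonicity, and off \<open>w\<close> there is agreement with \<open>u\<close>.\<close>
  have "continuous_on (D \<union> (closure D - {w})) h"
  proof (rule continuous_on_Un_local_open)
    have e: "D \<union> (closure D - {w}) = closure D" using Dc w by auto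
    show "openin (top_of_set (D \<union> (closure D - {w}))) D"
      unfolding e using openin_open_Int[OF D(1), of "closure D"] Dc by (simp add: inf_absorb2)
    show "openin (top_of_set (D \<union> (closure D - {w}))) (closure D - {w})"
      unfolding e using openin_open_Int[of "- {w}" "closure D"] by (simp add: Diff_eq open_Compl)
    show "continuous_on D h" by (rule harmonic_on_continuous[OF hh])
    show "continuous_on (closure D - {w}) h" by (rule continuous_on_eq[OF uc hu[symmetric]])
  qed
  moreover have "D \<union> (closure D - {w}) = closure D" using Dc w by auto
  ultimately have hc: "continuous_on (closure D) h" by simp
  have hb: "h z = ?l z" if "z \<in> frontier D" for z
    using that D(1) by (simp add: h_def frontier_def interior_open)
  show ?thesis
  proof (rule that[of h])
    show "dirichlet D ?l h" unfolding dirichlet_def using hc hh hb by blast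
    fix z assume z: "z \<in> D" "z \<noteq> w"
    then have "h z = u z" using hu Dc by blast
    then show "G z w = cnj (\<mu> z) * \<mu> w * (h z - ?l z)"
      using \<mu>0[OF z(1)] w0 by (simp add: u_def g_def)
  qed
qed

section \<open>The gradient vanishes almost everywhere on the zero set\<close>

lemma emeasure_lborel_translate:
  assumes "A \<in> sets borel"
  shows "{z. z - (c::complex) \<in> A} \<in> sets borel" "emeasure lborel {z. z - c \<in> A} = emeasure lborel A"
proof -
  have e: "{z. z - c \<in> A} = (+) (- c) -` A \<inter> space lborel" by auto
  show "{z. z - c \<in> A} \<in> sets borel" unfolding e using assms by measurable
  have "emeasure lborel A = emeasure (distr lborel borel ((+) (- c))) A" by (simp add: lborel_distr_plus)
  also have "\<dots> = emeasure lborel {z. z - c \<in> A}" unfolding e by (rule emeasure_distr) (use assms in auto)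
  finally show "emeasure lborel {z. z - c \<in> A} = emeasure lborel A" by simp
qed

text \<open>For every N, N disjoint sets of the same measure fit into one ball of finite
  measure.\<close>

lemma null_set_disjoint_translates:
  fixes A :: "complex set" and c :: "nat \<Rightarrow> complex"
  assumes A: "A \<in> sets borel" "A \<subseteq> cball 0 m" and c: "\<And>k. cmod (c k) \<le> 1"
    and disj: "\<And>j k z. j < k \<Longrightarrow> z - c j \<in> A \<Longrightarrow> z - c k \<in> A \<Longrightarrow> False"
  shows "A \<in> null_sets lborel"
proof -
  define B where "B k = {z. z - c k \<in> A}" for k
  have Bs: "B k \<in> sets lborel" "emeasure lborel (B k) = emeasure lborel A" for k
    unfolding B_def using emeasure_lborel_translate[OF A(1)] by auto
  have Bm: "B k \<subseteq> cball 0 (m + 1)" for k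
  proof
    fix z assume "z \<in> B k"
    then have "cmod (z - c k) \<le> m" using A(2) by (auto simp: B_def)
    then show "z \<in> cball 0 (m + 1)" using c[of k] norm_triangle_sub[of z "c k"] by simp
  qed
  have fin: "emeasure lborel (cball (0::complex) (m + 1)) < \<infinity>" by (rule emeasure_bounded_finite) simp
  have d: "disjoint_family_on B {..<N}" for N
    unfolding disjoint_family_on_def
  proof (intro ballI impI)
    fix j k :: nat assume "j \<noteq> k"
    then consider "j < k" | "k < j" by linarith
    then show "B j \<inter> B k = {}" using disj unfolding B_def by cases blast+
  qed
  have le: "of_nat N * emeasure lborel A \<le> emeasure lborel (cball (0::complex) (m + 1))" for N
  proof -
    have "of_nat N * emeasure lborel A = (\<Sum>k<N. emeasure lborel (B k))" by (simp add: Bs)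
    also have "\<dots> = emeasure lborel (\<Union>k<N. B k)" by (rule sum_emeasure) (use Bs d in auto)
    also have "\<dots> \<le> emeasure lborel (cball (0::complex) (m + 1))" by (rule emeasure_mono) (use Bm in auto)
    finally show ?thesis .
  qed
  define M where "M = enn2real (emeasure lborel (cball (0::complex) (m + 1)))"
  have M: "emeasure lborel (cball (0::complex) (m + 1)) = ennreal M" unfolding M_def using fin by simp
  have "emeasure lborel A < \<infinity>" using le[of 1] fin by (simp add: le_less_trans)
  then obtain a where a: "emeasure lborel A = ennreal a" "0 \<le> a" by (cases "emeasure lborel A") auto
  have "real N * a \<le> M" for N
  proof -
    have "ennreal (real N * a) \<le> ennreal M"
      using le[of N] a M by (simp add: ennreal_mult ennreal_of_nat_eq_real_of_nat)
    moreover have "0 \<le> M" by (simp add: M_def)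
    ultimately show ?thesis by (simp add: ennreal_le_iff)
  qed
  then have "a = 0" using a(2) by (metis ex_less_of_nat_mult less_le not_le)
  then show ?thesis using a A(1) by (intro null_setsI) auto
qed

text \<open>If \<open>D z v \<noteq> 0\<close> at a zero \<open>z\<close> then \<open>z + s v\<close> is not a zero for small \<open>s > 0\<close>.  The zeros for
  which this holds for all \<open>s\<close> below a fixed bound have infinitely many disjoint translates inside a
  bounded set, hence measure zero.\<close>

lemma directional_derivative_zero_AE:
  fixes u :: "complex \<Rightarrow> real" and v :: complex
  assumes S: "open S" and v: "cmod v = 1"
    and der: "\<And>z. z \<in> S \<Longrightarrow> (u has_derivative (\<lambda>h. D z h)) (at z)"
  shows "AE z in lborel. z \<in> S \<and> u z = 0 \<longrightarrow> D z v = 0"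
proof -
  have cu: "continuous_on S u" using der has_derivative_continuous by (intro continuous_at_imp_continuous_on) blast
  define Z where "Z = {z \<in> S. u z = 0}"
  have Zs: "Z \<in> sets borel"
  proof -
    have "closedin (top_of_set S) (S \<inter> u -` {0})" by (rule continuous_closedin_preimage[OF cu closed_singleton])
    moreover have "S \<inter> u -` {0} = Z" by (auto simp: Z_def)
    ultimately obtain T where "closed T" "Z = S \<inter> T" unfolding closedin_closed by auto
    then show ?thesis using S by auto
  qed
  \<comment> \<open>For fixed \<open>n\<close> strictly decreasing in \<open>k\<close>, with values
    between 0 and 1/(n+1), so all differences with j < k lie between 0 and 1/(n+1) too.\<close>
  define c where "c n k = inverse (real (Suc n + Suc k))" for n k
  have cp: "0 < c n k" "c n k < inverse (real (Suc n))" for n k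
    unfolding c_def by (auto intro!: less_imp_inverse_less)
  have cm: "c n k < c n j" if "j < k" for n j k
    unfolding c_def using that by (intro less_imp_inverse_less) auto
  \<comment> \<open>Zeros in a ball from which no difference of the numbers \<open>c n k\<close>
    leads to another zero along \<open>v\<close>; this makes the translates by \<open>c n k\<close>
    disjoint. Only countably many step lengths are tested, which keeps the set measurable.\<close>
  define A where "A n m = {z. z \<in> Z \<and> z \<in> cball 0 (real m) \<and>
      (\<forall>j k. j < k \<longrightarrow> z + of_real (c n j - c n k) * v \<notin> Z)}" for n m
  have null: "A n m \<in> null_sets lborel" for n m
  proof (rule null_set_disjoint_translates)
    show "A n m \<subseteq> cball 0 (real m)" by (auto simp: A_def)
    show "A n m \<in> sets borel"
    proof -
      have [measurable]: "Z \<in> sets borel" "cball (0::complex) (real m) \<in> sets borel" using Zs by auto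
      have "Measurable.pred borel (\<lambda>z. z \<in> Z \<and> z \<in> cball 0 (real m) \<and>
          (\<forall>j k. j < k \<longrightarrow> z + of_real (c n j - c n k) * v \<notin> Z))" by measurable
      then show ?thesis unfolding A_def by (simp add: pred_def)
    qed
    show "cmod (of_real (c n k) * v) \<le> 1" for k
    proof -
      have "inverse (real (Suc n)) \<le> 1" by (simp add: inverse_le_1_iff)
      then have "c n k \<le> 1" using cp(2)[of n k] by linarith
      then show ?thesis using cp(1)[of n k] v by (simp add: norm_mult)
    qed
    fix j k z assume jk: "(j::nat) < k" and z: "z - of_real (c n j) * v \<in> A n m" "z - of_real (c n k) * v \<in> A n m"
    have "z - of_real (c n j) * v + of_real (c n j - c n k) * v \<notin> Z" using z(1) jk by (auto simp: A_def)
    moreover have "z - of_real (c n j) * v + of_real (c n j - c n k) * v = z - of_real (c n k) * v" by (simp add: algebra_simps)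
    ultimately have "z - of_real (c n k) * v \<notin> Z" by metis
    then show False using z(2) by (simp add: A_def)
  qed
  have "AE z in lborel. \<forall>n m. z \<notin> A n m"
    unfolding AE_all_countable using null AE_not_in by blast
  then show ?thesis
  proof eventually_elim
    case (elim z)
    show ?case
    proof
      assume z: "z \<in> S \<and> u z = 0"
      obtain m where m: "cmod z \<le> real m" using real_arch_simple by blast
      \<comment> \<open>A zero outside all the exceptional sets has further zeros arbitrarily close
        along \<open>v\<close>, so its difference quotients vanish along a sequence.\<close>
      have "\<exists>s. 0 < s \<and> s < inverse (real (Suc n)) \<and> z + of_real s * v \<in> Z" for n
      proof -
        obtain j k where jk: "j < k" "z + of_real (c n j - c n k) * v \<in> Z"
          using elim[rule_format, of n m] z m by (auto simp: A_def Z_def)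
        then show ?thesis using cm[of j k n] cp[of n j] cp[of n k] by (intro exI[of _ "c n j - c n k"]) auto
      qed
      then obtain s where s: "\<And>n. 0 < s n \<and> s n < inverse (real (Suc n))" "\<And>n. z + of_real (s n) * v \<in> Z" by metis
      have s0: "s n > 0" "s n < inverse (real (Suc n))" for n using s(1)[of n] by auto
      have sl: "s \<longlonglongrightarrow> 0"
        by (rule real_tendsto_sandwich[OF _ _ tendsto_const LIMSEQ_inverse_real_of_nat])
           (use s0 in \<open>auto intro!: always_eventually less_imp_le\<close>)
      define h where "h n = of_real (s n) * v" for n
      have nh: "norm (h n) = s n" for n using s0(1)[of n] v by (simp add: h_def norm_mult)
      have "filterlim h (at 0) sequentially"
      proof (rule filterlim_atI)
        show "h \<longlonglongrightarrow> 0" unfolding h_def using tendsto_mult[OF tendsto_of_real[OF sl] tendsto_const, of v] by simp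
        show "\<forall>\<^sub>F n in sequentially. h n \<noteq> 0" using nh s0(1) by (intro always_eventually allI) (metis norm_zero less_irrefl)
      qed
      moreover have "((\<lambda>h. norm (u (z + h) - u z - D z h) / norm h) \<longlongrightarrow> 0) (at 0)"
        using der z unfolding has_derivative_at by blast
      ultimately have lim: "(\<lambda>n. norm (u (z + h n) - u z - D z (h n)) / norm (h n)) \<longlonglongrightarrow> 0"
        by (rule filterlim_compose[rotated])
      have "norm (u (z + h n) - u z - D z (h n)) / norm (h n) = \<bar>D z v\<bar>" for n
      proof -
        have "u (z + h n) = 0" using s(2)[of n] by (simp add: Z_def h_def)
        moreover have "D z (h n) = s n * D z v"
          using linear_scale[OF has_derivative_linear[OF der], of z "s n" v] z by (simp add: h_def scaleR_conv_of_real)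
        ultimately show ?thesis using z nh s0(1)[of n] by (simp add: abs_mult)
      qed
      then have "(\<lambda>n::nat. \<bar>D z v\<bar>) \<longlonglongrightarrow> 0" using lim by simp
      then show "D z v = 0" by (simp add: LIMSEQ_const_iff)
    qed
  qed
qed

text \<open>For real \<open>u\<close> the differential is 2 Re(a h); the directions 1 and i recover
  the real and imaginary parts of \<open>a\<close>.\<close>

lemma wirt_zero_AE:
  assumes S: "open S" and der: "\<And>z. z \<in> S \<Longrightarrow> has_wirt (\<lambda>z. of_real (u z)) (a z) (cnj (a z)) z"
  shows "AE z in lborel. z \<in> S \<and> u z = 0 \<longrightarrow> a z = 0"
proof -
  have d: "(u has_derivative (\<lambda>h. 2 * Re (a z * h))) (at z)" if "z \<in> S" for z
  proof -
    have "((\<lambda>z. Re (complex_of_real (u z))) has_derivative (\<lambda>h. Re (a z * h + cnj (a z) * cnj h))) (at z)"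
      using der[OF that] unfolding has_wirt_def by (rule has_derivative_Re)
    then show ?thesis by (simp add: algebra_simps)
  qed
  have "AE z in lborel. z \<in> S \<and> u z = 0 \<longrightarrow> 2 * Re (a z * 1) = 0"
    by (rule directional_derivative_zero_AE[OF S _ d]) auto
  moreover have "AE z in lborel. z \<in> S \<and> u z = 0 \<longrightarrow> 2 * Re (a z * \<i>) = 0"
    by (rule directional_derivative_zero_AE[OF S _ d]) auto
  ultimately show ?thesis by eventually_elim (auto simp: complex_eq_iff)
qed


section \<open>Truncation at small values\<close>

text \<open>For \<open>x > 0\<close> this is \<open>x\<^sup>2 / (e + x)\<close>, a \<open>C\<^sup>1\<close> approximation of \<open>max x 0\<close> with slope in \<open>[0, 1]\<close>.\<close>

definition soft_ramp :: "real \<Rightarrow> real \<Rightarrow> real" where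
  "soft_ramp e x = max x 0 - e + e\<^sup>2 / (e + max x 0)"

definition soft_ramp' :: "real \<Rightarrow> real \<Rightarrow> real" where
  "soft_ramp' e x = 1 - e\<^sup>2 / (e + max x 0)\<^sup>2"

lemma soft_ramp_nonpos: "e > 0 \<Longrightarrow> x \<le> 0 \<Longrightarrow> soft_ramp e x = 0" "e > 0 \<Longrightarrow> x \<le> 0 \<Longrightarrow> soft_ramp' e x = 0"
  by (simp_all add: soft_ramp_def soft_ramp'_def max_absorb2 power2_eq_square)

lemma soft_ramp_eq: assumes "e > 0" shows "soft_ramp e x = (max x 0)\<^sup>2 / (e + max x 0)"
proof -
  define p where "p = max x 0"
  have "e + p > 0" using assms by (simp add: p_def add_pos_nonneg)
  then show ?thesis unfolding soft_ramp_def p_def[symmetric] by (simp add: field_simps power2_eq_square)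
qed

lemma soft_ramp_bounds:
  assumes "e > 0"
  shows "0 \<le> soft_ramp e x" "soft_ramp e x \<le> max x 0" "\<bar>soft_ramp e x - max x 0\<bar> \<le> e"
    "0 \<le> soft_ramp' e x" "soft_ramp' e x \<le> 1"
proof -
  define p where "p = max x 0"
  have p: "p \<ge> 0" "e + p > 0" using assms by (simp_all add: p_def add_pos_nonneg)
  have "e\<^sup>2 / (e + p) \<le> e" using p assms by (simp add: divide_le_eq power2_eq_square algebra_simps)
  moreover have "0 \<le> e\<^sup>2 / (e + p)" using p by simp
  ultimately show "soft_ramp e x \<le> max x 0" "\<bar>soft_ramp e x - max x 0\<bar> \<le> e"
    unfolding soft_ramp_def p_def[symmetric] by linarith+
  show "0 \<le> soft_ramp e x" unfolding soft_ramp_eq[OF assms] p_def[symmetric] using p by simp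
  have "e\<^sup>2 \<le> (e + p)\<^sup>2" using p assms by (intro power_mono) auto
  then have "e\<^sup>2 / (e + p)\<^sup>2 \<le> 1" using p by (simp add: divide_le_eq)
  moreover have "0 \<le> e\<^sup>2 / (e + p)\<^sup>2" by simp
  ultimately show "0 \<le> soft_ramp' e x" "soft_ramp' e x \<le> 1" unfolding soft_ramp'_def p_def[symmetric] by linarith+
qed

lemma soft_ramp_deriv:
  assumes e: "e > 0" shows "(soft_ramp e has_real_derivative soft_ramp' e x) (at x)"
proof (cases x "0::real" rule: linorder_cases)
  case less
  have "((\<lambda>x::real. 0) has_real_derivative 0) (at x)" by simp
  then have "(soft_ramp e has_real_derivative 0) (at x)"
    by (rule has_field_derivative_transform_within_open[where S = "{..<0}"])
       (use less soft_ramp_nonpos[OF e] in simp_all)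
  then show ?thesis using less soft_ramp_nonpos[OF e] by simp
next
  case greater
  have "((\<lambda>x. x - e + e\<^sup>2 / (e + x)) has_real_derivative 1 - e\<^sup>2 / (e + x)\<^sup>2) (at x)"
    using greater e by (auto intro!: derivative_eq_intros simp: power2_eq_square)
  then have "(soft_ramp e has_real_derivative 1 - e\<^sup>2 / (e + x)\<^sup>2) (at x)"
    by (rule has_field_derivative_transform_within_open[where S = "{0<..}"])
       (use greater in \<open>simp_all add: soft_ramp_def\<close>)
  then show ?thesis using greater by (simp add: soft_ramp'_def)
next
  case equal
  have "((\<lambda>h. soft_ramp e h / h) \<longlongrightarrow> 0) (at 0)"
  proof (rule Lim_null_comparison)
    show "\<forall>\<^sub>F h in at 0. norm (soft_ramp e h / h) \<le> \<bar>h\<bar> / e"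
    proof (intro always_eventually allI)
      fix h :: real
      show "norm (soft_ramp e h / h) \<le> \<bar>h\<bar> / e"
      proof (cases "h > 0")
        case True
        have "soft_ramp e h / h = h / (e + h)" using True soft_ramp_eq[OF e, of h] by (simp add: power2_eq_square)
        also have "\<dots> \<le> h / e" using True e by (intro divide_left_mono) auto
        finally show ?thesis using True soft_ramp_bounds(1)[OF e, of h] by simp
      next
        case False
        then have "soft_ramp e h = 0" using soft_ramp_nonpos(1)[OF e, of h] by simp
        then show ?thesis using divide_nonneg_pos[OF abs_ge_zero[of h] e] by simp
      qed
    qed
    show "((\<lambda>h::real. \<bar>h\<bar> / e) \<longlongrightarrow> 0) (at 0)" using e by (auto intro!: tendsto_eq_intros)
  qed
  then show ?thesis using equal soft_ramp_nonpos[OF e, of 0] by (simp add: DERIV_def)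
qed

text \<open>Soft thresholding. The dead zone [-e, e] makes the composition with a function vanishing
  at the frontier vanish near the frontier; the continuous slope in [0, 1] allows the chain rule and
  bounds that do not depend on e.\<close>

definition shrink :: "real \<Rightarrow> real \<Rightarrow> real" where
  "shrink e t = soft_ramp e (t - e) - soft_ramp e (- t - e)"

definition shrink' :: "real \<Rightarrow> real \<Rightarrow> real" where
  "shrink' e t = soft_ramp' e (t - e) + soft_ramp' e (- t - e)"

lemma shrink_deriv:
  assumes "e > 0" shows "(shrink e has_real_derivative shrink' e t) (at t)"
proof -
  have 1: "((\<lambda>t. t - e) has_real_derivative 1) (at t)" "((\<lambda>t. - t - e) has_real_derivative -1) (at t)"
    by (auto intro!: derivative_eq_intros)
  show ?thesis
    using DERIV_diff[OF DERIV_chain2[OF soft_ramp_deriv[OF assms] 1(1)] DERIV_chain2[OF soft_ramp_deriv[OF assms] 1(2)]]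
    by (simp add: shrink_def[abs_def] shrink'_def)
qed

lemma continuous_shrink': "e > 0 \<Longrightarrow> continuous_on UNIV (shrink' e)"
  unfolding shrink'_def soft_ramp'_def
  by (intro continuous_intros) (auto simp: add_nonneg_eq_0_iff max_def)

lemma shrink_bounds:
  assumes "e > 0"
  shows "\<bar>t\<bar> \<le> e \<Longrightarrow> shrink e t = 0" "\<bar>shrink e t\<bar> \<le> \<bar>t\<bar>" "0 \<le> shrink' e t" "shrink' e t \<le> 1"
    "\<bar>shrink e t - t\<bar> \<le> 2 * e"
proof -
  show "\<bar>t\<bar> \<le> e \<Longrightarrow> shrink e t = 0" using soft_ramp_nonpos(1)[OF assms] by (simp add: shrink_def abs_le_iff)
  have z: "t \<le> 0 \<Longrightarrow> soft_ramp e (t - e) = 0 \<and> soft_ramp' e (t - e) = 0"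
    "t \<ge> 0 \<Longrightarrow> soft_ramp e (- t - e) = 0 \<and> soft_ramp' e (- t - e) = 0"
    using soft_ramp_nonpos[OF assms] assms by auto
  note b1 = soft_ramp_bounds[OF assms, of "t - e"] and b2 = soft_ramp_bounds[OF assms, of "- t - e"]
  show "\<bar>shrink e t\<bar> \<le> \<bar>t\<bar>" using z b1 b2 assms unfolding shrink_def by (cases "t \<ge> 0") auto
  show "0 \<le> shrink' e t" "shrink' e t \<le> 1" using z b1 b2 unfolding shrink'_def by (cases "t \<ge> 0"; simp)+
  show "\<bar>shrink e t - t\<bar> \<le> 2 * e"
  proof (cases "t \<ge> 0")
    case True
    have "\<bar>max (t - e) 0 - t\<bar> \<le> e" using True assms by auto
    then show ?thesis using z(2)[OF True] b1(3) unfolding shrink_def by linarith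
  next
    case False
    have "\<bar>max (- t - e) 0 + t\<bar> \<le> e" using False assms by auto
    then show ?thesis using z(1) False b2(3) unfolding shrink_def by linarith
  qed
qed

lemma shrink_tendsto:
  assumes e: "\<And>n. e n > 0" "e \<longlonglongrightarrow> 0"
  shows "(\<lambda>n. shrink (e n) t) \<longlonglongrightarrow> t" "t \<noteq> 0 \<Longrightarrow> (\<lambda>n. shrink' (e n) t) \<longlonglongrightarrow> 1"
proof -
  have "(\<lambda>n. shrink (e n) t - t) \<longlonglongrightarrow> 0"
  proof (rule Lim_null_comparison)
    show "\<forall>\<^sub>F n in sequentially. norm (shrink (e n) t - t) \<le> 2 * e n"
      using shrink_bounds(5)[OF e(1)] by (intro always_eventually) simp
    show "(\<lambda>n. 2 * e n) \<longlonglongrightarrow> 0" using tendsto_mult_right_zero[OF e(2)] by simp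
  qed
  then show "(\<lambda>n. shrink (e n) t) \<longlonglongrightarrow> t" by (rule LIM_zero_cancel)
  have ramp: "(\<lambda>n. soft_ramp' (e n) (s - e n)) \<longlonglongrightarrow> 1" if "s > 0" for s
  proof -
    have "(\<lambda>n. soft_ramp' (e n) (s - e n)) \<longlonglongrightarrow> 1 - 0\<^sup>2 / (0 + max (s - 0) 0)\<^sup>2"
      unfolding soft_ramp'_def using that by (intro tendsto_intros e(2)) auto
    then show ?thesis by simp
  qed
  show "(\<lambda>n. shrink' (e n) t) \<longlonglongrightarrow> 1" if "t \<noteq> 0"
  proof (cases "t > 0")
    case True
    have "soft_ramp' (e n) (- t - e n) = 0" for n using soft_ramp_nonpos(2)[OF e(1)[of n]] True e(1)[of n] by simp
    then show ?thesis unfolding shrink'_def using ramp[OF True] by simp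
  next
    case False
    have "soft_ramp' (e n) (t - e n) = 0" for n using soft_ramp_nonpos(2)[OF e(1)[of n]] False e(1)[of n] by simp
    then show ?thesis unfolding shrink'_def using ramp[of "- t"] False that by simp
  qed
qed

section \<open>Energy and reproducing property\<close>

lemma cutoff_derivative_support:
  assumes C: "C1_compact (\<lambda>z. of_real (cutoff w r z)) E F" and r: "r > 0"
    and z: "cmod (z - w) < r / 2 \<or> cmod (z - w) > r"
  shows "E z = 0" "F z = 0"
proof -
  have h: "has_wirt (\<lambda>z. complex_of_real (cutoff w r z)) (E z) (F z) z" using C by (simp add: C1_compact_def)
  have "E z = 0 \<and> F z = 0"
  proof (cases "cmod (z - w) < r / 2")
    case True
    have "has_wirt (\<lambda>z. complex_of_real (cutoff w r z) - 1) (E z) (F z) z"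
      using has_wirt_diff[OF h has_wirt_const, of 1] by simp
    from has_wirt_zero_on_open[OF this open_ball[of w "r/2"]]
    show ?thesis using True cutoff_eq_1'[OF r] by (simp add: dist_norm norm_minus_commute)
  next
    case False
    then have zr: "cmod (z - w) > r" using z by simp
    have o: "open (- cball w r)" by (simp add: open_Compl)
    from has_wirt_zero_on_open[OF h o]
    show ?thesis using zr cutoff_eq_0[OF r] by (simp add: dist_norm norm_minus_commute)
  qed
  then show "E z = 0" "F z = 0" by auto
qed

lemma set_integrable_continuous_support:
  fixes g :: "complex \<Rightarrow> complex"
  assumes "compact K" "K \<subseteq> S" "continuous_on K g" "\<And>z. z \<in> S \<Longrightarrow> z \<notin> K \<Longrightarrow> g z = 0"
  shows "set_integrable lborel S g"
proof -
  have "integrable lborel (\<lambda>z. indicator K z *\<^sub>R g z)" by (rule borel_integrable_compact[OF assms(1,3)])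
  moreover have "(\<lambda>z. indicator K z *\<^sub>R g z) = (\<lambda>z. indicat_real S z *\<^sub>R g z)"
    using assms(2,4) by (auto simp: indicator_def fun_eq_iff)
  ultimately show ?thesis unfolding set_integrable_def by simp
qed

lemma borel_measurable_open_continuous:
  fixes g :: "complex \<Rightarrow> 'b::real_normed_vector"
  assumes "open S" "continuous_on S g"
  shows "(\<lambda>z. indicat_real S z *\<^sub>R g z) \<in> borel_measurable lborel"
proof -
  have "(\<lambda>z. indicat_real S z *\<^sub>R g z) \<in> borel_measurable borel"
    by (intro borel_measurable_continuous_on_indicator assms) (use assms in auto)
  then show ?thesis by simp
qed

text \<open>To be applied to the real and imaginary parts of q, since the truncation acts on real
  functions. Off the pole \<open>w\<close>, \<open>u\<close> is harmonic with z-derivative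
  \<open>a\<close>; the cutoff about \<open>w\<close>, with Wirtinger derivatives \<open>E\<close>
  and \<open>F\<close>, keeps the integrations by parts away from the pole.\<close>

locale singular_harmonic =
  fixes D :: "complex set" and w :: complex and r :: real and E F :: "complex \<Rightarrow> complex"
    and u :: "complex \<Rightarrow> real" and a :: "complex \<Rightarrow> complex"
  assumes D: "open D" "bounded D" and r: "r > 0" "cball w r \<subseteq> D"
    and C: "C1_compact (\<lambda>z. of_real (cutoff w r z)) E F"
    and der: "\<And>z. z \<in> D - {w} \<Longrightarrow> has_wirt (\<lambda>z. of_real (u z)) (a z) (cnj (a z)) z"
    and hol: "a holomorphic_on D - {w}"
    and cont: "continuous_on (closure D - {w}) u"
    and bd: "\<And>z. z \<in> frontier D \<Longrightarrow> u z = 0"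
begin

abbreviation "S \<equiv> D - {w}"
abbreviation "\<eta> \<equiv> cutoff w r"

definition "\<epsilon> n = inverse (real (Suc n))"

lemma eps: "\<epsilon> n > 0" "\<epsilon> \<longlonglongrightarrow> 0"
  unfolding \<epsilon>_def using LIMSEQ_inverse_real_of_nat by (auto simp: \<epsilon>_def[abs_def])

definition "K0 = cball w r - ball w (r / 2)"
definition "Ke n = {z \<in> closure D - ball w (r / 2). \<epsilon> n \<le> \<bar>u z\<bar>}"

lemma openS: "open S" using D by (simp add: open_delete)

lemma K0: "compact K0" "K0 \<subseteq> S"
  unfolding K0_def using r by (auto intro!: compact_diff)

text \<open>\<open>u\<close> vanishes on the frontier and is continuous up to it away from the pole,
  so the set where |u| is at least \<open>\<epsilon> n\<close>, with a disc about \<open>w\<close>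
  removed, is closed and misses the frontier.\<close>

lemma Ke: "compact (Ke n)" "Ke n \<subseteq> S"
proof -
  have cl: "closed (closure D - ball w (r / 2))" by (intro closed_Diff) auto
  have c: "continuous_on (closure D - ball w (r / 2)) u"
    by (rule continuous_on_subset[OF cont]) (use r in auto)
  have "closed {z \<in> closure D - ball w (r / 2). \<bar>u z\<bar> \<in> {\<epsilon> n..}}"
    by (rule continuous_closed_preimage[OF _ cl, unfolded vimage_def Int_def mem_Collect_eq]) (auto intro!: continuous_intros c)
  then have "closed (Ke n)" by (simp add: Ke_def)
  moreover have "bounded (Ke n)" using bounded_closure[OF D(2)] by (rule bounded_subset) (auto simp: Ke_def)
  ultimately show "compact (Ke n)" by (simp add: compact_eq_bounded_closed)
  show "Ke n \<subseteq> S"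
  proof
    fix z assume z: "z \<in> Ke n"
    then have "u z \<noteq> 0" using eps(1)[of n] by (auto simp: Ke_def)
    then have "z \<notin> frontier D" using bd by blast
    then show "z \<in> S" using z D(1) r by (auto simp: Ke_def frontier_def interior_open)
  qed
qed

lemma contS: "continuous_on S u" "continuous_on S a" "continuous_on S E" "continuous_on S F" "continuous_on S \<eta>"
proof -
  show "continuous_on S u" by (rule continuous_on_subset[OF cont]) (use closure_subset in auto)
  show "continuous_on S a" by (rule holomorphic_on_imp_continuous_on[OF hol])
  show "continuous_on S E" "continuous_on S F" using C1_compact_continuous[OF C] continuous_on_subset by blast+
  show "continuous_on S \<eta>"
    using continuous_on_Re[OF C1_compact_continuous(1)[OF C]] continuous_on_subset by (simp, blast)
qed

lemma cshrink: "continuous_on S (\<lambda>z. shrink (\<epsilon> n) (u z))" "continuous_on S (\<lambda>z. shrink' (\<epsilon> n) (u z))"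
proof -
  have "continuous_on UNIV (shrink (\<epsilon> n))"
    using shrink_deriv[OF eps(1)] by (intro continuous_at_imp_continuous_on ballI DERIV_isCont) blast
  then show "continuous_on S (\<lambda>z. shrink (\<epsilon> n) (u z))" by (rule continuous_on_compose2[OF _ contS(1)]) simp
  show "continuous_on S (\<lambda>z. shrink' (\<epsilon> n) (u z))"
    by (rule continuous_on_compose2[OF continuous_shrink'[OF eps(1)] contS(1)]) simp
qed

lemma EF0: "z \<notin> K0 \<Longrightarrow> E z = 0" "z \<notin> K0 \<Longrightarrow> F z = 0"
  using cutoff_derivative_support[OF C r(1), of z] by (auto simp: K0_def dist_norm norm_minus_commute)

lemma annulus_integrable:
  assumes "continuous_on S g" shows "set_integrable lborel S (\<lambda>z. E z * g z)" "set_integrable lborel S (\<lambda>z. F z * g z)"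
proof -
  have c: "continuous_on K0 g" "continuous_on K0 E" "continuous_on K0 F"
    using assms contS K0(2) continuous_on_subset by blast+
  show "set_integrable lborel S (\<lambda>z. E z * g z)" "set_integrable lborel S (\<lambda>z. F z * g z)"
    by (rule set_integrable_continuous_support[OF K0]; use EF0 in \<open>auto intro!: continuous_intros c\<close>)+
qed

lemma cutoff_complement_has_wirt: "has_wirt (\<lambda>z. 1 - of_real (\<eta> z)) (- E z) (- F z) z"
proof -
  have "has_wirt (\<lambda>z. complex_of_real (\<eta> z)) (E z) (F z) z" using C by (simp add: C1_compact_def)
  from has_wirt_diff[OF has_wirt_const this, of 1] show ?thesis by simp
qed

lemma shrink_has_wirt:
  assumes "z \<in> S"
  shows "has_wirt (\<lambda>z. of_real (shrink (\<epsilon> n) (u z))) (of_real (shrink' (\<epsilon> n) (u z)) * a z) (of_real (shrink' (\<epsilon> n) (u z)) * cnj (a z)) z"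
  by (rule has_wirt_chain_real[OF der[OF assms] shrink_deriv[OF eps(1)]])

lemma outside_Ke:
  assumes "z \<in> S - Ke n" shows "(1 - complex_of_real (\<eta> z)) * of_real (shrink (\<epsilon> n) (u z)) = 0"
proof (cases "z \<in> ball w (r / 2)")
  case True
  then have "\<eta> z = 1" by (intro cutoff_eq_1'[OF r(1)]) (simp add: dist_norm norm_minus_commute)
  then show ?thesis by simp
next
  case False
  have "z \<in> closure D" using assms closure_subset by blast
  then have "\<bar>u z\<bar> \<le> \<epsilon> n" using assms False by (auto simp: Ke_def)
  then show ?thesis using shrink_bounds(1)[OF eps(1)] by simp
qed

text \<open>The z-bar derivative of (1 - cutoff) * shrink(u) * a has integral 0. As \<open>a\<close>
  is holomorphic and du/dz-bar is the conjugate of \<open>a\<close>, this leaves the truncated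
  energy and a term with the factor \<open>F\<close>, which lives on a fixed annulus and stays
  bounded when the truncation is removed.\<close>

lemma energy_identity:
  "set_integrable lborel S (\<lambda>z. complex_of_real ((1 - \<eta> z) * shrink' (\<epsilon> n) (u z) * (cmod (a z))\<^sup>2))"
  "(LINT z:S|lborel. complex_of_real ((1 - \<eta> z) * shrink' (\<epsilon> n) (u z) * (cmod (a z))\<^sup>2)) =
   (LINT z:S|lborel. F z * (of_real (shrink (\<epsilon> n) (u z)) * a z))"
proof -
  let ?t = "\<lambda>z. complex_of_real (shrink (\<epsilon> n) (u z))" and ?t' = "\<lambda>z. complex_of_real (shrink' (\<epsilon> n) (u z))"
  let ?c = "\<lambda>z. 1 - complex_of_real (\<eta> z)"
  have w: "has_wirt (\<lambda>z. ?c z * ?t z * a z)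
     ((- E z * ?t z + ?c z * (?t' z * a z)) * a z + ?c z * ?t z * deriv a z)
     ((- F z * ?t z + ?c z * (?t' z * cnj (a z))) * a z + ?c z * ?t z * 0) z" if z: "z \<in> S" for z
    by (intro has_wirt_mult cutoff_complement_has_wirt shrink_has_wirt[OF z] has_wirt_holomorphic[OF hol openS z])
  have zero: "?c z * ?t z * a z = 0" if "z \<in> S - Ke n" for z using outside_Ke[OF that] by simp
  have cd: "continuous_on S (deriv a)" by (intro holomorphic_on_imp_continuous_on holomorphic_deriv hol openS)
  have cA: "continuous_on S (\<lambda>z. (- E z * ?t z + ?c z * (?t' z * a z)) * a z + ?c z * ?t z * deriv a z)"
    by (intro continuous_intros contS cshrink cd)
  have cB: "continuous_on S (\<lambda>z. (- F z * ?t z + ?c z * (?t' z * cnj (a z))) * a z + ?c z * ?t z * 0)"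
    by (intro continuous_intros contS cshrink cd)
  have I2: "set_integrable lborel S (\<lambda>z. (- F z * ?t z + ?c z * (?t' z * cnj (a z))) * a z + ?c z * ?t z * 0)"
    by (rule integral_wirt_open_zero(2)[OF openS Ke[of n] w cA cB zero])
  have I4: "(LINT z:S|lborel. (- F z * ?t z + ?c z * (?t' z * cnj (a z))) * a z + ?c z * ?t z * 0) = 0"
    by (rule integral_wirt_open_zero(4)[OF openS Ke[of n] w cA cB zero])
  have s1: "set_integrable lborel S (\<lambda>z. F z * (?t z * a z))"
    by (rule annulus_integrable) (intro continuous_intros contS cshrink)
  have eq: "(- F z * ?t z + ?c z * (?t' z * cnj (a z))) * a z + ?c z * ?t z * 0 + F z * (?t z * a z)
     = complex_of_real ((1 - \<eta> z) * shrink' (\<epsilon> n) (u z) * (cmod (a z))\<^sup>2)" for z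
    by (simp add: of_real_cmod_power2 algebra_simps)
  show "set_integrable lborel S (\<lambda>z. complex_of_real ((1 - \<eta> z) * shrink' (\<epsilon> n) (u z) * (cmod (a z))\<^sup>2))"
    using set_integral_add(1)[OF I2 s1] unfolding eq .
  show "(LINT z:S|lborel. complex_of_real ((1 - \<eta> z) * shrink' (\<epsilon> n) (u z) * (cmod (a z))\<^sup>2)) =
   (LINT z:S|lborel. F z * (?t z * a z))"
    using set_integral_add(2)[OF I2 s1] unfolding eq I4 add_0 .
qed

lemma zero_set_AE: "AE z in lborel. z \<in> S \<and> u z = 0 \<longrightarrow> a z = 0"
  by (rule wirt_zero_AE[OF openS der])

text \<open>Since |shrink(u)| <= |u|, the annulus term of \<open>energy_identity\<close> is bounded
  independently of n, and Fatou's lemma applies. The slopes tend to 1 where \<open>u\<close> is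
  nonzero; elsewhere \<open>a\<close> vanishes almost everywhere by
  \<open>zero_set_AE\<close>.\<close>

lemma energy_finite: "integrable lborel (\<lambda>z. indicator S z * ((1 - \<eta> z) * (cmod (a z))\<^sup>2))"
proof (rule Fatou_integrable(1))
  let ?f = "\<lambda>n z. indicator S z * ((1 - \<eta> z) * shrink' (\<epsilon> n) (u z) * (cmod (a z))\<^sup>2)"
  let ?C = "LINT z|lborel. norm (indicat_real S z *\<^sub>R (F z * (of_real (u z) * a z)))"
  have si: "set_integrable lborel S (\<lambda>z. F z * (of_real (u z) * a z))"
    by (rule annulus_integrable) (intro continuous_intros contS)
  have c: "(\<lambda>z. indicat_real S z *\<^sub>R complex_of_real ((1 - \<eta> z) * shrink' (\<epsilon> n) (u z) * (cmod (a z))\<^sup>2)) = (\<lambda>z. complex_of_real (?f n z))" for n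
    by (auto simp: indicator_def)
  show int: "integrable lborel (?f n)" for n
    using energy_identity(1)[of n] unfolding set_integrable_def c by (simp only: complex_of_real_integrable_eq)
  show "\<And>n z. 0 \<le> ?f n z" using cutoff_range shrink_bounds(3)[OF eps(1)] by simp
  show "AE z in lborel. (\<lambda>n. ?f n z) \<longlonglongrightarrow> indicator S z * ((1 - \<eta> z) * (cmod (a z))\<^sup>2)"
    using zero_set_AE
  proof eventually_elim
    case (elim z)
    show ?case
    proof (cases "z \<in> S \<and> u z \<noteq> 0")
      case True
      have "(\<lambda>n. ?f n z) \<longlonglongrightarrow> indicator S z * ((1 - \<eta> z) * 1 * (cmod (a z))\<^sup>2)"
        using True by (intro tendsto_intros shrink_tendsto(2) eps) auto
      then show ?thesis by simp
    next
      case False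
      then have "z \<notin> S \<or> a z = 0" using elim by blast
      then show ?thesis by (auto simp: indicator_def)
    qed
  qed
  show "(\<lambda>z. indicator S z * ((1 - \<eta> z) * (cmod (a z))\<^sup>2)) \<in> borel_measurable lborel"
  proof -
    have "continuous_on S (\<lambda>z. (1 - \<eta> z) * (cmod (a z))\<^sup>2)" by (intro continuous_intros contS)
    from borel_measurable_open_continuous[OF openS this] show ?thesis by simp
  qed
  show "\<And>z. 0 \<le> indicator S z * ((1 - \<eta> z) * (cmod (a z))\<^sup>2)" using cutoff_range by simp
  show "integral\<^sup>L lborel (?f n) \<le> ?C" for n
  proof -
    have e: "complex_of_real (integral\<^sup>L lborel (?f n)) = (LINT z:S|lborel. F z * (of_real (shrink (\<epsilon> n) (u z)) * a z))"
      using energy_identity(2)[of n] unfolding set_lebesgue_integral_def c by (simp only: integral_complex_of_real)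
    have "\<bar>integral\<^sup>L lborel (?f n)\<bar> = cmod (LINT z:S|lborel. F z * (of_real (shrink (\<epsilon> n) (u z)) * a z))"
      by (simp only: e[symmetric] norm_of_real)
    also have "\<dots> \<le> (LINT z|lborel. norm (indicat_real S z *\<^sub>R (F z * (of_real (shrink (\<epsilon> n) (u z)) * a z))))"
      unfolding set_lebesgue_integral_def by (rule integral_norm_bound)
    also have "\<dots> \<le> ?C"
    proof (rule integral_mono)
      have "set_integrable lborel S (\<lambda>z. F z * (of_real (shrink (\<epsilon> n) (u z)) * a z))"
        by (rule annulus_integrable) (intro continuous_intros contS cshrink)
      then show "integrable lborel (\<lambda>z. norm (indicat_real S z *\<^sub>R (F z * (of_real (shrink (\<epsilon> n) (u z)) * a z))))"
        unfolding set_integrable_def by (rule integrable_norm)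
      show "integrable lborel (\<lambda>z. norm (indicat_real S z *\<^sub>R (F z * (of_real (u z) * a z))))"
        using si unfolding set_integrable_def by (rule integrable_norm)
      fix z
      have "cmod (F z) * (\<bar>shrink (\<epsilon> n) (u z)\<bar> * cmod (a z)) \<le> cmod (F z) * (\<bar>u z\<bar> * cmod (a z))"
        by (intro mult_left_mono mult_right_mono shrink_bounds(2) eps) auto
      then show "norm (indicat_real S z *\<^sub>R (F z * (of_real (shrink (\<epsilon> n) (u z)) * a z))) \<le> norm (indicat_real S z *\<^sub>R (F z * (of_real (u z) * a z)))"
        by (simp add: norm_mult indicator_def)
    qed
    finally show ?thesis by linarith
  qed
  show "(\<lambda>n::nat. ?C) \<longlonglongrightarrow> ?C" by simp
qed

text \<open>The z-derivative of cnj f * (1 - cutoff) * shrink(u) has integral 0, and cnj f is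
  antiholomorphic, so only the cutoff and the truncated function are differentiated.\<close>

lemma weighted_pairing:
  assumes f: "f holomorphic_on D" "set_integrable lborel D (\<lambda>z. (cmod (f z))\<^sup>2)"
  shows "set_integrable lborel S (\<lambda>z. cnj (f z) * (1 - of_real (\<eta> z)) * a z)"
    and "(LINT z:S|lborel. cnj (f z) * (1 - of_real (\<eta> z)) * a z) = (LINT z:S|lborel. E z * (cnj (f z) * of_real (u z)))"
proof -
  let ?t = "\<lambda>n z. complex_of_real (shrink (\<epsilon> n) (u z))" and ?t' = "\<lambda>n z. complex_of_real (shrink' (\<epsilon> n) (u z))"
  let ?c = "\<lambda>z. 1 - complex_of_real (\<eta> z)"
  have fS: "f holomorphic_on S" by (rule holomorphic_on_subset[OF f(1)]) auto
  have cf: "continuous_on S f" by (rule holomorphic_on_imp_continuous_on[OF fS])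
  have cdf: "continuous_on S (deriv f)" by (intro holomorphic_on_imp_continuous_on holomorphic_deriv fS openS)
  \<comment> \<open>A majorant for the product of \<open>f\<close> and \<open>a\<close>, integrable
    because the energy is finite.\<close>
  let ?W = "\<lambda>z. indicator S z *\<^sub>R (cmod (f z))\<^sup>2 + indicator S z * ((1 - \<eta> z) * (cmod (a z))\<^sup>2)"
  have f2: "set_integrable lborel S (\<lambda>z. (cmod (f z))\<^sup>2)"
    by (rule set_integrable_subset[OF f(2)]) (use openS in auto)
  have W: "integrable lborel ?W"
    by (intro Bochner_Integration.integrable_add energy_finite f2[unfolded set_integrable_def])
  have bound: "norm (indicat_real S z *\<^sub>R (cnj (f z) * ?c z * (of_real t * a z))) \<le> ?W z" if t: "0 \<le> t" "t \<le> 1" for z t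
  proof (cases "z \<in> S")
    case True
    have c: "0 \<le> 1 - \<eta> z" "1 - \<eta> z \<le> 1" using cutoff_range[of w r z] by auto
    have nc: "cmod (?c z) = 1 - \<eta> z"
      using c(1) by (metis norm_of_real abs_of_nonneg of_real_1 of_real_diff)
    have "norm (cnj (f z) * ?c z * (of_real t * a z)) = (cmod (f z) * cmod (a z)) * (1 - \<eta> z) * t"
      using t by (simp add: norm_mult nc)
    also have "\<dots> \<le> (cmod (f z) * cmod (a z)) * (1 - \<eta> z) * 1" using t c by (intro mult_left_mono) auto
    also have "\<dots> \<le> ((cmod (f z))\<^sup>2 + (cmod (a z))\<^sup>2) * (1 - \<eta> z)"
    proof -
      have "cmod (f z) * cmod (a z) \<le> (cmod (f z))\<^sup>2 + (cmod (a z))\<^sup>2"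
      proof -
        have "0 \<le> cmod (f z) * cmod (a z)" by simp
        then show ?thesis using sum_squares_bound[of "cmod (f z)" "cmod (a z)"] by linarith
      qed
      then show ?thesis using c by (simp add: mult_right_mono)
    qed
    also have "\<dots> \<le> (cmod (f z))\<^sup>2 + (1 - \<eta> z) * (cmod (a z))\<^sup>2"
      using mult_left_mono[OF c(2), of "(cmod (f z))\<^sup>2"] by (simp add: algebra_simps)
    finally show ?thesis using True by simp
  qed (use cutoff_range in simp)
  have w: "has_wirt (\<lambda>z. cnj (f z) * ?c z * ?t n z)
     ((0 * ?c z + cnj (f z) * (- E z)) * ?t n z + cnj (f z) * ?c z * (?t' n z * a z))
     ((cnj (deriv f z) * ?c z + cnj (f z) * (- F z)) * ?t n z + cnj (f z) * ?c z * (?t' n z * cnj (a z))) z" if z: "z \<in> S" for n z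
  proof (intro has_wirt_mult cutoff_complement_has_wirt shrink_has_wirt[OF z])
    show "has_wirt (\<lambda>z. cnj (f z)) 0 (cnj (deriv f z)) z"
      using has_wirt_cnj[OF has_wirt_holomorphic[OF fS openS z]] by simp
  qed
  have zero: "cnj (f z) * ?c z * ?t n z = 0" if "z \<in> S - Ke n" for n z using outside_Ke[OF that] by (simp add: mult.assoc)
  have cA: "continuous_on S (\<lambda>z. (0 * ?c z + cnj (f z) * (- E z)) * ?t n z + cnj (f z) * ?c z * (?t' n z * a z))" for n
    by (intro continuous_intros contS cshrink cf)
  have cB: "continuous_on S (\<lambda>z. (cnj (deriv f z) * ?c z + cnj (f z) * (- F z)) * ?t n z + cnj (f z) * ?c z * (?t' n z * cnj (a z)))" for n
    by (intro continuous_intros contS cshrink cf cdf)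
  have I1: "set_integrable lborel S (\<lambda>z. (0 * ?c z + cnj (f z) * (- E z)) * ?t n z + cnj (f z) * ?c z * (?t' n z * a z))" for n
    by (rule integral_wirt_open_zero(1)[OF openS Ke w cA cB zero])
  have I3: "(LINT z:S|lborel. (0 * ?c z + cnj (f z) * (- E z)) * ?t n z + cnj (f z) * ?c z * (?t' n z * a z)) = 0" for n
    by (rule integral_wirt_open_zero(3)[OF openS Ke w cA cB zero])
  have s1: "set_integrable lborel S (\<lambda>z. E z * (cnj (f z) * ?t n z))" for n
    by (rule annulus_integrable) (intro continuous_intros contS cshrink cf)
  have eq: "(0 * ?c z + cnj (f z) * (- E z)) * ?t n z + cnj (f z) * ?c z * (?t' n z * a z) + E z * (cnj (f z) * ?t n z)
      = cnj (f z) * ?c z * (?t' n z * a z)" for n z by (simp add: algebra_simps)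
  have id: "(LINT z:S|lborel. cnj (f z) * ?c z * (?t' n z * a z)) = (LINT z:S|lborel. E z * (cnj (f z) * ?t n z))" for n
    using set_integral_add(2)[OF I1[of n] s1[of n]] unfolding eq I3 add_0 .
  have m1: "(\<lambda>z. indicat_real S z *\<^sub>R (cnj (f z) * ?c z * (?t' n z * a z))) \<in> borel_measurable lborel" for n
  proof -
    have "continuous_on S (\<lambda>z. cnj (f z) * ?c z * (?t' n z * a z))" by (intro continuous_intros contS cshrink cf)
    from borel_measurable_open_continuous[OF openS this] show ?thesis .
  qed
  have m2: "(\<lambda>z. indicat_real S z *\<^sub>R (cnj (f z) * ?c z * a z)) \<in> borel_measurable lborel"
  proof -
    have "continuous_on S (\<lambda>z. cnj (f z) * ?c z * a z)" by (intro continuous_intros contS cf)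
    from borel_measurable_open_continuous[OF openS this] show ?thesis .
  qed
  have lim1: "AE z in lborel. (\<lambda>n. indicat_real S z *\<^sub>R (cnj (f z) * ?c z * (?t' n z * a z))) \<longlonglongrightarrow> indicat_real S z *\<^sub>R (cnj (f z) * ?c z * a z)"
    using zero_set_AE
  proof eventually_elim
    case (elim z)
    show ?case
    proof (cases "z \<in> S \<and> u z \<noteq> 0")
      case True
      have "(\<lambda>n. indicat_real S z *\<^sub>R (cnj (f z) * ?c z * (?t' n z * a z))) \<longlonglongrightarrow> indicat_real S z *\<^sub>R (cnj (f z) * ?c z * (of_real 1 * a z))"
        using True by (intro tendsto_intros shrink_tendsto(2) eps) auto
      then show ?thesis by simp
    next
      case False
      then have "z \<notin> S \<or> a z = 0" using elim by blast
      then show ?thesis by (auto simp: indicator_def)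
    qed
  qed
  have b1: "AE z in lborel. norm (indicat_real S z *\<^sub>R (cnj (f z) * ?c z * (?t' n z * a z))) \<le> ?W z" for n
    by (intro AE_I2 bound shrink_bounds eps)
  have si: "set_integrable lborel S (\<lambda>z. cnj (f z) * ?c z * a z)"
    unfolding set_integrable_def by (rule integrable_dominated_convergence[OF m2 m1 W lim1 b1])
  then show "set_integrable lborel S (\<lambda>z. cnj (f z) * (1 - of_real (\<eta> z)) * a z)" .
  have l1: "(\<lambda>n. LINT z:S|lborel. cnj (f z) * ?c z * (?t' n z * a z)) \<longlonglongrightarrow> (LINT z:S|lborel. cnj (f z) * ?c z * a z)"
    unfolding set_lebesgue_integral_def by (rule integral_dominated_convergence[OF m2 m1 W lim1 b1])
  have s2: "set_integrable lborel S (\<lambda>z. E z * (cnj (f z) * of_real (u z)))"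
    by (rule annulus_integrable) (intro continuous_intros contS cf)
  have l2: "(\<lambda>n. LINT z:S|lborel. E z * (cnj (f z) * ?t n z)) \<longlonglongrightarrow> (LINT z:S|lborel. E z * (cnj (f z) * of_real (u z)))"
    unfolding set_lebesgue_integral_def
  proof (rule integral_dominated_convergence[OF _ _ integrable_norm[OF s2[unfolded set_integrable_def]]])
    show "(\<lambda>z. indicat_real S z *\<^sub>R (E z * (cnj (f z) * of_real (u z)))) \<in> borel_measurable lborel"
      using s2 unfolding set_integrable_def by auto
    show "(\<lambda>z. indicat_real S z *\<^sub>R (E z * (cnj (f z) * ?t n z))) \<in> borel_measurable lborel" for n
      using s1[of n] unfolding set_integrable_def by auto
    show "AE z in lborel. (\<lambda>n. indicat_real S z *\<^sub>R (E z * (cnj (f z) * ?t n z))) \<longlonglongrightarrow> indicat_real S z *\<^sub>R (E z * (cnj (f z) * of_real (u z)))"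
      by (intro AE_I2 tendsto_intros shrink_tendsto(1) eps)
    show "AE z in lborel. norm (indicat_real S z *\<^sub>R (E z * (cnj (f z) * ?t n z))) \<le> norm (indicat_real S z *\<^sub>R (E z * (cnj (f z) * of_real (u z))))" for n
    proof (rule AE_I2)
      fix z
      have "cmod (E z) * (cmod (f z) * \<bar>shrink (\<epsilon> n) (u z)\<bar>) \<le> cmod (E z) * (cmod (f z) * \<bar>u z\<bar>)"
        by (intro mult_left_mono shrink_bounds(2) eps) auto
      then show "norm (indicat_real S z *\<^sub>R (E z * (cnj (f z) * ?t n z))) \<le> norm (indicat_real S z *\<^sub>R (E z * (cnj (f z) * of_real (u z))))"
        by (simp add: norm_mult indicator_def)
    qed
  qed
  from LIMSEQ_unique[OF l1[unfolded id] l2]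
  show "(LINT z:S|lborel. cnj (f z) * (1 - of_real (\<eta> z)) * a z) = (LINT z:S|lborel. E z * (cnj (f z) * of_real (u z)))" .
qed

end

section \<open>The reproducing property and its consequences\<close>

lemma set_lint_delete_point:
  fixes g :: "complex \<Rightarrow> complex"
  assumes "open D" "continuous_on D g"
  shows "(LINT z:D - {w}|lborel. g z) = (LINT z:D|lborel. g z)"
    and "set_integrable lborel (D - {w}) g \<longleftrightarrow> set_integrable lborel D g"
proof -
  have m: "(\<lambda>z. indicat_real D z *\<^sub>R g z) \<in> borel_measurable lborel"
    using borel_measurable_open_continuous[OF assms] by simp
  have oD: "open (D - {w})" using assms(1) by (simp add: open_delete)
  have m': "(\<lambda>z. indicat_real (D - {w}) z *\<^sub>R g z) \<in> borel_measurable lborel"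
    using borel_measurable_open_continuous[OF oD continuous_on_subset[OF assms(2)]] by simp
  have ae: "AE z in lborel. indicat_real (D - {w}) z *\<^sub>R g z = indicat_real D z *\<^sub>R g z"
    using AE_lborel_singleton[of w] by eventually_elim (simp add: indicator_def)
  show "(LINT z:D - {w}|lborel. g z) = (LINT z:D|lborel. g z)"
    unfolding set_lebesgue_integral_def by (rule integral_cong_AE[OF m' m ae])
  show "set_integrable lborel (D - {w}) g \<longleftrightarrow> set_integrable lborel D g"
    unfolding set_integrable_def by (rule integrable_cong_AE[OF m' m ae])
qed

lemma set_integrable_of_real_iff:
  "set_integrable M A (\<lambda>z. complex_of_real (g z)) \<longleftrightarrow> set_integrable M A g"
proof -
  have "(\<lambda>z. indicat_real A z *\<^sub>R complex_of_real (g z)) = (\<lambda>z. complex_of_real (indicat_real A z *\<^sub>R g z))"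
    by (auto simp: indicator_def)
  then show ?thesis unfolding set_integrable_def by (simp only: complex_of_real_integrable_eq)
qed

lemma set_integrable_real_bound:
  fixes f g :: "complex \<Rightarrow> real"
  assumes "set_integrable lborel S g" "open S" "continuous_on S f" "\<And>z. z \<in> S \<Longrightarrow> \<bar>f z\<bar> \<le> g z"
  shows "set_integrable lborel S f"
  unfolding set_integrable_def
proof (rule Bochner_Integration.integrable_bound[OF assms(1)[unfolded set_integrable_def]])
  show "(\<lambda>z. indicat_real S z *\<^sub>R f z) \<in> borel_measurable lborel"
    by (rule borel_measurable_open_continuous[OF assms(2,3)])
  show "AE z in lborel. norm (indicat_real S z *\<^sub>R f z) \<le> norm (indicat_real S z *\<^sub>R g z)"
    using assms(4) by (intro AE_I2) (force simp: indicator_def)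
qed

text \<open>The pole part of q is antiholomorphic, so q and \<open>H\<close> have the same
  z-derivative off \<open>w\<close>. Split it by the cutoff: the far part is integrated by parts
  with q, which vanishes at the frontier, the near part with \<open>H\<close>, which is regular at
  \<open>w\<close>. The annulus terms containing \<open>H\<close> cancel and only the pole
  contributes.\<close>

theorem reproducing_property:
  assumes D: "open D" "bounded D" and w: "w \<in> D"
    and H: "dirichlet D (\<lambda>z. - 1 / (2 * cnj (z - w))) H"
  shows "set_integrable lborel D (\<lambda>z. (cmod (wirt H z))\<^sup>2)"
    and "\<And>f. f holomorphic_on D \<Longrightarrow> set_integrable lborel D (\<lambda>z. (cmod (f z))\<^sup>2) \<Longrightarrow>
       (LINT z:D|lborel. cnj (f z) * wirt H z) = - of_real (pi / 2) * cnj (f w)"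
proof -
  obtain r where r: "r > 0" "cball w r \<subseteq> D" using D(1) w open_contains_cball by blast
  obtain E F where C: "C1_compact (\<lambda>z. of_real (cutoff w r z)) E F" using cutoff_C1_compact[OF r(1)] by blast
  let ?S = "D - {w}" and ?e = "\<lambda>z. complex_of_real (cutoff w r z)"
  have oS: "open ?S" using D(1) by (simp add: open_delete)
  define k where "k = wirt H"
  have har: "H harmonic_on D" and Hc: "continuous_on (closure D) H" and Hb: "\<And>z. z \<in> frontier D \<Longrightarrow> H z = - 1 / (2 * cnj (z - w))"
    using H unfolding dirichlet_def by auto
  have kD: "k holomorphic_on D" and lD: "(\<lambda>z. cnj (wirt_bar H z)) holomorphic_on D"
    using har unfolding harmonic_on_def k_def by auto
  have hH: "has_wirt H (k z) (wirt_bar H z) z" if "z \<in> D" for z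
    using harmonic_on_has_wirt[OF har that] by (simp add: k_def)
  define q where "q z = H z + 1 / (2 * cnj (z - w))" for z
  define lb where "lb z = wirt_bar H z - 1 / (2 * (cnj (z - w))\<^sup>2)" for z
  have hq: "has_wirt q (k z) (lb z) z" if z: "z \<in> ?S" for z
  proof -
    have "((\<lambda>z. 1 / (2 * (z - w))) has_field_derivative - 1 / (2 * (z - w)\<^sup>2)) (at z)"
      using z by (auto intro!: derivative_eq_intros simp: power2_eq_square divide_simps; simp add: algebra_simps)
    from has_wirt_cnj[OF has_wirt_field_derivative[OF this]]
    have "has_wirt (\<lambda>z. 1 / (2 * cnj (z - w))) 0 (- 1 / (2 * (cnj (z - w))\<^sup>2)) z" by simp
    from has_wirt_add[OF hH this] show ?thesis using z unfolding q_def[abs_def] lb_def by simp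
  qed
  \<comment> \<open>The z-derivatives of Re q and, next, of Im q, to which the truncation applies;
    they recombine to \<open>a1 + \<i> * a2 = k\<close>.\<close>
  define a1 where "a1 z = (k z + cnj (lb z)) / 2" for z
  define a2 where "a2 z = (- \<i> * k z + cnj (- \<i> * lb z)) / 2" for z
  have ka: "k z = a1 z + \<i> * a2 z" for z by (simp add: a1_def a2_def field_simps)
  have hlb: "(\<lambda>z. cnj (lb z)) holomorphic_on ?S"
  proof -
    have "(\<lambda>z. cnj (wirt_bar H z) - 1 / (2 * (z - w)\<^sup>2)) holomorphic_on ?S"
      by (intro holomorphic_intros holomorphic_on_subset[OF lD]) auto
    then show ?thesis by (simp add: lb_def)
  qed
  have kS: "k holomorphic_on ?S" by (rule holomorphic_on_subset[OF kD]) auto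
  have h1: "a1 holomorphic_on ?S" unfolding a1_def by (intro holomorphic_intros kS hlb) auto
  have h2: "a2 holomorphic_on ?S" unfolding a2_def complex_cnj_mult by (intro holomorphic_intros kS hlb) auto
  have qc: "continuous_on (closure D - {w}) q"
    unfolding q_def[abs_def] by (intro continuous_intros continuous_on_subset[OF Hc]) auto
  have qb: "q z = 0" if "z \<in> frontier D" for z using Hb[OF that] by (simp add: q_def)
  interpret R: singular_harmonic D w r E F "\<lambda>z. Re (q z)" a1
  proof
    show "has_wirt (\<lambda>z. complex_of_real (Re (q z))) (a1 z) (cnj (a1 z)) z" if "z \<in> ?S" for z
      using has_wirt_Re[OF hq[OF that]] unfolding a1_def .
  qed (use D r C h1 qb in \<open>auto intro!: continuous_intros qc\<close>)
  interpret I: singular_harmonic D w r E F "\<lambda>z. Im (q z)" a2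
  proof
    show "has_wirt (\<lambda>z. complex_of_real (Im (q z))) (a2 z) (cnj (a2 z)) z" if "z \<in> ?S" for z
      using has_wirt_Re[OF has_wirt_cmult[OF hq[OF that], of "- \<i>"]] unfolding a2_def by simp
  qed (use D r C h2 qb in \<open>auto intro!: continuous_intros qc\<close>)
  have ck: "continuous_on D k" by (rule holomorphic_on_imp_continuous_on[OF kD])
  have cH: "continuous_on D H" by (rule harmonic_on_continuous[OF har])
  have cE: "continuous_on D E" "continuous_on D F" "continuous_on D ?e"
    using C1_compact_continuous[OF C] continuous_on_subset by blast+
  have ce: "continuous_on D (cutoff w r)" using continuous_on_Re[OF cE(3)] by simp
  show "set_integrable lborel D (\<lambda>z. (cmod (wirt H z))\<^sup>2)"
  proof -
    have "set_integrable lborel ?S (\<lambda>z. 2 * ((1 - cutoff w r z) * (cmod (a1 z))\<^sup>2) + 2 * ((1 - cutoff w r z) * (cmod (a2 z))\<^sup>2))"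
      by (intro set_integral_add(1) set_integrable_mult_right; unfold set_integrable_def real_scaleR_def; rule R.energy_finite I.energy_finite)
    then have "set_integrable lborel ?S (\<lambda>z. (1 - cutoff w r z) * (cmod (k z))\<^sup>2)"
    proof (rule set_integrable_real_bound[OF _ oS])
      show "continuous_on ?S (\<lambda>z. (1 - cutoff w r z) * (cmod (k z))\<^sup>2)"
        by (rule continuous_on_subset[of D]) (auto intro!: continuous_intros ck ce)
      fix z
      have "(cmod (k z))\<^sup>2 \<le> (cmod (a1 z) + cmod (a2 z))\<^sup>2"
        using norm_triangle_ineq[of "a1 z" "\<i> * a2 z"] by (intro power_mono) (simp_all add: ka norm_mult)
      also have "\<dots> \<le> 2 * (cmod (a1 z))\<^sup>2 + 2 * (cmod (a2 z))\<^sup>2"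
        using sum_squares_bound[of "cmod (a1 z)" "cmod (a2 z)"] by (simp add: power2_sum)
      finally have b: "(cmod (k z))\<^sup>2 \<le> 2 * (cmod (a1 z))\<^sup>2 + 2 * (cmod (a2 z))\<^sup>2" .
      have c: "0 \<le> 1 - cutoff w r z" using cutoff_range[of w r z] by simp
      have "\<bar>(1 - cutoff w r z) * (cmod (k z))\<^sup>2\<bar> = (1 - cutoff w r z) * (cmod (k z))\<^sup>2" using c by simp
      also have "\<dots> \<le> (1 - cutoff w r z) * (2 * (cmod (a1 z))\<^sup>2 + 2 * (cmod (a2 z))\<^sup>2)" by (rule mult_left_mono[OF b c])
      finally show "\<bar>(1 - cutoff w r z) * (cmod (k z))\<^sup>2\<bar> \<le> 2 * ((1 - cutoff w r z) * (cmod (a1 z))\<^sup>2) + 2 * ((1 - cutoff w r z) * (cmod (a2 z))\<^sup>2)"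
        by (simp add: algebra_simps)
    qed
    then have "set_integrable lborel ?S (\<lambda>z. complex_of_real ((1 - cutoff w r z) * (cmod (k z))\<^sup>2))" by (simp only: set_integrable_of_real_iff)
    moreover have "continuous_on D (\<lambda>z. complex_of_real ((1 - cutoff w r z) * (cmod (k z))\<^sup>2))" by (intro continuous_intros ck ce)
    ultimately have 1: "set_integrable lborel D (\<lambda>z. complex_of_real ((1 - cutoff w r z) * (cmod (k z))\<^sup>2))"
      using set_lint_delete_point(2)[OF D(1)] by blast
    have 2: "set_integrable lborel D (\<lambda>z. complex_of_real (cutoff w r z * (cmod (k z))\<^sup>2))"
    proof (rule set_integrable_continuous_support[OF compact_cball r(2)])
      show "continuous_on (cball w r) (\<lambda>z. complex_of_real (cutoff w r z * (cmod (k z))\<^sup>2))"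
        by (rule continuous_on_subset[OF _ r(2)]) (intro continuous_intros ck ce)
      show "complex_of_real (cutoff w r z * (cmod (k z))\<^sup>2) = 0" if "z \<notin> cball w r" for z
        using cutoff_eq_0[OF r(1), of z w] that by (simp add: dist_norm norm_minus_commute)
    qed
    have "complex_of_real ((1 - cutoff w r z) * (cmod (k z))\<^sup>2) + complex_of_real (cutoff w r z * (cmod (k z))\<^sup>2) = complex_of_real ((cmod (wirt H z))\<^sup>2)" for z
      by (simp add: k_def algebra_simps)
    then show ?thesis using set_integral_add(1)[OF 1 2] by (simp only: set_integrable_of_real_iff)
  qed
  fix f assume f: "f holomorphic_on D" "set_integrable lborel D (\<lambda>z. (cmod (f z))\<^sup>2)"
  have cf: "continuous_on D f" by (rule holomorphic_on_imp_continuous_on[OF f(1)])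
  have cdf: "continuous_on D (deriv f)" by (intro holomorphic_on_imp_continuous_on holomorphic_deriv f D)
  have SD: "continuous_on D g \<Longrightarrow> continuous_on ?S g" for g :: "complex \<Rightarrow> complex" by (rule continuous_on_subset) auto
  note P1 = R.weighted_pairing[OF f] and P2 = I.weighted_pairing[OF f]
  have cinv: "continuous_on ?S (\<lambda>z. 1 / (2 * cnj (z - w)))" by (intro continuous_intros) auto
  have eH: "set_integrable lborel ?S (\<lambda>z. E z * (cnj (f z) * H z))"
    by (rule R.annulus_integrable) (intro continuous_intros SD cf cH)
  have ei: "set_integrable lborel ?S (\<lambda>z. E z * (cnj (f z) * (1 / (2 * cnj (z - w)))))"
    by (rule R.annulus_integrable) (intro continuous_on_mult continuous_on_cnj cinv SD cf)
  have eRe: "set_integrable lborel ?S (\<lambda>z. E z * (cnj (f z) * of_real (Re (q z))))"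
    by (rule R.annulus_integrable) (intro continuous_on_mult continuous_on_cnj continuous_on_of_real R.contS SD cf)
  have eIm: "set_integrable lborel ?S (\<lambda>z. \<i> * (E z * (cnj (f z) * of_real (Im (q z)))))"
    by (intro set_integrable_mult_right R.annulus_integrable) (intro continuous_on_mult continuous_on_cnj continuous_on_of_real I.contS SD cf)
  have P2i: "set_integrable lborel ?S (\<lambda>z. \<i> * (cnj (f z) * (1 - ?e z) * a2 z))" by (intro set_integrable_mult_right P2(1))
  have eq1: "cnj (f z) * (1 - ?e z) * a1 z + \<i> * (cnj (f z) * (1 - ?e z) * a2 z) = cnj (f z) * (1 - ?e z) * k z" for z
    by (simp add: ka algebra_simps)
  have eq2: "E z * (cnj (f z) * of_real (Re (q z))) + \<i> * (E z * (cnj (f z) * of_real (Im (q z)))) = E z * (cnj (f z) * H z) + E z * (cnj (f z) * (1 / (2 * cnj (z - w))))" for z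
  proof -
    have "E z * (cnj (f z) * of_real (Re (q z))) + \<i> * (E z * (cnj (f z) * of_real (Im (q z)))) = E z * (cnj (f z) * (of_real (Re (q z)) + \<i> * of_real (Im (q z))))"
      by (simp only: ring_distribs mult.left_commute[of \<i>])
    also have "of_real (Re (q z)) + \<i> * of_real (Im (q z)) = q z" by (simp add: complex_eq_iff)
    finally show ?thesis by (simp only: q_def ring_distribs)
  qed
  \<comment> \<open>The far part becomes integrals of the cutoff derivative \<open>E\<close> against
    \<open>H\<close> and against the pole.\<close>
  have A: "(LINT z:?S|lborel. cnj (f z) * (1 - ?e z) * k z) = (LINT z:?S|lborel. E z * (cnj (f z) * H z)) + (LINT z:?S|lborel. E z * (cnj (f z) * (1 / (2 * cnj (z - w)))))"
  proof -
    have "(LINT z:?S|lborel. cnj (f z) * (1 - ?e z) * k z) = (LINT z:?S|lborel. cnj (f z) * (1 - ?e z) * a1 z) + (LINT z:?S|lborel. \<i> * (cnj (f z) * (1 - ?e z) * a2 z))"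
      using set_integral_add(2)[OF P1(1) P2i] unfolding eq1 .
    also have "\<dots> = (LINT z:?S|lborel. E z * (cnj (f z) * of_real (Re (q z)))) + (LINT z:?S|lborel. \<i> * (E z * (cnj (f z) * of_real (Im (q z)))))"
      by (simp only: P1(2) P2(2) set_integral_mult_right)
    also have "\<dots> = (LINT z:?S|lborel. E z * (cnj (f z) * H z)) + (LINT z:?S|lborel. E z * (cnj (f z) * (1 / (2 * cnj (z - w)))))"
      using set_integral_add(2)[OF eRe eIm] set_integral_add(2)[OF eH ei] unfolding eq2 by (simp only:)
    finally show ?thesis .
  qed
  have hcf: "has_wirt (\<lambda>z. cnj (f z)) 0 (cnj (deriv f z)) z" if "z \<in> D" for z
    using has_wirt_cnj[OF has_wirt_holomorphic[OF f(1) D(1) that]] by simp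
  have he: "has_wirt ?e (E z) (F z) z" for z using C by (simp add: C1_compact_def)
  have wfe: "has_wirt (\<lambda>z. cnj (f z) * ?e z) (0 * ?e z + cnj (f z) * E z) (cnj (deriv f z) * ?e z + cnj (f z) * F z) z" if "z \<in> D" for z
    by (rule has_wirt_mult[OF hcf[OF that] he])
  have e0: "?e z = 0" if "z \<notin> cball w r" for z
    using cutoff_eq_0[OF r(1), of z w] that by (simp add: dist_norm norm_minus_commute)
  have B1: "set_integrable lborel D (\<lambda>z. (0 * ?e z + cnj (f z) * E z) * H z + cnj (f z) * ?e z * k z)"
    and B2: "(LINT z:D|lborel. (0 * ?e z + cnj (f z) * E z) * H z + cnj (f z) * ?e z * k z) = 0"
  proof -
    have w: "has_wirt (\<lambda>z. cnj (f z) * ?e z * H z) ((0 * ?e z + cnj (f z) * E z) * H z + cnj (f z) * ?e z * k z)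
      ((cnj (deriv f z) * ?e z + cnj (f z) * F z) * H z + cnj (f z) * ?e z * wirt_bar H z) z" if "z \<in> D" for z
      by (rule has_wirt_mult[OF wfe[OF that] hH[OF that]])
    have cwb: "continuous_on D (wirt_bar H)"
      using continuous_on_cnj[OF holomorphic_on_imp_continuous_on[OF lD]] by simp
    have c1: "continuous_on D (\<lambda>z. (0 * ?e z + cnj (f z) * E z) * H z + cnj (f z) * ?e z * k z)"
      by (intro continuous_intros cf cE cH ck ce)
    have c2: "continuous_on D (\<lambda>z. (cnj (deriv f z) * ?e z + cnj (f z) * F z) * H z + cnj (f z) * ?e z * wirt_bar H z)"
      by (intro continuous_intros cf cE cH cdf cwb ce)
    have z: "cnj (f z) * ?e z * H z = 0" if "z \<in> D - cball w r" for z using e0[of z] that by simp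
    show "set_integrable lborel D (\<lambda>z. (0 * ?e z + cnj (f z) * E z) * H z + cnj (f z) * ?e z * k z)"
      by (rule integral_wirt_open_zero(1)[OF D(1) compact_cball r(2) w c1 c2 z])
    show "(LINT z:D|lborel. (0 * ?e z + cnj (f z) * E z) * H z + cnj (f z) * ?e z * k z) = 0"
      by (rule integral_wirt_open_zero(3)[OF D(1) compact_cball r(2) w c1 c2 z])
  qed
  have fk: "set_integrable lborel D (\<lambda>z. cnj (f z) * ?e z * k z)"
  proof (rule set_integrable_continuous_support[OF compact_cball r(2)])
    show "continuous_on (cball w r) (\<lambda>z. cnj (f z) * ?e z * k z)"
      by (rule continuous_on_subset[OF _ r(2)]) (intro continuous_intros cf ck ce)
  qed (use e0 in auto)
  have cEf: "continuous_on D (\<lambda>z. E z * (cnj (f z) * H z))" by (intro continuous_intros cf cE cH)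
  have eHD: "set_integrable lborel D (\<lambda>z. E z * (cnj (f z) * H z))"
    using eH set_lint_delete_point(2)[OF D(1) cEf] by blast
  \<comment> \<open>The near part contributes the same \<open>H\<close> term with the opposite
    sign.\<close>
  have B: "(LINT z:D|lborel. cnj (f z) * ?e z * k z) = - (LINT z:?S|lborel. E z * (cnj (f z) * H z))"
  proof -
    have "(LINT z:D|lborel. (0 * ?e z + cnj (f z) * E z) * H z + cnj (f z) * ?e z * k z) =
      (LINT z:D|lborel. E z * (cnj (f z) * H z) + cnj (f z) * ?e z * k z)" by (simp add: ac_simps)
    also have "\<dots> = (LINT z:D|lborel. E z * (cnj (f z) * H z)) + (LINT z:D|lborel. cnj (f z) * ?e z * k z)"
      by (rule set_integral_add(2)[OF eHD fk])
    finally show ?thesis using B2 set_lint_delete_point(1)[OF D(1) cEf, of w] by (simp add: eq_neg_iff_add_eq_0 add.commute)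
  qed
  \<comment> \<open>Cauchy--Pompeiu for the zero extension of cnj f times the cutoff, whose
    z-derivative is cnj f times \<open>E\<close>; the cutoff is 1 at \<open>w\<close>.\<close>
  have Cp: "(LINT z:?S|lborel. E z * (cnj (f z) * (1 / (2 * cnj (z - w))))) = - of_real (pi / 2) * cnj (f w)"
  proof -
    have "C1_compact (extend0 D (\<lambda>z. cnj (f z) * ?e z)) (extend0 D (\<lambda>z. 0 * ?e z + cnj (f z) * E z))
       (extend0 D (\<lambda>z. cnj (deriv f z) * ?e z + cnj (f z) * F z))"
    proof (rule C1_compact_extend0[OF D(1) compact_cball r(2) wfe])
      show "continuous_on D (\<lambda>z. 0 * ?e z + cnj (f z) * E z)" by (intro continuous_intros cf cE ce)
      show "continuous_on D (\<lambda>z. cnj (deriv f z) * ?e z + cnj (f z) * F z)" by (intro continuous_intros cf cdf cE ce)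
    qed (use e0 in auto)
    from Cauchy_Pompeiu_cnj(1)[OF this, of w]
    have "(LINT z|lborel. extend0 D (\<lambda>z. 0 * ?e z + cnj (f z) * E z) z / cnj (z - w)) = - of_real pi * cnj (f w)"
      using w cutoff_eq_1'[OF r(1), of w w] r(1) by (simp add: extend0_def)
    \<comment> \<open>At z = w the quotient is 0 by the convention for division by 0, in agreement
      with the deleted point.\<close>
    moreover have "(LINT z:?S|lborel. E z * (cnj (f z) * (1 / (2 * cnj (z - w)))))
       = (LINT z|lborel. (1/2) * (extend0 D (\<lambda>z. 0 * ?e z + cnj (f z) * E z) z / cnj (z - w)))"
      unfolding set_lebesgue_integral_def
      by (rule Bochner_Integration.integral_cong) (auto simp: extend0_def indicator_def)
    ultimately show ?thesis by (simp only: integral_mult_right_zero) simp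
  qed
  have c1e: "continuous_on D (\<lambda>z. cnj (f z) * (1 - ?e z) * k z)" by (intro continuous_intros cf ck ce)
  have s1e: "set_integrable lborel ?S (\<lambda>z. cnj (f z) * (1 - ?e z) * k z)"
    using set_integral_add(1)[OF P1(1) P2i] unfolding eq1 .
  have s1D: "set_integrable lborel D (\<lambda>z. cnj (f z) * (1 - ?e z) * k z)"
    using s1e set_lint_delete_point(2)[OF D(1) c1e] by blast
  have "cnj (f z) * (1 - ?e z) * k z + cnj (f z) * ?e z * k z = cnj (f z) * wirt H z" for z
    by (simp add: k_def algebra_simps)
  then have "(LINT z:D|lborel. cnj (f z) * wirt H z) = (LINT z:D|lborel. cnj (f z) * (1 - ?e z) * k z) + (LINT z:D|lborel. cnj (f z) * ?e z * k z)"
    using set_integral_add(2)[OF s1D fk] by (simp only:)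
  also have "(LINT z:D|lborel. cnj (f z) * (1 - ?e z) * k z) = (LINT z:?S|lborel. cnj (f z) * (1 - ?e z) * k z)"
    using set_lint_delete_point(1)[OF D(1) c1e] by simp
  finally show "(LINT z:D|lborel. cnj (f z) * wirt H z) = - of_real (pi / 2) * cnj (f w)"
    unfolding A B Cp by simp
qed

text \<open>The choice s = sqrt(B / A) balances both terms; if \<open>A\<close> or \<open>B\<close>
  is 0, the term that remains becomes arbitrarily small for suitable s.\<close>

lemma le_sqrt_mult_if_AM:
  fixes x A B :: real
  assumes "0 \<le> x" "0 \<le> A" "0 \<le> B" and le: "\<And>s. s > 0 \<Longrightarrow> 2 * x \<le> s * A + B / s"
  shows "x\<^sup>2 \<le> A * B"
proof (cases "A = 0 \<or> B = 0")
  case True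
  have "x \<le> e" if e: "e > 0" for e
  proof (cases "A = 0")
    case True
    have "2 * x \<le> B / ((B + 1) / (2 * e))" using le[of "(B + 1) / (2 * e)"] e assms True by simp
    also have "\<dots> = 2 * e * (B / (B + 1))" by simp
    also have "\<dots> \<le> 2 * e * 1" using e assms(3) by (intro mult_left_mono) auto
    finally show ?thesis by simp
  next
    case False
    then have "B = 0" using \<open>A = 0 \<or> B = 0\<close> by simp
    then have "2 * x \<le> (2 * e / (A + 1)) * A" using le[of "2 * e / (A + 1)"] e assms by simp
    also have "\<dots> = 2 * e * (A / (A + 1))" by simp
    also have "\<dots> \<le> 2 * e * 1" using e assms(2) by (intro mult_left_mono) auto
    finally show ?thesis by simp
  qed
  then have "x \<le> 0" by (rule field_le_epsilon[of x 0, simplified])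
  then show ?thesis using assms by simp
next
  case False
  then have p: "A > 0" "B > 0" using assms by auto
  define s where "s = sqrt (B / A)"
  have s: "s > 0" "s\<^sup>2 = B / A" using p by (auto simp: s_def)
  have "B / s = s * A"
    using s p by (simp add: field_simps power2_eq_square)
  then have "x \<le> s * A" using le[OF s(1)] by (simp add: mult.commute)
  then have "x\<^sup>2 \<le> (s * A)\<^sup>2" using assms by (intro power_mono) auto
  also have "\<dots> = A * B" unfolding power_mult_distrib s(2) using p by (simp add: power2_eq_square)
  finally show ?thesis .
qed

text \<open>Reproducing \<open>\<kappa>\<close> itself identifies its squared norm with its value at
  \<open>w\<close>, and Cauchy--Schwarz bounds point evaluation. In this shape the facts pass to a
  limit of domains, whereas the reproducing identity would require convergence of the
  pairings.\<close>

corollary kernel_bounds: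
  assumes D: "open D" "bounded D" and w: "w \<in> D"
    and H: "dirichlet D (\<lambda>z. - 1 / (2 * cnj (z - w))) H"
  defines "\<kappa> \<equiv> \<lambda>z. - (2 / of_real pi) * wirt H z"
  shows "\<kappa> holomorphic_on D" "set_integrable lborel D (\<lambda>z. (cmod (\<kappa> z))\<^sup>2)"
    and "\<kappa> w = of_real (LINT z:D|lborel. (cmod (\<kappa> z))\<^sup>2)"
    and "\<And>f. f holomorphic_on D \<Longrightarrow> set_integrable lborel D (\<lambda>z. (cmod (f z))\<^sup>2) \<Longrightarrow>
       (cmod (f w))\<^sup>2 \<le> (LINT z:D|lborel. (cmod (f z))\<^sup>2) * Re (\<kappa> w)"
proof -
  note rp = reproducing_property[OF D w H]
  show hol: "\<kappa> holomorphic_on D"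
    using H unfolding dirichlet_def harmonic_on_def \<kappa>_def by (intro holomorphic_intros) auto
  have cf: "(cmod (\<kappa> z))\<^sup>2 = (2 / pi)\<^sup>2 * (cmod (wirt H z))\<^sup>2" for z
    by (simp add: \<kappa>_def norm_mult norm_divide power_mult_distrib power_divide)
  show int: "set_integrable lborel D (\<lambda>z. (cmod (\<kappa> z))\<^sup>2)"
    unfolding cf by (intro set_integrable_mult_right rp(1))
  have rep: "(LINT z:D|lborel. cnj (f z) * \<kappa> z) = cnj (f w)"
    if "f holomorphic_on D" "set_integrable lborel D (\<lambda>z. (cmod (f z))\<^sup>2)" for f
  proof -
    have "(LINT z:D|lborel. cnj (f z) * \<kappa> z) = (LINT z:D|lborel. - (2 / of_real pi) * (cnj (f z) * wirt H z))"
      by (simp add: \<kappa>_def ac_simps)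
    also have "\<dots> = - (2 / of_real pi) * (LINT z:D|lborel. cnj (f z) * wirt H z)" by (rule set_integral_mult_right)
    finally show ?thesis unfolding rp(2)[OF that] by simp
  qed
  have "cnj (\<kappa> w) = (LINT z:D|lborel. of_real ((cmod (\<kappa> z))\<^sup>2))"
    using rep[OF hol int] by (simp add: of_real_cmod_power2 mult.commute)
  also have "\<dots> = of_real (LINT z:D|lborel. (cmod (\<kappa> z))\<^sup>2)" by (rule set_integral_complex_of_real)
  finally show kw: "\<kappa> w = of_real (LINT z:D|lborel. (cmod (\<kappa> z))\<^sup>2)"
    by (metis complex_cnj_cnj complex_cnj_complex_of_real)
  show "(cmod (f w))\<^sup>2 \<le> (LINT z:D|lborel. (cmod (f z))\<^sup>2) * Re (\<kappa> w)"
    if f: "f holomorphic_on D" "set_integrable lborel D (\<lambda>z. (cmod (f z))\<^sup>2)" for f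
    unfolding kw Re_complex_of_real
  proof (rule le_sqrt_mult_if_AM)
    show "0 \<le> (LINT z:D|lborel. (cmod (f z))\<^sup>2)" "0 \<le> (LINT z:D|lborel. (cmod (\<kappa> z))\<^sup>2)"
      unfolding set_lebesgue_integral_def by (intro Bochner_Integration.integral_nonneg; simp)+
    fix s :: real assume s: "s > 0"
    have i: "set_integrable lborel D (\<lambda>z. s * (cmod (f z))\<^sup>2 + (1 / s) * (cmod (\<kappa> z))\<^sup>2)"
      by (intro set_integral_add(1) set_integrable_mult_right f int)
    have p: "2 * cmod (cnj (f z) * \<kappa> z) \<le> s * (cmod (f z))\<^sup>2 + (1 / s) * (cmod (\<kappa> z))\<^sup>2" for z
    proof -
      have "2 * (s * cmod (f z)) * cmod (\<kappa> z) \<le> (s * cmod (f z))\<^sup>2 + (cmod (\<kappa> z))\<^sup>2" by (rule sum_squares_bound)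
      then have "(2 * (s * cmod (f z)) * cmod (\<kappa> z)) / s \<le> ((s * cmod (f z))\<^sup>2 + (cmod (\<kappa> z))\<^sup>2) / s"
        using s by (intro divide_right_mono) auto
      then show ?thesis using s by (simp add: norm_mult power2_eq_square add_divide_distrib ac_simps)
    qed
    have "2 * cmod (f w) = cmod (LINT z:D|lborel. 2 * (cnj (f z) * \<kappa> z))"
    proof -
      have "(LINT z:D|lborel. 2 * (cnj (f z) * \<kappa> z)) = 2 * cnj (f w)" by (simp only: set_integral_mult_right rep[OF f])
      then show ?thesis by (simp add: norm_mult)
    qed
    also have "\<dots> \<le> (LINT z:D|lborel. s * (cmod (f z))\<^sup>2 + (1 / s) * (cmod (\<kappa> z))\<^sup>2)"
    proof -
      let ?g = "\<lambda>z. indicat_real D z *\<^sub>R (2 * (cnj (f z) * \<kappa> z))"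
      have b: "norm (?g z) \<le> indicat_real D z *\<^sub>R (s * (cmod (f z))\<^sup>2 + (1 / s) * (cmod (\<kappa> z))\<^sup>2)" for z
        using p[of z] by (cases "z \<in> D") (simp_all add: norm_mult)
      have "continuous_on D (\<lambda>z. 2 * (cnj (f z) * \<kappa> z))"
        by (intro continuous_intros holomorphic_on_imp_continuous_on f hol)
      note m = borel_measurable_open_continuous[OF D(1) this]
      have ig: "integrable lborel ?g"
        by (rule Bochner_Integration.integrable_bound[OF i[unfolded set_integrable_def] m])
           (intro AE_I2 order_trans[OF b], simp only: real_norm_def abs_ge_self)
      have "norm (LINT z|lborel. ?g z) \<le> (LINT z|lborel. norm (?g z))" by (rule integral_norm_bound)
      also have "\<dots> \<le> (LINT z|lborel. indicat_real D z *\<^sub>R (s * (cmod (f z))\<^sup>2 + (1 / s) * (cmod (\<kappa> z))\<^sup>2))"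
        by (rule integral_mono[OF integrable_norm[OF ig] i[unfolded set_integrable_def] b])
      finally show ?thesis unfolding set_lebesgue_integral_def .
    qed
    also have "\<dots> = (LINT z:D|lborel. s * (cmod (f z))\<^sup>2) + (LINT z:D|lborel. (1 / s) * (cmod (\<kappa> z))\<^sup>2)"
      by (rule set_integral_add(2)) (intro set_integrable_mult_right f int)+
    also have "\<dots> = s * (LINT z:D|lborel. (cmod (f z))\<^sup>2) + (1 / s) * (LINT z:D|lborel. (cmod (\<kappa> z))\<^sup>2)"
      by (simp only: set_integral_mult_right)
    also have "\<dots> = s * (LINT z:D|lborel. (cmod (f z))\<^sup>2) + (LINT z:D|lborel. (cmod (\<kappa> z))\<^sup>2) / s" by simp
    finally show "2 * cmod (f w) \<le> s * (LINT z:D|lborel. (cmod (f z))\<^sup>2) + (LINT z:D|lborel. (cmod (\<kappa> z))\<^sup>2) / s" .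
  qed simp
qed


section \<open>Characterisation of the Bergman kernel\<close>

lemma continuous_nonneg_integral_zero:
  fixes g :: "complex \<Rightarrow> real"
  assumes W: "open W" and c: "continuous_on W g" and i: "set_integrable lborel W g"
    and nn: "\<And>z. z \<in> W \<Longrightarrow> 0 \<le> g z" and le: "(LINT z:W|lborel. g z) \<le> 0" and z: "z \<in> W"
  shows "g z = 0"
proof (rule ccontr)
  assume gz: "g z \<noteq> 0"
  have nn': "0 \<le> indicat_real W x *\<^sub>R g x" for x using nn by (simp add: indicator_def)
  have "(LINT x|lborel. indicat_real W x *\<^sub>R g x) = 0"
    using le nn' unfolding set_lebesgue_integral_def by (intro antisym Bochner_Integration.integral_nonneg) auto
  then have ae: "AE x in lborel. indicat_real W x *\<^sub>R g x = 0"
    using integral_nonneg_eq_0_iff_AE[OF i[unfolded set_integrable_def]] nn' by simp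
  have "open (W \<inter> g -` (- {0}))" using continuous_open_preimage[OF c W, of "- {0}"] by (simp add: open_Compl)
  then obtain e where e: "e > 0" "ball z e \<subseteq> W \<inter> g -` (- {0})"
    using z gz unfolding open_contains_ball by blast
  have "AE x in lborel. x \<notin> ball z e"
    using ae by eventually_elim (use e(2) in \<open>auto simp: indicator_def\<close>)
  then have "ball z e \<in> null_sets lborel" by (subst AE_iff_null_sets) auto
  then have "measure lborel (ball z e) = 0" by (simp add: null_setsD1 measure_def)
  then show False using measure_ball_complex[of e z] e(1) by simp
qed

text \<open>The evaluation bound makes the squared norm of every competitor with value 1 at
  \<open>w\<close> at least 1/c, and \<open>\<kappa>\<close> divided by c attains this value, so it
  is a minimiser. The parallelogram law identifies it on \<open>W\<close> with the minimiser chosen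
  by \<open>SOME\<close>.\<close>

lemma bergman_kernel_eqI:
  assumes W: "open W" and \<rho>: "continuous_on W \<rho>" "\<And>z. z \<in> W \<Longrightarrow> \<rho> z > 0"
    and \<kappa>: "\<kappa> \<in> bergman_space W \<rho>" "(LINT z:W|lborel. (cmod (\<kappa> z))\<^sup>2 * \<rho> z) \<le> c" "\<kappa> w = of_real c"
    and ev: "\<And>f. f \<in> bergman_space W \<rho> \<Longrightarrow> (cmod (f w))\<^sup>2 \<le> (LINT z:W|lborel. (cmod (f z))\<^sup>2 * \<rho> z) * c"
    and z: "z \<in> W"
  shows "bergman_kernel W \<rho> z w = \<kappa> z"
proof -
  define N where "N f = (LINT z:W|lborel. (cmod (f z))\<^sup>2 * \<rho> z)" for f
  have N0: "N f \<ge> 0" for f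
    unfolding N_def set_lebesgue_integral_def
    by (rule Bochner_Integration.integral_nonneg) (use less_imp_le[OF \<rho>(2)] in \<open>auto simp: indicator_def\<close>)
  have norm2: "(bergman_norm W \<rho> f)\<^sup>2 = N f" for f using N0[of f] by (simp add: bergman_norm_def N_def)
  have norm_le: "bergman_norm W \<rho> f \<le> bergman_norm W \<rho> g \<longleftrightarrow> N f \<le> N g" for f g
    by (simp add: bergman_norm_def N_def)
  have cw: "continuous_on W (\<lambda>z. (cmod (f z))\<^sup>2 * \<rho> z)" if "f holomorphic_on W" for f
    by (intro continuous_intros \<rho>(1) holomorphic_on_imp_continuous_on that)
  have scale: "(\<lambda>z. a * f z) \<in> bergman_space W \<rho>" "N (\<lambda>z. a * f z) = (cmod a)\<^sup>2 * N f" if f: "f \<in> bergman_space W \<rho>" for a f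
  proof -
    have eq: "(cmod (a * f z))\<^sup>2 * \<rho> z = (cmod a)\<^sup>2 * ((cmod (f z))\<^sup>2 * \<rho> z)" for z by (simp add: norm_mult power_mult_distrib)
    show "(\<lambda>z. a * f z) \<in> bergman_space W \<rho>"
      using f unfolding bergman_space_def mem_Collect_eq eq by (auto intro!: holomorphic_intros)
    show "N (\<lambda>z. a * f z) = (cmod a)\<^sup>2 * N f" unfolding N_def eq by (rule set_integral_mult_right)
  qed
  have vanish: "f x = 0" if f: "f holomorphic_on W" "set_integrable lborel W (\<lambda>z. (cmod (f z))\<^sup>2 * \<rho> z)" "N f \<le> 0" and x: "x \<in> W" for f x
  proof -
    have "(cmod (f x))\<^sup>2 * \<rho> x = 0"
      by (rule continuous_nonneg_integral_zero[OF W cw[OF f(1)] f(2) _ _ x]) (use f(3) less_imp_le[OF \<rho>(2)] in \<open>auto simp: N_def\<close>)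
    then show ?thesis using \<rho>(2)[OF x] by simp
  qed
  show ?thesis
  proof (cases "\<exists>f \<in> bergman_space W \<rho>. f w = 1")
    case True
    then obtain f1 where f1: "f1 \<in> bergman_space W \<rho>" "f1 w = 1" by blast
    have "1 \<le> N f1 * c" using ev[OF f1(1)] f1(2) by (simp add: N_def)
    then have c: "c > 0" using N0[of f1] by (metis mult_nonneg_nonpos not_le order.strict_trans1 zero_less_one)
    have low: "1 / c \<le> N f" if "f \<in> bergman_space W \<rho>" "f w = 1" for f
      using ev[OF that(1)] that(2) c by (simp add: N_def divide_le_eq)
    define \<phi> where "\<phi> z = (1 / of_real c) * \<kappa> z" for z
    have \<phi>: "\<phi> \<in> bergman_space W \<rho>" "\<phi> w = 1"
      unfolding \<phi>_def[abs_def] by (rule scale(1)[OF \<kappa>(1)]) (use \<kappa>(3) c in simp)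
    have "N \<phi> = (1 / c)\<^sup>2 * N \<kappa>" unfolding \<phi>_def using scale(2)[OF \<kappa>(1), of "1 / of_real c"] c by (simp add: norm_divide)
    also have "\<dots> \<le> (1 / c)\<^sup>2 * c" using \<kappa>(2) by (intro mult_left_mono) (simp_all add: N_def)
    also have "\<dots> = 1 / c" using c by (simp add: power2_eq_square)
    finally have N\<phi>: "N \<phi> = 1 / c" using low[OF \<phi>] by simp
    have min\<phi>: "bergman_minimizer W \<rho> w \<phi>"
      unfolding bergman_minimizer_def norm_le N\<phi> using \<phi> low by blast
    define \<psi> where "\<psi> = (SOME \<phi>. bergman_minimizer W \<rho> w \<phi>)"
    have "bergman_minimizer W \<rho> w \<psi>" unfolding \<psi>_def by (rule someI[where P = "bergman_minimizer W \<rho> w"], rule min\<phi>)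
    then have \<psi>: "\<psi> \<in> bergman_space W \<rho>" "\<psi> w = 1" "N \<psi> \<le> N \<phi>"
      using \<phi> unfolding bergman_minimizer_def norm_le by blast+
    have N\<psi>: "N \<psi> = 1 / c" using low[OF \<psi>(1,2)] \<psi>(3) N\<phi> by simp
    have hol: "\<phi> holomorphic_on W" "\<psi> holomorphic_on W" and int: "set_integrable lborel W (\<lambda>z. (cmod (\<phi> z))\<^sup>2 * \<rho> z)" "set_integrable lborel W (\<lambda>z. (cmod (\<psi> z))\<^sup>2 * \<rho> z)"
      using \<phi>(1) \<psi>(1) unfolding bergman_space_def by auto
    \<comment> \<open>The midpoint of the two minimisers is again a competitor, which forces the
      half difference \<open>d\<close> to have norm 0.\<close>
    define m where "m z = 1/2 * (\<phi> z + \<psi> z)" for z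
    define d where "d z = 1/2 * (\<phi> z - \<psi> z)" for z
    have hmd: "m holomorphic_on W" "d holomorphic_on W" unfolding m_def d_def by (intro holomorphic_intros hol)+
    have par: "(cmod (m z))\<^sup>2 * \<rho> z + (cmod (d z))\<^sup>2 * \<rho> z = 1/2 * ((cmod (\<phi> z))\<^sup>2 * \<rho> z) + 1/2 * ((cmod (\<psi> z))\<^sup>2 * \<rho> z)" for z
    proof -
      have "(cmod (m z))\<^sup>2 + (cmod (d z))\<^sup>2 = 1/2 * (cmod (\<phi> z))\<^sup>2 + 1/2 * (cmod (\<psi> z))\<^sup>2"
        unfolding m_def d_def cmod_power2 by (simp add: power2_eq_square algebra_simps add_divide_distrib diff_divide_distrib)
      from arg_cong[OF this, of "\<lambda>x. x * \<rho> z"] show ?thesis by (simp only: distrib_right mult.assoc)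
    qed
    have s: "set_integrable lborel W (\<lambda>z. 1/2 * ((cmod (\<phi> z))\<^sup>2 * \<rho> z) + 1/2 * ((cmod (\<psi> z))\<^sup>2 * \<rho> z))"
      by (intro set_integral_add(1) set_integrable_mult_right int)
    have nn: "0 \<le> (cmod (f x))\<^sup>2 * \<rho> x" if "x \<in> W" for f x using \<rho>(2)[OF that] by simp
    have im: "set_integrable lborel W (\<lambda>z. (cmod (m z))\<^sup>2 * \<rho> z)"
    proof (rule set_integrable_real_bound[OF s W cw[OF hmd(1)]])
      show "\<bar>(cmod (m x))\<^sup>2 * \<rho> x\<bar> \<le> 1/2 * ((cmod (\<phi> x))\<^sup>2 * \<rho> x) + 1/2 * ((cmod (\<psi> x))\<^sup>2 * \<rho> x)" if "x \<in> W" for x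
        using par[of x] nn[OF that, of m] nn[OF that, of d] by linarith
    qed
    have id: "set_integrable lborel W (\<lambda>z. (cmod (d z))\<^sup>2 * \<rho> z)"
    proof (rule set_integrable_real_bound[OF s W cw[OF hmd(2)]])
      show "\<bar>(cmod (d x))\<^sup>2 * \<rho> x\<bar> \<le> 1/2 * ((cmod (\<phi> x))\<^sup>2 * \<rho> x) + 1/2 * ((cmod (\<psi> x))\<^sup>2 * \<rho> x)" if "x \<in> W" for x
        using par[of x] nn[OF that, of m] nn[OF that, of d] by linarith
    qed
    have "N m + N d = (LINT z:W|lborel. 1/2 * ((cmod (\<phi> z))\<^sup>2 * \<rho> z) + 1/2 * ((cmod (\<psi> z))\<^sup>2 * \<rho> z))"
      unfolding N_def par[symmetric] by (rule set_integral_add(2)[OF im id, symmetric])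
    also have "\<dots> = 1/2 * N \<phi> + 1/2 * N \<psi>"
      unfolding N_def set_integral_mult_right[symmetric] by (rule set_integral_add(2)) (intro set_integrable_mult_right int)+
    finally have "N m + N d = 1 / c" using N\<phi> N\<psi> by simp
    moreover have "1 / c \<le> N m"
      by (rule low) (use hmd im \<phi>(2) \<psi>(2) in \<open>auto simp: bergman_space_def m_def\<close>)
    ultimately have "N d \<le> 0" by linarith
    from vanish[OF hmd(2) id this z] have "\<psi> z = \<phi> z" by (simp add: d_def)
    then have "\<psi> z / of_real ((bergman_norm W \<rho> \<psi>)\<^sup>2) = \<kappa> z"
      unfolding norm2 N\<psi> using c by (simp add: \<phi>_def)
    then show ?thesis using True unfolding bergman_kernel_def Let_def \<psi>_def by simp
  next
    case False
    \<comment> \<open>Otherwise a multiple of \<open>\<kappa>\<close> would take the value 1 at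
      \<open>w\<close>. Hence c = 0, the norm of \<open>\<kappa>\<close> is 0, and both sides of the
      claim vanish.\<close>
    have "\<kappa> w = 0"
    proof (rule ccontr)
      assume "\<kappa> w \<noteq> 0"
      then show False using False scale(1)[OF \<kappa>(1), of "1 / \<kappa> w"] by force
    qed
    then have "N \<kappa> \<le> 0" using \<kappa>(2,3) by (simp add: N_def)
    then have "\<kappa> z = 0" using vanish[OF _ _ _ z] \<kappa>(1) unfolding bergman_space_def by blast
    then show ?thesis using False unfolding bergman_kernel_def by simp
  qed
qed

section \<open>Exhaustion\<close>

lemma uniform_limit_compact:
  assumes lu: "locally_uniform_limit S f l" and K: "compact K" "K \<subseteq> S"
  shows "uniform_limit K f l sequentially"
proof -
  have "\<forall>p\<in>K. \<exists>e>0. uniform_limit (ball p e \<inter> S) f l sequentially"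
    using lu K(2) unfolding locally_uniform_limit_def by blast
  then obtain e where e: "\<And>p. p \<in> K \<Longrightarrow> e p > 0" "\<And>p. p \<in> K \<Longrightarrow> uniform_limit (ball p (e p) \<inter> S) f l sequentially"
    by metis
  obtain T where T: "T \<subseteq> K" "finite T" "K \<subseteq> (\<Union>p\<in>T. ball p (e p))"
    by (rule compactE_image[OF K(1), of K "\<lambda>p. ball p (e p)"]) (use e(1) in auto)
  show ?thesis
  proof (rule uniform_limitI)
    fix d :: real assume d: "d > 0"
    have "\<forall>\<^sub>F n in sequentially. \<forall>p\<in>T. \<forall>x\<in>ball p (e p) \<inter> S. dist (f n x) (l x) < d"
      using T(1) e(2) uniform_limitD[OF _ d] by (subst eventually_ball_finite_distrib[OF T(2)]) blast
    then show "\<forall>\<^sub>F n in sequentially. \<forall>x\<in>K. dist (f n x) (l x) < d"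
      by eventually_elim (use T(3) K(2) in blast)
  qed
qed

lemma has_wirt_ln_cmod:
  assumes "z \<noteq> w"
  shows "has_wirt (\<lambda>z. of_real (ln (cmod (z - w)))) (1 / (2 * (z - w))) (1 / (2 * cnj (z - w))) z"
proof -
  have sq: "(cmod (z - w))\<^sup>2 > 0" using assms by simp
  have "(ln has_real_derivative 1 / (cmod (z - w))\<^sup>2) (at ((cmod (z - w))\<^sup>2))"
    using DERIV_ln_divide[OF sq] .
  from DERIV_cdivide[OF this, of 2]
  have "((\<lambda>t. ln t / 2) has_real_derivative 1 / (cmod (z - w))\<^sup>2 / 2) (at ((cmod (z - w))\<^sup>2))" .
  from has_wirt_chain_real[OF has_wirt_cmod_sq this]
  have 1: "has_wirt (\<lambda>z. of_real (ln ((cmod (z - w))\<^sup>2) / 2)) (of_real (1 / (cmod (z - w))\<^sup>2 / 2) * cnj (z - w))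
     (of_real (1 / (cmod (z - w))\<^sup>2 / 2) * (z - w)) z" .
  have eq: "ln ((cmod (x - w))\<^sup>2) / 2 = ln (cmod (x - w))" for x
    by (cases "x = w") (simp_all add: ln_realpow)
  have "of_real (1 / (cmod y)\<^sup>2 / 2) * cnj y = 1 / (2 * y)" "of_real (1 / (cmod y)\<^sup>2 / 2) * y = 1 / (2 * cnj y)"
    if "y \<noteq> 0" for y using that by (simp_all add: of_real_cmod_power2)
  then have 2: "of_real (1 / (cmod (z - w))\<^sup>2 / 2) * cnj (z - w) = 1 / (2 * (z - w))"
    and 3: "of_real (1 / (cmod (z - w))\<^sup>2 / 2) * (z - w) = 1 / (2 * cnj (z - w))"
    using assms by (simp_all del: complex_cnj_diff of_real_divide)
  show ?thesis using has_wirt_cong[OF 1 2 3] unfolding eq .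
qed

text \<open>\<open>h n v\<close> is the regular part for the pole \<open>v\<close> in the n-th
  domain and \<open>\<eta>\<close> is the limit. Convergence is assumed on products that stay off
  the diagonal, which is what \<open>green_function\<close> provides; the behaviour at z = w has to
  be derived.\<close>

locale exhaustion =
  fixes W :: "complex set" and w :: complex and D :: "nat \<Rightarrow> complex set"
    and h :: "nat \<Rightarrow> complex \<Rightarrow> complex \<Rightarrow> complex" and \<eta> :: "complex \<Rightarrow> complex \<Rightarrow> complex"
  assumes D: "\<And>n. open (D n)" "\<And>n. bounded (D n)" "\<And>n. w \<in> D n" "\<And>n. D n \<subseteq> D (Suc n)"
    and W: "W = (\<Union>n. D n)"
    and h: "\<And>n v. v \<in> D n \<Longrightarrow> dirichlet (D n) (\<lambda>z. of_real (ln (cmod (z - v)))) (h n v)"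
    and conv: "\<And>K r. compact K \<Longrightarrow> K \<subseteq> W \<Longrightarrow> cball w r \<subseteq> W \<Longrightarrow> K \<inter> cball w r = {} \<Longrightarrow>
       uniform_limit (K \<times> cball w r) (\<lambda>n (z, v). h n v z) (\<lambda>(z, v). \<eta> z v) sequentially"
begin

definition "H n z = wirt_bar (\<lambda>v. h n v z) w"
text \<open>Defined as a limit and not through \<open>\<eta>\<close>, which carries no information
  at z = w.\<close>

definition "L z = lim (\<lambda>n. H n z)"

lemma openW: "open W" unfolding W using D(1) by blast

lemma wW: "w \<in> W" unfolding W using D(3) by blast

lemma mono: "m \<le> n \<Longrightarrow> D m \<subseteq> D n"
  using lift_Suc_mono_le[of D m n] D(4) by blast

lemma compact_subset_D:
  assumes "compact K" "K \<subseteq> W" shows "\<exists>N. \<forall>n\<ge>N. K \<subseteq> D n"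
proof -
  obtain T where T: "finite T" "K \<subseteq> (\<Union>n\<in>T. D n)"
    by (rule compactE_image[OF assms(1), of UNIV D]) (use D(1) assms(2) W in auto)
  obtain N where N: "\<And>m. m \<in> T \<Longrightarrow> m \<le> N" using T(1) unfolding finite_nat_set_iff_bounded_le by blast
  have "K \<subseteq> D n" if "n \<ge> N" for n using T(2) mono N that by (meson UN_least order_trans)
  then show ?thesis by blast
qed

lemma eventually_subset: "compact K \<Longrightarrow> K \<subseteq> W \<Longrightarrow> \<forall>\<^sub>F n in sequentially. K \<subseteq> D n"
  using compact_subset_D unfolding eventually_sequentially by blast

lemma H_dirichlet: "dirichlet (D n) (\<lambda>z. - 1 / (2 * cnj (z - w))) (H n)"
  unfolding H_def[abs_def] by (rule log_potential_parameter(2)[OF D(1,2) h D(3)])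

lemma H_harmonic: "H n harmonic_on D n"
  using H_dirichlet unfolding dirichlet_def by blast

lemma h_harmonic: "z \<in> D n \<Longrightarrow> (\<lambda>v. h n v z) harmonic_on D n"
  using log_potential_parameter(1)[OF D(1,2) h] closure_subset by blast

text \<open>The gradient estimate in the second variable turns uniform convergence on
  \<open>K\<close> times a disc about \<open>w\<close> into uniform convergence on \<open>K\<close>
  of the derivatives at \<open>w\<close>.\<close>

lemma eta_facts:
  assumes K: "compact K" "K \<subseteq> W" "K \<inter> cball w r = {}" and r: "r > 0" "cball w r \<subseteq> W"
  shows "\<And>z. z \<in> K \<Longrightarrow> (\<lambda>v. \<eta> z v) harmonic_on ball w r"
    and "uniform_limit K H (\<lambda>z. wirt_bar (\<lambda>v. \<eta> z v) w) sequentially"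
proof -
  have ul: "uniform_limit (K \<times> cball w r) (\<lambda>n (z, v). h n v z) (\<lambda>(z, v). \<eta> z v) sequentially"
    by (rule conv[OF K(1,2) r(2) K(3)])
  have ev: "\<forall>\<^sub>F n in sequentially. K \<subseteq> D n \<and> cball w r \<subseteq> D n"
    using eventually_subset[OF K(1,2)] eventually_subset[OF compact_cball r(2)] by eventually_elim blast
  have hb: "(\<lambda>v. h n v z) harmonic_on ball w r" if "z \<in> K" "K \<subseteq> D n \<and> cball w r \<subseteq> D n" for n z
    by (rule harmonic_on_subset[OF h_harmonic]) (use that ball_subset_cball in auto)
  show har: "(\<lambda>v. \<eta> z v) harmonic_on ball w r" if z: "z \<in> K" for z
  proof (rule harmonic_uniform_limit(1)[OF _ r(1)])
    show "\<forall>\<^sub>F n in sequentially. (\<lambda>v. h n v z) harmonic_on ball w r"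
      using ev by eventually_elim (use hb[OF z] in blast)
    show "uniform_limit (ball w r) (\<lambda>n v. h n v z) (\<lambda>v. \<eta> z v) sequentially"
    proof (rule uniform_limitI)
      fix e :: real assume "e > 0"
      then have "\<forall>\<^sub>F n in sequentially. \<forall>x\<in>K \<times> cball w r. dist (case x of (z, v) \<Rightarrow> h n v z) (case x of (z, v) \<Rightarrow> \<eta> z v) < e"
        by (rule uniform_limitD[OF ul])
      then show "\<forall>\<^sub>F n in sequentially. \<forall>v\<in>ball w r. dist (h n v z) (\<eta> z v) < e"
        by eventually_elim (use z in force)
    qed
  qed
  show "uniform_limit K H (\<lambda>z. wirt_bar (\<lambda>v. \<eta> z v) w) sequentially"
  proof (rule uniform_limitI)
    fix e :: real assume e: "e > 0"
    \<comment> \<open>The gradient estimate on radius r then gives 4 e' / r = e / 2.\<close>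
    define e' where "e' = e * r / 8"
    have e': "e' > 0" using e r by (simp add: e'_def)
    have "\<forall>\<^sub>F n in sequentially. \<forall>x\<in>K \<times> cball w r. dist (case x of (z, v) \<Rightarrow> h n v z) (case x of (z, v) \<Rightarrow> \<eta> z v) < e'"
      by (rule uniform_limitD[OF ul e'])
    with ev show "\<forall>\<^sub>F n in sequentially. \<forall>z\<in>K. dist (H n z) (wirt_bar (\<lambda>v. \<eta> z v) w) < e"
    proof eventually_elim
      case (elim n)
      show ?case
      proof
        fix z assume z: "z \<in> K"
        have "cmod (wirt_bar (\<lambda>v. h n v z) w - wirt_bar (\<lambda>v. \<eta> z v) w) \<le> 4 * e' / r"
        proof (rule harmonic_gradient_diff(2)[OF hb[OF z elim(1)] har[OF z] r(1)])
          fix v assume "v \<in> ball w r"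
          then have "(z, v) \<in> K \<times> cball w r" using z by simp
          then have "dist (h n v z) (\<eta> z v) < e'" using elim(2) by fastforce
          then show "cmod (h n v z - \<eta> z v) \<le> e'" by (simp add: dist_norm)
        qed
        also have "\<dots> < e" using e r by (simp add: e'_def)
        finally show "dist (H n z) (wirt_bar (\<lambda>v. \<eta> z v) w) < e" by (simp add: dist_norm H_def)
      qed
    qed
  qed
qed

lemma punctured_compact:
  assumes K: "compact K" "K \<subseteq> W" "w \<notin> K"
  obtains r where "r > 0" "cball w r \<subseteq> W" "K \<inter> cball w r = {}"
proof -
  have "open (W - K)" using openW K(1) by (simp add: open_Diff compact_imp_closed)
  then obtain r where "r > 0" "cball w r \<subseteq> W - K" using wW K(3) open_contains_cball by blast
  then show ?thesis using that by blast
qed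

lemma H_uniform_limit:
  assumes K: "compact K" "K \<subseteq> W" "w \<notin> K"
  shows "uniform_limit K H (\<lambda>z. wirt_bar (\<lambda>v. \<eta> z v) w) sequentially"
  using punctured_compact[OF K] eta_facts(2)[OF K(1,2)] by metis

text \<open>Convergence is known on circles avoiding \<open>w\<close>; the maximum principle fills
  in the discs, including those centred at \<open>w\<close>.\<close>

lemma local_limit:
  assumes a: "a \<in> W"
  obtains s g where "s > 0" "ball a s \<subseteq> W" "uniform_limit (ball a s) H g sequentially"
    "\<forall>\<^sub>F n in sequentially. H n harmonic_on ball a s"
proof -
  obtain t where t: "t > 0" "cball a t \<subseteq> W" using a openW open_contains_cball by blast
  define R where "R = (if a = w then t / 2 else min (t / 2) (dist a w / 2))"
  have R: "R > 0" "R < t" "w \<notin> sphere a R" using t(1) by (auto simp: R_def min_def)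
  have ct: "cball a R \<subseteq> cball a t" using R by auto
  obtain N where N: "\<And>n. n \<ge> N \<Longrightarrow> cball a t \<subseteq> D n" using compact_subset_D[OF compact_cball t(2)] by blast
  have har: "H (n + N) harmonic_on ball a t" for n
    by (rule harmonic_on_subset[OF H_harmonic]) (use N[of "n + N"] ball_subset_cball in auto)
  have "uniform_limit (sphere a R) H (\<lambda>z. wirt_bar (\<lambda>v. \<eta> z v) w) sequentially"
  proof (rule H_uniform_limit)
    have "sphere a R \<subseteq> cball a R" by auto
    then show "sphere a R \<subseteq> W" using ct t(2) by blast
  qed (use R in auto)
  then have "uniform_limit (sphere a R) (\<lambda>n. H (n + N)) (\<lambda>z. wirt_bar (\<lambda>v. \<eta> z v) w) sequentially"
    by (rule uniform_limit_shift)
  then obtain g where g: "uniform_limit (cball a R) (\<lambda>n. H (n + N)) g sequentially"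
    by (rule harmonic_uniform_limit_from_sphere[OF har R(1,2)]) blast
  have "uniform_limit (ball a R) H g sequentially"
  proof (rule uniform_limitI)
    fix e :: real assume "e > 0"
    then have "\<forall>\<^sub>F n in sequentially. \<forall>x\<in>cball a R. dist (H (n + N) x) (g x) < e" by (rule uniform_limitD[OF g])
    then have "\<forall>\<^sub>F n in sequentially. \<forall>x\<in>cball a R. dist (H n x) (g x) < e"
      using eventually_sequentially_seg[of "\<lambda>n. \<forall>x\<in>cball a R. dist (H n x) (g x) < e" N] by simp
    then show "\<forall>\<^sub>F n in sequentially. \<forall>x\<in>ball a R. dist (H n x) (g x) < e"
      by eventually_elim auto
  qed
  moreover have "\<forall>\<^sub>F n in sequentially. H n harmonic_on ball a R"
    unfolding eventually_sequentially
  proof (intro exI[of _ N] allI impI)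
    fix n assume n: "n \<ge> N"
    have "ball a R \<subseteq> D n" using N[OF n] ct ball_subset_cball by blast
    then show "H n harmonic_on ball a R" by (rule harmonic_on_subset[OF H_harmonic])
  qed
  moreover have "ball a R \<subseteq> W" using ct t(2) ball_subset_cball by blast
  ultimately show ?thesis using that R(1) by blast
qed

lemma L_facts:
  shows "L harmonic_on W" and "\<And>z. z \<in> W \<Longrightarrow> (\<lambda>n. wirt (H n) z) \<longlonglongrightarrow> wirt L z"
    and "\<And>z. z \<in> W \<Longrightarrow> z \<noteq> w \<Longrightarrow> L z = wirt_bar (\<lambda>v. \<eta> z v) w"
    and "\<And>z. z \<in> W \<Longrightarrow> z \<noteq> w \<Longrightarrow> has_wirt (\<lambda>v. \<eta> z v) (wirt (\<lambda>v. \<eta> z v) w) (L z) w"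
proof -
  have loc: "\<exists>s>0. L harmonic_on ball a s \<and> (\<lambda>n. wirt (H n) a) \<longlonglongrightarrow> wirt L a" if a: "a \<in> W" for a
  proof -
    obtain s g where sg: "s > 0" "ball a s \<subseteq> W" "uniform_limit (ball a s) H g sequentially"
      "\<forall>\<^sub>F n in sequentially. H n harmonic_on ball a s"
      by (rule local_limit[OF a]) blast
    have eq: "L x = g x" if "x \<in> ball a s" for x
      unfolding L_def using tendsto_uniform_limitI[OF sg(3) that] by (rule limI)
    have ul: "uniform_limit (ball a s) H L sequentially"
    proof (rule uniform_limitI)
      fix e :: real assume "e > 0"
      from uniform_limitD[OF sg(3) this] show "\<forall>\<^sub>F n in sequentially. \<forall>x\<in>ball a s. dist (H n x) (L x) < e"
        by eventually_elim (simp add: eq)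
    qed
    show ?thesis
      using harmonic_uniform_limit(1)[OF sg(4,1) ul] harmonic_uniform_limit(2)[OF sg(4,1) ul, of a] sg(1) by auto
  qed
  show "L harmonic_on W"
    by (rule harmonic_on_open_cover) (metis loc open_ball centre_in_ball)
  show "\<And>z. z \<in> W \<Longrightarrow> (\<lambda>n. wirt (H n) z) \<longlonglongrightarrow> wirt L z" using loc by blast
  show Lz: "L z = wirt_bar (\<lambda>v. \<eta> z v) w" if z: "z \<in> W" "z \<noteq> w" for z
  proof -
    have "uniform_limit {z} H (\<lambda>z. wirt_bar (\<lambda>v. \<eta> z v) w) sequentially"
      by (rule H_uniform_limit) (use z in auto)
    then have "(\<lambda>n. H n z) \<longlonglongrightarrow> wirt_bar (\<lambda>v. \<eta> z v) w" by (rule tendsto_uniform_limitI) simp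
    then show ?thesis unfolding L_def by (rule limI)
  qed
  show "has_wirt (\<lambda>v. \<eta> z v) (wirt (\<lambda>v. \<eta> z v) w) (L z) w" if z: "z \<in> W" "z \<noteq> w" for z
  proof -
    have c: "compact {z}" "{z} \<subseteq> W" "w \<notin> {z}" using z by auto
    obtain r where r: "r > 0" "cball w r \<subseteq> W" "{z} \<inter> cball w r = {}" by (rule punctured_compact[OF c]) blast
    have "(\<lambda>v. \<eta> z v) harmonic_on ball w r" by (rule eta_facts(1)[OF c(1,2) r(3,1,2)]) simp
    from harmonic_on_has_wirt[OF this, of w] show ?thesis using r(1) Lz[OF z] by simp
  qed
qed

definition "\<kappa> z = - (2 / of_real pi) * wirt L z"

lemma kappa_holomorphic: "\<kappa> holomorphic_on W"
  using L_facts(1) unfolding harmonic_on_def \<kappa>_def by (intro holomorphic_intros) auto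

text \<open>Fatou's lemma yields the norm as an inequality, the form that
  \<open>bergman_kernel_eqI\<close> asks for. The evaluation bound passes to the limit because
  integrals of |f|^2 over the subdomains are at most the integral over \<open>W\<close>.\<close>

lemma kappa_bounds:
  shows "set_integrable lborel W (\<lambda>z. (cmod (\<kappa> z))\<^sup>2)"
    and "(LINT z:W|lborel. (cmod (\<kappa> z))\<^sup>2) \<le> Re (\<kappa> w)" and "\<kappa> w = of_real (Re (\<kappa> w))"
    and "\<And>f. f holomorphic_on W \<Longrightarrow> set_integrable lborel W (\<lambda>z. (cmod (f z))\<^sup>2) \<Longrightarrow>
       (cmod (f w))\<^sup>2 \<le> (LINT z:W|lborel. (cmod (f z))\<^sup>2) * Re (\<kappa> w)"
proof -
  define k where "k n z = - (2 / of_real pi) * wirt (H n) z" for n z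
  note kb = kernel_bounds[OF D(1,2,3) H_dirichlet, folded k_def]
  have lim: "(\<lambda>n. k n z) \<longlonglongrightarrow> \<kappa> z" if "z \<in> W" for z
    unfolding k_def \<kappa>_def by (intro tendsto_mult tendsto_const L_facts(2) that)
  define N where "N n = (LINT z:D n|lborel. (cmod (k n z))\<^sup>2)" for n
  have kw: "k n w = of_real (N n)" for n unfolding N_def by (rule kb(3))
  have Nl: "N \<longlonglongrightarrow> Re (\<kappa> w)" using tendsto_Re[OF lim[OF wW]] by (simp add: kw)
  have "(\<lambda>n. Im (k n w)) \<longlonglongrightarrow> Im (\<kappa> w)" by (rule tendsto_Im[OF lim[OF wW]])
  then have "Im (\<kappa> w) = 0" by (simp add: kw LIMSEQ_const_iff)
  then show "\<kappa> w = of_real (Re (\<kappa> w))" by (simp add: complex_eq_iff)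
  have evD: "\<forall>\<^sub>F n in sequentially. z \<in> D n" if "z \<in> W" for z
    using eventually_subset[of "{z}"] that by simp
  have pt: "(\<lambda>n. indicat_real (D n) z *\<^sub>R (cmod (k n z))\<^sup>2) \<longlonglongrightarrow> indicat_real W z *\<^sub>R (cmod (\<kappa> z))\<^sup>2" for z
  proof (cases "z \<in> W")
    case True
    have "(\<lambda>n. (cmod (k n z))\<^sup>2) \<longlonglongrightarrow> (cmod (\<kappa> z))\<^sup>2" by (intro tendsto_intros lim True)
    moreover have "\<forall>\<^sub>F n in sequentially. (cmod (k n z))\<^sup>2 = indicat_real (D n) z *\<^sub>R (cmod (k n z))\<^sup>2"
      using evD[OF True] by eventually_elim simp
    ultimately show ?thesis using True by (simp add: Lim_transform_eventually)
  next
    case False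
    then have "z \<notin> D n" for n using W by blast
    then show ?thesis using False by simp
  qed
  have meas: "(\<lambda>z. indicat_real W z *\<^sub>R (cmod (\<kappa> z))\<^sup>2) \<in> borel_measurable lborel"
    by (rule borel_measurable_open_continuous[OF openW])
       (intro continuous_intros holomorphic_on_imp_continuous_on kappa_holomorphic)
  have F1: "integrable lborel (\<lambda>z. indicat_real (D n) z *\<^sub>R (cmod (k n z))\<^sup>2)" for n
    using kb(2)[of n] unfolding set_integrable_def .
  have F2: "(LINT z|lborel. indicat_real (D n) z *\<^sub>R (cmod (k n z))\<^sup>2) \<le> N n" for n
    by (simp add: N_def set_lebesgue_integral_def)
  have F3: "AE z in lborel. (\<lambda>n. indicat_real (D n) z *\<^sub>R (cmod (k n z))\<^sup>2) \<longlonglongrightarrow> indicat_real W z *\<^sub>R (cmod (\<kappa> z))\<^sup>2"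
    using pt by simp
  note Fat = Fatou_integrable[OF F1 _ F3 meas _ F2 Nl]
  show "set_integrable lborel W (\<lambda>z. (cmod (\<kappa> z))\<^sup>2)"
    unfolding set_integrable_def by (rule Fat(1)) (auto simp: indicator_def)
  show "(LINT z:W|lborel. (cmod (\<kappa> z))\<^sup>2) \<le> Re (\<kappa> w)"
    unfolding set_lebesgue_integral_def by (rule Fat(2)) (auto simp: indicator_def)
  fix f assume f: "f holomorphic_on W" "set_integrable lborel W (\<lambda>z. (cmod (f z))\<^sup>2)"
  have "(cmod (f w))\<^sup>2 \<le> (LINT z:W|lborel. (cmod (f z))\<^sup>2) * N n" for n
  proof -
    have sub: "D n \<subseteq> W" using W by blast
    have fD: "set_integrable lborel (D n) (\<lambda>z. (cmod (f z))\<^sup>2)"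
      by (rule set_integrable_subset[OF f(2) _ sub]) (use D(1) in auto)
    have "(cmod (f w))\<^sup>2 \<le> (LINT z:D n|lborel. (cmod (f z))\<^sup>2) * Re (k n w)"
      by (rule kb(4)[OF holomorphic_on_subset[OF f(1) sub] fD])
    also have "\<dots> \<le> (LINT z:W|lborel. (cmod (f z))\<^sup>2) * Re (k n w)"
    proof (rule mult_right_mono)
      show "(LINT z:D n|lborel. (cmod (f z))\<^sup>2) \<le> (LINT z:W|lborel. (cmod (f z))\<^sup>2)"
        unfolding set_lebesgue_integral_def
        by (rule integral_mono[OF fD[unfolded set_integrable_def] f(2)[unfolded set_integrable_def]])
           (use sub in \<open>auto simp: indicator_def\<close>)
      show "0 \<le> Re (k n w)" unfolding kw N_def set_lebesgue_integral_def
        by (simp add: Bochner_Integration.integral_nonneg)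
    qed
    finally show ?thesis by (simp add: kw)
  qed
  moreover have "(\<lambda>n. (LINT z:W|lborel. (cmod (f z))\<^sup>2) * N n) \<longlonglongrightarrow> (LINT z:W|lborel. (cmod (f z))\<^sup>2) * Re (\<kappa> w)"
    by (intro tendsto_mult tendsto_const Nl)
  ultimately show "(cmod (f w))\<^sup>2 \<le> (LINT z:W|lborel. (cmod (f z))\<^sup>2) * Re (\<kappa> w)"
    by (intro LIMSEQ_le_const) auto
qed

text \<open>Multiplication by \<open>m\<close> is an isometry from the space with weight |m|^2 to
  the unweighted one and changes evaluation at \<open>w\<close> by the factor
  \<open>m w\<close>.\<close>

lemma weighted_bergman_kernel:
  assumes m: "m holomorphic_on W" "\<And>z. z \<in> W \<Longrightarrow> m z \<noteq> 0" and z: "z \<in> W"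
  shows "bergman_kernel W (\<lambda>z. (cmod (m z))\<^sup>2) z w = \<kappa> z / (m z * cnj (m w))"
proof (rule bergman_kernel_eqI[where c = "Re (\<kappa> w) / (cmod (m w))\<^sup>2" and \<kappa> = "\<lambda>z. \<kappa> z / (m z * cnj (m w))", OF openW _ _ _ _ _ _ z])
  let ?\<rho> = "\<lambda>z. (cmod (m z))\<^sup>2" and ?k = "\<lambda>z. \<kappa> z / (m z * cnj (m w))"
  have w0: "m w \<noteq> 0" by (rule m(2)[OF wW])
  show "continuous_on W ?\<rho>" by (intro continuous_intros holomorphic_on_imp_continuous_on m)
  show "\<And>z. z \<in> W \<Longrightarrow> 0 < ?\<rho> z" using m(2) by simp
  have eq: "(cmod (?k z))\<^sup>2 * ?\<rho> z = (1 / (cmod (m w))\<^sup>2) * (cmod (\<kappa> z))\<^sup>2" if "z \<in> W" for z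
    using m(2)[OF that] by (simp add: norm_divide norm_mult power_divide power_mult_distrib)
  have ind: "indicat_real W z *\<^sub>R ((cmod (?k z))\<^sup>2 * ?\<rho> z) = indicat_real W z *\<^sub>R ((1 / (cmod (m w))\<^sup>2) * (cmod (\<kappa> z))\<^sup>2)" for z
    using eq[of z] by (cases "z \<in> W") simp_all
  have si: "set_integrable lborel W (\<lambda>z. (cmod (?k z))\<^sup>2 * ?\<rho> z)"
    unfolding set_integrable_def ind
    using set_integrable_mult_right[OF kappa_bounds(1)] unfolding set_integrable_def by blast
  show "?k \<in> bergman_space W ?\<rho>"
    unfolding bergman_space_def using si m(2) w0 by (auto intro!: holomorphic_intros kappa_holomorphic m(1))
  have "(LINT z:W|lborel. (cmod (?k z))\<^sup>2 * ?\<rho> z) = (LINT z:W|lborel. (1 / (cmod (m w))\<^sup>2) * (cmod (\<kappa> z))\<^sup>2)"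
    unfolding set_lebesgue_integral_def ind ..
  also have "\<dots> = (1 / (cmod (m w))\<^sup>2) * (LINT z:W|lborel. (cmod (\<kappa> z))\<^sup>2)" by (rule set_integral_mult_right)
  also have "\<dots> \<le> (1 / (cmod (m w))\<^sup>2) * Re (\<kappa> w)" by (rule mult_left_mono[OF kappa_bounds(2)]) simp
  finally show "(LINT z:W|lborel. (cmod (?k z))\<^sup>2 * ?\<rho> z) \<le> Re (\<kappa> w) / (cmod (m w))\<^sup>2" by simp
  show "?k w = of_real (Re (\<kappa> w) / (cmod (m w))\<^sup>2)"
    by (subst kappa_bounds(3)) (simp add: of_real_cmod_power2)
  fix f assume f: "f \<in> bergman_space W ?\<rho>"
  have F: "(cmod (f z * m z))\<^sup>2 = (cmod (f z))\<^sup>2 * ?\<rho> z" for z by (simp add: norm_mult power_mult_distrib)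
  have "(cmod (f w * m w))\<^sup>2 \<le> (LINT z:W|lborel. (cmod (f z * m z))\<^sup>2) * Re (\<kappa> w)"
    by (rule kappa_bounds(4)) (use f m(1) in \<open>auto simp: bergman_space_def F intro!: holomorphic_intros\<close>)
  then have "(cmod (f w))\<^sup>2 * ?\<rho> w \<le> (LINT z:W|lborel. (cmod (f z))\<^sup>2 * ?\<rho> z) * Re (\<kappa> w)" unfolding F .
  then show "(cmod (f w))\<^sup>2 \<le> (LINT z:W|lborel. (cmod (f z))\<^sup>2 * ?\<rho> z) * (Re (\<kappa> w) / ?\<rho> w)"
    using w0 by (simp add: pos_le_divide_eq)
qed

end

text \<open>\<open>wirt\<close> and \<open>wirt_bar\<close> are total operators, so
  differentiability is claimed along with the formula: it makes the iterated derivative a genuine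
  one.\<close>

theorem theorem3p1:
  fixes W U :: "complex set"
    and \<mu> :: "complex \<Rightarrow> complex"
    and \<rho> :: "complex \<Rightarrow> real"
    and G :: "complex \<Rightarrow> complex \<Rightarrow> complex"
    and z w :: complex
  assumes "open W" and "connected W"
    and "\<exists>f \<in> bergman_space W (\<lambda>_. 1). \<exists>\<zeta>\<in>W. f \<zeta> \<noteq> 0"
    and "open U" and "closure W \<subseteq> U" and "\<mu> holomorphic_on U"
    and "\<forall>\<zeta> \<in> closure W. \<mu> \<zeta> \<noteq> 0"
    and "\<rho> = (\<lambda>\<zeta>. (cmod (\<mu> \<zeta>))\<^sup>2)"
    and "green_function W \<rho> G"
    and "z \<in> W" and "w \<in> W" and "z \<noteq> w"
  shows "(\<forall>\<^sub>F z' in nhds z. (\<lambda>w'. G z' w') differentiable (at w)) \<and>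
         (\<lambda>z'. wirt_bar (\<lambda>w'. G z' w') w) differentiable (at z) \<and>
         bergman_kernel W \<rho> z w =
           - (2 / (complex_of_real pi * complex_of_real (\<rho> z) * complex_of_real (\<rho> w))) *
           wirt (\<lambda>z'. wirt_bar (\<lambda>w'. G z' w') w) z"
proof -
  note W = assms(1) and U = assms(4,5) and \<mu> = assms(6,7) and \<rho> = assms(8) and z = assms(10) and w = assms(11) and zw = assms(12)
  obtain E g where E: "jordan_exhaustion W E" and g: "\<And>j. green_function_on_jordan_domain (E j) \<rho> (g j)"
    and lim: "locally_uniform_limit {(z, w). z \<in> W \<and> w \<in> W \<and> z \<noteq> w} (\<lambda>j (z, w). g j z w) (\<lambda>(z, w). G z w)"
    using assms(9) unfolding green_function_def by blast
  have Eo: "open (E j)" "bounded (E j)" "closure (E j) \<subseteq> E (Suc j)" and WE: "W = (\<Union>j. E j)" for j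
    using E unfolding jordan_exhaustion_def jordan_domain_def by auto
  have WU: "W \<subseteq> closure W" by (rule closure_subset)
  have EW: "closure (E j) \<subseteq> W" for j using Eo(3) WE by blast
  have \<mu>W: "\<mu> holomorphic_on W" using \<mu>(1) U(2) WU by (meson holomorphic_on_subset order_trans)
  have \<mu>0: "\<mu> x \<noteq> 0" if "x \<in> W" for x using \<mu>(2) WU that by blast
  have c\<mu>: "continuous_on W \<mu>" by (rule holomorphic_on_imp_continuous_on[OF \<mu>W])
  \<comment> \<open>Dropping the first domains puts \<open>w\<close> into all of the remaining
    ones.\<close>
  obtain N where N: "w \<in> E N" using w WE by blast
  define D where "D n = E (n + N)" for n
  define k where "k n = g (n + N)" for n
  have mono: "E i \<subseteq> E (i + m)" for i m
  proof (induction m)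
    case (Suc m)
    have "E (i + m) \<subseteq> E (Suc (i + m))" using Eo(3) closure_subset by (meson order_trans)
    then show ?case using Suc by simp
  qed simp
  define P where "P n v f \<longleftrightarrow> dirichlet (D n) (\<lambda>x. of_real (ln (cmod (x - v)))) f \<and>
      (\<forall>x\<in>D n. x \<noteq> v \<longrightarrow> k n x v = cnj (\<mu> x) * \<mu> v * (f x - of_real (ln (cmod (x - v)))))" for n v f
  have ex: "\<exists>f. P n v f" if v: "v \<in> D n" for n v
  proof (rule green_function_decomposition[of "D n" U \<mu> \<rho> "k n" v])
    show "closure (D n) \<subseteq> U" using EW[of "n + N"] WU U(2) unfolding D_def by blast
    show "\<And>x. x \<in> closure (D n) \<Longrightarrow> \<mu> x \<noteq> 0" using EW[of "n + N"] \<mu>0 unfolding D_def by blast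
    show ?thesis if "dirichlet (D n) (\<lambda>x. of_real (ln (cmod (x - v)))) f"
      "\<And>x. x \<in> D n \<Longrightarrow> x \<noteq> v \<Longrightarrow> k n x v = cnj (\<mu> x) * \<mu> v * (f x - of_real (ln (cmod (x - v))))" for f
      using that unfolding P_def by blast
  qed (use Eo U \<mu> \<rho> g v in \<open>auto simp: D_def k_def\<close>)
  \<comment> \<open>One regular part is fixed for each domain and pole, so that it becomes a
    function of both.\<close>
  define h where "h n v = (SOME f. P n v f)" for n v
  have hP: "P n v (h n v)" if "v \<in> D n" for n v
    unfolding h_def by (rule someI_ex[OF ex[OF that]])
  have h: "\<And>n v. v \<in> D n \<Longrightarrow> dirichlet (D n) (\<lambda>x. of_real (ln (cmod (x - v)))) (h n v)"
    "\<And>n v x. v \<in> D n \<Longrightarrow> x \<in> D n \<Longrightarrow> x \<noteq> v \<Longrightarrow> k n x v = cnj (\<mu> x) * \<mu> v * (h n v x - of_real (ln (cmod (x - v))))"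
    using hP unfolding P_def by blast+
  \<comment> \<open>The decomposition of the approximating Green's functions, solved for the regular
    part and written with the limit \<open>G\<close>.\<close>
  define \<eta> where "\<eta> x v = G x v / (cnj (\<mu> x) * \<mu> v) + of_real (ln (cmod (x - v)))" for x v
  have DW: "W = (\<Union>n. D n)"
  proof
    show "W \<subseteq> (\<Union>n. D n)"
    proof
      fix x assume "x \<in> W"
      then obtain i where "x \<in> E i" using WE by blast
      then have "x \<in> D i" using mono[of i N] unfolding D_def by blast
      then show "x \<in> (\<Union>n. D n)" by blast
    qed
    show "(\<Union>n. D n) \<subseteq> W" unfolding D_def WE by blast
  qed
  have Dsub: "D n \<subseteq> D (n + m)" for n m using mono[of "n + N" m] unfolding D_def by (simp add: ac_simps)
  have Dev: "\<forall>\<^sub>F n in sequentially. K \<subseteq> D n" if K: "compact K" "K \<subseteq> W" for K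
  proof -
    obtain T where T: "finite T" "K \<subseteq> (\<Union>n\<in>T. D n)"
      by (rule compactE_image[OF K(1), of UNIV D]) (use Eo(1) K(2) DW in \<open>auto simp: D_def\<close>)
    obtain M where M: "\<And>m. m \<in> T \<Longrightarrow> m \<le> M" using T(1) unfolding finite_nat_set_iff_bounded_le by blast
    have "K \<subseteq> D n" if "n \<ge> M" for n
    proof -
      have "D m \<subseteq> D n" if "m \<in> T" for m using Dsub[of m "n - m"] M[OF that] \<open>n \<ge> M\<close> by simp
      then show ?thesis using T(2) by blast
    qed
    then show ?thesis unfolding eventually_sequentially by blast
  qed
  interpret exhaustion W w D h \<eta>
  proof
    show "open (D n)" "bounded (D n)" for n using Eo unfolding D_def by auto
    show "w \<in> D n" for n using mono[of N n] N unfolding D_def by (auto simp: add.commute)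
    show "D n \<subseteq> D (Suc n)" for n using Dsub[of n 1] by simp
    show "W = (\<Union>n. D n)" by (rule DW)
    show "dirichlet (D n) (\<lambda>x. of_real (ln (cmod (x - v)))) (h n v)" if "v \<in> D n" for n v by (rule h(1)[OF that])
    fix K r assume K: "compact K" "K \<subseteq> W" "cball w r \<subseteq> W" "K \<inter> cball w r = {}"
    let ?P = "K \<times> cball w r"
    have Pc: "compact ?P" by (intro compact_Times K) simp
    have "?P \<subseteq> {(z, w). z \<in> W \<and> w \<in> W \<and> z \<noteq> w}" using K by auto
    from uniform_limit_shift[OF uniform_limit_compact[OF lim Pc this], of N]
    have ul: "uniform_limit ?P (\<lambda>n (z, w). k n z w) (\<lambda>(z, w). G z w) sequentially" unfolding k_def .
    \<comment> \<open>In the difference of the regular parts the logarithms cancel; what is left is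
      the difference of the Green's functions times this factor, which is bounded on the compact
      product.\<close>
    have "continuous_on ?P (\<lambda>p. 1 / (cnj (\<mu> (fst p)) * \<mu> (snd p)))"
      by (intro continuous_intros continuous_on_compose2[OF c\<mu>]) (use K \<mu>0 in auto)
    then have "bounded ((\<lambda>p. 1 / (cnj (\<mu> (fst p)) * \<mu> (snd p))) ` ?P)"
      using compact_continuous_image[OF _ Pc] compact_imp_bounded by blast
    then obtain B where B: "B > 0" "\<And>p. p \<in> ?P \<Longrightarrow> cmod (1 / (cnj (\<mu> (fst p)) * \<mu> (snd p))) \<le> B"
      unfolding bounded_pos by auto
    show "uniform_limit ?P (\<lambda>n (z, v). h n v z) (\<lambda>(z, v). \<eta> z v) sequentially"
    proof (rule uniform_limitI)
      fix e :: real assume e: "e > 0"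
      have eB: "e / B > 0" using e B(1) by simp
      show "\<forall>\<^sub>F n in sequentially. \<forall>p\<in>?P. dist (case p of (z, v) \<Rightarrow> h n v z) (case p of (z, v) \<Rightarrow> \<eta> z v) < e"
        using uniform_limitD[OF ul eB] Dev[OF K(1,2)] Dev[OF compact_cball K(3)]
      proof eventually_elim
        case (elim n)
        show ?case
        proof
          fix p assume p: "p \<in> ?P"
          obtain x v where xv: "p = (x, v)" by (cases p)
          have x: "x \<in> K" "v \<in> cball w r" "x \<noteq> v" "x \<in> W" "v \<in> W" using p K unfolding xv by auto
          let ?q = "cnj (\<mu> x) * \<mu> v"
          have q0: "?q \<noteq> 0" using \<mu>0 x by simp
          have "k n x v = ?q * (h n v x - of_real (ln (cmod (x - v))))"
            by (rule h(2)) (use elim x in auto)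
          then have "h n v x = k n x v / ?q + of_real (ln (cmod (x - v)))" using q0 by (simp add: divide_simps)
          then have "h n v x - \<eta> x v = (k n x v - G x v) * (1 / ?q)"
            unfolding \<eta>_def by (simp add: diff_divide_distrib)
          then have "cmod (h n v x - \<eta> x v) = cmod (k n x v - G x v) * cmod (1 / ?q)" by (simp only: norm_mult)
          also have "\<dots> \<le> cmod (k n x v - G x v) * B"
            using B(2)[OF p] unfolding xv by (intro mult_left_mono) auto
          also have "\<dots> < e / B * B"
            using elim(1) p B(1) unfolding xv by (intro mult_strict_right_mono) (auto simp: dist_norm)
          finally show "dist (case p of (z, v) \<Rightarrow> h n v z) (case p of (z, v) \<Rightarrow> \<eta> z v) < e"
            using B(1) unfolding xv by (simp add: dist_norm)
        qed
      qed
    qed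
  qed
  \<comment> \<open>The logarithm is written in \<open>v - x\<close> because the next derivative is
    taken in the pole.\<close>
  have G_eq: "G x v = cnj (\<mu> x) * (\<mu> v * (\<eta> x v - of_real (ln (cmod (v - x)))))" if "x \<in> W" "v \<in> W" for x v
    using \<mu>0 that by (simp add: \<eta>_def norm_minus_commute)
  have G_wirt: "has_wirt (\<lambda>v. G x v)
      (cnj (\<mu> x) * (deriv \<mu> w * (\<eta> x w - of_real (ln (cmod (w - x)))) + \<mu> w * (wirt (\<lambda>v. \<eta> x v) w - 1 / (2 * (w - x)))))
      (cnj (\<mu> x) * (0 * (\<eta> x w - of_real (ln (cmod (w - x)))) + \<mu> w * (L x - 1 / (2 * cnj (w - x))))) w"
    if x: "x \<in> W" "x \<noteq> w" for x
  proof (rule has_wirt_transform[OF _ openW w])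
    show "has_wirt (\<lambda>v. cnj (\<mu> x) * (\<mu> v * (\<eta> x v - of_real (ln (cmod (v - x))))))
      (cnj (\<mu> x) * (deriv \<mu> w * (\<eta> x w - of_real (ln (cmod (w - x)))) + \<mu> w * (wirt (\<lambda>v. \<eta> x v) w - 1 / (2 * (w - x)))))
      (cnj (\<mu> x) * (0 * (\<eta> x w - of_real (ln (cmod (w - x)))) + \<mu> w * (L x - 1 / (2 * cnj (w - x))))) w"
      by (intro has_wirt_cmult has_wirt_mult has_wirt_diff has_wirt_ln_cmod L_facts(4) x has_wirt_holomorphic[OF \<mu>W openW w])
         (use x in simp)
    show "cnj (\<mu> x) * (\<mu> v * (\<eta> x v - of_real (ln (cmod (v - x))))) = G x v" if "v \<in> W" for v
      using G_eq[OF x(1) that] by simp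
  qed
  have op: "open (W - {w})" using openW by (simp add: open_delete)
  have zS: "z \<in> W - {w}" using z zw by simp
  have Q: "wirt_bar (\<lambda>v. G x v) w = cnj (\<mu> x) * (\<mu> w * (L x - 1 / (2 * cnj (w - x))))" if "x \<in> W - {w}" for x
    using has_wirt_unique(2)[OF G_wirt, of x] that by simp
  have "((\<lambda>x. 1 / (2 * (w - x))) has_field_derivative 1 / (2 * (w - z)\<^sup>2)) (at z)"
    using zw by (auto intro!: derivative_eq_intros simp: power2_eq_square divide_simps; simp add: algebra_simps)
  from has_wirt_cnj[OF has_wirt_field_derivative[OF this]]
  have i: "has_wirt (\<lambda>x. 1 / (2 * cnj (w - x))) 0 (1 / (2 * (cnj (w - z))\<^sup>2)) z" by simp
  have c: "has_wirt (\<lambda>x. cnj (\<mu> x)) 0 (cnj (deriv \<mu> z)) z"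
    using has_wirt_cnj[OF has_wirt_holomorphic[OF \<mu>W openW z]] by simp
  note R = has_wirt_mult[OF c has_wirt_cmult[OF has_wirt_diff[OF harmonic_on_has_wirt[OF L_facts(1) z] i], of "\<mu> w"]]
  note R' = has_wirt_transform[OF R op zS Q[symmetric]]
  \<comment> \<open>The conjugate of \<open>\<mu>\<close> and 1/cnj(w - z) are antiholomorphic in z,
    so d/dz acts on \<open>L\<close> only.\<close>
  have val: "wirt (\<lambda>z'. wirt_bar (\<lambda>w'. G z' w') w) z = cnj (\<mu> z) * (\<mu> w * wirt L z)"
    using has_wirt_unique(1)[OF R'] by simp
  have "\<forall>\<^sub>F z' in nhds z. (\<lambda>w'. G z' w') differentiable (at w)"
    using eventually_nhds_in_open[OF op zS]
    by eventually_elim (use has_wirt_imp_differentiable[OF G_wirt] in auto)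
  moreover have "(\<lambda>z'. wirt_bar (\<lambda>w'. G z' w') w) differentiable (at z)"
    by (rule has_wirt_imp_differentiable[OF R'])
  moreover have "bergman_kernel W \<rho> z w =
           - (2 / (complex_of_real pi * complex_of_real (\<rho> z) * complex_of_real (\<rho> w))) *
           wirt (\<lambda>z'. wirt_bar (\<lambda>w'. G z' w') w) z"
  proof -
    have "bergman_kernel W \<rho> z w = \<kappa> z / (\<mu> z * cnj (\<mu> w))"
      unfolding \<rho> by (rule weighted_bergman_kernel[OF \<mu>W \<mu>0 z])
    \<comment> \<open>Since \<open>\<rho>\<close> is \<open>\<mu>\<close> times its conjugate,
      dividing by \<open>\<mu> z * cnj (\<mu> w)\<close> is multiplying by
      \<open>cnj (\<mu> z) * \<mu> w\<close> and dividing by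
      \<open>\<rho> z * \<rho> w\<close>.\<close>
    then show ?thesis
      unfolding val \<rho> \<kappa>_def using \<mu>0[OF z] \<mu>0[OF w] by (simp add: of_real_cmod_power2 divide_simps)
  qed
  ultimately show ?thesis by blast
qed

end
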